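(* Let $B$ be a block algebra of $FG$ and let $r$ be the multiplicity of $1$ as an elementary divisor of the Cartan matrix of $B$. Then there exists a set of $r$ pairwise orthogonal non-zero idempotents in $Pr(B,B)$. Moreover, $r$ is maximal with this property.
   Context: $F$ is a field of characteristic $p>0$ and $G$ is a finite group; $F$ contains a root of unity of order $|G|_{p'}$, so that $F$ is a splitting field for $FH$ for every subgroup $H\le G$. A block algebra of $FG$ is $B=FGb$ with $b$ a primitive idempotent of $Z(FG)$. $(B,B)$-bimodules are regarded as left $F[G\times G]$-modules via $(g,h)m=gmh^{-1}$. $Pr(B,B)$ is the free abelian group on the isomorphism classes $[M]$ of indecomposable projective $(B,B)$-bimodules (i.e. projective as modules over $B\otimes_F B^{\mathrm{op}}$), where $[M]:=[M_1]+\cdots+[M_s]$ if $M\cong M_1\oplus\cdots\oplus M_s$ with $M_i$ indecomposable. It is a (not necessarily unital) ring with multiplication induced by $[M]\cdot[N]:=[M\otimes_{FG}N]$. The Cartan matrix of $B$ is $C=(c_{ij})\in\mathrm{Mat}_l(\mathbb{Z})$ with $c_{ij}=\dim_F(\epsilon_iB\epsilon_j)$, where $\epsilon_1,\dots,\epsilon_l$ are primitive idempotents of $B$ such that $B\epsilon_1,\dots,B\epsilon_l$ is a complete list of pairwise non-isomorphic projective indecomposable $B$-modules. Its elementary divisors are the diagonal entries of its Smith normal form over $\mathbb{Z}$ (they are powers of $p$). Two idempotents $e,e'$ of a ring are orthogonal if $ee'=e'e=0$. *)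

theory Defs
  imports
    "HOL-Algebra.Free_Abelian_Groups"
    "HOL-Library.Cardinality"
    "HOL-Library.Product_Plus"
    "HOL-Library.Poly_Mapping"
    "HOL-Computational_Algebra.Computational_Algebra"
    "Jordan_Normal_Form.Matrix"
begin

text \<open>
  The finite group \<open>G\<close> is a type of class \<open>{finite, group_add}\<close>: \<open>group_add\<close> is the class of
  arbitrary, not necessarily commutative groups, only written additively, so
  \<open>g + h\<close>, \<open>0\<close>, \<open>- g\<close> stand for \<open>gh\<close>, \<open>1\<close>, \<open>g\<^sup>-\<^sup>1\<close>. The group algebra \<open>FG\<close> is then the type
  \<open>'g \<Rightarrow>\<^sub>0 'f\<close>, whose multiplication is convolution, and \<open>F[G \<times> G]\<close> is \<open>'g \<times> 'g \<Rightarrow>\<^sub>0 'f\<close>.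
\<close>


section \<open>Idempotents and blocks\<close>

definition primitive_idempotent :: "'r::ring_1 set \<Rightarrow> 'r \<Rightarrow> bool" where
  "primitive_idempotent R e \<longleftrightarrow>
     e \<in> R \<and> e * e = e \<and> e \<noteq> 0 \<and>
     (\<forall>x\<in>R. \<forall>y\<in>R. x * x = x \<and> y * y = y \<and> x * y = 0 \<and> y * x = 0 \<and> e = x + y
        \<longrightarrow> x = 0 \<or> y = 0)"

definition ring_center :: "'r::ring_1 set" where
  "ring_center = {z. \<forall>x. z * x = x * z}"

definition block_idempotent :: "('g::{finite,group_add} \<Rightarrow>\<^sub>0 'f::field) \<Rightarrow> bool" where
  "block_idempotent b \<longleftrightarrow> primitive_idempotent ring_center b"

definition block :: "('g::{finite,group_add} \<Rightarrow>\<^sub>0 'f::field) \<Rightarrow> ('g \<Rightarrow>\<^sub>0 'f) set" where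
  "block b = {x * b | x. True}"


section \<open>Modules over a block of a ring\<close>

text \<open>
  Let \<open>e\<close> be a central idempotent of the ring \<open>'r\<close>. A left module over the ring \<open>'r e\<close> is the same
  thing as a left \<open>'r\<close>-module on which \<open>e\<close> acts as the identity. The record \<open>module\<close> is reused
  only as a container, its locale being restricted to commutative rings; the fields \<open>mult\<close> and
  \<open>one\<close> are irrelevant.
\<close>

definition left_module :: "'r::ring_1 \<Rightarrow> ('r, 'm) module \<Rightarrow> bool" where
  "left_module e M \<longleftrightarrow> abelian_group M \<and>
     (\<forall>a. \<forall>x\<in>carrier M. a \<odot>\<^bsub>M\<^esub> x \<in> carrier M) \<and>
     (\<forall>a c. \<forall>x\<in>carrier M. (a + c) \<odot>\<^bsub>M\<^esub> x = a \<odot>\<^bsub>M\<^esub> x \<oplus>\<^bsub>M\<^esub> c \<odot>\<^bsub>M\<^esub> x) \<and>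
     (\<forall>a. \<forall>x\<in>carrier M. \<forall>y\<in>carrier M. a \<odot>\<^bsub>M\<^esub> (x \<oplus>\<^bsub>M\<^esub> y) = a \<odot>\<^bsub>M\<^esub> x \<oplus>\<^bsub>M\<^esub> a \<odot>\<^bsub>M\<^esub> y) \<and>
     (\<forall>a c. \<forall>x\<in>carrier M. (a * c) \<odot>\<^bsub>M\<^esub> x = a \<odot>\<^bsub>M\<^esub> (c \<odot>\<^bsub>M\<^esub> x)) \<and>
     (\<forall>x\<in>carrier M. e \<odot>\<^bsub>M\<^esub> x = x)"

definition left_hom :: "('r, 'm) module \<Rightarrow> ('r, 'n) module \<Rightarrow> ('m \<Rightarrow> 'n) \<Rightarrow> bool" where
  "left_hom M N f \<longleftrightarrow>
     (\<forall>x\<in>carrier M. f x \<in> carrier N) \<and>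
     (\<forall>x\<in>carrier M. \<forall>y\<in>carrier M. f (x \<oplus>\<^bsub>M\<^esub> y) = f x \<oplus>\<^bsub>N\<^esub> f y) \<and>
     (\<forall>a. \<forall>x\<in>carrier M. f (a \<odot>\<^bsub>M\<^esub> x) = a \<odot>\<^bsub>N\<^esub> f x)"

definition left_iso :: "('r, 'm) module \<Rightarrow> ('r, 'n) module \<Rightarrow> bool" where
  "left_iso M N \<longleftrightarrow> (\<exists>f. left_hom M N f \<and> bij_betw f (carrier M) (carrier N))"

definition left_submodule :: "('r, 'm) module \<Rightarrow> 'm set \<Rightarrow> bool" where
  "left_submodule M X \<longleftrightarrow> X \<subseteq> carrier M \<and> \<zero>\<^bsub>M\<^esub> \<in> X \<and>
     (\<forall>x\<in>X. \<forall>y\<in>X. x \<oplus>\<^bsub>M\<^esub> y \<in> X) \<and> (\<forall>a. \<forall>x\<in>X. a \<odot>\<^bsub>M\<^esub> x \<in> X)"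

definition indecomposable :: "('r, 'm) module \<Rightarrow> bool" where
  "indecomposable M \<longleftrightarrow> carrier M \<noteq> {\<zero>\<^bsub>M\<^esub>} \<and>
     (\<forall>X Y. left_submodule M X \<and> left_submodule M Y \<and> X \<inter> Y = {\<zero>\<^bsub>M\<^esub>} \<and>
        carrier M = {x \<oplus>\<^bsub>M\<^esub> y | x y. x \<in> X \<and> y \<in> Y} \<longrightarrow> X = {\<zero>\<^bsub>M\<^esub>} \<or> Y = {\<zero>\<^bsub>M\<^esub>})"

definition direct_sum :: "nat \<Rightarrow> (nat \<Rightarrow> ('r, 'm) module) \<Rightarrow> ('r, nat \<Rightarrow> 'm) module" where
  "direct_sum n M =
     \<lparr>carrier = (\<Pi>\<^sub>E i\<in>{..<n}. carrier (M i)), monoid.mult = undefined, one = undefined,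
      zero = (\<lambda>i\<in>{..<n}. \<zero>\<^bsub>M i\<^esub>),
      add = (\<lambda>v w. \<lambda>i\<in>{..<n}. v i \<oplus>\<^bsub>M i\<^esub> w i),
      smult = (\<lambda>a v. \<lambda>i\<in>{..<n}. a \<odot>\<^bsub>M i\<^esub> v i)\<rparr>"

definition left_ideal :: "'r::ring_1 \<Rightarrow> ('r, 'r) module" where
  "left_ideal e =
     \<lparr>carrier = {x * e | x. True}, monoid.mult = undefined, one = undefined,
      zero = 0, add = (+), smult = (*)\<rparr>"

text \<open>
  Finitely generated projective \<open>'r e\<close>-modules: direct summands, up to isomorphism, of the free
  module \<open>('r e)\<^sup>n\<close> for some \<open>n\<close>.
\<close>

definition projective :: "'r::ring_1 \<Rightarrow> ('r, 'm) module \<Rightarrow> bool" where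
  "projective e M \<longleftrightarrow> left_module e M \<and>
     (\<exists>n i q. left_hom M (direct_sum n (\<lambda>_. left_ideal e)) i \<and>
              left_hom (direct_sum n (\<lambda>_. left_ideal e)) M q \<and>
              (\<forall>x\<in>carrier M. q (i x) = x))"

definition indec_projective :: "'r::ring_1 \<Rightarrow> ('r, 'm) module \<Rightarrow> bool" where
  "indec_projective e M \<longleftrightarrow> projective e M \<and> indecomposable M"

text \<open>
  Isomorphism classes are formed among the modules whose carrier is a subset of \<open>nat \<Rightarrow> 'f\<close>.
  As \<open>nat \<Rightarrow> 'f\<close> contains \<open>F\<^sup>n\<close> for every \<open>n\<close>, each finitely generated module over \<open>FG\<close> or
  \<open>F[G \<times> G]\<close>, whatever the type of its elements, is isomorphic to one of these.
\<close>

definition iso_class ::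
  "('x::monoid_add \<Rightarrow>\<^sub>0 'f::field) \<Rightarrow> ('x \<Rightarrow>\<^sub>0 'f, 'm) module \<Rightarrow> ('x \<Rightarrow>\<^sub>0 'f, nat \<Rightarrow> 'f) module set" where
  "iso_class e M = {N. left_module e N \<and> left_iso N M}"

definition indec_projective_classes ::
  "('x::monoid_add \<Rightarrow>\<^sub>0 'f::field) \<Rightarrow> ('x \<Rightarrow>\<^sub>0 'f, nat \<Rightarrow> 'f) module set set" where
  "indec_projective_classes e =
     {iso_class e M | M :: ('x \<Rightarrow>\<^sub>0 'f, nat \<Rightarrow> 'f) module. indec_projective e M}"

text \<open>
  The element \<open>[M] = [M\<^sub>1] + \<dots> + [M\<^sub>s]\<close> of the free abelian group for \<open>M \<cong> M\<^sub>1 \<oplus> \<dots> \<oplus> M\<^sub>s\<close>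
  projective with \<open>M\<^sub>i\<close> indecomposable; uniqueness is the Krull-Schmidt theorem.
\<close>

definition module_class ::
  "('x::monoid_add \<Rightarrow>\<^sub>0 'f::field) \<Rightarrow> ('x \<Rightarrow>\<^sub>0 'f, 'm) module \<Rightarrow>
   (('x \<Rightarrow>\<^sub>0 'f, nat \<Rightarrow> 'f) module set \<Rightarrow>\<^sub>0 int)" where
  "module_class e M =
     (THE c. \<exists>s (N :: nat \<Rightarrow> ('x \<Rightarrow>\<^sub>0 'f, nat \<Rightarrow> 'f) module).
        (\<forall>i<s. indec_projective e (N i)) \<and> left_iso M (direct_sum s N) \<and>
        c = (\<Sum>i<s. frag_of (iso_class e (N i))))"


section \<open>Bimodules as left modules over the group algebra of \<open>G \<times> G\<close>\<close>

text \<open>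
  An \<open>(FG, FG)\<close>-bimodule is a left \<open>F[G \<times> G]\<close>-module via \<open>(g, h) m = g m h\<^sup>-\<^sup>1\<close>. Thus \<open>m \<mapsto> a m\<close> is the
  action of \<open>left_emb a\<close> and \<open>m \<mapsto> m a\<close> that of \<open>right_emb a\<close>. Equivalently, \<open>FG \<otimes>\<^sub>F FG\<^sup>o\<^sup>p\<close> is
  identified with \<open>F[G \<times> G]\<close> by \<open>a \<otimes> c \<mapsto> left_emb a * right_emb c\<close>, and \<open>B \<otimes>\<^sub>F B\<^sup>o\<^sup>p\<close> becomes
  \<open>F[G \<times> G] (bi_idem b)\<close>. So \<open>(B, B)\<close>-bimodules are the modules on which \<open>bi_idem b\<close>, that is
  \<open>m \<mapsto> b m b\<close>, acts as the identity.
\<close>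

definition left_emb :: "('g::{finite,group_add} \<Rightarrow>\<^sub>0 'f::field) \<Rightarrow> ('g \<times> 'g \<Rightarrow>\<^sub>0 'f)" where
  "left_emb a = (\<Sum>g\<in>UNIV. Poly_Mapping.single (g, 0) (Poly_Mapping.lookup a g))"

definition right_emb :: "('g::{finite,group_add} \<Rightarrow>\<^sub>0 'f::field) \<Rightarrow> ('g \<times> 'g \<Rightarrow>\<^sub>0 'f)" where
  "right_emb a = (\<Sum>g\<in>UNIV. Poly_Mapping.single (0, - g) (Poly_Mapping.lookup a g))"

definition bi_idem :: "('g::{finite,group_add} \<Rightarrow>\<^sub>0 'f::field) \<Rightarrow> ('g \<times> 'g \<Rightarrow>\<^sub>0 'f)" where
  "bi_idem b = left_emb b * right_emb b"

text \<open>
  \<open>M \<otimes>\<^sub>F\<^sub>G N\<close> is the free abelian group on \<open>M \<times> N\<close> modulo the subgroup generated by the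
  biadditivity relations and \<open>m a \<otimes> n - m \<otimes> a n\<close>. The element \<open>x = \<Sum> x(g, h) (g, h)\<close> acts by
  \<open>m \<otimes> n \<mapsto> \<Sum> x(g, h) g m \<otimes> n h\<^sup>-\<^sup>1\<close>.
\<close>

definition tensor_rels ::
  "('g::{finite,group_add} \<times> 'g \<Rightarrow>\<^sub>0 'f::field, 'm) module \<Rightarrow> ('g \<times> 'g \<Rightarrow>\<^sub>0 'f, 'n) module \<Rightarrow>
   ('m \<times> 'n \<Rightarrow>\<^sub>0 int) set" where
  "tensor_rels M N =
     {frag_of (m \<oplus>\<^bsub>M\<^esub> m', n) - frag_of (m, n) - frag_of (m', n) | m m' n.
        m \<in> carrier M \<and> m' \<in> carrier M \<and> n \<in> carrier N} \<union>
     {frag_of (m, n \<oplus>\<^bsub>N\<^esub> n') - frag_of (m, n) - frag_of (m, n') | m n n'.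
        m \<in> carrier M \<and> n \<in> carrier N \<and> n' \<in> carrier N} \<union>
     {frag_of (right_emb a \<odot>\<^bsub>M\<^esub> m, n) - frag_of (m, left_emb a \<odot>\<^bsub>N\<^esub> n) | a m n.
        m \<in> carrier M \<and> n \<in> carrier N}"

definition tensor_act ::
  "('g::{finite,group_add} \<times> 'g \<Rightarrow>\<^sub>0 'f::field, 'm) module \<Rightarrow> ('g \<times> 'g \<Rightarrow>\<^sub>0 'f, 'n) module \<Rightarrow>
   ('g \<times> 'g \<Rightarrow>\<^sub>0 'f) \<Rightarrow> ('m \<times> 'n \<Rightarrow>\<^sub>0 int) \<Rightarrow> ('m \<times> 'n \<Rightarrow>\<^sub>0 int)" where
  "tensor_act M N x =
     frag_extend (\<lambda>(m, n). \<Sum>(g, h)\<in>UNIV.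
       frag_of (Poly_Mapping.single (g, 0) (Poly_Mapping.lookup x (g, h)) \<odot>\<^bsub>M\<^esub> m,
                Poly_Mapping.single (0, h) 1 \<odot>\<^bsub>N\<^esub> n))"

definition tensor ::
  "('g::{finite,group_add} \<times> 'g \<Rightarrow>\<^sub>0 'f::field, 'm) module \<Rightarrow> ('g \<times> 'g \<Rightarrow>\<^sub>0 'f, 'n) module \<Rightarrow>
   ('g \<times> 'g \<Rightarrow>\<^sub>0 'f, ('m \<times> 'n \<Rightarrow>\<^sub>0 int) set) module" where
  "tensor M N =
     (let A = free_Abelian_group (carrier M \<times> carrier N);
          K = generate A (tensor_rels M N)
      in \<lparr>carrier = carrier (A Mod K), monoid.mult = undefined, one = undefined,
          zero = \<one>\<^bsub>A Mod K\<^esub>, add = (\<lambda>X Y. X \<otimes>\<^bsub>A Mod K\<^esub> Y),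
          smult = (\<lambda>x X. \<Union>z\<in>X. K #>\<^bsub>A\<^esub> tensor_act M N x z)\<rparr>)"


section \<open>The ring \<open>Pr(B, B)\<close>\<close>

definition Pr ::
  "('g::{finite,group_add} \<Rightarrow>\<^sub>0 'f::field) \<Rightarrow> (('g \<times> 'g \<Rightarrow>\<^sub>0 'f, nat \<Rightarrow> 'f) module set \<Rightarrow>\<^sub>0 int) set" where
  "Pr b = carrier (free_Abelian_group (indec_projective_classes (bi_idem b)))"

definition Pr_mult ::
  "('g::{finite,group_add} \<Rightarrow>\<^sub>0 'f::field) \<Rightarrow>
   (('g \<times> 'g \<Rightarrow>\<^sub>0 'f, nat \<Rightarrow> 'f) module set \<Rightarrow>\<^sub>0 int) \<Rightarrow>
   (('g \<times> 'g \<Rightarrow>\<^sub>0 'f, nat \<Rightarrow> 'f) module set \<Rightarrow>\<^sub>0 int) \<Rightarrow>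
   (('g \<times> 'g \<Rightarrow>\<^sub>0 'f, nat \<Rightarrow> 'f) module set \<Rightarrow>\<^sub>0 int)" where
  "Pr_mult b x y =
     frag_extend (\<lambda>P. frag_extend (\<lambda>Q.
       module_class (bi_idem b) (tensor (SOME M. M \<in> P) (SOME N. N \<in> Q))) y) x"

definition Pr_orthogonal_idempotents ::
  "('g::{finite,group_add} \<Rightarrow>\<^sub>0 'f::field) \<Rightarrow>
   (('g \<times> 'g \<Rightarrow>\<^sub>0 'f, nat \<Rightarrow> 'f) module set \<Rightarrow>\<^sub>0 int) set \<Rightarrow> bool" where
  "Pr_orthogonal_idempotents b E \<longleftrightarrow> E \<subseteq> Pr b \<and>
     (\<forall>x\<in>E. x \<noteq> 0 \<and> Pr_mult b x x = x) \<and>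
     (\<forall>x\<in>E. \<forall>y\<in>E. x \<noteq> y \<longrightarrow> Pr_mult b x y = 0)"


section \<open>Cartan matrix and elementary divisors\<close>

text \<open>
  \<open>\<epsilon> 0, \<dots>, \<epsilon> (l - 1)\<close> are primitive idempotents of \<open>B\<close> such that the \<open>B (\<epsilon> i)\<close> form a complete
  list of pairwise non-isomorphic projective indecomposable left \<open>B\<close>-modules.
\<close>

definition pim_idempotents ::
  "('g::{finite,group_add} \<Rightarrow>\<^sub>0 'f::field) \<Rightarrow> nat \<Rightarrow> (nat \<Rightarrow> 'g \<Rightarrow>\<^sub>0 'f) \<Rightarrow> bool" where
  "pim_idempotents b l \<epsilon> \<longleftrightarrow>
     (\<forall>i<l. primitive_idempotent (block b) (\<epsilon> i) \<and> indec_projective b (left_ideal (\<epsilon> i))) \<and>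
     (\<forall>i<l. \<forall>j<l. left_iso (left_ideal (\<epsilon> i)) (left_ideal (\<epsilon> j)) \<longrightarrow> i = j) \<and>
     (\<forall>M :: ('g \<Rightarrow>\<^sub>0 'f, nat \<Rightarrow> 'f) module. indec_projective b M \<longrightarrow>
        (\<exists>i<l. left_iso M (left_ideal (\<epsilon> i))))"

definition group_algebra_dim :: "('g::{finite,group_add} \<Rightarrow>\<^sub>0 'f::field) set \<Rightarrow> nat" where
  "group_algebra_dim = vector_space.dim (\<lambda>c x. Poly_Mapping.single 0 c * x)"

definition cartan_matrix ::
  "('g::{finite,group_add} \<Rightarrow>\<^sub>0 'f::field) \<Rightarrow> nat \<Rightarrow> (nat \<Rightarrow> 'g \<Rightarrow>\<^sub>0 'f) \<Rightarrow> int mat" where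
  "cartan_matrix b l \<epsilon> =
     mat l l (\<lambda>(i, j). int (group_algebra_dim {\<epsilon> i * x * \<epsilon> j | x. x \<in> block b}))"

definition smith_normal_form_of :: "int mat \<Rightarrow> int mat \<Rightarrow> bool" where
  "smith_normal_form_of C D \<longleftrightarrow>
     (\<exists>P Q. P \<in> carrier_mat (dim_row C) (dim_row C) \<and> invertible_mat P \<and>
            Q \<in> carrier_mat (dim_col C) (dim_col C) \<and> invertible_mat Q \<and> D = P * C * Q) \<and>
     diagonal_mat D \<and>
     (\<forall>i<min (dim_row D) (dim_col D). D $$ (i, i) \<ge> 0) \<and>
     (\<forall>i. Suc i < min (dim_row D) (dim_col D) \<longrightarrow> D $$ (i, i) dvd D $$ (Suc i, Suc i))"


section \<open>The hypothesis on the field\<close>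

definition p_prime_part :: "nat \<Rightarrow> nat \<Rightarrow> nat" where
  "p_prime_part p n = n div p ^ multiplicity p n"

definition root_of_unity_of_order :: "'f::field \<Rightarrow> nat \<Rightarrow> bool" where
  "root_of_unity_of_order \<zeta> n \<longleftrightarrow> n > 0 \<and> \<zeta> ^ n = 1 \<and> (\<forall>k. 0 < k \<and> k < n \<longrightarrow> \<zeta> ^ k \<noteq> 1)"

end

theory Submission
  imports
    Defs
    "HOL-Number_Theory.Residues"
    "HOL-Algebra.Multiplicative_Group"
    "Jordan_Normal_Form.Determinant"
begin

text \<open>
  If \<open>F\<close> is a splitting field, the indecomposable projective bimodules are the
  \<open>P\<^sub>i\<^sub>j = B\<epsilon>\<^sub>i \<otimes>\<^sub>F \<epsilon>\<^sub>jB\<close>, and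
  \<open>P\<^sub>i\<^sub>j \<otimes>\<^sub>F\<^sub>G P\<^sub>k\<^sub>m\<close> is the sum of \<open>c\<^sub>j\<^sub>k = dim \<epsilon>\<^sub>jB\<epsilon>\<^sub>k\<close>
  copies of \<open>P\<^sub>i\<^sub>m\<close>. Hence \<open>Pr(B,B)\<close> is the group of integral \<open>l \<times> l\<close> matrices with
  the product \<open>X C Y\<close>, and by base change \<open>C\<close> may be replaced by its Smith normal form \<open>D\<close>. The matrix
  units \<open>E\<^sub>i\<^sub>i\<close> with \<open>D\<^sub>i\<^sub>i = 1\<close> are orthogonal idempotents. Conversely a prime \<open>q\<close> dividing the first
  elementary divisor other than 1 divides all later ones, so modulo \<open>q\<close> the product factors through a
  space of dimension \<open>r\<close>; this bounds every orthogonal system and does not need Brauer's theorem that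
  \<open>det C\<close> is a power of \<open>p\<close>.

  That \<open>F\<close> splits \<open>FG\<close> is shown inside the finite ring \<open>kG\<close>, where \<open>k\<close> is the subfield of \<open>p\<^sup>m\<close>
  elements that contains the root of unity. For a primitive idempotent \<open>e\<close> of \<open>kG\<close> the residue
  ring of \<open>e kG e\<close> is commutative by Wedderburn's little theorem. The trace of the corresponding simple
  module is the identity on this residue ring, and sends \<open>G\<close> into \<open>k\<close>, since a group element is a
  \<open>k\<close>-linear combination of idempotents plus a nilpotent element on each of them.
\<close>

section \<open>Values of cyclotomic polynomials\<close>

text \<open>\<open>F\<close> may be infinite, so neither Wedderburn's theorem nor the argument with
  powers that makes a corner \<open>e kG e\<close> local applies to \<open>FG\<close> directly. Both
  are used over the finite field \<open>k\<close>, and the outcome is carried to \<open>F\<close> by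
  linearity: it is recorded only that each \<open>e g e\<close>, \<open>g\<close> in
  \<open>G\<close>, is a scalar multiple of \<open>e\<close> plus an element of the span of a finite
  multiplicative set of nilpotent elements. Such a span is nilpotent, so \<open>e\<close> stays
  local over \<open>F\<close>, with residue field \<open>F\<close>. A record on generators also
  survives the passage to \<open>F[G \<times> G]\<close>, where products of local idempotents have
  to be local again. Krull-Schmidt and the list of indecomposable projective bimodules are then read
  off from residue maps into \<open>F\<close>. The exponent \<open>m\<close> is the totient of the
  \<open>p'\<close>-part \<open>n\<close> of the group order: by Euler's theorem \<open>n\<close>
  divides \<open>p^m - 1\<close>, so \<open>k\<close>, the fixed field of the \<open>m\<close>-th
  power of Frobenius, contains the given root of unity. Such a \<open>k\<close> is also closed under
  \<open>p\<close>-power roots, which the eigenvalues of arbitrary group elements require.\<close>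

definition cyclotomic :: "nat \<Rightarrow> complex poly" where
  "cyclotomic n = (\<Prod>w\<in>{w. w ^ n = 1 \<and> (\<forall>k. 0 < k \<and> k < n \<longrightarrow> w ^ k \<noteq> 1)}. [:- w, 1:])"

lemma unity_root_order:
  fixes w :: complex
  assumes "n > 0" "w ^ n = 1"
  obtains d where "d dvd n" "d > 0" "w ^ d = 1" "\<forall>k. 0 < k \<and> k < d \<longrightarrow> w ^ k \<noteq> 1"
proof -
  define d where "d = (LEAST k. 0 < k \<and> w ^ k = 1)"
  have d: "0 < d \<and> w ^ d = 1" unfolding d_def by (rule LeastI[of _ n]) (use assms in auto)
  have min: "w ^ k \<noteq> 1" if "0 < k" "k < d" for k
    using not_less_Least[of k "\<lambda>k. 0 < k \<and> w ^ k = 1"] that by (auto simp: d_def)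
  have "w ^ n = (w ^ d) ^ (n div d) * w ^ (n mod d)"
    by (simp flip: power_mult power_add)
  hence "w ^ (n mod d) = 1" using assms d by simp
  hence "n mod d = 0" using min[of "n mod d"] d by fastforce
  thus ?thesis using that d min by auto
qed

lemma finite_unity_roots: "n > 0 \<Longrightarrow> finite {w::complex. w ^ n = 1 \<and> P w}"
  using finite_roots_unity[of n, where 'a = complex] by (rule rev_finite_subset) auto

text \<open>The derivative of \<open>x^n - 1\<close> can vanish only at 0, which is no root, so the
  polynomial is the product over its distinct roots; these are then sorted by their exact
  order.\<close>

lemma unity_poly_factor:
  assumes "n > 0"
  shows "Polynomial.monom 1 n - 1 = (\<Prod>d\<in>{d. d dvd n}. cyclotomic d)"
proof -
  define S where "S d = {w::complex. w ^ d = 1 \<and> (\<forall>k. 0 < k \<and> k < d \<longrightarrow> w ^ k \<noteq> 1)}" for d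
  let ?A = "Polynomial.monom 1 n - 1 :: complex poly"
  have deg: "degree ?A = n" "lead_coeff ?A = 1"
  proof -
    have "degree (1 :: complex poly) < degree (Polynomial.monom (1::complex) n)"
      using assms by (simp add: degree_monom_eq)
    thus "degree ?A = n" by (metis degree_monom_eq diff_conv_add_uminus degree_add_eq_left degree_minus one_neq_zero)
    thus "lead_coeff ?A = 1" using assms by simp
  qed
  have rs: "rsquarefree ?A"
    unfolding rsquarefree_roots
  proof (intro allI notI)
    fix a assume a: "poly ?A a = 0 \<and> poly (pderiv ?A) a = 0"
    have "pderiv ?A = Polynomial.smult (of_nat n) (Polynomial.monom 1 (n - 1))"
      by (simp add: pderiv_diff pderiv_monom smult_monom)
    with a assms have "a ^ (n - 1) = 0" by (simp add: poly_monom)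
    hence "a = 0" by (cases "n - 1 = 0") auto
    with a assms show False by (simp add: poly_monom power_0_left)
  qed
  have "?A = (\<Prod>z | poly ?A z = 0. [:-z, 1:])"
    using complex_poly_decompose_rsquarefree[OF rs] deg by simp
  also have "{z. poly ?A z = 0} = (\<Union>d\<in>{d. d dvd n}. S d)"
  proof (intro Set.set_eqI iffI)
    fix w assume "w \<in> {z. poly ?A z = 0}"
    hence "w ^ n = 1" by (simp add: poly_monom)
    then obtain d where "d dvd n" "w ^ d = 1" "\<forall>k. 0 < k \<and> k < d \<longrightarrow> w ^ k \<noteq> 1"
      using unity_root_order[OF assms] by metis
    hence "d dvd n" "w \<in> S d" unfolding S_def by blast+
    thus "w \<in> (\<Union>d\<in>{d. d dvd n}. S d)" by auto
  next
    fix w assume "w \<in> (\<Union>d\<in>{d. d dvd n}. S d)"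
    then obtain d where "d dvd n" "w ^ d = 1" by (auto simp: S_def)
    thus "w \<in> {z. poly ?A z = 0}" by (auto simp: poly_monom power_mult elim!: dvdE)
  qed
  also have "(\<Prod>z\<in>(\<Union>d\<in>{d. d dvd n}. S d). [:-z, 1:]) = (\<Prod>d\<in>{d. d dvd n}. \<Prod>z\<in>S d. [:-z, 1:])"
  proof (rule prod.UNION_disjoint)
    show "finite {d. d dvd n}" using assms by simp
    show "\<forall>i\<in>{d. d dvd n}. finite (S i)"
      unfolding S_def using assms by (auto intro!: finite_unity_roots dest: dvd_pos_nat)
    show "\<forall>i\<in>{d. d dvd n}. \<forall>j\<in>{d. d dvd n}. i \<noteq> j \<longrightarrow> S i \<inter> S j = {}"
    proof safe
      fix i j w assume ij: "i dvd n" "j dvd n" "i \<noteq> j" and w: "w \<in> S i" "w \<in> S j"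
      have "0 < i" "0 < j" using ij assms by (auto dest: dvd_pos_nat)
      thus "w \<in> {}" using w ij by (cases "i < j") (auto simp: S_def)
    qed
  qed
  finally show ?thesis unfolding cyclotomic_def S_def by simp
qed

lemma cyclotomic_nonzero: "cyclotomic n \<noteq> 0"
  unfolding cyclotomic_def by (cases "finite {w::complex. w ^ n = 1 \<and> (\<forall>k. 0 < k \<and> k < n \<longrightarrow> w ^ k \<noteq> 1)}") auto

lemma lead_coeff_cyclotomic: "lead_coeff (cyclotomic n) = 1"
  unfolding cyclotomic_def by (simp add: lead_coeff_prod)

text \<open>By induction the factors of \<open>x^n - 1\<close> other than the last one multiply to a
  monic integral polynomial \<open>B\<close>. Division by \<open>B\<close> with remainder over the
  integers has to agree with the exact division over the complex numbers.\<close>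

lemma cyclotomic_int:
  assumes "n > 0"
  shows "\<exists>P :: int poly. map_poly of_int P = cyclotomic n"
  using assms
proof (induction n rule: less_induct)
  case (less n)
  define P where "P d = (SOME P :: int poly. map_poly of_int P = cyclotomic d)" for d
  have P: "map_poly of_int (P d) = cyclotomic d" if "d dvd n" "d \<noteq> n" for d
  proof -
    have "0 < d" "d < n" using that less.prems by (auto dest: dvd_pos_nat dvd_imp_le)
    from less.IH[OF this(2,1)] show ?thesis unfolding P_def by (rule someI_ex)
  qed
  let ?h = "map_poly (of_int :: int \<Rightarrow> complex)"
  have hm: "?h (p * q) = ?h p * ?h q" for p q by (intro poly_eqI) (simp add: coeff_map_poly coeff_mult)
  have ha: "?h (p + q) = ?h p + ?h q" for p q by (intro poly_eqI) (simp add: coeff_map_poly)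
  have hp: "?h (\<Prod>d\<in>A. P d) = (\<Prod>d\<in>A. ?h (P d))" for A
    by (induction A rule: infinite_finite_induct) (auto simp: hm)
  define B where "B = (\<Prod>d\<in>{d. d dvd n} - {n}. P d)"
  have hB: "?h B = (\<Prod>d\<in>{d. d dvd n} - {n}. cyclotomic d)"
    unfolding B_def hp by (rule prod.cong) (auto simp: P)
  have A: "Polynomial.monom 1 n - 1 = cyclotomic n * ?h B"
    unfolding unity_poly_factor[OF less.prems] hB
    by (subst prod.remove[of _ n]) (use less.prems in auto)
  have hB0: "?h B \<noteq> 0" unfolding hB by (simp add: cyclotomic_nonzero less.prems)
  hence B0: "B \<noteq> 0" by auto
  have degh: "degree (?h p) = degree p" for p by (rule degree_map_poly) auto
  have "lead_coeff (?h B) = 1" unfolding hB by (simp add: lead_coeff_prod lead_coeff_cyclotomic)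
  hence lB: "lead_coeff B = 1" by (simp add: degh coeff_map_poly)
  \<comment> \<open>\<open>B\<close> is monic, so pseudo-division does not scale the
    dividend.\<close>
  obtain Q r where Qr: "pseudo_divmod (Polynomial.monom 1 n - 1) B = (Q, r)" by force
  have eq: "Polynomial.monom 1 n - 1 = B * Q + r" and r: "r = 0 \<or> degree r < degree B"
    using pseudo_divmod[OF B0 Qr] lB by simp_all
  have "?h (Polynomial.monom 1 n - 1) = Polynomial.monom 1 n - 1"
    by (intro poly_eqI) (simp add: coeff_map_poly)
  hence "cyclotomic n * ?h B = ?h B * ?h Q + ?h r"
    using eq A by (metis ha hm)
  hence *: "?h r = ?h B * (cyclotomic n - ?h Q)" by (simp add: algebra_simps)
  \<comment> \<open>A non-zero multiple of \<open>B\<close> has at least the degree of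
    \<open>B\<close>, whereas a non-zero remainder has less.\<close>
  have "cyclotomic n - ?h Q = 0"
  proof (rule ccontr)
    assume nz: "cyclotomic n - ?h Q \<noteq> 0"
    hence "degree (?h r) = degree (?h B) + degree (cyclotomic n - ?h Q)" "?h r \<noteq> 0"
      using hB0 unfolding * by (auto simp: degree_mult_eq)
    thus False using r by (auto simp: degh)
  qed
  thus ?case by (intro exI[of _ Q]) simp
qed

lemma poly_of_int_map: "poly (map_poly of_int p) (of_int x) = (of_int (poly p x) :: complex)"
  by (induction p) (simp_all add: map_poly_pCons)

text \<open>\<open>N\<close> is the absolute value of the \<open>n\<close>-th cyclotomic polynomial
  at \<open>q\<close>. A root of unity \<open>w\<close> other than 1 satisfies
  \<open>|q - w| > q - 1\<close>, and the cyclotomic factors of \<open>x^d - 1\<close> are among the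
  factors of \<open>x^n - 1\<close> different from the \<open>n\<close>-th one.\<close>

lemma cyclotomic_value:
  fixes q n :: nat
  assumes "q \<ge> 2" "n \<ge> 2"
  obtains N :: int where "N > int q - 1"
    and "\<And>d. d dvd n \<Longrightarrow> d < n \<Longrightarrow> \<exists>s. int q ^ n - 1 = N * s * (int q ^ d - 1)"
proof -
  have n: "n > 0" using assms by simp
  define P where "P d = (SOME P :: int poly. map_poly of_int P = cyclotomic d)" for d
  have P: "map_poly of_int (P d) = cyclotomic d" if "d dvd n" for d
    unfolding P_def using cyclotomic_int[OF dvd_pos_nat[OF n that]] by (rule someI_ex)
  define v where "v d = poly (P d) (int q)" for d
  have v: "complex_of_int (v d) = poly (cyclotomic d) (of_nat q)" if "d dvd n" for d
    using poly_of_int_map[of "P d" "int q"] P[OF that] by (simp add: v_def)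
  have prodv: "int q ^ d - 1 = (\<Prod>k\<in>{k. k dvd d}. v k)" if "d dvd n" for d
  proof -
    have d0: "d > 0" using that n by (auto dest: dvd_pos_nat)
    have "complex_of_int (\<Prod>k\<in>{k. k dvd d}. v k) = poly (\<Prod>k\<in>{k. k dvd d}. cyclotomic k) (of_nat q)"
      unfolding of_int_prod poly_prod using that by (intro prod.cong refl v) (auto intro: dvd_trans)
    also have "\<dots> = poly (Polynomial.monom 1 d - 1) (of_nat q)" using unity_poly_factor[OF d0] by simp
    also have "\<dots> = complex_of_int (int q ^ d - 1)" by (simp add: poly_monom)
    finally show ?thesis using of_int_eq_iff by metis
  qed
  define S where "S = {w::complex. w ^ n = 1 \<and> (\<forall>k. 0 < k \<and> k < n \<longrightarrow> w ^ k \<noteq> 1)}"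
  have finS: "finite S" unfolding S_def using n by (rule finite_unity_roots)
  have ge1: "norm (of_nat q - w) > real q - 1" if "w \<in> S" for w
  proof -
    have "norm w ^ n = 1" using that by (simp add: S_def norm_power[symmetric])
    hence "norm w = 1" using power_eq_imp_eq_base[of "norm w" n 1] n by simp
    have w1: "w \<noteq> 1" using that assms by (auto simp: S_def dest: spec[of _ 1])
    show ?thesis
    proof (rule ccontr)
      assume "\<not> ?thesis"
      hence le: "norm (of_nat q - w) \<le> real q - 1" by simp
      have "Re w \<le> 1" using complex_Re_le_cmod[of w] \<open>norm w = 1\<close> by simp
      moreover have "real q - Re w \<le> norm (of_nat q - w)"
        using complex_Re_le_cmod[of "of_nat q - w"] by simp
      ultimately have "Re w = 1" using le by linarith
      hence "Im w = 0" using \<open>norm w = 1\<close> by (simp add: cmod_def)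
      with \<open>Re w = 1\<close> w1 show False by (simp add: complex_eq_iff)
    qed
  qed
  \<comment> \<open>One primitive root is named to show that the product over \<open>S\<close> is
    not empty: its factor exceeds \<open>q - 1\<close>, and all other factors are at least
    1.\<close>
  define z where "z = cis (2 * pi / real n)"
  have zS: "z \<in> S"
    unfolding S_def
  proof (safe)
    show "z ^ n = 1" using n by (simp add: z_def DeMoivre)
    fix k assume k: "0 < k" "k < n" "z ^ k = 1"
    hence "cis (real k * (2 * pi / real n)) = 1" by (simp add: z_def DeMoivre)
    hence "cos (real k * (2 * pi / real n)) = 1" by (simp add: complex_eq_iff)
    then obtain m :: int where "real k * (2 * pi / real n) = real_of_int m * 2 * pi"
      unfolding cos_one_2pi_int by blast
    hence "real k = real_of_int m * real n" using n by (simp add: field_simps)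
    hence "int k = m * int n" by (metis of_int_eq_iff of_int_mult of_int_of_nat_eq)
    hence "int n dvd int k" by simp
    thus False using k by (simp add: nat_dvd_not_less)
  qed
  have "real q - 1 < norm (of_nat q - z)" using ge1 zS by simp
  also have "\<dots> \<le> norm (of_nat q - z) * (\<Prod>w\<in>S - {z}. norm (of_nat q - w))"
  proof -
    have "1 \<le> (\<Prod>w\<in>S - {z}. norm (of_nat q - w))"
    proof (rule prod_ge_1)
      fix x assume "x \<in> S - {z}"
      hence "norm (of_nat q - x) > real q - 1" using ge1 by blast
      thus "1 \<le> norm (of_nat q - x)" using assms by linarith
    qed
    thus ?thesis by (simp add: mult_le_cancel_left1)
  qed
  also have "\<dots> = norm (\<Prod>w\<in>S. of_nat q - w)"
    unfolding prod_norm[symmetric] using finS zS by (subst prod.remove[of S z]) auto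
  also have "(\<Prod>w\<in>S. of_nat q - w) = poly (cyclotomic n) (of_nat q)"
    unfolding cyclotomic_def poly_prod S_def[symmetric] by simp
  also have "\<dots> = of_int (v n)" using v[of n] by simp
  finally have "real_of_int (\<bar>v n\<bar>) > real q - 1" by simp
  hence N: "\<bar>v n\<bar> > int q - 1" by linarith
  show ?thesis
  proof (rule that[OF N])
    fix d assume d: "d dvd n" "d < n"
    have sub: "{k. k dvd d} \<subseteq> {k. k dvd n} - {n}" using d n by (auto intro: dvd_trans dest: dvd_imp_le)
    have "int q ^ n - 1 = v n * (\<Prod>k\<in>{k. k dvd n} - {n}. v k)"
      using prodv[of n] n by (simp add: prod.remove[of "{k. k dvd n}" n])
    also have "(\<Prod>k\<in>{k. k dvd n} - {n}. v k) = (\<Prod>k\<in>{k. k dvd n} - {n} - {k. k dvd d}. v k) * (\<Prod>k\<in>{k. k dvd d}. v k)"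
      using sub n by (intro prod.subset_diff) auto
    finally have "int q ^ n - 1 = v n * (\<Prod>k\<in>{k. k dvd n} - {n} - {k. k dvd d}. v k) * (int q ^ d - 1)"
      using prodv[OF d(1)] by simp
    \<comment> \<open>The sign of \<open>v n\<close> goes into the cofactor
      \<open>s\<close>.\<close>
    also have "v n = \<bar>v n\<bar> * sgn (v n)" by (metis mult.commute sgn_mult_abs)
    finally show "\<exists>s. int q ^ n - 1 = \<bar>v n\<bar> * s * (int q ^ d - 1)"
      by (intro exI[of _ "sgn (v n) * (\<Prod>k\<in>{k. k dvd n} - {n} - {k. k dvd d}. v k)"]) (simp only: mult.assoc)
  qed
qed

section \<open>Wedderburn's little theorem\<close>

text \<open>The quotient \<open>L / J\<close> is a finite division ring. It is handled through subsets of \<open>L\<close> that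
  contain \<open>J\<close> and through congruences modulo \<open>J\<close>, because \<open>L\<close> is not a type.\<close>

locale finite_division_quotient =
  fixes L J :: "'r::ring_1 set" and e :: 'r
  assumes fin: "finite L"
    and L: "0 \<in> L" "e \<in> L" "\<And>x y. x \<in> L \<Longrightarrow> y \<in> L \<Longrightarrow> x - y \<in> L"
      "\<And>x y. x \<in> L \<Longrightarrow> y \<in> L \<Longrightarrow> x * y \<in> L"
    and id: "\<And>x. x \<in> L \<Longrightarrow> e * x = x" "\<And>x. x \<in> L \<Longrightarrow> x * e = x"
    and J: "J \<subseteq> L" "0 \<in> J" "e \<notin> J" "\<And>x y. x \<in> J \<Longrightarrow> y \<in> J \<Longrightarrow> x - y \<in> J"
      "\<And>x y. x \<in> J \<Longrightarrow> y \<in> L \<Longrightarrow> x * y \<in> J" "\<And>x y. x \<in> L \<Longrightarrow> y \<in> J \<Longrightarrow> x * y \<in> J"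
    and inv: "\<And>x. x \<in> L \<Longrightarrow> x \<notin> J \<Longrightarrow> \<exists>y\<in>L. x * y = e \<and> y * x = e"
begin

lemma J_minus: "x \<in> J \<Longrightarrow> - x \<in> J" using J(4)[OF J(2)] by simp
lemma J_add: "x \<in> J \<Longrightarrow> y \<in> J \<Longrightarrow> x + y \<in> J" using J(4)[of x "- y"] J_minus by simp
lemma L_minus: "x \<in> L \<Longrightarrow> - x \<in> L" using L(3)[OF L(1)] by simp
lemma L_add: "x \<in> L \<Longrightarrow> y \<in> L \<Longrightarrow> x + y \<in> L" using L(3)[of x "- y"] L_minus by simp
lemma finJ: "finite J" using fin J(1) finite_subset by blast
lemma J_cancel: "x - y \<in> J \<Longrightarrow> y \<in> J \<Longrightarrow> x \<in> J" using J_add[of "x - y" y] by simp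
lemma J_sym: "x - y \<in> J \<Longrightarrow> y - x \<in> J" using J_minus[of "x - y"] by simp
lemma J_trans: "x - y \<in> J \<Longrightarrow> y - z \<in> J \<Longrightarrow> x - z \<in> J" using J_add[of "x - y" "y - z"] by simp
lemma J_both: "x \<in> L \<Longrightarrow> y \<in> J \<Longrightarrow> z \<in> L \<Longrightarrow> x * y * z \<in> J"
  using J(5,6) by blast
lemma unit_notin_J: "x \<in> L \<Longrightarrow> y \<in> L \<Longrightarrow> x * y = e \<Longrightarrow> x \<notin> J \<and> y \<notin> J"
  using J(3,5,6) by metis

text \<open>The full preimage in \<open>L\<close> of an additive subgroup of \<open>L / J\<close>
  that is stable under left multiplication by \<open>K\<close>; when \<open>K\<close> is a division
  subring, this is a subspace.\<close>

definition cong_module :: "'r set \<Rightarrow> 'r set \<Rightarrow> bool" where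
  "cong_module K W \<longleftrightarrow> J \<subseteq> W \<and> W \<subseteq> L \<and> (\<forall>x\<in>W. \<forall>y\<in>W. x - y \<in> W) \<and> (\<forall>x\<in>K. \<forall>y\<in>W. x * y \<in> W)"

text \<open>The full preimage in \<open>L\<close> of a division subring of
  \<open>L / J\<close>.\<close>

definition div_subring :: "'r set \<Rightarrow> bool" where
  "div_subring K \<longleftrightarrow> cong_module K K \<and> e \<in> K \<and> (\<forall>x\<in>K - J. \<forall>y\<in>L. x * y = e \<and> y * x = e \<longrightarrow> y \<in> K)"

lemma cong_moduleI:
  assumes "J \<subseteq> W" "W \<subseteq> L" "\<And>x y. x \<in> W \<Longrightarrow> y \<in> W \<Longrightarrow> x - y \<in> W"
    "\<And>x y. x \<in> K \<Longrightarrow> y \<in> W \<Longrightarrow> x * y \<in> W"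
  shows "cong_module K W"
  using assms unfolding cong_module_def by simp

lemma div_subringI:
  assumes "J \<subseteq> K" "K \<subseteq> L" "\<And>x y. x \<in> K \<Longrightarrow> y \<in> K \<Longrightarrow> x - y \<in> K"
    "\<And>x y. x \<in> K \<Longrightarrow> y \<in> K \<Longrightarrow> x * y \<in> K" "e \<in> K"
    "\<And>x y. x \<in> K \<Longrightarrow> y \<in> L \<Longrightarrow> x * y = e \<Longrightarrow> y * x = e \<Longrightarrow> y \<in> K"
  shows "div_subring K"
  unfolding div_subring_def using assms by (intro conjI ballI impI cong_moduleI) auto

lemma cong_module_J:
  assumes "div_subring K" shows "cong_module K J"
proof -
  have "K \<subseteq> L" using assms unfolding div_subring_def cong_module_def by blast
  thus ?thesis using J(1,4,6) by (intro cong_moduleI) blast+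
qed

lemma cong_module_add: "cong_module K W \<Longrightarrow> x \<in> W \<Longrightarrow> y \<in> W \<Longrightarrow> x + y \<in> W"
proof -
  assume *: "cong_module K W" "x \<in> W" "y \<in> W"
  hence d: "\<And>x y. x \<in> W \<Longrightarrow> y \<in> W \<Longrightarrow> x - y \<in> W" and "0 \<in> W"
    using J(2) unfolding cong_module_def by auto
  from d[OF *(2) d[OF this(2) *(3)]] show ?thesis by simp
qed

text \<open>One more basis vector. A coefficient outside \<open>J\<close> is invertible, so
  \<open>z w\<close> lies in \<open>U\<close> only for \<open>z\<close> in \<open>J\<close>; hence
  every fibre of the map \<open>(z, u) \<mapsto> u + z w\<close> has \<open>card J\<close>
  elements.\<close>

lemma cong_module_extend:
  assumes K: "div_subring K" and U: "cong_module K U" and w: "w \<in> L" "w \<notin> U"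
  shows "cong_module K {u + z * w | u z. u \<in> U \<and> z \<in> K}"
    and "card K * card U = card J * card {u + z * w | u z. u \<in> U \<and> z \<in> K}"
proof -
  let ?U' = "{u + z * w | u z. u \<in> U \<and> z \<in> K}"
  have KL: "K \<subseteq> L" "J \<subseteq> K" and K0: "0 \<in> K" and Kd: "\<And>x y. x \<in> K \<Longrightarrow> y \<in> K \<Longrightarrow> x - y \<in> K"
    and Km: "\<And>x y. x \<in> K \<Longrightarrow> y \<in> K \<Longrightarrow> x * y \<in> K"
    using K J(2) unfolding div_subring_def cong_module_def by auto
  have UL: "J \<subseteq> U" "U \<subseteq> L" and Ud: "\<And>x y. x \<in> U \<Longrightarrow> y \<in> U \<Longrightarrow> x - y \<in> U"
    and Um: "\<And>x y. x \<in> K \<Longrightarrow> y \<in> U \<Longrightarrow> x * y \<in> U"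
    using U J(2) unfolding cong_module_def by auto
  have zw: "z * w \<in> U \<longleftrightarrow> z \<in> J" if "z \<in> K" for z
  proof
    assume *: "z * w \<in> U"
    show "z \<in> J"
    proof (rule ccontr)
      assume "z \<notin> J"
      then obtain y where y: "y \<in> L" "z * y = e" "y * z = e" using inv[of z] \<open>z \<in> K\<close> KL by blast
      hence "y \<in> K" using K that \<open>z \<notin> J\<close> unfolding div_subring_def by blast
      hence "y * (z * w) \<in> U" using * Um by blast
      moreover have "y * (z * w) = w" using y id w by (simp flip: mult.assoc)
      ultimately show False using w by simp
    qed
  next
    assume "z \<in> J" thus "z * w \<in> U" using J(5) w UL by blast
  qed
  show "cong_module K ?U'"
    unfolding cong_module_def
  proof (intro conjI ballI subsetI)
    fix x assume "x \<in> J"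
    moreover have "x = x + 0 * w" by simp
    ultimately show "x \<in> ?U'" using UL(1) K0 by blast
  next
    fix x assume "x \<in> ?U'"
    then obtain u z where "x = u + z * w" "u \<in> L" "z \<in> L" using UL KL by blast
    thus "x \<in> L" using L_add L(4) w(1) by simp
  next
    fix x y assume "x \<in> ?U'" "y \<in> ?U'"
    then obtain u z u' z' where "x = u + z * w" "y = u' + z' * w" "u \<in> U" "z \<in> K" "u' \<in> U" "z' \<in> K" by auto
    moreover have "u + z * w - (u' + z' * w) = (u - u') + (z - z') * w" by (simp add: algebra_simps)
    ultimately show "x - y \<in> ?U'" using Ud Kd by blast
  next
    fix k x assume "k \<in> K" "x \<in> ?U'"
    then obtain u z where "x = u + z * w" "u \<in> U" "z \<in> K" by auto
    moreover have "k * (u + z * w) = k * u + (k * z) * w" by (simp add: algebra_simps)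
    ultimately show "k * x \<in> ?U'" using \<open>k \<in> K\<close> Um Km by blast
  qed
  have finK: "finite K" "finite U" using KL UL fin finite_subset by blast+
  let ?f = "\<lambda>(z, u). u + z * w"
  have img: "?f ` (K \<times> U) = ?U'" by (auto simp: image_iff)
  have fib: "card {p \<in> K \<times> U. ?f p = v} = card J" if "v \<in> ?U'" for v
  proof -
    from that obtain u0 z0 where v: "v = u0 + z0 * w" "u0 \<in> U" "z0 \<in> K" by auto
    have "{p \<in> K \<times> U. ?f p = v} = (\<lambda>j. (z0 + j, u0 - j * w)) ` J"
    proof (intro Set.set_eqI iffI)
      fix p assume "p \<in> {p \<in> K \<times> U. ?f p = v}"
      then obtain z u where p: "p = (z, u)" "z \<in> K" "u \<in> U" "u + z * w = u0 + z0 * w" using v by auto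
      hence "(z - z0) * w = u0 - u" by (simp add: algebra_simps)
      hence "(z - z0) * w \<in> U" using Ud v p by simp
      hence "z - z0 \<in> J" using zw Kd v p by simp
      thus "p \<in> (\<lambda>j. (z0 + j, u0 - j * w)) ` J" using p \<open>(z - z0) * w = u0 - u\<close>
        by (intro image_eqI[of _ _ "z - z0"]) auto
    next
      fix p assume "p \<in> (\<lambda>j. (z0 + j, u0 - j * w)) ` J"
      then obtain j where j: "j \<in> J" "p = (z0 + j, u0 - j * w)" by auto
      have "z0 + j \<in> K" using Kd[of z0 "- j"] v j KL J_minus by auto
      moreover have "j * w \<in> U" using zw j KL by blast
      ultimately show "p \<in> {p \<in> K \<times> U. ?f p = v}" using v j Ud by (auto simp: algebra_simps)
    qed
    moreover have "inj_on (\<lambda>j. (z0 + j, u0 - j * w)) J" by (auto simp: inj_on_def)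
    ultimately show ?thesis by (simp add: card_image)
  qed
  have "card (K \<times> U) = (\<Sum>v\<in>?U'. card {p \<in> K \<times> U. ?f p = v})"
    using sum.image_gen[of "K \<times> U" "\<lambda>_. 1 :: nat" ?f] finK unfolding img by simp
  also have "\<dots> = card ?U' * card J" by (simp add: fib)
  finally show "card K * card U = card J * card ?U'" by (simp add: card_cartesian_product mult.commute)
qed

text \<open>\<open>t\<close> is the dimension of \<open>W / U\<close> over \<open>K / J\<close>.
  Multiplying out the powers of \<open>card J\<close> keeps the formula free of divisions.\<close>

lemma card_cong_module:
  assumes K: "div_subring K" and U: "cong_module K U" and W: "cong_module K W" and UW: "U \<subseteq> W"
  shows "\<exists>t. card W * card J ^ t = card U * card K ^ t"
  using U UW
proof (induction "card W - card U" arbitrary: U rule: less_induct)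
  case less
  have finW: "finite W" using W fin finite_subset unfolding cong_module_def by blast
  show ?case
  proof (cases "U = W")
    case True thus ?thesis by (intro exI[of _ 0]) simp
  next
    case False
    then obtain w where w: "w \<in> W" "w \<notin> U" using less by blast
    have wL: "w \<in> L" using w W unfolding cong_module_def by blast
    let ?U' = "{u + z * w | u z. u \<in> U \<and> z \<in> K}"
    note ext = cong_module_extend[OF K less.prems(1) wL w(2)]
    have zeroK: "0 \<in> K" "e \<in> K" and zeroU: "0 \<in> U"
      using K less.prems(1) J(2) unfolding div_subring_def cong_module_def by blast+
    have sub: "?U' \<subseteq> W" using less.prems W w(1) cong_module_add[OF W] unfolding cong_module_def by blast
    have "U \<subseteq> ?U'"
    proof
      fix u assume "u \<in> U"
      moreover have "u = u + 0 * w" by simp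
      ultimately show "u \<in> ?U'" using zeroK by blast
    qed
    moreover have "w = 0 + e * w" using id(1)[OF wL] by simp
    hence "w \<in> ?U'" using zeroK zeroU by blast
    ultimately have "U \<subset> ?U'" using w by blast
    hence "card U < card ?U'" using psubset_card_mono[OF finite_subset[OF sub finW]] by blast
    moreover have "card ?U' \<le> card W" by (rule card_mono[OF finW sub])
    ultimately have "card W - card ?U' < card W - card U" by linarith
    from less.hyps[OF this ext(1) sub] obtain t where t: "card W * card J ^ t = card ?U' * card K ^ t" by blast
    have "card W * card J ^ Suc t = card J * card ?U' * card K ^ t" using t by (simp add: ac_simps)
    also have "\<dots> = card U * card K ^ Suc t" using ext(2) by (simp add: ac_simps)
    finally show ?thesis by blast
  qed
qed

lemma card_cong_module_power:
  assumes K: "div_subring K" and kq: "card K = card J * q" and W: "cong_module K W"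
  shows "\<exists>t. card W = card J * q ^ t"
proof -
  have "card J > 0" using J(2) finJ by (auto simp: card_gt_0_iff)
  moreover obtain t where "card W * card J ^ t = card J * card K ^ t"
    using card_cong_module[OF K cong_module_J[OF K] W] W unfolding cong_module_def by blast
  ultimately have "card W = card J * q ^ t" by (simp add: kq power_mult_distrib)
  thus ?thesis by blast
qed

section \<open>Centralizers, the centre and conjugacy classes of the quotient\<close>

definition centr :: "'r \<Rightarrow> 'r set" where
  "centr a = {x \<in> L. x * a - a * x \<in> J}"

lemma comm_diff: "x * a - a * x \<in> J \<Longrightarrow> y * a - a * y \<in> J \<Longrightarrow> (x - y) * a - a * (x - y) \<in> J"
  using J(4)[of "x * a - a * x" "y * a - a * y"] by (simp add: algebra_simps)

lemma comm_mult:
  assumes "x \<in> L" "y \<in> L" "x * a - a * x \<in> J" "y * a - a * y \<in> J"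
  shows "(x * y) * a - a * (x * y) \<in> J"
  using J_add[OF J(6)[OF assms(1,4)] J(5)[OF assms(3,2)]] by (simp add: algebra_simps)

lemma comm_inv:
  assumes "x \<in> L" "y \<in> L" "a \<in> L" "x * a - a * x \<in> J" "x * y = e" "y * x = e"
  shows "y * a - a * y \<in> J"
proof -
  have "y * (x * a - a * x) * y \<in> J" using assms J_both by blast
  moreover have "y * (x * a - a * x) * y = (y * x) * a * y - y * a * (x * y)" by (simp add: algebra_simps)
  ultimately have "a * y - y * a \<in> J" using assms id L by simp
  thus ?thesis by (rule J_sym)
qed

lemma comm_J: "x \<in> J \<Longrightarrow> a \<in> L \<Longrightarrow> x * a - a * x \<in> J"
  using J(4)[OF J(5)[of x a] J(6)[of a x]] by blast

lemma div_subring_centr: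
  assumes a: "a \<in> L" shows "div_subring (centr a)"
proof (rule div_subringI)
  show "J \<subseteq> centr a" using J(1) comm_J[OF _ a] unfolding centr_def by blast
  show "centr a \<subseteq> L" unfolding centr_def by blast
  show "e \<in> centr a" using L(2) id a J(2) unfolding centr_def by simp
  show "x - y \<in> centr a" "x * y \<in> centr a" if "x \<in> centr a" "y \<in> centr a" for x y
    using that L(3,4)[of x y] comm_diff[of x a y] comm_mult[of x y a] unfolding centr_def by blast+
  show "y \<in> centr a" if "x \<in> centr a" "y \<in> L" "x * y = e" "y * x = e" for x y
    using that comm_inv[of x y a] a unfolding centr_def by blast
qed

definition cent :: "'r set" where "cent = {x \<in> L. \<forall>a\<in>L. x * a - a * x \<in> J}"

lemma div_subring_cent: "div_subring cent"
proof (rule div_subringI)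
  show "J \<subseteq> cent" using J(1) comm_J unfolding cent_def by blast
  show "cent \<subseteq> L" unfolding cent_def by blast
  show "e \<in> cent" using L(2) id J(2) unfolding cent_def by simp
  show "x - y \<in> cent" "x * y \<in> cent" if "x \<in> cent" "y \<in> cent" for x y
    using that L(3,4)[of x y] comm_diff[of x _ y] comm_mult[of x y] unfolding cent_def by blast+
  show "y \<in> cent" if "x \<in> cent" "y \<in> L" "x * y = e" "y * x = e" for x y
    using that comm_inv[of x y] unfolding cent_def by blast
qed

text \<open>Conjugacy in \<open>L / J\<close>, written as \<open>x a = b x\<close> modulo
  \<open>J\<close> so that no inverse has to be chosen.\<close>

definition conj_class :: "'r \<Rightarrow> 'r set" where
  "conj_class a = {b \<in> L. \<exists>x\<in>L - J. x * a - b * x \<in> J}"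

lemma conj_class_refl: "a \<in> L \<Longrightarrow> a \<in> conj_class a"
  unfolding conj_class_def using L(2) J(2,3) id by (auto intro!: bexI[of _ e])

lemma not_J_mult: "x \<in> L - J \<Longrightarrow> y \<in> L - J \<Longrightarrow> x * y \<in> L - J"
proof -
  assume x: "x \<in> L - J" and y: "y \<in> L - J"
  obtain x' where x': "x' \<in> L" "x' * x = e" using inv x by blast
  have "x' * (x * y) = y" using x' id y by (simp flip: mult.assoc)
  thus ?thesis using J(6) x' x y L(4) by (metis DiffD1 DiffD2 DiffI)
qed

lemma conj_class_trans:
  assumes "a \<in> L" "b \<in> conj_class a" "c \<in> conj_class b" shows "c \<in> conj_class a"
proof -
  obtain x y where x: "x \<in> L - J" "x * a - b * x \<in> J" and y: "y \<in> L - J" "y * b - c * y \<in> J" and "b \<in> L" "c \<in> L"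
    using assms unfolding conj_class_def by blast
  have "y * (x * a - b * x) + (y * b - c * y) * x \<in> J" using x y by (intro J_add J(6)[of y] J(5)[of _ x]) auto
  hence "(y * x) * a - c * (y * x) \<in> J" by (simp add: algebra_simps)
  thus ?thesis using not_J_mult[OF y(1) x(1)] \<open>c \<in> L\<close> unfolding conj_class_def by blast
qed

lemma conj_class_sym:
  assumes "a \<in> L" "b \<in> conj_class a" shows "a \<in> conj_class b"
proof -
  obtain x where x: "x \<in> L - J" "x * a - b * x \<in> J" and "b \<in> L"
    using assms unfolding conj_class_def by blast
  obtain y where y: "y \<in> L" "x * y = e" "y * x = e" using inv x by blast
  have "y * (x * a - b * x) * y \<in> J" using x y J_both by blast
  moreover have "y * (x * a - b * x) * y = (y * x) * a * y - y * b * (x * y)" by (simp add: algebra_simps)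
  ultimately have "a * y - y * b \<in> J" using y id assms \<open>b \<in> L\<close> L by simp
  hence "y * b - a * y \<in> J" by (rule J_sym)
  thus ?thesis using y unit_notin_J[of x y] x assms unfolding conj_class_def by blast
qed

text \<open>Double counting of the pairs \<open>(x, b)\<close> with \<open>x a = b x\<close> modulo
  \<open>J\<close>: for a unit \<open>x\<close> the possible \<open>b\<close> form one coset of
  \<open>J\<close>, and for a conjugate \<open>b\<close> the possible \<open>x\<close> form a left
  translate of the units of the centralizer.\<close>

lemma card_conj_class:
  assumes a: "a \<in> L"
  shows "(card L - card J) * card J = card (conj_class a) * (card (centr a) - card J)"
proof -
  let ?P = "\<lambda>x b. x * a - b * x \<in> J"
  let ?cl = "conj_class a"
  have clL: "?cl \<subseteq> L" unfolding conj_class_def by blast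
  have finC: "finite ?cl" using clL fin finite_subset by blast
  have 1: "card {b \<in> ?cl. ?P x b} = card J" if x: "x \<in> L - J" for x
  proof -
    obtain y where y: "y \<in> L" "x * y = e" "y * x = e" using inv x by blast
    have *: "?P x b \<longleftrightarrow> b - x * a * y \<in> J" if "b \<in> L" for b
    proof
      assume "?P x b"
      hence "(x * a - b * x) * y \<in> J" using J(5) y by blast
      hence "x * a * y - b \<in> J" using y that id by (simp add: algebra_simps)
      thus "b - x * a * y \<in> J" by (rule J_sym)
    next
      assume "b - x * a * y \<in> J"
      hence "(b - x * a * y) * x \<in> J" using J(5) x by blast
      hence "b * x - x * a \<in> J" using y that id a L x by (simp add: algebra_simps)
      thus "?P x b" by (rule J_sym)
    qed
    have xay: "x * a * y \<in> L" using x a y by (intro L(4)) auto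
    have "{b \<in> ?cl. ?P x b} = (\<lambda>j. x * a * y + j) ` J"
    proof (intro Set.set_eqI iffI)
      fix b assume "b \<in> {b \<in> ?cl. ?P x b}"
      thus "b \<in> (\<lambda>j. x * a * y + j) ` J" using * clL by (intro image_eqI[of _ _ "b - x * a * y"]) auto
    next
      fix b assume "b \<in> (\<lambda>j. x * a * y + j) ` J"
      then obtain j where j: "j \<in> J" "b = x * a * y + j" by blast
      hence "b \<in> L" using xay J(1) L_add by blast
      moreover have "?P x b" using * j \<open>b \<in> L\<close> by simp
      ultimately show "b \<in> {b \<in> ?cl. ?P x b}" using x unfolding conj_class_def by blast
    qed
    thus ?thesis by (simp add: card_image)
  qed
  have 2: "card {x \<in> L - J. ?P x b} = card (centr a) - card J" if b: "b \<in> ?cl" for b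
  proof -
    obtain x0 where x0: "x0 \<in> L - J" "?P x0 b" using b unfolding conj_class_def by blast
    obtain y where y: "y \<in> L" "x0 * y = e" "y * x0 = e" using inv x0 by blast
    have bL: "b \<in> L" using b clL by blast
    have yJ: "y \<in> L - J" using unit_notin_J[of x0 y] x0 y by blast
    have "{x \<in> L - J. ?P x b} = (\<lambda>c. x0 * c) ` (centr a - J)"
    proof (intro Set.set_eqI iffI)
      fix x assume "x \<in> {x \<in> L - J. ?P x b}"
      hence x: "x \<in> L - J" "?P x b" by auto
      have "x0 * a * y - b \<in> J"
      proof -
        have "(x0 * a - b * x0) * y \<in> J" using J(5) y x0 by blast
        thus ?thesis using y bL id by (simp add: algebra_simps)
      qed
      hence 3: "(x0 * a * y - b) * x \<in> J" using J(5) x by blast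
      have "x0 * a * (y * x) - x * a = (x0 * a * y - b) * x - (x * a - b * x)" by (simp add: algebra_simps)
      hence "x0 * a * (y * x) - x * a \<in> J" using J(4)[OF 3 x(2)] by (simp only:)
      hence "y * (x0 * a * (y * x) - x * a) \<in> J" using J(6) y by blast
      moreover have "y * (x0 * a * (y * x) - x * a) = (y * x0) * a * (y * x) - (y * x) * a" by (simp add: algebra_simps)
      ultimately have "a * (y * x) - (y * x) * a \<in> J" using y id a by simp
      hence "(y * x) * a - a * (y * x) \<in> J" by (rule J_sym)
      hence "y * x \<in> centr a - J" using not_J_mult[OF yJ x(1)] unfolding centr_def by blast
      moreover have "x = x0 * (y * x)" using y x id by (simp flip: mult.assoc)
      ultimately show "x \<in> (\<lambda>c. x0 * c) ` (centr a - J)" by blast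
    next
      fix x assume "x \<in> (\<lambda>c. x0 * c) ` (centr a - J)"
      then obtain c where c: "x = x0 * c" "c \<in> L - J" "c * a - a * c \<in> J" unfolding centr_def by blast
      have "x0 * (c * a - a * c) + (x0 * a - b * x0) * c \<in> J" using c x0 by (intro J_add J(6)[of x0] J(5)[of _ c]) auto
      hence "?P x b" using c by (simp add: algebra_simps)
      thus "x \<in> {x \<in> L - J. ?P x b}" using not_J_mult[OF x0(1) c(2)] c by blast
    qed
    moreover have "inj_on (\<lambda>c. x0 * c) (centr a - J)"
    proof (rule inj_onI)
      fix c d assume "c \<in> centr a - J" "d \<in> centr a - J" "x0 * c = x0 * d"
      hence "y * x0 * c = y * x0 * d" "c \<in> L" "d \<in> L" by (auto simp: mult.assoc centr_def)
      thus "c = d" using y id by simp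
    qed
    moreover have "J \<subseteq> centr a" using J(1) comm_J a unfolding centr_def by blast
    ultimately show ?thesis by (simp add: card_image card_Diff_subset finJ)
  qed
  have "(\<Sum>x\<in>L - J. card {b \<in> ?cl. ?P x b}) = (\<Sum>b\<in>?cl. card {x \<in> L - J. ?P x b})"
    by (rule sum_multicount_gen) (use fin finC in auto)
  thus ?thesis using 1 2 by (simp add: card_Diff_subset finJ J(1))
qed

text \<open>Witt's argument: in the class equation of \<open>L - J\<close>, the integer \<open>N\<close> of
  \<open>cyclotomic_value\<close> divides every term but the order of the centre, which is smaller than \<open>N\<close>.\<close>

theorem commutative_quotient:
  assumes "x \<in> L" "y \<in> L"
  shows "x * y - y * x \<in> J"
proof (rule ccontr)
  assume nc: "\<not> ?thesis"
  have J0: "card J > 0" using J(2) finJ by (auto simp: card_gt_0_iff)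
  have cm: "cong_module cent cent" using div_subring_cent unfolding div_subring_def by blast
  \<comment> \<open>The cosets of \<open>J\<close> in the preimage of the centre; their number
    \<open>q\<close> is the order of the centre of \<open>L / J\<close>.\<close>
  define C where "C = (\<lambda>z. {z' \<in> cent. z' - z \<in> J}) ` cent"
  have finCent: "finite cent" using fin unfolding cent_def by simp
  have Jcent: "J \<subseteq> cent" using cm unfolding cong_module_def by blast
  have "card J * card C = card (\<Union>C)"
  proof (rule card_partition)
    show "finite C" unfolding C_def using finCent by blast
    show "finite (\<Union>C)" unfolding C_def using finCent by auto
    show "card c = card J" if "c \<in> C" for c
    proof -
      from that obtain z where z: "z \<in> cent" "c = {z' \<in> cent. z' - z \<in> J}" unfolding C_def by blast
      have "c = (\<lambda>j. z + j) ` J"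
      proof (intro Set.set_eqI iffI)
        fix u assume "u \<in> c" thus "u \<in> (\<lambda>j. z + j) ` J" using z by (intro image_eqI[of _ _ "u - z"]) auto
      next
        fix u assume "u \<in> (\<lambda>j. z + j) ` J"
        thus "u \<in> c" using z Jcent cong_module_add[OF cm] by auto
      qed
      thus ?thesis by (simp add: card_image)
    qed
    show "c1 \<inter> c2 = {}" if "c1 \<in> C" "c2 \<in> C" "c1 \<noteq> c2" for c1 c2
      using that J_sym J_trans unfolding C_def by blast
  qed
  moreover have "\<Union>C = cent" unfolding C_def using J(2) by auto
  ultimately have cq: "card cent = card J * card C" by simp
  define q where "q = card C"
  note cq = cq[folded q_def]
  have "e \<in> cent" using div_subring_cent unfolding div_subring_def by blast
  hence "J \<subset> cent" using J(3) Jcent by blast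
  hence "card J < card cent" using finCent psubset_card_mono by blast
  hence q2: "q \<ge> 2" using cq by (cases "q = 0 \<or> q = 1") auto
  have cmL: "cong_module K L" if "K \<subseteq> L" for K unfolding cong_module_def using L J(1) that by blast
  obtain n where n: "card L = card J * q ^ n"
    using card_cong_module_power[OF div_subring_cent cq cmL] unfolding cent_def by blast
  have centL: "cent \<subset> L" using assms nc unfolding cent_def by blast
  have "card cent < card L" using centL fin psubset_card_mono by blast
  hence "q ^ 1 < q ^ n" using n cq J0 by simp
  hence n2: "n \<ge> 2" using q2 by (subst (asm) power_strict_increasing_iff) auto
  obtain N :: int where N: "N > int q - 1"
    "\<And>d. d dvd n \<Longrightarrow> d < n \<Longrightarrow> \<exists>s. int q ^ n - 1 = N * s * (int q ^ d - 1)"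
    using cyclotomic_value[OF q2 n2] by blast
  have cl_dvd: "int (card J) * N dvd int (card (conj_class a))" if a: "a \<in> L" "a \<notin> cent" for a
  proof -
    have K: "div_subring (centr a)" using div_subring_centr a by blast
    have KL: "centr a \<subseteq> L" unfolding centr_def by blast
    have "cong_module cent (centr a)" using K a unfolding div_subring_def cong_module_def cent_def centr_def by blast
    then obtain d where d: "card (centr a) = card J * q ^ d"
      using card_cong_module_power[OF div_subring_cent cq] by blast
    \<comment> \<open>The centralizer is counted as a space over the centre, and \<open>L\<close> as
      a space over the centralizer; comparing exponents gives \<open>n = d t\<close>.\<close>
    obtain t where t: "card L = card J * (q ^ d) ^ t" using card_cong_module_power[OF K d cmL[OF KL]] by blast
    hence "q ^ n = q ^ (d * t)" using n J0 by (simp add: power_mult)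
    hence dn: "n = d * t" using q2 by (subst (asm) power_inject_exp) auto
    have "a \<in> L \<and> (\<exists>b\<in>L. a * b - b * a \<notin> J)" using a unfolding cent_def by blast
    hence "centr a \<subset> L" using J_sym unfolding centr_def by blast
    hence "card (centr a) < card L" using fin psubset_card_mono by blast
    hence "q ^ d < q ^ n" using n d J0 by simp
    hence "d < n" using q2 by (subst (asm) power_strict_increasing_iff) auto
    moreover have "e \<in> centr a" using K unfolding div_subring_def by blast
    moreover have "J \<subseteq> centr a" using K unfolding div_subring_def cong_module_def by blast
    ultimately have "card J < card (centr a)" using J(3) fin KL finite_subset by (metis psubsetI psubset_card_mono)
    hence "q ^ d > 1" using d by simp
    obtain s where s: "int q ^ n - 1 = N * s * (int q ^ d - 1)" using N(2)[of d] dn \<open>d < n\<close> by auto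
    have pos: "card J \<le> card L" "card J \<le> card (centr a)" using J(1) \<open>J \<subseteq> centr a\<close> fin KL finite_subset card_mono by metis+
    have "int (card L - card J) = int (card J) * (int q ^ n - 1)"
      using pos(1) by (simp add: of_nat_diff n right_diff_distrib)
    moreover have "int (card (centr a) - card J) = int (card J) * (int q ^ d - 1)"
      using pos(2) by (simp add: of_nat_diff d right_diff_distrib)
    moreover have "int (card L - card J) * int (card J) = int (card (conj_class a)) * int (card (centr a) - card J)"
      using card_conj_class[OF a(1)] by (simp flip: of_nat_mult)
    ultimately have "int (card J) * (int (card J) * (int q ^ n - 1)) = int (card J) * (int (card (conj_class a)) * (int q ^ d - 1))"
      by (simp add: ac_simps)
    hence "int (card (conj_class a)) * (int q ^ d - 1) = int (card J) * (int q ^ n - 1)"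
      using J0 by (simp only: mult_cancel_left) simp
    hence "int (card (conj_class a)) * (int q ^ d - 1) = int (card J) * N * s * (int q ^ d - 1)"
      by (simp only: s mult.assoc)
    moreover have "int q ^ d - 1 \<noteq> 0" using \<open>q ^ d > 1\<close> by (metis eq_iff_diff_eq_0 less_irrefl of_nat_1 of_nat_eq_iff of_nat_power)
    ultimately have "int (card (conj_class a)) = int (card J) * N * s" by (simp only: mult_cancel_right) blast
    thus ?thesis by simp
  qed
  have N0: "N > 0" using N(1) q2 by simp
  \<comment> \<open>The classes of the non-central elements. Each has size divisible by
    \<open>card J * N\<close>, hence so has the set of all non-central elements.\<close>
  define X where "X = conj_class ` (L - cent)"
  have noncent: "b \<in> L - cent" if a: "a \<in> L - cent" and b: "b \<in> conj_class a" for a b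
  proof (rule ccontr)
    assume "b \<notin> L - cent"
    hence bc: "b \<in> cent" "b \<in> L" using b unfolding conj_class_def by auto
    obtain x where x: "x \<in> L - J" "x * a - b * x \<in> J" using b unfolding conj_class_def by blast
    have "b * x - x * b \<in> J" using bc x unfolding cent_def by blast
    hence "x * (a - b) \<in> J" using J_trans[OF x(2)] by (simp add: algebra_simps)
    moreover obtain y where y: "y \<in> L" "y * x = e" using inv x by blast
    ultimately have 1: "y * (x * (a - b)) \<in> J" using J(6) by blast
    have "y * (x * (a - b)) = (y * x) * (a - b)" by (simp only: mult.assoc)
    also have "\<dots> = a - b" using y(2) id(1)[of "a - b"] L(3) a bc by simp
    finally have "a - b \<in> J" using 1 by simp
    hence "a - b \<in> cent" using Jcent by auto
    hence "a \<in> cent" using cong_module_add[OF cm _ bc(1)] by fastforce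
    thus False using a by blast
  qed
  have "nat (int (card J) * N) dvd card (\<Union>X)"
  proof (rule dvd_partition)
    show "finite (\<Union>X)" unfolding X_def conj_class_def using fin by auto
    show "\<forall>c\<in>X. nat (int (card J) * N) dvd card c"
      using cl_dvd N0 unfolding X_def by (auto simp: nat_dvd_iff)
    show "\<forall>c1\<in>X. \<forall>c2\<in>X. c1 \<noteq> c2 \<longrightarrow> c1 \<inter> c2 = {}"
    proof (intro ballI impI, rule ccontr)
      fix c1 c2 assume c: "c1 \<in> X" "c2 \<in> X" "c1 \<noteq> c2" "c1 \<inter> c2 \<noteq> {}"
      then obtain a b u where ab: "a \<in> L" "b \<in> L" "c1 = conj_class a" "c2 = conj_class b" "u \<in> conj_class a" "u \<in> conj_class b"
        unfolding X_def by blast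
      have "b \<in> conj_class a" "a \<in> conj_class b" using ab conj_class_trans conj_class_sym by blast+
      hence "c1 = c2" using ab conj_class_trans by blast
      thus False using c by blast
    qed
  qed
  moreover have "\<Union>X = L - cent" unfolding X_def using noncent conj_class_refl by blast
  moreover have "card (L - cent) = card L - card cent" using centL finCent by (intro card_Diff_subset) auto
  ultimately have "nat (int (card J) * N) dvd card L - card cent" by simp
  hence "int (card J) * N dvd int (card L - card cent)" using N0 by (simp add: nat_dvd_iff)
  also have "int (card L - card cent) = int (card J) * (int q ^ n - int q)"
    using \<open>card cent < card L\<close> unfolding n cq by (simp add: of_nat_diff algebra_simps)
  finally have "N dvd int q ^ n - int q" using J0 by simp
  moreover have "N dvd int q ^ n - 1"
  proof -
    obtain s where "int q ^ n - 1 = N * s * (int q ^ 1 - 1)" using N(2)[of 1] n2 by auto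
    thus ?thesis by simp
  qed
  ultimately have "N dvd (int q ^ n - 1) - (int q ^ n - int q)" by (rule dvd_diff[rotated])
  hence "N dvd int q - 1" by simp
  thus False using N(1) q2 zdvd_imp_le by fastforce
qed

end

section \<open>Primitive idempotents of finite rings\<close>

definition nilpotent :: "'r::ring_1 \<Rightarrow> bool" where
  "nilpotent x \<longleftrightarrow> (\<exists>m. x ^ m = 0)"

lemma nilpotent_fix_right:
  assumes "nilpotent (n :: 'r::ring_1)" "u = u * n" shows "u = 0"
proof -
  have "u = u * n ^ m" for m by (induction m) (use assms in \<open>simp_all flip: mult.assoc\<close>)
  thus ?thesis using assms unfolding nilpotent_def by (metis mult_zero_right)
qed

lemma nilpotent_minus: "nilpotent (x :: 'r::ring_1) \<Longrightarrow> nilpotent (- x)"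
  unfolding nilpotent_def by (metis mult_zero_right power_minus)

lemma nilpotent_commute_mult:
  assumes "nilpotent x" "x * y = y * (x :: 'r::ring_1)" shows "nilpotent (x * y)"
proof -
  have "(x * y) ^ m = x ^ m * y ^ m" for m
  proof (induction m)
    case (Suc m)
    have "x ^ m * y = y * x ^ m" by (rule power_commuting_commutes[OF assms(2)])
    hence "x * (y * x ^ m) * y ^ m = x * (x ^ m * y) * y ^ m" by simp
    thus ?case using Suc by (simp add: mult.assoc)
  qed simp
  thus ?thesis using assms(1) unfolding nilpotent_def by (metis mult_zero_left)
qed

text \<open>The powers of \<open>x\<close> are eventually periodic. An exponent that is a multiple
  of the period and lies beyond the pre-period is not changed by doubling.\<close>

lemma finite_power_idempotent:
  assumes "finite R" "\<And>m. m > 0 \<Longrightarrow> (x :: 'r::ring_1) ^ m \<in> R"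
  shows "\<exists>m>0. x ^ m * x ^ m = x ^ m"
proof -
  have "\<not> inj_on (\<lambda>m. x ^ Suc m) UNIV"
    using assms finite_subset[of "range (\<lambda>m. x ^ Suc m)" R] by (auto dest: finite_imageD simp del: power_Suc)
  then obtain i j where ij: "i < j" "x ^ Suc i = x ^ Suc j"
    unfolding inj_on_def by (metis nat_neq_iff)
  define d where "d = j - i"
  have per: "x ^ (s + d) = x ^ s" if "s > i" for s
  proof -
    have "x ^ (s + d) = x ^ Suc j * x ^ (s - Suc i)" using that ij unfolding power_add[symmetric] d_def
      by (intro arg_cong[of _ _ "power x"]) simp
    also have "\<dots> = x ^ s" using that unfolding ij(2)[symmetric] power_add[symmetric]
      by (intro arg_cong[of _ _ "power x"]) simp
    finally show ?thesis .
  qed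
  have perk: "x ^ (s + k * d) = x ^ s" if "s > i" for s k
    by (induction k) (use that per[of "s + _ * d"] in \<open>simp_all add: algebra_simps\<close>)
  have "d > 0" using ij by (simp add: d_def)
  hence "Suc i * d > i" by (metis less_le_trans lessI mult_le_mono2 nat_mult_1_right Suc_leI One_nat_def)
  thus ?thesis using perk[of "Suc i * d" "Suc i"] by (intro exI[of _ "Suc i * d"]) (auto simp flip: power_add)
qed

locale finite_subring_idempotent =
  fixes R :: "'r::ring_1 set" and e :: 'r
  assumes finR: "finite R" and R: "1 \<in> R" "\<And>x y. x \<in> R \<Longrightarrow> y \<in> R \<Longrightarrow> x - y \<in> R"
      "\<And>x y. x \<in> R \<Longrightarrow> y \<in> R \<Longrightarrow> x * y \<in> R"
    and prim: "primitive_idempotent R e"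
begin

definition L :: "'r set" where "L = {x \<in> R. e * x = x \<and> x * e = x}"
text \<open>The radical of the local ring \<open>L\<close>; that it is an ideal follows from
  \<open>J_mult\<close>, \<open>J_mult_left\<close> and \<open>J_diff\<close>.\<close>

definition J :: "'r set" where "J = {x \<in> L. nilpotent x}"

lemma R0: "0 \<in> R" using R(2)[OF R(1) R(1)] by simp
lemma R_minus: "x \<in> R \<Longrightarrow> - x \<in> R" using R(2)[OF R0, of x] by simp
lemma R_add: "x \<in> R \<Longrightarrow> y \<in> R \<Longrightarrow> x + y \<in> R" using R(2)[of x "- y"] R_minus by simp
lemma R_power: "x \<in> R \<Longrightarrow> x ^ m \<in> R" by (induction m) (auto simp: R)
lemma R_sum: "(\<And>i. i \<in> A \<Longrightarrow> f i \<in> R) \<Longrightarrow> sum f A \<in> R"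
  by (induction A rule: infinite_finite_induct) (auto simp: R0 R_add)
lemma e: "e \<in> R" "e * e = e" "e \<noteq> 0" using prim unfolding primitive_idempotent_def by auto
lemma eL: "e \<in> L" using e by (simp add: L_def)
lemma L_id: "x \<in> L \<Longrightarrow> e * x = x" "x \<in> L \<Longrightarrow> x * e = x" by (auto simp: L_def)
lemma LR: "x \<in> L \<Longrightarrow> x \<in> R" by (simp add: L_def)
lemma L_diff: "x \<in> L \<Longrightarrow> y \<in> L \<Longrightarrow> x - y \<in> L" by (simp add: L_def R algebra_simps)
lemma L_mult: "x \<in> L \<Longrightarrow> y \<in> L \<Longrightarrow> x * y \<in> L" unfolding L_def using R by (simp flip: mult.assoc) (simp add: mult.assoc)
lemma L_corner: "x \<in> R \<Longrightarrow> e * x * e \<in> L" unfolding L_def using R e by (simp flip: mult.assoc) (simp add: mult.assoc)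
lemma L_power: "x \<in> L \<Longrightarrow> m > 0 \<Longrightarrow> x ^ m \<in> L"
proof (induction m)
  case (Suc m) thus ?case by (cases m) (auto intro: L_mult)
qed simp

text \<open>Some power of \<open>x\<close> is an idempotent of \<open>L\<close>, and primitivity of
  \<open>e\<close> leaves only 0 and \<open>e\<close>.\<close>

lemma nilpotent_or_unit:
  assumes "x \<in> L" shows "nilpotent x \<or> (\<exists>y\<in>L. x * y = e \<and> y * x = e)"
proof -
  obtain m where m: "m > 0" "x ^ m * x ^ m = x ^ m"
    using finite_power_idempotent[OF finR] assms L_power LR by blast
  let ?f = "x ^ m"
  have f: "?f \<in> L" using L_power assms m by blast
  have "?f \<in> R" "e - ?f \<in> R" using LR f R e by auto
  moreover have "(e - ?f) * (e - ?f) = e - ?f" "?f * (e - ?f) = 0" "(e - ?f) * ?f = 0" "e = ?f + (e - ?f)"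
    using L_id[OF f] m e by (simp_all add: algebra_simps)
  ultimately have "?f = 0 \<or> e - ?f = 0" using prim m(2) unfolding primitive_idempotent_def by blast
  thus ?thesis
  proof
    assume "?f = 0" thus ?thesis unfolding nilpotent_def by blast
  next
    assume "e - ?f = 0"
    hence fe: "x ^ m = e" by simp
    obtain m' where m': "m = Suc m'" using m by (cases m) auto
    have y: "e * x ^ m' * e \<in> L" using L_corner R_power LR assms by blast
    have "x * (e * x ^ m' * e) = x ^ m * e" using L_id[OF assms] m' by (simp flip: mult.assoc)
    moreover have "(e * x ^ m' * e) * x = e * x ^ m" using L_id[OF assms] m' power_Suc2[of x m'] by (simp add: mult.assoc)
    ultimately show ?thesis using fe e y by auto
  qed
qed

text \<open>From \<open>x y = e\<close> follows \<open>x^k y^k e = e\<close> for every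
  \<open>k\<close>, also when \<open>x^k = 0\<close>.\<close>

lemma nilpotent_no_right_inverse:
  assumes "x \<in> L" "nilpotent x" "y \<in> L" "x * y = e" shows False
proof -
  obtain m where m: "x ^ m = 0" using assms unfolding nilpotent_def by blast
  have "x ^ k * y ^ k * e = e" for k
  proof (induction k)
    case (Suc k)
    have "x ^ Suc k * y ^ Suc k * e = x ^ k * (x * y) * (y ^ k * e)" by (simp only: power_Suc2[of x] power_Suc[of y] mult.assoc)
    also have "\<dots> = x ^ k * (e * (y ^ k * e))" using assms by (simp add: mult.assoc)
    also have "e * (y ^ k * e) = y ^ k * e" using assms(3) L_power[of y k] L_id e by (cases "k = 0") (simp_all flip: mult.assoc)
    finally show ?case using Suc by (simp add: mult.assoc)
  qed (use e in simp)
  from this[of m] m e show False by simp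
qed

lemma nilpotent_no_left_inverse:
  assumes "x \<in> L" "nilpotent x" "y \<in> L" "y * x = e" shows False
proof -
  have "\<not> nilpotent y" using nilpotent_no_right_inverse[of y x] assms by blast
  then obtain z where z: "z \<in> L" "y * z = e" "z * y = e" using nilpotent_or_unit assms by blast
  have "x = z" using z assms L_id by (metis mult.assoc)
  thus False using nilpotent_no_right_inverse z assms by blast
qed

lemma J_mult: "x \<in> J \<Longrightarrow> y \<in> L \<Longrightarrow> x * y \<in> J"
proof (rule ccontr)
  assume x: "x \<in> J" and y: "y \<in> L" and "x * y \<notin> J"
  then obtain z where "z \<in> L" "x * y * z = e" using nilpotent_or_unit[of "x * y"] L_mult unfolding J_def by blast
  thus False using nilpotent_no_right_inverse[of x "y * z"] x y L_mult unfolding J_def by (simp add: mult.assoc)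
qed

lemma J_mult_left: "x \<in> L \<Longrightarrow> y \<in> J \<Longrightarrow> x * y \<in> J"
proof (rule ccontr)
  assume x: "x \<in> L" and y: "y \<in> J" and "x * y \<notin> J"
  then obtain z where "z \<in> L" "z * (x * y) = e" using nilpotent_or_unit[of "x * y"] L_mult unfolding J_def by blast
  thus False using nilpotent_no_left_inverse[of y "z * x"] x y L_mult unfolding J_def by (simp add: mult.assoc)
qed

text \<open>Otherwise a left inverse of \<open>x - y\<close> produces \<open>a = e + b\<close> with
  \<open>a\<close> and \<open>b\<close> nilpotent. If \<open>a^(j+1) e = 0\<close>, then
  \<open>a^j e\<close> is fixed by right multiplication with the nilpotent \<open>- b\<close> and
  vanishes; descending to \<open>j = 0\<close> gives \<open>e = 0\<close>.\<close>

lemma J_diff: "x \<in> J \<Longrightarrow> y \<in> J \<Longrightarrow> x - y \<in> J"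
proof (rule ccontr)
  assume x: "x \<in> J" and y: "y \<in> J" and "x - y \<notin> J"
  then obtain z where z: "z \<in> L" "z * (x - y) = e"
    using nilpotent_or_unit[of "x - y"] L_diff unfolding J_def by blast
  define a b where "a = z * x" and "b = z * y"
  have ab: "a \<in> J" "b \<in> J" using J_mult_left z x y unfolding a_def b_def by blast+
  have ab3: "a = e + b" using z(2) by (simp add: a_def b_def algebra_simps)
  have aL: "a \<in> L" "b \<in> L" using ab unfolding J_def by auto
  obtain k where k: "a ^ k = 0" using ab unfolding J_def nilpotent_def by blast
  have down: "a ^ j * e = 0" if "a ^ Suc j * e = 0" for j
  proof -
    have "a ^ Suc j * e = a ^ j * a" using L_id[OF aL(1)] by (simp only: power_Suc2 mult.assoc)
    hence "a ^ j * (e + b) = 0" using that ab3 by simp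
    hence "a ^ j * e = a ^ j * e * (- b)" using L_id[OF aL(2)] by (simp add: algebra_simps eq_neg_iff_add_eq_0)
    thus ?thesis using nilpotent_fix_right[of "- b"] nilpotent_minus ab unfolding J_def by blast
  qed
  have "a ^ (k - j) * e = 0" if "j \<le> k" for j
    using that
  proof (induction j)
    case 0 thus ?case using k by simp
  next
    case (Suc j)
    hence "a ^ Suc (k - Suc j) * e = 0" by (simp add: Suc_diff_Suc)
    thus ?case by (rule down)
  qed
  from this[of k] e show False by simp
qed

sublocale finite_division_quotient L J e
proof
  show "finite L" using finR unfolding L_def by simp
  show "0 \<in> L" using R0 by (simp add: L_def)
  show "0 \<in> J" using \<open>0 \<in> L\<close> unfolding J_def nilpotent_def by (auto intro: exI[of _ 1])
  show "e \<notin> J"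
  proof
    assume "e \<in> J"
    hence "nilpotent e" unfolding J_def by simp
    thus False using nilpotent_fix_right[of e e] e by simp
  qed
  show "\<exists>y\<in>L. x * y = e \<and> y * x = e" if "x \<in> L" "x \<notin> J" for x
    using nilpotent_or_unit that unfolding J_def by blast
qed (use eL L_diff L_mult L_id J_mult J_mult_left J_diff in \<open>auto simp: J_def\<close>)

lemma J_sum: "(\<And>i. i \<in> A \<Longrightarrow> f i \<in> J) \<Longrightarrow> sum f A \<in> J"
  by (induction A rule: infinite_finite_induct) (auto simp: J J_add)

text \<open>The annihilator of the simple module belonging to \<open>e\<close>; the factor ring \<open>R / I\<close> is the full
  matrix ring over \<open>L / J\<close> of the size found in \<open>idempotent_decomposition\<close>.\<close>

definition I :: "'r set" where "I = {y \<in> R. \<forall>r\<in>R. \<forall>s\<in>R. e * r * y * s * e \<in> J}"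

section \<open>The simple quotient \<open>R / I\<close> and its rank calculus\<close>

lemma IR: "y \<in> I \<Longrightarrow> y \<in> R" by (simp add: I_def)
lemma I0: "0 \<in> I" using J(2) R0 by (simp add: I_def)
lemma I_add: "x \<in> I \<Longrightarrow> y \<in> I \<Longrightarrow> x + y \<in> I"
  unfolding I_def using J_add R_add by (simp add: distrib_left distrib_right)
lemma I_diff: "x \<in> I \<Longrightarrow> y \<in> I \<Longrightarrow> x - y \<in> I"
  unfolding I_def using J(4) R by (simp add: left_diff_distrib right_diff_distrib)
lemma I_mult:
  assumes "x \<in> R" "y \<in> I" "z \<in> R" shows "x * y * z \<in> I"
proof -
  have "e * r * (x * y * z) * s * e \<in> J" if "r \<in> R" "s \<in> R" for r s
  proof -
    have "r * x \<in> R" "z * s \<in> R" using assms that R(3) by blast+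
    hence "e * (r * x) * y * (z * s) * e \<in> J" using assms(2) unfolding I_def by blast
    thus ?thesis by (simp add: mult.assoc)
  qed
  moreover have "x * y * z \<in> R" by (intro R(3) assms IR)
  ultimately show ?thesis unfolding I_def by simp
qed
lemma I_left: "x \<in> R \<Longrightarrow> y \<in> I \<Longrightarrow> x * y \<in> I" using I_mult[of x y 1] R by simp
lemma I_right: "y \<in> I \<Longrightarrow> z \<in> R \<Longrightarrow> y * z \<in> I" using I_mult[of 1 y z] R by simp

text \<open>Outside \<open>I\<close> some \<open>e r y s e\<close> is a unit of the local ring
  \<open>L\<close>; its inverse is absorbed into the left factor.\<close>

lemma factor_through_e:
  assumes "y \<in> R" "y \<notin> I"
  obtains u v where "u \<in> R" "v \<in> R" "e * u = u" "v * e = v" "u * y * v = e"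
proof -
  obtain r s where rs: "r \<in> R" "s \<in> R" "e * r * y * s * e \<notin> J" using assms unfolding I_def by blast
  have "e * (r * y * s) * e \<in> L" by (intro L_corner R rs assms)
  hence "e * r * y * s * e \<in> L" by (simp add: mult.assoc)
  then obtain z where z: "z \<in> L" "z * (e * r * y * s * e) = e" using inv rs by blast
  show ?thesis
  proof (rule that[of "z * r" "s * e"])
    show "z * r \<in> R" "s * e \<in> R" using z rs LR R e by blast+
    show "e * (z * r) = z * r" using L_id z by (simp flip: mult.assoc)
    show "s * e * e = s * e" using e by (simp add: mult.assoc)
    have "z * (e * r * y * s * e) = (z * e) * r * y * (s * e)" by (simp add: mult.assoc)
    thus "z * r * y * (s * e) = e" using z L_id by simp
  qed
qed

text \<open>The size of the right ideal \<open>y R\<close> plays the part of the rank of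
  \<open>y\<close>. It drops when a part of \<open>y\<close> that is detected by \<open>u\<close> is
  cut off, and it is the measure of the two inductions below.\<close>

lemma card_image_less:
  assumes "y \<in> R" "y' = y * t" "t \<in> R" "w \<in> R" "u * y' = 0" "u * (y * w) = e"
  shows "card ((*) y' ` R) < card ((*) y ` R)"
proof (rule psubset_card_mono)
  have "y * w \<notin> (*) y' ` R"
  proof
    assume "y * w \<in> (*) y' ` R"
    then obtain x where "y * w = y' * x" by blast
    hence "u * (y * w) = u * y' * x" by (simp add: mult.assoc)
    thus False using assms e by simp
  qed
  moreover have "(*) y' ` R \<subseteq> (*) y ` R" using assms R by (auto simp: mult.assoc)
  ultimately show "(*) y' ` R \<subset> (*) y ` R" using assms by blast
qed (simp add: finR)

text \<open>Von Neumann regularity of the matrix ring \<open>R / I\<close>, by rank reduction: if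
  \<open>u y v = e\<close>, then \<open>y - y v u y\<close> is annihilated by \<open>u\<close> and
  has smaller rank.\<close>

lemma regular_mod_I:
  assumes "y \<in> R" shows "\<exists>w\<in>R. y - y * w * y \<in> I"
  using assms
proof (induction "card ((*) y ` R)" arbitrary: y rule: less_induct)
  case less
  show ?case
  proof (cases "y \<in> I")
    case True thus ?thesis using R0 by (intro bexI[of _ 0]) auto
  next
    case False
    obtain u v where uv: "u \<in> R" "v \<in> R" "e * u = u" "v * e = v" "u * y * v = e"
      using factor_through_e[OF less.prems False] by blast
    define y' where "y' = y - y * v * u * y"
    have y': "y' = y * (1 - v * u * y)" by (simp add: y'_def algebra_simps)
    have "u * y' = u * y - (u * y * v) * u * y" by (simp add: y'_def algebra_simps)
    also have "\<dots> = 0" using uv by simp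
    finally have "u * y' = 0" .
    moreover have "1 - v * u * y \<in> R" by (intro R uv less.prems)
    ultimately have "card ((*) y' ` R) < card ((*) y ` R)"
      using card_image_less[OF less.prems y', of v u] uv by (simp add: mult.assoc)
    moreover have "y' \<in> R" unfolding y'_def by (intro R uv less.prems)
    ultimately obtain w where w: "w \<in> R" "y' - y' * w * y' \<in> I" using less.hyps by blast
    \<comment> \<open>The quasi-inverse \<open>w\<close> of \<open>y'\<close> is carried back to
      \<open>y\<close> through \<open>(1 - y v u) y = y' = y (1 - v u y)\<close>.\<close>
    let ?w = "v * u + (1 - v * u * y) * w * (1 - y * v * u)"
    have "y - y * ?w * y = y' - y' * w * y'" by (simp add: y'_def algebra_simps)
    moreover have "?w \<in> R" by (intro R R_add uv less.prems w)
    ultimately show ?thesis using w by metis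
  qed
qed

text \<open>Outside \<open>I\<close> the idempotent \<open>f\<close> has a subidempotent
  \<open>f1 = v1 u1\<close> with \<open>u1 v1 = e\<close>, a copy of \<open>e\<close>. Splitting it
  off leaves an idempotent of smaller rank; \<open>n\<close> is the rank of \<open>f\<close> in the
  matrix ring \<open>R / I\<close>.\<close>

lemma idempotent_decomposition:
  assumes "f \<in> R" "f * f = f"
  shows "\<exists>(n::nat) u v. (\<forall>i<n. u i \<in> R \<and> v i \<in> R \<and> e * u i = u i \<and> v i * e = v i \<and> u i * v i = e) \<and>
           f - (\<Sum>i<n. v i * u i) \<in> I"
  using assms
proof (induction "card ((*) f ` R)" arbitrary: f rule: less_induct)
  case less
  show ?case
  proof (cases "f \<in> I")
    case True thus ?thesis by (intro exI[of _ 0]) auto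
  next
    case False
    obtain u v where uv: "u \<in> R" "v \<in> R" "e * u = u" "v * e = v" "u * f * v = e"
      using factor_through_e[OF less.prems(1) False] by blast
    define u1 v1 f1 where "u1 = u * f" and "v1 = f * v" and "f1 = v1 * u1"
    have u1v1: "u1 * v1 = e" using uv less.prems unfolding u1_def v1_def by (metis mult.assoc)
    have u1: "e * u1 = u1" "u1 * f = u1" and v1: "v1 * e = v1" "f * v1 = v1" and R1: "u1 \<in> R" "v1 \<in> R"
      using uv less.prems R unfolding u1_def v1_def by (metis mult.assoc)+
    have f1: "f1 * f1 = f1" "f * f1 = f1" "f1 * f = f1" "f1 \<in> R"
      using u1v1 u1 v1 R1 R unfolding f1_def by (metis mult.assoc)+
    define f' where "f' = f - f1"
    have f': "f' * f' = f'" "f' = f * f'" "f' \<in> R" using f1 less.prems R unfolding f'_def by (simp_all add: algebra_simps)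
    have "u1 * f1 = u1" unfolding f1_def using u1v1 u1 by (metis mult.assoc)
    hence "u1 * f' = 0" unfolding f'_def using u1 by (simp add: algebra_simps)
    moreover have "u1 * (f * v1) = e" using u1v1 v1 by simp
    ultimately have "card ((*) f' ` R) < card ((*) f ` R)"
      using card_image_less[OF less.prems(1) f'(2) f'(3) R1(2)] by blast
    from less.hyps[OF this f'(3,1)] obtain n :: nat and U V where
      UV: "\<And>i. i < n \<Longrightarrow> U i \<in> R \<and> V i \<in> R \<and> e * U i = U i \<and> V i * e = V i \<and> U i * V i = e"
      "f' - (\<Sum>i<n. V i * U i) \<in> I" by blast
    let ?U = "U(n := u1)" and ?V = "V(n := v1)"
    have "(\<Sum>i<Suc n. ?V i * ?U i) = (\<Sum>i<n. V i * U i) + f1" by (simp add: f1_def)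
    hence "f - (\<Sum>i<Suc n. ?V i * ?U i) \<in> I" using UV(2) by (simp add: f'_def algebra_simps)
    moreover have "\<forall>i<Suc n. ?U i \<in> R \<and> ?V i \<in> R \<and> e * ?U i = ?U i \<and> ?V i * e = ?V i \<and> ?U i * ?V i = e"
      using UV(1) u1 v1 R1 u1v1 by (simp add: less_Suc_eq)
    ultimately show ?thesis by blast
  qed
qed

text \<open>Modulo \<open>J\<close> the map \<open>x \<mapsto> \<Sum>i. U\<^sub>i x V\<^sub>i\<close> is the matrix trace of \<open>R / I\<close>.\<close>

theorem trace_exists:
  obtains N :: nat and U V where
    "\<And>i. i < N \<Longrightarrow> U i \<in> R \<and> V i \<in> R \<and> e * U i = U i \<and> V i * e = V i"
    "\<And>x. x \<in> L \<Longrightarrow> (\<Sum>i<N. U i * x * V i) - x \<in> J"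
    "\<And>x. x \<in> R \<Longrightarrow> nilpotent x \<Longrightarrow> (\<Sum>i<N. U i * x * V i) \<in> J"
    "\<And>f. f \<in> R \<Longrightarrow> f * f = f \<Longrightarrow> \<exists>n. (\<Sum>i<N. U i * f * V i) - of_nat n * e \<in> J"
proof -
  obtain N :: nat and U V where
    UV: "\<And>i. i < N \<Longrightarrow> U i \<in> R \<and> V i \<in> R \<and> e * U i = U i \<and> V i * e = V i"
    and z: "1 - (\<Sum>i<N. V i * U i) \<in> I"
    using idempotent_decomposition[OF R(1)] by auto
  define z where "z = 1 - (\<Sum>i<N. V i * U i)"
  define \<tau> where "\<tau> x = (\<Sum>i<N. U i * x * V i)" for x
  have one: "1 = (\<Sum>i<N. V i * U i) + z" by (simp add: z_def)
  have zI: "z \<in> I" using z by (simp add: z_def)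
  have add: "\<tau> (x + y) = \<tau> x + \<tau> y" and diff: "\<tau> (x - y) = \<tau> x - \<tau> y" for x y
    by (simp_all add: \<tau>_def algebra_simps sum.distrib sum_subtractf)
  have UxV: "U i * x * V j \<in> L" if "i < N" "j < N" "x \<in> R" for i j x
  proof -
    have "U i * x * V j = e * (U i * x * V j) * e" using UV that by (simp add: mult.assoc) (metis mult.assoc)
    thus ?thesis using L_corner[of "U i * x * V j"] UV that R by simp
  qed
  have UIV: "U i * y * V j \<in> J" if "i < N" "j < N" "y \<in> I" for i j y
  proof -
    have "e * U i * y * V j * e = U i * y * V j" using UV that by (simp add: mult.assoc)
    moreover have "e * U i * y * V j * e \<in> J" using UV that unfolding I_def by blast
    ultimately show ?thesis by simp
  qed
  have tI: "\<tau> y \<in> J" if "y \<in> I" for y unfolding \<tau>_def by (rule J_sum) (use UIV that in auto)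
  \<comment> \<open>Inserting \<open>1 = (\<Sum>j. V j U j) + z\<close> between \<open>x\<close> and
    \<open>y\<close> yields products of two elements of \<open>L\<close>. These commute modulo
    \<open>J\<close> by Wedderburn's theorem, which is what makes \<open>\<tau>\<close> a
    trace.\<close>
  have expand: "\<tau> (x * y) - (\<Sum>i<N. \<Sum>j<N. (U i * x * V j) * (U j * y * V i)) \<in> J" if "x \<in> R" "y \<in> R" for x y
  proof -
    have "\<tau> (x * y) = (\<Sum>i<N. U i * x * ((\<Sum>j<N. V j * U j) + z) * y * V i)"
      unfolding \<tau>_def one[symmetric] by (simp add: mult.assoc)
    also have "\<dots> = (\<Sum>i<N. (\<Sum>j<N. (U i * x * V j) * (U j * y * V i)) + U i * (x * z * y) * V i)"
      by (intro sum.cong refl) (simp add: algebra_simps sum_distrib_left sum_distrib_right)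
    finally have "\<tau> (x * y) - (\<Sum>i<N. \<Sum>j<N. (U i * x * V j) * (U j * y * V i)) = \<tau> (x * z * y)"
      by (simp add: sum.distrib \<tau>_def)
    thus ?thesis using tI[OF I_mult] zI that by simp
  qed
  have trace: "\<tau> (x * y) - \<tau> (y * x) \<in> J" if xy: "x \<in> R" "y \<in> R" for x y
  proof -
    let ?S = "\<lambda>x y. \<Sum>i<N. \<Sum>j<N. (U i * x * V j) * (U j * y * V i)"
    have "?S y x = (\<Sum>i<N. \<Sum>j<N. (U j * y * V i) * (U i * x * V j))" by (rule sum.swap)
    hence "?S x y - ?S y x = (\<Sum>i<N. \<Sum>j<N. (U i * x * V j) * (U j * y * V i) - (U j * y * V i) * (U i * x * V j))"
      by (simp add: sum_subtractf)
    also have "\<dots> \<in> J" by (intro J_sum commutative_quotient UxV) (use xy in auto)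
    finally show ?thesis using expand[OF xy] expand[OF xy(2,1)] J_trans J_sym by blast
  qed
  \<comment> \<open>Modulo \<open>J\<close> the factor \<open>U i * e\<close> commutes with
    \<open>x * V i\<close>; the sum over \<open>i\<close> then becomes \<open>x\<close> times
    \<open>\<Sum>i. V i U i\<close>, which is 1 up to an element of \<open>I\<close>.\<close>
  have onL: "\<tau> x - x \<in> J" if x: "x \<in> L" for x
  proof -
    have "U i * x * V i - x * V i * U i * e \<in> J" if "i < N" for i
    proof -
      have 1: "U i * e \<in> L" and 2: "x * V i \<in> L"
        using UV[OF that] e R L_corner[of "U i"] L_id[OF x] LR[OF x] by (simp_all add: L_def mult.assoc) (simp_all flip: mult.assoc)
      have "(U i * e) * (x * V i) - (x * V i) * (U i * e) \<in> J" by (rule commutative_quotient[OF 1 2])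
      moreover have "(U i * e) * (x * V i) = U i * (e * x) * V i" by (simp add: mult.assoc)
      ultimately show ?thesis using L_id[OF x] by (simp add: mult.assoc)
    qed
    hence "(\<Sum>i<N. U i * x * V i - x * V i * U i * e) \<in> J" by (intro J_sum) auto
    moreover have "(\<Sum>i<N. x * V i * U i * e) = x * (\<Sum>i<N. V i * U i) * e"
      by (simp add: sum_distrib_left sum_distrib_right mult.assoc)
    moreover have "\<dots> = x - x * z * e" using L_id[OF x] by (simp add: z_def algebra_simps)
    ultimately have "\<tau> x - (x - x * z * e) \<in> J" by (simp add: \<tau>_def sum_subtractf)
    moreover have "x * z * e \<in> J"
    proof -
      have "e * x * z * 1 * e \<in> J" using zI x R LR unfolding I_def by blast
      thus ?thesis using L_id[OF x] by simp
    qed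
    ultimately show ?thesis using J(4)[of "\<tau> x - (x - x * z * e)" "x * z * e"] by simp
  qed
  \<comment> \<open>Induction on the index of nilpotency modulo \<open>I\<close>. If
    \<open>w\<close> is a quasi-inverse of \<open>x\<close>, then \<open>x\<close> has the trace of
    \<open>x w x\<close>, and so of \<open>x' = x x w\<close>; modulo \<open>I\<close> the power
    \<open>x'^m\<close> is \<open>x^(m+1) w\<close>, so the index has dropped by one.\<close>
  have nilp: "\<tau> x \<in> J" if "x \<in> R" "x ^ m \<in> I" for x m
    using that
  proof (induction m arbitrary: x)
    case 0
    hence "x \<in> I" using I_left[of x 1] by simp
    thus ?case by (rule tI)
  next
    case (Suc m)
    show ?case
    proof (cases m)
      case 0 thus ?thesis using Suc tI by simp
    next
      case (Suc m')
      obtain w where w: "w \<in> R" "x - x * w * x \<in> I" using regular_mod_I Suc.prems by blast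
      define x' where "x' = x * (x * w)"
      have xwR: "x * w \<in> R" by (rule R(3)[OF Suc.prems(1) w(1)])
      have x'R: "x' \<in> R" unfolding x'_def by (rule R(3)[OF Suc.prems(1) xwR])
      have pow: "x' ^ Suc k - x ^ Suc (Suc k) * w \<in> I" for k
      proof (induction k)
        case 0 show ?case by (simp add: x'_def I0 mult.assoc)
      next
        case (Suc k)
        have "x' ^ Suc (Suc k) - x ^ Suc (Suc (Suc k)) * w =
          (x' ^ Suc k - x ^ Suc (Suc k) * w) * x' - x ^ Suc k * (x - x * w * x) * (x * w)"
        proof -
          have "x ^ Suc (Suc (Suc k)) = x ^ Suc k * x * x" "x ^ Suc (Suc k) = x ^ Suc k * x"
            "x' ^ Suc (Suc k) = x' ^ Suc k * x'" by (simp_all only: power_Suc2)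
          thus ?thesis by (simp add: x'_def algebra_simps del: power_Suc)
        qed
        moreover have "\<dots> \<in> I"
          by (intro I_diff I_right[OF _ x'R] I_mult[OF R_power _ xwR] Suc w(2) \<open>x \<in> R\<close>)
        ultimately show ?case by simp
      qed
      have "x ^ Suc m * w \<in> I" using I_right Suc.prems w by blast
      hence "x' ^ m \<in> I" using pow[of m'] I_add[of "x' ^ m - x ^ Suc m * w" "x ^ Suc m * w"] Suc by simp
      hence "\<tau> x' \<in> J" using Suc.IH x'R by blast
      moreover have "\<tau> (x * w * x) - \<tau> x' \<in> J" using trace[OF xwR \<open>x \<in> R\<close>] by (simp add: x'_def)
      moreover have "\<tau> x - \<tau> (x * w * x) \<in> J" using tI[OF w(2)] by (simp add: diff)
      ultimately show ?thesis using J_cancel J_trans by blast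
    qed
  qed
  \<comment> \<open>Each piece \<open>v i * u i\<close> has the same trace as
    \<open>u i * v i = e\<close>, so the trace of \<open>f\<close> counts the pieces.\<close>
  have idem: "\<exists>n. \<tau> f - of_nat n * e \<in> J" if f: "f \<in> R" "f * f = f" for f
  proof -
    obtain n :: nat and u v where uv: "\<And>i. i < n \<Longrightarrow> u i \<in> R \<and> v i \<in> R \<and> u i * v i = e"
      "f - (\<Sum>i<n. v i * u i) \<in> I" using idempotent_decomposition[OF f] by blast
    have tsum: "\<tau> (\<Sum>i<n. v i * u i) = (\<Sum>i<n. \<tau> (v i * u i))"
      using sum_comp_morphism[of \<tau> "\<lambda>i. v i * u i" "{..<n}"] add by (simp add: \<tau>_def o_def)
    have "\<tau> (v i * u i) - e \<in> J" if "i < n" for i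
      using trace[of "v i" "u i"] onL[OF eL] uv(1)[OF that] J_trans by fastforce
    hence "(\<Sum>i<n. \<tau> (v i * u i) - e) \<in> J" by (intro J_sum) auto
    hence "\<tau> (\<Sum>i<n. v i * u i) - of_nat n * e \<in> J" by (simp add: tsum sum_subtractf)
    moreover have "\<tau> f - \<tau> (\<Sum>i<n. v i * u i) \<in> J" using tI[OF uv(2)] by (simp add: diff)
    ultimately show ?thesis using J_trans by blast
  qed
  show ?thesis
  proof (rule that[of N U V])
    show "(\<Sum>i<N. U i * x * V i) \<in> J" if "x \<in> R" "nilpotent x" for x
      using nilp[of x] that I0 unfolding nilpotent_def \<tau>_def by metis
  qed (use UV onL idem in \<open>auto simp: \<tau>_def\<close>)
qed

end

section \<open>Splitting in characteristic p\<close>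

abbreviation scal :: "'f \<Rightarrow> ('x::monoid_add \<Rightarrow>\<^sub>0 'f::semiring_1)" where
  "scal c \<equiv> Poly_Mapping.single 0 c"

lemma poly_mapping_expand:
  fixes x :: "'x::finite \<Rightarrow>\<^sub>0 'f::comm_monoid_add"
  shows "x = (\<Sum>g\<in>UNIV. Poly_Mapping.single g (Poly_Mapping.lookup x g))"
  by (rule poly_mapping_eqI) (simp add: lookup_sum lookup_single when_def)

lemma scal_central:
  fixes x :: "'x::{finite,monoid_add} \<Rightarrow>\<^sub>0 'f::comm_semiring_1"
  shows "scal c * x = x * scal c"
proof -
  have "scal c * (\<Sum>g\<in>UNIV. Poly_Mapping.single g (Poly_Mapping.lookup x g)) =
        (\<Sum>g\<in>UNIV. Poly_Mapping.single g (Poly_Mapping.lookup x g)) * scal c"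
    by (simp add: sum_distrib_left sum_distrib_right mult_single mult.commute)
  thus ?thesis by (simp flip: poly_mapping_expand)
qed

lemma scal_add: "scal (c + d) = scal c + scal d" by (rule single_add)
lemma scal_sum: "scal (sum f A) = (\<Sum>i\<in>A. scal (f i))"
  by (induction A rule: infinite_finite_induct) (simp_all add: scal_add)
lemma scal_mult: "scal (c * d) = scal c * scal d" by (simp add: mult_single)
lemma scal_power: "scal (c ^ n) = scal c ^ n" by (induction n) (simp_all add: scal_mult)

section \<open>Binomial theorem and Frobenius map for commuting elements\<close>

lemma commuting_binomial:
  fixes y z :: "'r::ring_1"
  assumes "y * z = z * y"
  shows "(y + z) ^ n = (\<Sum>k\<le>n. of_nat (n choose k) * y ^ k * z ^ (n - k))"
proof (induction n)
  case (Suc n)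
  let ?S = "\<Sum>k\<le>n. of_nat (n choose k) * y ^ k * z ^ (n - k)"
  have zy: "z * y ^ k = y ^ k * z" for k using power_commuting_commutes[OF assms, of k] by simp
  have cy: "a * (of_nat m * b) = of_nat m * (a * b)" for a b :: 'r and m
    by (metis mult.assoc mult_of_nat_commute)
  have "(y + z) ^ Suc n = y * ?S + z * ?S" using Suc by (simp add: distrib_right)
  also have "y * ?S = (\<Sum>k\<le>n. of_nat (n choose k) * y ^ Suc k * z ^ (n - k))"
    by (simp add: sum_distrib_left mult.assoc cy)
  also have "z * ?S = (\<Sum>k\<le>n. of_nat (n choose k) * y ^ k * z ^ (Suc n - k))"
    unfolding sum_distrib_left
  proof (rule sum.cong)
    fix k assume "k \<in> {..n}"
    hence "Suc n - k = Suc (n - k)" by auto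
    moreover have "z * (y ^ k * z ^ (n - k)) = y ^ k * (z * z ^ (n - k))" using zy by (simp flip: mult.assoc)
    ultimately show "z * (of_nat (n choose k) * y ^ k * z ^ (n - k)) = of_nat (n choose k) * y ^ k * z ^ (Suc n - k)"
      by (simp add: mult.assoc cy)
  qed simp
  also have "\<dots> = z ^ Suc n + (\<Sum>k\<le>n. of_nat (n choose Suc k) * y ^ Suc k * z ^ (n - k))"
    using sum.atMost_Suc_shift[of "\<lambda>k. of_nat (n choose k) * y ^ k * z ^ (Suc n - k)" n]
    by (simp add: binomial_eq_0)
  finally have "(y + z) ^ Suc n = z ^ Suc n +
     (\<Sum>k\<le>n. (of_nat (n choose k) + of_nat (n choose Suc k)) * y ^ Suc k * z ^ (n - k))"
    by (simp add: distrib_right sum.distrib ac_simps)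
  also have "\<dots> = (\<Sum>k\<le>Suc n. of_nat (Suc n choose k) * y ^ k * z ^ (Suc n - k))"
    by (subst sum.atMost_Suc_shift) simp
  finally show ?case .
qed simp

lemma commuting_freshman:
  fixes y z :: "'r::ring_1"
  assumes "y * z = z * y" "prime p" "of_nat p = (0 :: 'r)"
  shows "(y + z) ^ (p ^ a) = y ^ (p ^ a) + z ^ (p ^ a)"
proof (induction a)
  case (Suc a)
  let ?q = "p ^ a"
  have c: "y ^ ?q * z ^ ?q = z ^ ?q * y ^ ?q"
    using power_commuting_commutes[OF power_commuting_commutes[OF assms(1), symmetric], of ?q ?q] by simp
  have p0: "p > 0" using assms(2) prime_gt_0_nat by blast
  have "(y + z) ^ (p ^ Suc a) = ((y + z) ^ ?q) ^ p" by (simp add: power_mult[symmetric] mult.commute)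
  also have "\<dots> = (\<Sum>k\<le>p. of_nat (p choose k) * (y ^ ?q) ^ k * (z ^ ?q) ^ (p - k))"
    unfolding Suc commuting_binomial[OF c] ..
  also have "\<dots> = (\<Sum>k\<in>{0, p}. of_nat (p choose k) * (y ^ ?q) ^ k * (z ^ ?q) ^ (p - k))"
  proof (intro sum.mono_neutral_right ballI)
    fix k assume "k \<in> {..p} - {0, p}"
    hence "p dvd (p choose k)" using assms(2) by (intro dvd_choose_prime) auto
    then obtain m where "p choose k = p * m" by blast
    hence "of_nat (p choose k) = (0 :: 'r)" using assms(3) by simp
    thus "of_nat (p choose k) * (y ^ ?q) ^ k * (z ^ ?q) ^ (p - k) = 0" by simp
  qed auto
  finally show ?case using p0 by (simp add: power_mult[symmetric] mult.commute)
qed simp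

lemma single_power_card:
  fixes g :: "'g::{finite,group_add}"
  shows "Poly_Mapping.single g (1 :: 'f::comm_semiring_1) ^ CARD('g) = 1"
proof -
  define G :: "'g monoid" where "G = \<lparr>carrier = (UNIV :: 'g set), monoid.mult = (+), one = 0\<rparr>"
  interpret G: group G by (rule groupI) (auto simp: G_def add.assoc intro: left_minus)
  have "Poly_Mapping.single g (1 :: 'f) ^ m = Poly_Mapping.single (g [^]\<^bsub>G\<^esub> m) 1" for m
  proof (induction m)
    case (Suc m) 
    have "Poly_Mapping.single g (1 :: 'f) ^ Suc m = Poly_Mapping.single g (1 :: 'f) ^ m * Poly_Mapping.single g 1"
      by (rule power_Suc2)
    thus ?case unfolding Suc by (simp add: mult_single G_def)
  qed (simp add: G_def)
  moreover have "g [^]\<^bsub>G\<^esub> CARD('g) = 0"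
    using G.pow_order_eq_1[of g] by (simp add: G_def Coset.order_def)
  ultimately show ?thesis by simp
qed

definition coeffs_in :: "'f set \<Rightarrow> ('x::monoid_add \<Rightarrow>\<^sub>0 'f::field) set" where
  "coeffs_in k = {x. \<forall>g. Poly_Mapping.lookup x g \<in> k}"

text \<open>For \<open>q\<close> a power of the characteristic these are the fixed points in
  \<open>F\<close> of an iterate of the Frobenius map: a subfield with at most \<open>q\<close>
  elements.\<close>

definition root_subfield :: "nat \<Rightarrow> 'f::field set" where
  "root_subfield q = {c. c ^ q = c}"

locale char_p_splitting =
  fixes p m n a :: nat and \<zeta> :: "'f::field" and tg :: "'g::{finite,group_add} itself"
  assumes p: "CHAR('f) = p" "prime p" and m: "m > 0" and n: "n dvd p ^ m - 1" "n > 0"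
    and card: "CARD('g) = n * p ^ a" and root: "root_of_unity_of_order \<zeta> n"
begin

abbreviation q :: nat where "q \<equiv> p ^ m"
abbreviation k :: "'f set" where "k \<equiv> root_subfield q"
abbreviation R :: "('g \<Rightarrow>\<^sub>0 'f) set" where "R \<equiv> coeffs_in k"

section \<open>The finite field \<open>k\<close> and the finite ring \<open>kG\<close>\<close>

lemma q2: "q \<ge> 2"
  using prime_ge_2_nat[OF p(2)] m by (metis One_nat_def Suc_leI le_trans power_increasing power_one_right prime_ge_1_nat p(2))

lemma k_0: "0 \<in> k" and k_1: "1 \<in> k" using m prime_gt_0_nat[OF p(2)] by (auto simp: root_subfield_def power_0_left)
lemma k_mult: "c \<in> k \<Longrightarrow> d \<in> k \<Longrightarrow> c * d \<in> k" by (simp add: root_subfield_def power_mult_distrib)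
lemma k_add: "c \<in> k \<Longrightarrow> d \<in> k \<Longrightarrow> c + d \<in> k"
  using freshmans_dream'[of q m c d] p by (simp add: root_subfield_def)
lemma k_diff: "c \<in> k \<Longrightarrow> d \<in> k \<Longrightarrow> c - d \<in> k"
proof -
  assume cd: "c \<in> k" "d \<in> k"
  have "((c - d) + d) ^ q = (c - d) ^ q + d ^ q" using p by (intro freshmans_dream'[of q m]) auto
  thus ?thesis using cd by (simp add: root_subfield_def algebra_simps)
qed
lemma k_inverse: "c \<in> k \<Longrightarrow> inverse c \<in> k" by (simp add: root_subfield_def power_inverse)
lemma k_of_nat: "of_nat i \<in> k" by (induction i) (auto simp: k_0 k_1 k_add)
lemma k_power: "c \<in> k \<Longrightarrow> c ^ i \<in> k" by (induction i) (auto simp: k_1 k_mult)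
lemma k_sum: "(\<And>i. i \<in> A \<Longrightarrow> f i \<in> k) \<Longrightarrow> sum f A \<in> k"
  by (induction A rule: infinite_finite_induct) (auto simp: k_0 k_add)

lemma finite_k: "finite k"
proof -
  let ?P = "Polynomial.monom 1 q - Polynomial.monom 1 1 :: 'f poly"
  have "Polynomial.coeff ?P q = 1" using q2 by simp
  hence "?P \<noteq> 0" by (metis coeff_0 zero_neq_one)
  moreover have "k \<subseteq> {c. poly ?P c = 0}" by (auto simp: root_subfield_def poly_monom)
  ultimately show ?thesis using poly_roots_finite finite_subset by blast
qed

lemma finite_R: "finite R"
proof (rule finite_imageD)
  show "finite (Poly_Mapping.lookup ` R)"
    by (rule finite_subset[OF _ finite_PiE[of UNIV "\<lambda>_. k"]]) (auto simp: coeffs_in_def finite_k)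
  show "inj_on Poly_Mapping.lookup R" by (rule inj_onI) (simp add: lookup_inject)
qed

lemma R_single: "c \<in> k \<Longrightarrow> Poly_Mapping.single g c \<in> R"
  by (auto simp: coeffs_in_def lookup_single when_def k_0)
lemma R_diff: "x \<in> R \<Longrightarrow> y \<in> R \<Longrightarrow> x - y \<in> R" by (simp add: coeffs_in_def lookup_minus k_diff)
lemma R_add: "x \<in> R \<Longrightarrow> y \<in> R \<Longrightarrow> x + y \<in> R" by (simp add: coeffs_in_def lookup_add k_add)
lemma R_sum: "(\<And>i. i \<in> A \<Longrightarrow> f i \<in> R) \<Longrightarrow> sum f A \<in> R"
  by (simp add: coeffs_in_def lookup_sum k_sum)
lemma R_1: "1 \<in> R" using R_single[OF k_1, of 0] by simp
lemma R_mult: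
  assumes "x \<in> R" "y \<in> R" shows "x * y \<in> R"
proof -
  have "(\<Sum>g\<in>UNIV. Poly_Mapping.single g (Poly_Mapping.lookup x g)) *
        (\<Sum>g\<in>UNIV. Poly_Mapping.single g (Poly_Mapping.lookup y g)) \<in> R"
    unfolding sum_product mult_single using assms
    by (intro R_sum R_single k_mult) (auto simp: coeffs_in_def)
  thus ?thesis by (simp flip: poly_mapping_expand)
qed
lemma R_power: "x \<in> R \<Longrightarrow> x ^ i \<in> R" by (induction i) (auto simp: R_1 R_mult)

lemma zeta: "\<zeta> ^ n = 1" "\<zeta> \<noteq> 0" "\<zeta> \<in> k"
proof -
  show z: "\<zeta> ^ n = 1" using root by (simp add: root_of_unity_of_order_def)
  thus "\<zeta> \<noteq> 0" using n(2) by (auto simp: power_0_left)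
  obtain t where "q - 1 = n * t" using n by blast
  hence "q = Suc (n * t)" using q2 by linarith
  hence "\<zeta> ^ q = \<zeta>" using z by (simp add: power_mult)
  thus "\<zeta> \<in> k" by (simp add: root_subfield_def)
qed

lemma of_nat_n: "of_nat n \<noteq> (0 :: 'f)"
proof
  assume "of_nat n = (0 :: 'f)"
  hence "p dvd n" using p(1) of_nat_eq_0_iff_char_dvd by blast
  hence "p dvd q - 1" using n(1) dvd_trans by blast
  moreover have "p dvd q" using m by (simp add: dvd_power)
  ultimately have "p dvd 1" using q2 by (metis dvd_diffD1 le_trans one_le_numeral)
  thus False using p(2) by (simp add: prime_nat_iff)
qed

lemma of_nat_p: "of_nat p = (0 :: 'g \<Rightarrow>\<^sub>0 'f)"
proof -
  have "of_nat p = scal (of_nat p :: 'f)" by simp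
  also have "of_nat p = (0 :: 'f)" using p(1) of_nat_CHAR by blast
  finally show ?thesis by simp
qed

lemma zeta_sum:
  assumes "i < n" shows "(\<Sum>j<n. \<zeta> ^ (i * j)) = (if i = 0 then of_nat n else 0)"
proof (cases "i = 0")
  case False
  have ne: "\<zeta> ^ i \<noteq> 1" using root assms False by (auto simp: root_of_unity_of_order_def)
  have "(\<zeta> ^ i) ^ n = 1" using zeta by (metis mult.commute power_mult power_one)
  hence "(\<Sum>j<n. (\<zeta> ^ i) ^ j) = 0" using geometric_sum[OF ne, of n] by simp
  thus ?thesis using False by (simp add: power_mult)
qed simp

text \<open>The projection to the eigenspace of the \<open>p'\<close>-element \<open>g ^ p ^ a\<close> with eigenvalue
  \<open>\<zeta> ^ (- j)\<close>.\<close>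

definition spectral :: "'g \<Rightarrow> nat \<Rightarrow> 'g \<Rightarrow>\<^sub>0 'f" where
  "spectral g j = scal (inverse (of_nat n)) * (\<Sum>i<n. scal (\<zeta> ^ (i * j)) * (Poly_Mapping.single g 1 ^ (p ^ a)) ^ i)"

text \<open>A discrete Fourier transform of the powers of \<open>h\<close>, which satisfies
  \<open>h^n = 1\<close>. It works because \<open>\<zeta>\<close> has order exactly \<open>n\<close>
  and \<open>n\<close> is invertible in \<open>F\<close>.\<close>

lemma spectral:
  fixes g :: 'g
  defines "h \<equiv> Poly_Mapping.single g 1 ^ (p ^ a) :: 'g \<Rightarrow>\<^sub>0 'f"
  shows "spectral g j \<in> R"
    and "h * spectral g j = scal (inverse (\<zeta> ^ j)) * spectral g j"
    and "spectral g j * spectral g j = spectral g j"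
    and "(\<Sum>j<n. spectral g j) = 1"
    and "Poly_Mapping.single g 1 * spectral g j = spectral g j * Poly_Mapping.single g 1"
proof -
  note sp = spectral_def[of g, folded h_def]
  have hn: "h ^ n = 1"
    using single_power_card[of g] unfolding card h_def by (simp add: power_mult[symmetric] mult.commute)
  have hR: "h \<in> R" unfolding h_def by (intro R_power R_single k_1)
  show "spectral g j \<in> R" unfolding sp
    by (intro R_mult R_sum R_single k_inverse k_of_nat k_power zeta R_power hR)
  have hs: "h * spectral g j = scal (inverse (\<zeta> ^ j)) * spectral g j" for j
  proof -
    let ?f = "\<lambda>i. scal (\<zeta> ^ (i * j)) * h ^ i"
    \<comment> \<open>Multiplication by \<open>h\<close> shifts the summation index; the last term
      closes up with the first because \<open>h^n = 1\<close> and
      \<open>\<zeta>^n = 1\<close>.\<close>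
    have step: "h * ?f i = scal (inverse (\<zeta> ^ j)) * ?f (Suc i)" for i
    proof -
      have "scal (inverse (\<zeta> ^ j)) * scal (\<zeta> ^ (Suc i * j)) = (scal (\<zeta> ^ (i * j)) :: 'g \<Rightarrow>\<^sub>0 'f)"
        unfolding scal_mult[symmetric] using zeta(2) by (simp add: power_add mult.assoc[symmetric])
      moreover have "h * ?f i = scal (\<zeta> ^ (i * j)) * h ^ Suc i"
        by (simp add: mult.assoc[symmetric] scal_central[symmetric, of h])
      ultimately show ?thesis by (simp only: mult.assoc[symmetric])
    qed
    have "?f n = ?f 0" using hn zeta(1) by (simp add: power_mult)
    moreover have "?f 0 + (\<Sum>i<n. ?f (Suc i)) = (\<Sum>i<n. ?f i) + ?f n"
      using sum.lessThan_Suc_shift[of ?f n] sum.lessThan_Suc[of ?f n] by (simp only:)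
    ultimately have "(\<Sum>i<n. ?f (Suc i)) = (\<Sum>i<n. ?f i)" by (simp only: add.commute[of "?f 0"] add_right_cancel)
    hence "h * (\<Sum>i<n. ?f i) = scal (inverse (\<zeta> ^ j)) * (\<Sum>i<n. ?f i)"
      unfolding sum_distrib_left step by (simp flip: sum_distrib_left)
    moreover have "h * (scal c * y) = scal c * (h * y)" for c y
      by (simp only: mult.assoc[symmetric] scal_central[of c h])
    ultimately show ?thesis unfolding sp by (simp only:)
      (simp only: mult.assoc[symmetric] scal_mult[symmetric] mult.commute[of "inverse (of_nat n)"])
  qed
  thus "h * spectral g j = scal (inverse (\<zeta> ^ j)) * spectral g j" .
  have his: "h ^ i * spectral g j = scal (inverse (\<zeta> ^ (i * j))) * spectral g j" for i
  proof (induction i)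
    case (Suc i)
    have "h ^ Suc i * spectral g j = h * (h ^ i * spectral g j)" by (simp add: mult.assoc)
    also have "\<dots> = scal (inverse (\<zeta> ^ (i * j))) * (h * spectral g j)"
      unfolding Suc by (metis mult.assoc scal_central)
    also have "\<dots> = scal (inverse (\<zeta> ^ (Suc i * j))) * spectral g j"
      unfolding hs by (simp add: mult.assoc[symmetric] mult_single power_add mult.commute)
    finally show ?case .
  qed simp
  have "(\<Sum>i<n. scal (\<zeta> ^ (i * j)) * h ^ i) * spectral g j = (\<Sum>i<n. spectral g j)"
    unfolding sum_distrib_right mult.assoc his using zeta(2)
    by (intro sum.cong refl) (simp add: mult.assoc[symmetric] mult_single)
  hence "spectral g j * spectral g j = scal (inverse (of_nat n)) * (of_nat n * spectral g j)"
    unfolding sp[of j] by (subst mult.assoc) (simp add: sp[of j])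
  also have "\<dots> = scal (inverse (of_nat n) * of_nat n) * spectral g j"
    by (simp add: scal_mult mult.assoc del: single_of_nat) (simp)
  finally show "spectral g j * spectral g j = spectral g j" using of_nat_n by simp
  have "(\<Sum>j<n. spectral g j) = scal (inverse (of_nat n)) * (\<Sum>i<n. \<Sum>j<n. scal (\<zeta> ^ (i * j)) * h ^ i)"
    unfolding sp by (subst sum.swap) (simp add: sum_distrib_left)
  also have "(\<Sum>i<n. \<Sum>j<n. scal (\<zeta> ^ (i * j)) * h ^ i) = (\<Sum>i<n. scal (\<Sum>j<n. \<zeta> ^ (i * j)) * h ^ i)"
    by (intro sum.cong refl) (simp add: sum_distrib_right scal_sum)
  also have "\<dots> = (\<Sum>i<n. if i = 0 then scal (of_nat n) else 0)"
    by (intro sum.cong refl) (simp add: zeta_sum)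
  also have "\<dots> = scal (of_nat n)" using n(2) by (simp add: sum.delta)
  finally show "(\<Sum>j<n. spectral g j) = 1" using of_nat_n by (simp add: mult_single del: single_of_nat)
  have "Poly_Mapping.single g 1 * h = h * Poly_Mapping.single g 1" unfolding h_def by (rule power_commutes[symmetric])
  hence hi: "Poly_Mapping.single g 1 * h ^ i = h ^ i * Poly_Mapping.single g 1" for i
    using power_commuting_commutes[of h "Poly_Mapping.single g 1" i] by simp
  have "Poly_Mapping.single g 1 * (scal c * y) = scal c * y * Poly_Mapping.single g 1"
    if "Poly_Mapping.single g 1 * y = y * Poly_Mapping.single g 1" for c :: 'f and y
    using that by (metis mult.assoc scal_central)
  thus "Poly_Mapping.single g 1 * spectral g j = spectral g j * Poly_Mapping.single g 1"
    unfolding sp using hi by (simp add: sum_distrib_left sum_distrib_right)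
qed

text \<open>On the corner the trace \<open>\<tau>\<close> is the identity modulo the radical. So it
  is enough that \<open>\<tau>\<close> maps each group element into the \<open>k\<close>-space
  \<open>K\<close> of elements whose residue is a scalar from \<open>k\<close>.\<close>

theorem corner_residue:
  assumes prim: "primitive_idempotent R e" and x: "x \<in> R" "e * x = x" "x * e = x"
  shows "\<exists>c\<in>k. nilpotent (x - scal c * e)"
proof -
  interpret C: finite_subring_idempotent R e
    by unfold_locales (use finite_R R_1 R_diff R_mult prim in auto)
  obtain N :: nat and U V where
    UV: "\<And>i. i < N \<Longrightarrow> U i \<in> R \<and> V i \<in> R \<and> e * U i = U i \<and> V i * e = V i" and
    onL: "\<And>x. x \<in> C.L \<Longrightarrow> (\<Sum>i<N. U i * x * V i) - x \<in> C.J" and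
    nilp: "\<And>x. x \<in> R \<Longrightarrow> nilpotent x \<Longrightarrow> (\<Sum>i<N. U i * x * V i) \<in> C.J" and
    idem: "\<And>f. f \<in> R \<Longrightarrow> f * f = f \<Longrightarrow> \<exists>n. (\<Sum>i<N. U i * f * V i) - of_nat n * e \<in> C.J"
    using C.trace_exists by blast
  define \<tau> where "\<tau> y = (\<Sum>i<N. U i * y * V i)" for y
  define K where "K = {y. \<exists>c\<in>k. y - scal c * e \<in> C.J}"
  have t_add: "\<tau> (y + z) = \<tau> y + \<tau> z" for y z by (simp add: \<tau>_def algebra_simps sum.distrib)
  have t_sum: "\<tau> (sum f A) = (\<Sum>i\<in>A. \<tau> (f i))" for A and f :: "'c \<Rightarrow> _"
    by (induction A rule: infinite_finite_induct) (auto simp: t_add, auto simp: \<tau>_def)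
  have t_scal: "\<tau> (scal c * y) = scal c * \<tau> y" for c y
    unfolding \<tau>_def sum_distrib_left by (intro sum.cong refl) (metis mult.assoc scal_central)
  have K_add: "y + z \<in> K" if yz: "y \<in> K" "z \<in> K" for y z
  proof -
    obtain c d where "c \<in> k" "d \<in> k" "y - scal c * e \<in> C.J" "z - scal d * e \<in> C.J"
      using yz unfolding K_def by blast
    moreover have "(y + z) - scal (c + d) * e = (y - scal c * e) + (z - scal d * e)"
      by (simp add: scal_add algebra_simps)
    ultimately show ?thesis unfolding K_def using C.J_add k_add by (metis (mono_tags, lifting) mem_Collect_eq)
  qed
  have K_scal: "scal d * y \<in> K" if y: "y \<in> K" and d: "d \<in> k" for y d
  proof -
    obtain c where c: "c \<in> k" "y - scal c * e \<in> C.J" using y unfolding K_def by blast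
    have "scal d * e \<in> C.L" using C.e R_mult[OF R_single[OF d] C.e(1)] unfolding C.L_def
      by (simp add: mult.assoc) (metis mult.assoc scal_central C.e(2))
    hence "scal d * e * (y - scal c * e) \<in> C.J" using C.J_mult_left c by blast
    moreover have "e * (y - scal c * e) = y - scal c * e" using c C.L_id unfolding C.J_def by blast
    hence "scal d * e * (y - scal c * e) = scal d * y - scal (d * c) * e"
      by (simp add: mult.assoc) (simp add: right_diff_distrib scal_mult mult.assoc)
    ultimately have "scal d * y - scal (d * c) * e \<in> C.J" by simp
    thus ?thesis unfolding K_def using k_mult[OF d c(1)] by blast
  qed
  have K_sum: "sum f A \<in> K" if "\<And>i. i \<in> A \<Longrightarrow> f i \<in> K" for A and f :: "'c \<Rightarrow> _"
  proof -
    have "0 \<in> K" unfolding K_def using k_0 C.J(2) by (auto intro: bexI[of _ 0])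
    thus ?thesis using that by (induction A rule: infinite_finite_induct) (auto simp: K_add)
  qed
  have JK: "y \<in> K" if "y \<in> C.J" for y unfolding K_def using k_0 that by (auto intro!: bexI[of _ 0])
  have tg: "\<tau> (Poly_Mapping.single g 1) \<in> K" for g :: 'g
  proof -
    let ?X = "Poly_Mapping.single g 1 :: 'g \<Rightarrow>\<^sub>0 'f"
    have XR: "?X \<in> R" by (intro R_single k_1)
    have "\<tau> (?X * spectral g j) \<in> K" for j
    proof -
      define l where "l = inverse (\<zeta> ^ j)"
      \<comment> \<open>The \<open>p^a\<close>-th root of \<open>l\<close> in \<open>k\<close>:
        since \<open>l^q = l\<close>, the power of \<open>l\<close> with exponent
        \<open>p^((m - 1) a) * p^a = q^a\<close> is \<open>l\<close> again.\<close>
      define \<mu> where "\<mu> = l ^ (p ^ ((m - 1) * a))"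
      have lk: "l \<in> k" unfolding l_def by (intro k_inverse k_power zeta)
      hence muk: "\<mu> \<in> k" unfolding \<mu>_def by (rule k_power)
      have "l ^ (q ^ i) = l" for i using lk by (induction i) (simp_all add: power_mult root_subfield_def)
      moreover have "p ^ ((m - 1) * a) * p ^ a = q ^ a"
        using m by (cases m) (simp_all add: power_mult[symmetric] power_add[symmetric] algebra_simps)
      ultimately have mu: "\<mu> ^ (p ^ a) = l" unfolding \<mu>_def by (simp flip: power_mult)
      let ?s = "spectral g j"
      \<comment> \<open>The part of \<open>g - \<mu>\<close> on one eigenspace. Its
        \<open>p^a\<close>-th power involves \<open>(g - \<mu>)^(p^a) = g^(p^a) - l\<close>, which
        the spectral idempotent annihilates; so \<open>\<nu>\<close> is nilpotent and its trace lies
        in the radical.\<close>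
      define \<nu> where "\<nu> = (?X - scal \<mu>) * ?s"
      have "(?X - scal \<mu> + scal \<mu>) ^ (p ^ a) = (?X - scal \<mu>) ^ (p ^ a) + scal \<mu> ^ (p ^ a)"
        by (rule commuting_freshman[OF _ p(2) of_nat_p]) (simp add: scal_central)
      hence pw: "(?X - scal \<mu>) ^ (p ^ a) = ?X ^ (p ^ a) - scal l" by (simp add: mu flip: scal_power)
      have comm: "(?X - scal \<mu>) * ?s = ?s * (?X - scal \<mu>)"
        using spectral(5)[of g j] by (simp add: left_diff_distrib right_diff_distrib scal_central)
      have "\<nu> ^ (p ^ a) * ?s = (?X - scal \<mu>) ^ (p ^ a) * ?s"
      proof -
        have "\<nu> ^ i * ?s = (?X - scal \<mu>) ^ i * ?s" for i
        proof (induction i)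
          case (Suc i)
          have "\<nu> ^ Suc i * ?s = \<nu> * (\<nu> ^ i * ?s)" by (simp add: mult.assoc)
          also have "\<dots> = (?X - scal \<mu>) * (?s * (?X - scal \<mu>) ^ i) * ?s"
            by (simp only: Suc) (simp only: \<nu>_def mult.assoc)
          also have "?s * (?X - scal \<mu>) ^ i = (?X - scal \<mu>) ^ i * ?s"
            using power_commuting_commutes[OF comm, of i] by simp
          finally show ?case using spectral(3)[of g j] by (simp add: mult.assoc)
        qed simp
        thus ?thesis .
      qed
      also have "\<dots> = 0" using spectral(2)[of g j] by (simp add: pw left_diff_distrib l_def)
      finally have "\<nu> ^ (p ^ a) * ?s = 0" .
      moreover have "\<nu> = ?s * (?X - scal \<mu>)" using comm by (simp add: \<nu>_def)
      ultimately have "\<nu> ^ Suc (p ^ a) = 0" by (simp only: power_Suc2) (simp flip: mult.assoc)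
      hence "nilpotent \<nu>" unfolding nilpotent_def by blast
      moreover have "\<nu> \<in> R" unfolding \<nu>_def by (intro R_mult R_diff XR R_single muk spectral)
      ultimately have 1: "\<tau> \<nu> \<in> K" using nilp JK unfolding \<tau>_def by blast
      \<comment> \<open>The trace of an idempotent is an integral multiple of \<open>e\<close>, and
        the prime field lies in \<open>k\<close>.\<close>
      obtain n' where "\<tau> ?s - of_nat n' * e \<in> C.J" using idem[OF spectral(1,3)] unfolding \<tau>_def by blast
      hence "\<tau> ?s \<in> K" unfolding K_def using k_of_nat by (auto intro!: bexI[of _ "of_nat n'"])
      hence 2: "\<tau> (scal \<mu> * ?s) \<in> K" unfolding t_scal using K_scal muk by blast
      have "?X * ?s = \<nu> + scal \<mu> * ?s" by (simp add: \<nu>_def left_diff_distrib)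
      thus ?thesis using 1 2 K_add t_add by simp
    qed
    hence "(\<Sum>j<n. \<tau> (?X * spectral g j)) \<in> K" by (intro K_sum)
    moreover have "?X = (\<Sum>j<n. ?X * spectral g j)" by (simp add: spectral(4) flip: sum_distrib_left)
    ultimately show ?thesis using t_sum by metis
  qed
  have "\<tau> (\<Sum>g\<in>UNIV. scal (Poly_Mapping.lookup x g) * Poly_Mapping.single g 1) \<in> K"
    unfolding t_sum t_scal using x by (intro K_sum K_scal tg) (simp add: coeffs_in_def)
  moreover have "(\<Sum>g\<in>UNIV. scal (Poly_Mapping.lookup x g) * Poly_Mapping.single g 1) = x"
    by (simp add: mult_single flip: poly_mapping_expand)
  ultimately obtain c where c: "c \<in> k" "\<tau> x - scal c * e \<in> C.J" unfolding K_def by auto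
  have "x \<in> C.L" using x by (simp add: C.L_def)
  hence "\<tau> x - x \<in> C.J" using onL unfolding \<tau>_def by blast
  hence "x - scal c * e \<in> C.J" using c(2) C.J_trans C.J_sym by blast
  thus ?thesis using c(1) unfolding C.J_def by blast
qed

end

section \<open>Split local idempotents\<close>

definition corner :: "'r::ring_1 \<Rightarrow> 'r set" where
  "corner e = {x. e * x = x \<and> x * e = x}"

text \<open>\<open>l\<close> is the residue map of the local ring \<open>corner e\<close>; its values outside the corner are junk.\<close>

definition split_local :: "('r::ring_1 \<Rightarrow> 'f::field) \<Rightarrow> 'r \<Rightarrow> bool" where
  "split_local l e \<longleftrightarrow> e * e = e \<and> l e = 1 \<and>
     (\<forall>x\<in>corner e. \<forall>y\<in>corner e. l (x + y) = l x + l y \<and> l (x * y) = l x * l y) \<and>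
     (\<forall>x\<in>corner e. l x \<noteq> 0 \<longrightarrow> (\<exists>y\<in>corner e. x * y = e \<and> y * x = e)) \<and>
     (\<forall>x\<in>corner e. l x = 0 \<longrightarrow> nilpotent x)"

lemma corner_add: "x \<in> corner e \<Longrightarrow> y \<in> corner e \<Longrightarrow> x + y \<in> corner e"
  by (simp add: corner_def algebra_simps)
lemma corner_diff: "x \<in> corner e \<Longrightarrow> y \<in> corner e \<Longrightarrow> x - y \<in> corner e"
  by (simp add: corner_def algebra_simps)
lemma corner_mult: "x \<in> corner e \<Longrightarrow> y \<in> corner e \<Longrightarrow> x * y \<in> corner e"
  unfolding corner_def by (simp add: mult.assoc) (simp flip: mult.assoc)
lemma cornerI: "e * e = e \<Longrightarrow> e * x * e \<in> corner e"
  unfolding corner_def by (simp add: mult.assoc) (simp flip: mult.assoc)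

text \<open>\<open>x \<mapsto> a x b\<close> is a ring isomorphism from \<open>corner f\<close> onto
  \<open>corner e\<close>, with inverse \<open>y \<mapsto> b y a\<close>.\<close>

lemma split_local_transport:
  assumes l: "split_local l e" and ab: "a * b = e" "b * a = f" "e * a = a" "a * f = a" "f * b = b" "b * e = b"
  shows "split_local (\<lambda>x. l (a * x * b)) f"
proof -
  have c: "a * x * b \<in> corner e" for x
    unfolding corner_def using ab by (simp add: mult.assoc) (simp flip: mult.assoc)
  show ?thesis unfolding split_local_def
  proof (intro conjI ballI impI)
    show "f * f = f" using ab by (metis mult.assoc)
    have "a * f * b = e" using ab by simp
    thus "l (a * f * b) = 1" using l by (simp add: split_local_def)
    fix x y assume xy: "x \<in> corner f" "y \<in> corner f"
    have "a * (x + y) * b = a * x * b + a * y * b" by (simp add: algebra_simps)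
    thus "l (a * (x + y) * b) = l (a * x * b) + l (a * y * b)" using l c by (simp add: split_local_def)
    have "a * (x * y) * b = a * x * (f * y) * b" using xy by (simp add: corner_def mult.assoc)
    also have "\<dots> = (a * x * b) * (a * y * b)" using ab(2) by (simp flip: ab(2) add: mult.assoc)
    finally show "l (a * (x * y) * b) = l (a * x * b) * l (a * y * b)" using l c by (simp add: split_local_def)
  next
    fix x assume x: "x \<in> corner f" "l (a * x * b) \<noteq> 0"
    then obtain y where y: "y \<in> corner e" "a * x * b * y = e" "y * (a * x * b) = e"
      using l c unfolding split_local_def by blast
    have fx: "b * a * x = x" "x * b * a = x" using x ab(2) by (simp_all add: corner_def mult.assoc)
    have "x * (b * y * a) = b * (a * x * b * y) * a" by (subst fx(1)[symmetric]) (simp only: mult.assoc)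
    moreover have "b * y * a * x = b * (y * (a * x * b)) * a" by (subst fx(2)[symmetric]) (simp only: mult.assoc)
    ultimately have "x * (b * y * a) = b * e * a" "b * y * a * x = b * e * a" by (simp_all only: y(2,3))
    hence "x * (b * y * a) = f" "b * y * a * x = f" using ab by simp_all
    moreover have "b * y * a \<in> corner f" unfolding corner_def using ab by (simp add: mult.assoc) (simp flip: mult.assoc)
    ultimately show "\<exists>y\<in>corner f. x * y = f \<and> y * x = f" by blast
  next
    fix x assume x: "x \<in> corner f" "l (a * x * b) = 0"
    have bk: "b * (a * x * b) ^ m * a = x ^ m * f" for m
    proof (induction m)
      case (Suc m)
      have "b * (a * x * b) ^ Suc m * a = (b * a) * x * (b * (a * x * b) ^ m * a)" by (simp add: mult.assoc)
      also have "\<dots> = x ^ Suc m * f" unfolding Suc using ab x by (simp add: corner_def mult.assoc)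
      finally show ?case .
    qed (use ab in simp)
    obtain m where "(a * x * b) ^ m = 0" using x l c unfolding split_local_def nilpotent_def by blast
    hence "x ^ m * f = 0" using bk[of m] by simp
    hence "x ^ m * (f * x) = 0" by (simp flip: mult.assoc)
    hence "x ^ Suc m = 0" using x by (simp only: corner_def power_Suc2) simp
    thus "nilpotent x" unfolding nilpotent_def by blast
  qed
qed

text \<open>The finite geometric series in \<open>s\<close>, cut down to the corner.\<close>

lemma corner_unit_minus_nilpotent:
  assumes e: "e * e = e" and s: "s \<in> corner e" "nilpotent s"
  shows "\<exists>y\<in>corner e. (e - s) * y = e \<and> y * (e - s) = e"
proof -
  obtain m where m: "s ^ m = 0" using s(2) unfolding nilpotent_def by blast
  define S where "S = (\<Sum>i<m. s ^ i)"
  have "(1 - s) * (\<Sum>i<k. s ^ i) = 1 - s ^ k" for k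
  proof (induction k)
    case (Suc k) thus ?case by (simp add: distrib_left) (simp add: left_diff_distrib)
  qed simp
  hence 1: "(1 - s) * S = 1" using m by (simp add: S_def)
  have "(\<Sum>i<k. s ^ i) * (1 - s) = 1 - s ^ k" for k
  proof (induction k)
    case (Suc k) thus ?case by (simp add: distrib_right) (simp add: right_diff_distrib power_commutes)
  qed simp
  hence 2: "S * (1 - s) = 1" using m by (simp add: S_def)
  have es: "(e - s) * e = e * (1 - s)" "e * (e - s) = (1 - s) * e"
    using e s(1) by (simp_all add: corner_def algebra_simps)
  have "(e - s) * (e * S * e) = ((e - s) * e) * S * e" by (simp only: mult.assoc)
  also have "\<dots> = e * ((1 - s) * S) * e" unfolding es by (simp only: mult.assoc)
  finally have A: "(e - s) * (e * S * e) = e" using 1 e by simp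
  have "(e * S * e) * (e - s) = e * S * (e * (e - s))" by (simp only: mult.assoc)
  also have "\<dots> = e * (S * (1 - s)) * e" unfolding es by (simp only: mult.assoc)
  finally have "(e * S * e) * (e - s) = e" using 2 e by simp
  thus ?thesis using A cornerI[OF e] by blast
qed

text \<open>Let \<open>w\<close> be a product of elements of \<open>T\<close> and \<open>t w\<close>
  non-zero. Then \<open>T t w\<close> is properly contained in \<open>T w\<close>: it misses
  \<open>t w\<close> itself, because \<open>t w = t' t w\<close> with \<open>t'\<close> nilpotent
  would force \<open>t w = 0\<close>. So a non-zero product has at most \<open>card T\<close>
  factors.\<close>

lemma finite_nil_semigroup:
  fixes T :: "'r::ring_1 set"
  assumes T: "finite T" "\<And>s t. s \<in> T \<Longrightarrow> t \<in> T \<Longrightarrow> s * t \<in> T" "\<And>t. t \<in> T \<Longrightarrow> nilpotent t"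
    and ts: "set ts \<subseteq> T" "length ts > card T"
  shows "prod_list ts = 0"
proof (rule ccontr)
  assume nz: "prod_list ts \<noteq> 0"
  define U where "U w = (\<lambda>t. t * w) ` T" for w
  have fix_left: "u = 0" if "t \<in> T" "u = t * u" for t u :: 'r
  proof -
    have "u = t ^ m * u" for m
    proof (induction m)
      case (Suc m)
      have "t ^ Suc m * u = t ^ m * (t * u)" by (simp only: power_Suc2 mult.assoc)
      thus ?case using Suc that(2) by simp
    qed simp
    thus ?thesis using T(3)[OF that(1)] unfolding nilpotent_def by (metis mult_zero_left)
  qed
  have "card (U (prod_list ts)) + length ts \<le> card (U 1)" if "set ts \<subseteq> T" "prod_list ts \<noteq> 0" for ts
    using that
  proof (induction ts)
    case (Cons t ts)
    let ?w = "prod_list ts"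
    have "U (t * ?w) \<subset> U ?w"
    proof
      show "U (t * ?w) \<subseteq> U ?w" unfolding U_def using T(2) Cons.prems by (auto simp flip: mult.assoc)
      have "t * ?w \<in> U ?w" using Cons.prems by (simp add: U_def)
      moreover have "t * ?w \<notin> U (t * ?w)" using fix_left Cons.prems unfolding U_def by auto
      ultimately show "U (t * ?w) \<noteq> U ?w" by blast
    qed
    hence "card (U (t * ?w)) < card (U ?w)" using T(1) by (intro psubset_card_mono) (simp add: U_def)
    moreover have "?w \<noteq> 0" using Cons.prems by auto
    ultimately show ?case using Cons by force
  qed simp
  from this[OF ts(1) nz] have "length ts \<le> card (U 1)" by simp
  also have "\<dots> \<le> card T" unfolding U_def by (rule card_image_le[OF T(1)])
  finally show False using ts(2) by simp
qed

text \<open>The linear span of a finite \<open>T\<close>. For infinite \<open>T\<close> all these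
  sums are 0 by convention, so finiteness is asked for where elements of \<open>T\<close> have to be
  found in it.\<close>

definition fspan :: "('x::{finite,monoid_add} \<Rightarrow>\<^sub>0 'f::field) set \<Rightarrow> ('x \<Rightarrow>\<^sub>0 'f) set" where
  "fspan T = range (\<lambda>c. \<Sum>t\<in>T. scal (c t) * t)"

lemma scal_left_commute:
  fixes x y :: "'x::{finite,monoid_add} \<Rightarrow>\<^sub>0 'f::comm_semiring_1"
  shows "y * (scal c * x) = scal c * (y * x)"
  by (simp only: mult.assoc[symmetric] scal_central[symmetric, of y])

lemma fspan_add: "x \<in> fspan T \<Longrightarrow> y \<in> fspan T \<Longrightarrow> x + y \<in> fspan T"
  unfolding fspan_def by (auto simp: scal_add distrib_right sum.distrib intro!: image_eqI[of _ _ "\<lambda>t. _ t + _ t"])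

lemma fspan_scal: "x \<in> fspan T \<Longrightarrow> scal c * x \<in> fspan T"
  unfolding fspan_def by (auto simp: sum_distrib_left scal_mult mult.assoc intro!: image_eqI[of _ _ "\<lambda>t. c * _ t"])

lemma fspan_0: "0 \<in> fspan T"
  unfolding fspan_def by (rule image_eqI[of _ _ "\<lambda>_. 0"]) auto

lemma fspan_sum: "(\<And>i. i \<in> A \<Longrightarrow> f i \<in> fspan T) \<Longrightarrow> sum f A \<in> fspan T"
  by (induction A rule: infinite_finite_induct) (auto simp: fspan_0 fspan_add)

lemma fspan_base: 
  assumes "finite T" "t \<in> T" shows "t \<in> fspan T"
  unfolding fspan_def
proof (rule image_eqI)
  have "(\<Sum>s\<in>T. scal (if s = t then 1 else 0) * s) = (\<Sum>s\<in>T. if s = t then t else 0)"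
    by (intro sum.cong) auto
  thus "t = (\<Sum>s\<in>T. scal (if s = t then 1 else 0) * s)" using assms by simp
qed simp

text \<open>The linear maps \<open>f\<close> and \<open>g\<close> are there so that one lemma covers
  products inside one algebra as well as products of images under \<open>left_emb\<close> and
  \<open>right_emb\<close>.\<close>

lemma fspan_bilinear:
  assumes "x \<in> fspan S" "y \<in> fspan T" "\<And>s t. s \<in> S \<Longrightarrow> t \<in> T \<Longrightarrow> f s * g t \<in> fspan V"
    and f: "\<And>x y. f (x + y) = f x + f y" "f 0 = 0" "\<And>c x. f (scal c * x) = scal c * f x"
    and g: "\<And>x y. g (x + y) = g x + g y" "g 0 = 0" "\<And>c x. g (scal c * x) = scal c * g x"
  shows "f x * g y \<in> fspan V"
proof -
  obtain c d where x: "x = (\<Sum>s\<in>S. scal (c s) * s)" and y: "y = (\<Sum>t\<in>T. scal (d t) * t)"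
    using assms unfolding fspan_def by auto
  have fs: "f (sum h A) = (\<Sum>i\<in>A. f (h i))" for h A
    by (induction A rule: infinite_finite_induct) (simp_all add: f)
  have gs: "g (sum h A) = (\<Sum>i\<in>A. g (h i))" for h A
    by (induction A rule: infinite_finite_induct) (simp_all add: g)
  have "f x * g y = (\<Sum>s\<in>S. \<Sum>t\<in>T. scal (c s) * f s * (scal (d t) * g t))"
    unfolding x y fs gs sum_product f(3) g(3) ..
  also have "\<dots> = (\<Sum>s\<in>S. \<Sum>t\<in>T. scal (c s * d t) * (f s * g t))"
  proof (intro sum.cong refl)
    fix s t
    have "scal (c s) * f s * (scal (d t) * g t) = scal (c s) * (f s * scal (d t)) * g t" by (simp only: mult.assoc)
    also have "f s * scal (d t) = scal (d t) * f s" by (rule scal_central[symmetric])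
    finally show "scal (c s) * f s * (scal (d t) * g t) = scal (c s * d t) * (f s * g t)"
      by (simp only: mult.assoc scal_mult)
  qed
  also have "\<dots> \<in> fspan V" using assms(3) by (intro fspan_sum fspan_scal) auto
  finally show ?thesis .
qed

text \<open>A power of \<open>x\<close> expands into products of elements of \<open>T\<close> of
  that length, and these vanish beyond length \<open>card T\<close>. The induction carries a right
  factor \<open>u\<close> that collects the letters already expanded.\<close>

lemma nilpotent_fspan:
  assumes T: "finite T" "\<And>s t. s \<in> T \<Longrightarrow> t \<in> T \<Longrightarrow> s * t \<in> T" "\<And>t. t \<in> T \<Longrightarrow> nilpotent t"
    and x: "x \<in> fspan T"
  shows "nilpotent x"
proof -
  obtain c where xc: "x = (\<Sum>t\<in>T. scal (c t) * t)" using x unfolding fspan_def by auto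
  have "x ^ j * u = 0" if "\<And>ts. set ts \<subseteq> T \<Longrightarrow> length ts = j \<Longrightarrow> prod_list ts * u = 0" for j u
    using that
  proof (induction j arbitrary: u)
    case 0 from 0[of "[]"] show ?case by simp
  next
    case (Suc j)
    have "x ^ j * (t * u) = 0" if "t \<in> T" for t
    proof (rule Suc.IH)
      fix ts assume "set ts \<subseteq> T" "length ts = j"
      thus "prod_list ts * (t * u) = 0" using Suc.prems[of "ts @ [t]"] that by (simp add: mult.assoc)
    qed
    hence "x ^ j * (scal (c t) * t * u) = 0" if "t \<in> T" for t
      using that by (simp only: mult.assoc scal_left_commute[of "x ^ j"]) simp
    hence "(\<Sum>t\<in>T. x ^ j * (scal (c t) * t * u)) = 0" by simp
    moreover have "x ^ Suc j * u = x ^ j * (x * u)" by (simp only: power_Suc2 mult.assoc)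
    moreover have "x * u = (\<Sum>t\<in>T. scal (c t) * t * u)" unfolding xc by (simp add: sum_distrib_right)
    ultimately show ?case by (simp add: sum_distrib_left)
  qed
  from this[of "Suc (card T)" 1] have "x ^ Suc (card T) = 0"
    using finite_nil_semigroup[OF T] by simp
  thus ?thesis unfolding nilpotent_def by blast
qed

text \<open>A finite multiplicative set of nilpotents spans a nilpotent ideal. Unlike \<open>split_local\<close>, this
  certificate passes to tensor products of group algebras.\<close>

definition split_data :: "('x::{finite,monoid_add} \<Rightarrow>\<^sub>0 'f::field) \<Rightarrow> ('x \<Rightarrow>\<^sub>0 'f) set \<Rightarrow> bool" where
  "split_data e T \<longleftrightarrow> e * e = e \<and> e \<noteq> 0 \<and> finite T \<and> (\<forall>s\<in>T. \<forall>t\<in>T. s * t \<in> T) \<and>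
     (\<forall>t\<in>T. nilpotent t \<and> t \<in> corner e) \<and>
     (\<forall>g. \<exists>c. \<exists>s\<in>fspan T. e * Poly_Mapping.single g 1 * e = scal c * e + s)"

text \<open>\<open>corner e\<close> is the sum of the scalar multiples of \<open>e\<close> and the
  nilpotent ideal \<open>fspan T\<close>, and the sum is direct because \<open>e\<close> is not
  nilpotent. The residue map reads off the scalar.\<close>

lemma split_data_imp_split_local:
  fixes e :: "'x::{finite,monoid_add} \<Rightarrow>\<^sub>0 'f::field"
  assumes "split_data e T" shows "\<exists>l :: ('x \<Rightarrow>\<^sub>0 'f) \<Rightarrow> 'f. split_local l e"
proof -
  have e: "e * e = e" "e \<noteq> 0" and T: "finite T" "\<And>s t. s \<in> T \<Longrightarrow> t \<in> T \<Longrightarrow> s * t \<in> T"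
    "\<And>t. t \<in> T \<Longrightarrow> nilpotent t" "\<And>t. t \<in> T \<Longrightarrow> t \<in> corner e"
    and res: "\<And>g. \<exists>c. \<exists>s\<in>fspan T. e * Poly_Mapping.single g 1 * e = scal c * e + s"
    using assms unfolding split_data_def by auto
  have nilp: "nilpotent x" if "x \<in> fspan T" for x using nilpotent_fspan[OF T(1-3) that] by blast
  have sp_mult: "x * y \<in> fspan T" if "x \<in> fspan T" "y \<in> fspan T" for x y
    by (rule fspan_bilinear[OF that, of "\<lambda>x. x" "\<lambda>x. x" T]) (auto intro: fspan_base T(1,2))
  have e_sp: "e * x = x" "x * e = x" if x: "x \<in> fspan T" for x
  proof -
    obtain c where xc: "x = (\<Sum>t\<in>T. scal (c t) * t)" using x unfolding fspan_def by auto
    have 1: "scal (c t) * t * e = scal (c t) * t" if "t \<in> T" for t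
      using T(4)[OF that] by (simp add: corner_def mult.assoc)
    have 2: "e * (scal (c t) * t) = scal (c t) * t" if "t \<in> T" for t
    proof -
      have "e * (scal (c t) * t) = scal (c t) * (e * t)" by (rule scal_left_commute)
      thus ?thesis using T(4)[OF that] by (simp add: corner_def)
    qed
    show "e * x = x" "x * e = x" unfolding xc sum_distrib_left sum_distrib_right using 1 2 by auto
  qed
  have ex: "\<exists>c. x - scal c * e \<in> fspan T" if x: "x \<in> corner e" for x
  proof -
    obtain c s where cs: "\<And>g. s g \<in> fspan T" "\<And>g. e * Poly_Mapping.single g 1 * e = scal (c g) * e + s g"
      using res by metis
    let ?a = "Poly_Mapping.lookup x"
    have "x = e * (\<Sum>g\<in>UNIV. scal (?a g) * Poly_Mapping.single g 1) * e"
      using x by (simp add: corner_def mult_single flip: poly_mapping_expand)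
    also have "\<dots> = (\<Sum>g\<in>UNIV. scal (?a g) * (e * Poly_Mapping.single g 1 * e))"
      unfolding sum_distrib_left sum_distrib_right
      by (intro sum.cong refl) (simp only: mult.assoc scal_left_commute[of e])
    also have "\<dots> = scal (\<Sum>g\<in>UNIV. ?a g * c g) * e + (\<Sum>g\<in>UNIV. scal (?a g) * s g)"
      unfolding cs(2) by (simp add: distrib_left sum.distrib scal_sum sum_distrib_right scal_mult mult.assoc)
    finally have "x - scal (\<Sum>g\<in>UNIV. ?a g * c g) * e = (\<Sum>g\<in>UNIV. scal (?a g) * s g)"
      by (metis add_diff_cancel_left')
    also have "\<dots> \<in> fspan T" by (intro fspan_sum fspan_scal cs)
    finally show ?thesis by blast
  qed
  have uniq: "c = d" if "x - scal c * e \<in> fspan T" "x - scal d * e \<in> fspan T" for x c d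
  proof (rule ccontr)
    assume ne: "c \<noteq> d"
    have "(x - scal c * e) + scal (- 1) * (x - scal d * e) \<in> fspan T"
      using that by (intro fspan_add fspan_scal)
    moreover have "(x - scal c * e) + scal (- 1) * (x - scal d * e) = scal (d - c) * e"
      by (simp add: algebra_simps single_diff single_uminus)
    ultimately have "scal (inverse (d - c)) * (scal (d - c) * e) \<in> fspan T" by (simp add: fspan_scal)
    moreover have "scal (inverse (d - c)) * (scal (d - c) * e) = e"
      using ne by (simp add: mult.assoc[symmetric] mult_single)
    ultimately have "nilpotent e" using nilp by simp
    thus False using nilpotent_fix_right[of e e] e by simp
  qed
  define l where "l x = (THE c. x - scal c * e \<in> fspan T)" for x
  have lI: "l x = c" if "x - scal c * e \<in> fspan T" for x c
    unfolding l_def using that uniq by (intro the_equality) blast+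
  have l: "x - scal (l x) * e \<in> fspan T" if "x \<in> corner e" for x using ex[OF that] lI by metis
  have "split_local l e"
    unfolding split_local_def
  proof (intro conjI ballI impI)
    show "l e = 1" by (rule lI) (simp add: fspan_0)
    fix x y assume xy: "x \<in> corner e" "y \<in> corner e"
    note lx = l[OF xy(1)] and ly = l[OF xy(2)]
    show "l (x + y) = l x + l y"
      using fspan_add[OF lx ly] by (intro lI) (simp add: scal_add algebra_simps)
    define s t where "s = x - scal (l x) * e" and "t = y - scal (l y) * e"
    have "x * y - scal (l x * l y) * e = scal (l x) * t + scal (l y) * s + s * t"
    proof -
      have x: "x = scal (l x) * e + s" and y: "y = scal (l y) * e + t" by (simp_all add: s_def t_def)
      have "x * y = scal (l x) * e * (scal (l y) * e) + scal (l x) * (e * t) + s * (scal (l y) * e) + s * t"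
        by (subst x, subst y) (simp add: algebra_simps)
      also have "scal (l x) * e * (scal (l y) * e) = scal (l x) * (e * scal (l y)) * e" by (simp only: mult.assoc)
      also have "\<dots> = scal (l x * l y) * e" by (simp only: scal_central[symmetric, of e] scal_mult mult.assoc e)
      also have "s * (scal (l y) * e) = scal (l y) * (s * e)" by (rule scal_left_commute)
      finally show ?thesis using e_sp lx ly by (simp add: s_def t_def)
    qed
    also have "\<dots> \<in> fspan T" using lx ly unfolding s_def t_def by (intro fspan_add fspan_scal sp_mult)
    finally show "l (x * y) = l x * l y" by (rule lI)
  next
    fix x assume x: "x \<in> corner e" "l x \<noteq> 0"
    let ?c = "inverse (l x)"
    \<comment> \<open>Chosen so that \<open>x\<close> is \<open>l x\<close> times
      \<open>e - s\<close>; lying in the span of \<open>T\<close>, \<open>s\<close> is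
      nilpotent.\<close>
    define s where "s = scal ?c * (scal (l x) * e - x)"
    have s': "s = scal (- ?c) * (x - scal (l x) * e)"
      by (simp add: s_def algebra_simps single_uminus)
    have "s \<in> fspan T" unfolding s' by (intro fspan_scal l x)
    hence s: "nilpotent s" "s \<in> corner e" using nilp e_sp by (auto simp: corner_def)
    have es: "e - s = scal ?c * x"
      using x(2) by (simp add: s_def right_diff_distrib mult.assoc[symmetric] mult_single)
    obtain y where y: "y \<in> corner e" "(e - s) * y = e" "y * (e - s) = e"
      using corner_unit_minus_nilpotent[OF e(1) s(2,1)] by blast
    have "x * (scal ?c * y) = e" "scal ?c * y * x = e"
      using y(2,3) unfolding es by (simp_all add: scal_left_commute mult.assoc)
    moreover have "scal ?c * y \<in> corner e"
      using y(1) by (simp add: corner_def scal_left_commute mult.assoc)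
    ultimately show "\<exists>y\<in>corner e. x * y = e \<and> y * x = e" by blast
  next
    fix x assume "x \<in> corner e" "l x = 0"
    thus "nilpotent x" using nilp l[of x] by simp
  qed (use e in simp)
  thus ?thesis by blast
qed

text \<open>In a proper orthogonal splitting \<open>f = x + y\<close> both right ideals
  \<open>x R\<close> and \<open>y R\<close> are smaller than \<open>f R\<close>, so the splitting
  process ends.\<close>

lemma primitive_decomposition:
  fixes R :: "'r::ring_1 set"
  assumes R: "finite R" "\<And>x y. x \<in> R \<Longrightarrow> y \<in> R \<Longrightarrow> x * y \<in> R" and f: "f \<in> R" "f * f = f"
  shows "\<exists>(N::nat) u. (\<forall>k<N. primitive_idempotent R (u k)) \<and> (\<Sum>k<N. u k) = f"
  using f
proof (induction "card ((*) f ` R)" arbitrary: f rule: less_induct)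
  case less
  consider "f = 0" | "primitive_idempotent R f" | "f \<noteq> 0" "\<not> primitive_idempotent R f" by blast
  thus ?case
  proof cases
    case 1 thus ?thesis by (intro exI[of _ 0]) simp
  next
    case 2 thus ?thesis by (intro exI[of _ 1] exI[of _ "\<lambda>_. f"]) simp
  next
    case 3
    then obtain x y where xy: "x \<in> R" "y \<in> R" "x * x = x" "y * y = y" "x * y = 0" "y * x = 0" "f = x + y" "x \<noteq> 0" "y \<noteq> 0"
      using less.prems unfolding primitive_idempotent_def by blast
    have smaller: "card ((*) x ` R) < card ((*) f ` R)"
      if xy: "x \<in> R" "y \<in> R" "x * x = x" "y * y = y" "x * y = 0" "y * x = 0" "f = x + y" "y \<noteq> 0" for x y
    proof (rule psubset_card_mono)
      have "y = f * y" "x = f * x" using xy by (simp_all add: distrib_right)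
      have "y \<notin> (*) x ` R"
      proof
        assume "y \<in> (*) x ` R"
        then obtain z where "y = x * z" by blast
        hence "y * y = (y * x) * z" by (simp add: mult.assoc)
        thus False using xy by simp
      qed
      moreover have "y \<in> (*) f ` R" using \<open>y = f * y\<close> xy by blast
      moreover have "(*) x ` R \<subseteq> (*) f ` R"
      proof
        fix w assume "w \<in> (*) x ` R"
        then obtain z where "z \<in> R" "w = f * x * z" using \<open>x = f * x\<close> by auto
        thus "w \<in> (*) f ` R" using R xy by (auto simp: mult.assoc)
      qed
      ultimately show "(*) x ` R \<subset> (*) f ` R" by blast
    qed (simp add: R)
    have fyx: "f = y + x" using xy by simp
    obtain N :: nat and u where u: "\<forall>k<N. primitive_idempotent R (u k)" "(\<Sum>k<N. u k) = x"
      using less.hyps[OF smaller[OF xy(1-7,9)] xy(1,3)] by blast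
    obtain M :: nat and v where v: "\<forall>k<M. primitive_idempotent R (v k)" "(\<Sum>k<M. v k) = y"
      using less.hyps[OF smaller[OF xy(2,1,4,3,6,5) fyx xy(8)] xy(2,4)] by blast
    let ?w = "\<lambda>k. if k < N then u k else v (k - N)"
    have "(\<Sum>k<N + m. ?w k) = (\<Sum>k<N. u k) + (\<Sum>k<m. v k)" for m
      by (induction m) (simp_all add: ac_simps)
    thus ?thesis using u v xy by (intro exI[of _ "N + M"] exI[of _ ?w]) auto
  qed
qed

text \<open>The idempotents are primitive in the finite ring \<open>kG\<close>. The radicals of
  their corners there are finite, hence usable as the sets \<open>T\<close>, and
  \<open>corner_residue\<close> supplies the scalars.\<close>

lemma (in char_p_splitting) split_decomposition:
  obtains N :: nat and u T where "(\<Sum>k<N. u k) = (1 :: 'g \<Rightarrow>\<^sub>0 'f)" "\<And>k. k < N \<Longrightarrow> split_data (u k) (T k)"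
proof -
  obtain N :: nat and u where u: "\<forall>i<N. primitive_idempotent R (u i)" "(\<Sum>i<N. u i) = 1"
    using primitive_decomposition[OF finite_R R_mult R_1] by auto
  define T where "T i = {x \<in> R. u i * x = x \<and> x * u i = x \<and> nilpotent x}" for i
  have "split_data (u i) (T i)" if "i < N" for i
  proof -
    have prim: "primitive_idempotent R (u i)" using u that by blast
    interpret C: finite_subring_idempotent R "u i"
      by unfold_locales (use finite_R R_1 R_diff R_mult prim in auto)
    have TJ: "T i = C.J" unfolding T_def C.J_def C.L_def by auto
    have "\<exists>c. \<exists>s\<in>fspan (T i). u i * Poly_Mapping.single g 1 * u i = scal c * u i + s" for g
    proof -
      let ?x = "u i * Poly_Mapping.single g 1 * u i"
      have x: "?x \<in> R" "u i * ?x = ?x" "?x * u i = ?x"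
        using C.L_corner[OF R_single[OF k_1, of g]] unfolding C.L_def by auto
      obtain c where c: "c \<in> k" "nilpotent (?x - scal c * u i)" using corner_residue[OF prim x] by blast
      have sc: "u i * (scal c * u i) = scal c * u i" 
        by (simp only: scal_left_commute C.e)
      have "?x - scal c * u i \<in> T i"
        unfolding T_def using x c C.e R_diff[OF x(1) R_mult[OF R_single[OF c(1), of 0] C.e(1)]] sc
        by (simp add: left_diff_distrib right_diff_distrib mult.assoc)
      hence "?x - scal c * u i \<in> fspan (T i)" by (intro fspan_base) (simp_all add: TJ C.finJ)
      thus ?thesis by (intro exI[of _ c] bexI[of _ "?x - scal c * u i"]) auto
    qed
    moreover have "\<forall>s\<in>T i. \<forall>t\<in>T i. s * t \<in> T i" unfolding TJ using C.J(1,5) by blast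
    ultimately show ?thesis unfolding split_data_def using C.e C.finJ
      by (auto simp: TJ) (auto simp: C.J_def C.L_def corner_def)
  qed
  thus ?thesis using that u by blast
qed

section \<open>The group algebra of the product group\<close>

lemma left_emb_single: "left_emb (Poly_Mapping.single g c) = Poly_Mapping.single (g, 0) c"
proof -
  have "left_emb (Poly_Mapping.single g c) = (\<Sum>h\<in>UNIV. if h = g then Poly_Mapping.single (g, 0) c else 0)"
    unfolding left_emb_def by (intro sum.cong) (auto simp: lookup_single when_def)
  thus ?thesis by simp
qed

lemma right_emb_single: "right_emb (Poly_Mapping.single g c) = Poly_Mapping.single (0, - g) c"
proof -
  have "right_emb (Poly_Mapping.single g c) = (\<Sum>h\<in>UNIV. if h = g then Poly_Mapping.single (0, - g) c else 0)"
    unfolding right_emb_def by (intro sum.cong) (auto simp: lookup_single when_def)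
  thus ?thesis by simp
qed

lemma left_emb_add: "left_emb (x + y) = left_emb x + left_emb y"
  by (simp add: left_emb_def lookup_add single_add sum.distrib)
lemma right_emb_add: "right_emb (x + y) = right_emb x + right_emb y"
  by (simp add: right_emb_def lookup_add single_add sum.distrib)
lemma left_emb_0: "left_emb 0 = 0" by (simp add: left_emb_def)
lemma right_emb_0: "right_emb 0 = 0" by (simp add: right_emb_def)
lemma left_emb_sum: "left_emb (sum f A) = (\<Sum>i\<in>A. left_emb (f i))"
  by (induction A rule: infinite_finite_induct) (simp_all add: left_emb_add left_emb_0)
lemma right_emb_sum: "right_emb (sum f A) = (\<Sum>i\<in>A. right_emb (f i))"
  by (induction A rule: infinite_finite_induct) (simp_all add: right_emb_add right_emb_0)

lemma left_emb_mult: "left_emb (x * y) = left_emb x * left_emb y"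
proof -
  let ?e = "\<lambda>x::'a \<Rightarrow>\<^sub>0 'b. \<Sum>g\<in>UNIV. Poly_Mapping.single g (Poly_Mapping.lookup x g)"
  have "left_emb (?e x * ?e y) = left_emb (?e x) * left_emb (?e y)"
    by (simp add: sum_product left_emb_sum left_emb_single mult_single)
  thus ?thesis by (simp flip: poly_mapping_expand)
qed

lemma right_emb_mult: "right_emb (x * y) = right_emb y * right_emb x"
proof -
  let ?e = "\<lambda>x::'a \<Rightarrow>\<^sub>0 'b. \<Sum>g\<in>UNIV. Poly_Mapping.single g (Poly_Mapping.lookup x g)"
  have "right_emb (?e x * ?e y) = (\<Sum>i\<in>UNIV. \<Sum>j\<in>UNIV. right_emb (Poly_Mapping.single j (Poly_Mapping.lookup y j)) * right_emb (Poly_Mapping.single i (Poly_Mapping.lookup x i)))"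
    by (simp add: sum_product right_emb_sum right_emb_single mult_single minus_add mult.commute)
  also have "\<dots> = right_emb (?e y) * right_emb (?e x)"
    by (subst sum.swap) (simp add: sum_product right_emb_sum)
  finally show ?thesis by (simp flip: poly_mapping_expand)
qed

lemma left_right_commute: "left_emb x * right_emb y = right_emb y * left_emb x"
  unfolding left_emb_def right_emb_def
  by (simp add: sum_product mult_single mult.commute) (rule sum.swap)

lemma left_emb_scal: "left_emb (scal c) = scal c"
  by (simp add: left_emb_single zero_prod_def)
lemma right_emb_scal: "right_emb (scal c) = scal c"
  by (simp add: right_emb_single zero_prod_def)
lemma left_emb_1: "left_emb 1 = 1" using left_emb_scal[of 1] by simp
lemma right_emb_1: "right_emb 1 = 1" using right_emb_scal[of 1] by simp

lemma left_emb_scal_mult: "left_emb (scal c * x) = scal c * left_emb x"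
  by (simp add: left_emb_mult left_emb_scal)
lemma right_emb_scal_mult: "right_emb (scal c * x) = scal c * right_emb x"
  by (simp add: right_emb_mult right_emb_scal scal_central)

lemma left_right_mult:
  "(left_emb x * right_emb y) * (left_emb x' * right_emb y') = left_emb (x * x') * right_emb (y' * y)"
proof -
  have "(left_emb x * right_emb y) * (left_emb x' * right_emb y') =
        left_emb x * (right_emb y * left_emb x') * right_emb y'" by (simp only: mult.assoc)
  also have "right_emb y * left_emb x' = left_emb x' * right_emb y" by (rule left_right_commute[symmetric])
  finally show ?thesis by (simp only: mult.assoc left_emb_mult right_emb_mult)
qed

lemma single_left_right: "Poly_Mapping.single (g, h) c = left_emb (Poly_Mapping.single g c) * right_emb (Poly_Mapping.single (- h) 1)"
  by (simp add: left_emb_single right_emb_single mult_single)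

text \<open>Pure tensors of non-zero elements are non-zero: the coefficient at
  \<open>(g, - h)\<close> is a product of two coefficients.\<close>

lemma left_right_nonzero:
  assumes "x \<noteq> 0" "y \<noteq> 0" shows "left_emb x * right_emb y \<noteq> 0"
proof -
  obtain g h where gh: "Poly_Mapping.lookup x g \<noteq> 0" "Poly_Mapping.lookup y h \<noteq> 0"
    using assms by (metis poly_mapping_eqI lookup_zero)
  have "Poly_Mapping.lookup (left_emb x * right_emb y) (g, - h) =
    (\<Sum>i\<in>UNIV. \<Sum>j\<in>UNIV. (if i = g \<and> j = h then Poly_Mapping.lookup x i * Poly_Mapping.lookup y j else 0))"
    unfolding left_emb_def right_emb_def
    by (simp add: sum_product mult_single lookup_sum lookup_single when_def cong: if_cong)
  also have "\<dots> = (\<Sum>i\<in>UNIV. if i = g then Poly_Mapping.lookup x g * Poly_Mapping.lookup y h else 0)"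
    by (intro sum.cong refl) (auto simp: if_distrib cong: if_cong)
  also have "\<dots> = Poly_Mapping.lookup x g * Poly_Mapping.lookup y h" by simp
  finally show ?thesis using gh by force
qed

lemma left_emb_power: "left_emb (x ^ m) = left_emb x ^ m"
  by (induction m) (simp_all add: left_emb_1 left_emb_mult)
lemma right_emb_power: "right_emb (x ^ m) = right_emb x ^ m"
  by (induction m) (simp_all add: right_emb_1 right_emb_mult power_commutes)

lemma nilpotent_left_right:
  assumes "nilpotent x \<or> nilpotent y" shows "nilpotent (left_emb x * right_emb y)"
  using assms
proof
  assume "nilpotent x"
  hence "nilpotent (left_emb x)" unfolding nilpotent_def by (metis left_emb_power left_emb_0)
  thus ?thesis by (rule nilpotent_commute_mult) (rule left_right_commute)
next
  assume "nilpotent y"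
  hence "nilpotent (right_emb y)" unfolding nilpotent_def by (metis right_emb_power right_emb_0)
  hence "nilpotent (right_emb y * left_emb x)" by (rule nilpotent_commute_mult) (rule left_right_commute[symmetric])
  thus ?thesis by (simp add: left_right_commute)
qed

text \<open>The radical of a tensor product of split local algebras is spanned by pure tensors with
  at least one factor in a radical. The other factor may be the idempotent itself, which explains
  the \<open>insert\<close>.\<close>

lemma split_data_tensor:
  assumes "split_data e S" "split_data f T"
  shows "split_data (left_emb e * right_emb f)
     {left_emb x * right_emb y | x y. x \<in> insert e S \<and> y \<in> insert f T \<and> (x \<in> S \<or> y \<in> T)}" (is "split_data ?h ?V")
proof -
  have e: "e * e = e" "e \<noteq> 0" and S: "finite S" "\<And>s t. s \<in> S \<Longrightarrow> t \<in> S \<Longrightarrow> s * t \<in> S"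
    "\<And>t. t \<in> S \<Longrightarrow> nilpotent t" "\<And>t. t \<in> S \<Longrightarrow> e * t = t \<and> t * e = t"
    and resS: "\<And>g. \<exists>c. \<exists>s\<in>fspan S. e * Poly_Mapping.single g 1 * e = scal c * e + s"
    using assms unfolding split_data_def corner_def by auto
  have f: "f * f = f" "f \<noteq> 0" and T: "finite T" "\<And>s t. s \<in> T \<Longrightarrow> t \<in> T \<Longrightarrow> s * t \<in> T"
    "\<And>t. t \<in> T \<Longrightarrow> nilpotent t" "\<And>t. t \<in> T \<Longrightarrow> f * t = t \<and> t * f = t"
    and resT: "\<And>g. \<exists>c. \<exists>s\<in>fspan T. f * Poly_Mapping.single g 1 * f = scal c * f + s"
    using assms unfolding split_data_def corner_def by auto
  have "?V \<subseteq> (\<lambda>(x, y). left_emb x * right_emb y) ` (insert e S \<times> insert f T)" by auto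
  hence finV: "finite ?V" by (rule finite_subset) (use S T in auto)
  have closed: "s * t \<in> ?V" if st: "s \<in> ?V" "t \<in> ?V" for s t
  proof -
    obtain x y x' y' where 1: "s = left_emb x * right_emb y" "x \<in> insert e S" "y \<in> insert f T" "x \<in> S \<or> y \<in> T"
      "t = left_emb x' * right_emb y'" "x' \<in> insert e S" "y' \<in> insert f T" "x' \<in> S \<or> y' \<in> T"
      using st by blast
    have "x * x' \<in> insert e S" "y' * y \<in> insert f T" "x \<in> S \<longrightarrow> x * x' \<in> S" "y \<in> T \<longrightarrow> y' * y \<in> T"
      using 1 e f S T by auto
    thus ?thesis unfolding 1(1,5) left_right_mult using 1(4) by blast
  qed
  have hh: "?h * ?h = ?h" using e f by (simp add: left_right_mult)
  have inc: "t \<in> corner ?h" if "t \<in> ?V" for t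
  proof -
    from that obtain x y where 1: "t = left_emb x * right_emb y" "x \<in> insert e S" "y \<in> insert f T" by blast
    hence "e * x = x" "x * e = x" "f * y = y" "y * f = y" using S T e f by auto
    thus ?thesis unfolding corner_def 1(1) by (simp add: left_right_mult)
  qed
  have resid: "\<exists>c. \<exists>s\<in>fspan ?V. ?h * Poly_Mapping.single g 1 * ?h = scal c * ?h + s" for g
  proof -
    obtain g1 g2 where g: "g = (g1, g2)" by force
    obtain c s where s: "s \<in> fspan S" "e * Poly_Mapping.single g1 1 * e = scal c * e + s" using resS by blast
    obtain d t where t: "t \<in> fspan T" "f * Poly_Mapping.single (- g2) 1 * f = scal d * f + t" using resT by blast
    have "?h * Poly_Mapping.single g 1 * ?h = left_emb (scal c * e + s) * right_emb (scal d * f + t)"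
      unfolding g single_left_right left_right_mult s(2)[symmetric] t(2)[symmetric] by (simp only: mult.assoc)
    also have "\<dots> = (scal c * left_emb e + left_emb s) * (scal d * right_emb f + right_emb t)"
      by (simp only: left_emb_add right_emb_add left_emb_scal_mult right_emb_scal_mult)
    also have "\<dots> = scal c * left_emb e * (scal d * right_emb f) +
      (scal c * (left_emb e * right_emb t) + left_emb s * (scal d * right_emb f) + left_emb s * right_emb t)"
      by (simp add: algebra_simps)
    also have "scal c * left_emb e * (scal d * right_emb f) = scal (c * d) * ?h"
    proof -
      have "scal c * left_emb e * (scal d * right_emb f) = scal c * (left_emb e * scal d) * right_emb f" by (simp only: mult.assoc)
      thus ?thesis by (simp only: scal_central[symmetric, of "left_emb e"] scal_mult mult.assoc)
    qed
    also have "left_emb s * (scal d * right_emb f) = scal d * (left_emb s * right_emb f)"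
      by (rule scal_left_commute)
    finally have eq: "?h * Poly_Mapping.single g 1 * ?h = scal (c * d) * ?h +
      (scal c * (left_emb e * right_emb t) + scal d * (left_emb s * right_emb f) + left_emb s * right_emb t)" .
    have bil: "left_emb x * right_emb y \<in> fspan ?V" if "x \<in> fspan X" "y \<in> fspan Y"
      "\<And>s t. s \<in> X \<Longrightarrow> t \<in> Y \<Longrightarrow> left_emb s * right_emb t \<in> ?V" for x y X Y
      by (rule fspan_bilinear[OF that(1,2) fspan_base[OF finV that(3)]])
        (simp_all add: left_emb_add right_emb_add left_emb_0 right_emb_0 left_emb_scal_mult right_emb_scal_mult)
    have ef: "e \<in> fspan {e}" "f \<in> fspan {f}" by (auto intro: fspan_base)
    have "left_emb e * right_emb t \<in> fspan ?V" by (rule bil[OF ef(1) t(1)]) blast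
    moreover have "left_emb s * right_emb f \<in> fspan ?V" by (rule bil[OF s(1) ef(2)]) blast
    moreover have "left_emb s * right_emb t \<in> fspan ?V" by (rule bil[OF s(1) t(1)]) blast
    ultimately have "scal c * (left_emb e * right_emb t) + scal d * (left_emb s * right_emb f) + left_emb s * right_emb t \<in> fspan ?V"
      by (intro fspan_add fspan_scal)
    thus ?thesis using eq by blast
  qed
  have nlV: "nilpotent t" if "t \<in> ?V" for t using that nilpotent_left_right S(3) T(3) by blast
  show ?thesis unfolding split_data_def
  proof (intro conjI ballI allI)
    show "?h \<noteq> 0" by (rule left_right_nonzero[OF e(2) f(2)])
  qed (fact hh finV closed nlV inc resid)+
qed

section \<open>Modules and Krull--Schmidt counting\<close>

locale lmod = abelian_group M for e :: "'r::ring_1" and M :: "('r, 'm) module" (structure) +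
  assumes lm: "left_module e M"
begin

lemma smult_closed [simp, intro]: "x \<in> carrier M \<Longrightarrow> a \<odot> x \<in> carrier M"
  and smult_l: "x \<in> carrier M \<Longrightarrow> (a + c) \<odot> x = a \<odot> x \<oplus> c \<odot> x"
  and smult_r: "x \<in> carrier M \<Longrightarrow> y \<in> carrier M \<Longrightarrow> a \<odot> (x \<oplus> y) = a \<odot> x \<oplus> a \<odot> y"
  and smult_assoc: "x \<in> carrier M \<Longrightarrow> (a * c) \<odot> x = a \<odot> (c \<odot> x)"
  and smult_e: "x \<in> carrier M \<Longrightarrow> e \<odot> x = x"
  using lm unfolding left_module_def by blast+

lemma smult_0: "x \<in> carrier M \<Longrightarrow> 0 \<odot> x = \<zero>"
  using smult_l[of x 0 0] add.r_cancel_one[of "0 \<odot> x" "0 \<odot> x"] by simp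

lemma smult_zero: "a \<odot> \<zero> = \<zero>"
  using smult_r[of \<zero> \<zero> a] add.r_cancel_one[of "a \<odot> \<zero>" "a \<odot> \<zero>"] by simp

lemma smult_1: "x \<in> carrier M \<Longrightarrow> 1 \<odot> x = x"
  using smult_assoc[of x 1 e] smult_e by simp

lemma smult_minus: "x \<in> carrier M \<Longrightarrow> (- 1) \<odot> x = \<ominus> x"
  using smult_l[of x "- 1" 1] by (simp add: smult_0 smult_1 minus_equality)

lemma diff_smult: "x \<in> carrier M \<Longrightarrow> y \<in> carrier M \<Longrightarrow> x \<ominus> y = x \<oplus> (- 1) \<odot> y"
  by (simp add: smult_minus a_minus_def)

end

lemma lmodI: "left_module e M \<Longrightarrow> lmod e M"
  unfolding lmod_def lmod_axioms_def by (simp add: left_module_def)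

lemma lmod_left_module: "lmod e M \<Longrightarrow> left_module e M"
  unfolding lmod_def lmod_axioms_def by simp

text \<open>Additive inverses come from the action of \<open>- 1\<close>, so the group axioms reduce
  to the condition on the action of 0.\<close>

lemma lmod_intro:
  assumes "\<And>x y. x \<in> carrier M \<Longrightarrow> y \<in> carrier M \<Longrightarrow> x \<oplus>\<^bsub>M\<^esub> y \<in> carrier M"
    and "\<zero>\<^bsub>M\<^esub> \<in> carrier M"
    and "\<And>x y z. x \<in> carrier M \<Longrightarrow> y \<in> carrier M \<Longrightarrow> z \<in> carrier M \<Longrightarrow> (x \<oplus>\<^bsub>M\<^esub> y) \<oplus>\<^bsub>M\<^esub> z = x \<oplus>\<^bsub>M\<^esub> (y \<oplus>\<^bsub>M\<^esub> z)"
    and "\<And>x y. x \<in> carrier M \<Longrightarrow> y \<in> carrier M \<Longrightarrow> x \<oplus>\<^bsub>M\<^esub> y = y \<oplus>\<^bsub>M\<^esub> x"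
    and z: "\<And>x. x \<in> carrier M \<Longrightarrow> \<zero>\<^bsub>M\<^esub> \<oplus>\<^bsub>M\<^esub> x = x"
    and z': "\<And>x. x \<in> carrier M \<Longrightarrow> 0 \<odot>\<^bsub>M\<^esub> x = \<zero>\<^bsub>M\<^esub>"
    and c: "\<And>a x. x \<in> carrier M \<Longrightarrow> a \<odot>\<^bsub>M\<^esub> x \<in> carrier M"
    and l: "\<And>a c x. x \<in> carrier M \<Longrightarrow> (a + c) \<odot>\<^bsub>M\<^esub> x = a \<odot>\<^bsub>M\<^esub> x \<oplus>\<^bsub>M\<^esub> c \<odot>\<^bsub>M\<^esub> x"
    and r: "\<And>a x y. x \<in> carrier M \<Longrightarrow> y \<in> carrier M \<Longrightarrow> a \<odot>\<^bsub>M\<^esub> (x \<oplus>\<^bsub>M\<^esub> y) = a \<odot>\<^bsub>M\<^esub> x \<oplus>\<^bsub>M\<^esub> a \<odot>\<^bsub>M\<^esub> y"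
    and a: "\<And>a c x. x \<in> carrier M \<Longrightarrow> (a * c) \<odot>\<^bsub>M\<^esub> x = a \<odot>\<^bsub>M\<^esub> (c \<odot>\<^bsub>M\<^esub> x)"
    and e: "\<And>x. x \<in> carrier M \<Longrightarrow> e \<odot>\<^bsub>M\<^esub> x = x"
  shows "lmod e M"
proof (rule lmodI)
  have "abelian_group M"
  proof (rule abelian_groupI)
    fix x assume x: "x \<in> carrier M"
    have one: "1 \<odot>\<^bsub>M\<^esub> x = x" using a[OF x, of 1 e] e x by simp
    have "(- 1) \<odot>\<^bsub>M\<^esub> x \<oplus>\<^bsub>M\<^esub> x = \<zero>\<^bsub>M\<^esub>" using l[OF x, of "- 1" 1] z'[OF x] one by simp
    thus "\<exists>y\<in>carrier M. y \<oplus>\<^bsub>M\<^esub> x = \<zero>\<^bsub>M\<^esub>" using c[OF x] by blast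
  qed (use assms in blast)+
  thus "left_module e M" unfolding left_module_def using c l r a e by blast
qed

lemma left_homD:
  assumes "left_hom M N f"
  shows "x \<in> carrier M \<Longrightarrow> f x \<in> carrier N"
    and "x \<in> carrier M \<Longrightarrow> y \<in> carrier M \<Longrightarrow> f (x \<oplus>\<^bsub>M\<^esub> y) = f x \<oplus>\<^bsub>N\<^esub> f y"
    and "x \<in> carrier M \<Longrightarrow> f (a \<odot>\<^bsub>M\<^esub> x) = a \<odot>\<^bsub>N\<^esub> f x"
  using assms unfolding left_hom_def by blast+

lemma left_homI:
  assumes "\<And>x. x \<in> carrier M \<Longrightarrow> f x \<in> carrier N"
    and "\<And>x y. x \<in> carrier M \<Longrightarrow> y \<in> carrier M \<Longrightarrow> f (x \<oplus>\<^bsub>M\<^esub> y) = f x \<oplus>\<^bsub>N\<^esub> f y"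
    and "\<And>a x. x \<in> carrier M \<Longrightarrow> f (a \<odot>\<^bsub>M\<^esub> x) = a \<odot>\<^bsub>N\<^esub> f x"
  shows "left_hom M N f"
  using assms unfolding left_hom_def by blast

lemma left_hom_comp:
  assumes "left_hom M N f" "left_hom N P g" shows "left_hom M P (\<lambda>x. g (f x))"
  using left_homD[OF assms(1)] left_homD[OF assms(2)] by (intro left_homI) simp_all

lemma left_hom_zero:
  assumes "lmod e M" "lmod e' N" "left_hom M N f" shows "f \<zero>\<^bsub>M\<^esub> = \<zero>\<^bsub>N\<^esub>"
proof -
  interpret M: lmod e M by fact
  interpret N: lmod e' N by fact
  have "f (0 \<odot>\<^bsub>M\<^esub> \<zero>\<^bsub>M\<^esub>) = 0 \<odot>\<^bsub>N\<^esub> f \<zero>\<^bsub>M\<^esub>" using left_homD(3)[OF assms(3)] by blast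
  thus ?thesis using N.smult_0 left_homD(1)[OF assms(3)] by (simp add: M.smult_0)
qed

lemma left_hom_diff:
  assumes "lmod e M" "lmod e' N" "left_hom M N f" "x \<in> carrier M" "y \<in> carrier M"
  shows "f (x \<ominus>\<^bsub>M\<^esub> y) = f x \<ominus>\<^bsub>N\<^esub> f y"
proof -
  interpret M: lmod e M by fact
  interpret N: lmod e' N by fact
  show ?thesis using left_homD[OF assms(3)] assms(4,5) by (simp add: M.diff_smult N.diff_smult)
qed

text \<open>Closure of \<open>M\<close> is what turns the inverse bijection into a homomorphism. In
  this form the lemma applies to \<open>tensor M N\<close>, where \<open>tensor_closed\<close>
  provides just that.\<close>

lemma left_iso_obtain:
  assumes "left_iso M N" "\<And>x y. x \<in> carrier M \<Longrightarrow> y \<in> carrier M \<Longrightarrow> x \<oplus>\<^bsub>M\<^esub> y \<in> carrier M"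
    "\<And>a x. x \<in> carrier M \<Longrightarrow> a \<odot>\<^bsub>M\<^esub> x \<in> carrier M"
  obtains f g where "left_hom M N f" "left_hom N M g" "\<And>x. x \<in> carrier M \<Longrightarrow> g (f x) = x"
    "\<And>y. y \<in> carrier N \<Longrightarrow> f (g y) = y"
proof -
  obtain f where f: "left_hom M N f" "bij_betw f (carrier M) (carrier N)"
    using assms(1) unfolding left_iso_def by blast
  define g where "g = inv_into (carrier M) f"
  have gf: "g (f x) = x" if "x \<in> carrier M" for x using f(2) that by (simp add: g_def bij_betw_inv_into_left)
  have fg: "f (g y) = y" "g y \<in> carrier M" if "y \<in> carrier N" for y
    using f(2) that by (auto simp: g_def bij_betw_inv_into_right bij_betw_def inv_into_into)
  have "left_hom N M g"
  proof (rule left_homI)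
    fix x y assume xy: "x \<in> carrier N" "y \<in> carrier N"
    have "f (g x \<oplus>\<^bsub>M\<^esub> g y) = x \<oplus>\<^bsub>N\<^esub> y" using left_homD(2)[OF f(1)] fg xy by simp
    thus "g (x \<oplus>\<^bsub>N\<^esub> y) = g x \<oplus>\<^bsub>M\<^esub> g y" using gf[OF assms(2)[OF fg(2)[OF xy(1)] fg(2)[OF xy(2)]]] by simp
  next
    fix a x assume x: "x \<in> carrier N"
    have "f (a \<odot>\<^bsub>M\<^esub> g x) = a \<odot>\<^bsub>N\<^esub> x" using left_homD(3)[OF f(1)] fg x by simp
    thus "g (a \<odot>\<^bsub>N\<^esub> x) = a \<odot>\<^bsub>M\<^esub> g x" using gf[OF assms(3)[OF fg(2)[OF x], of a]] by simp
  qed (use fg in simp)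
  thus ?thesis using that f gf fg by blast
qed

lemma left_isoI:
  assumes "left_hom M N f" "\<And>y. y \<in> carrier N \<Longrightarrow> g y \<in> carrier M" "\<And>x. x \<in> carrier M \<Longrightarrow> g (f x) = x"
    "\<And>y. y \<in> carrier N \<Longrightarrow> f (g y) = y"
  shows "left_iso M N"
  unfolding left_iso_def
  using assms left_homD(1)[OF assms(1)] by (intro exI[of _ f] conjI bij_betwI[of f _ _ g]) auto

lemma left_iso_trans: "left_iso M N \<Longrightarrow> left_iso N P \<Longrightarrow> left_iso M P"
proof -
  assume "left_iso M N" "left_iso N P"
  then obtain f g where f: "left_hom M N f" "bij_betw f (carrier M) (carrier N)"
    and g: "left_hom N P g" "bij_betw g (carrier N) (carrier P)" unfolding left_iso_def by blast
  have "left_hom M P (g \<circ> f)" using left_hom_comp[OF f(1) g(1)] by (simp add: comp_def)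
  thus ?thesis using bij_betw_trans[OF f(2) g(2)] unfolding left_iso_def by blast
qed

lemma left_iso_refl: "left_iso M M"
  unfolding left_iso_def left_hom_def by (intro exI[of _ "\<lambda>x. x"]) (auto simp: bij_betw_def)

lemma left_iso_sym:
  assumes "lmod e M" "left_iso M N" shows "left_iso N M"
proof -
  interpret M: lmod e M by fact
  show ?thesis
  proof (rule left_iso_obtain[OF assms(2)])
    fix f g assume f: "left_hom M N f" and g: "left_hom N M g"
      and gf: "\<And>x. x \<in> carrier M \<Longrightarrow> g (f x) = x" and fg: "\<And>y. y \<in> carrier N \<Longrightarrow> f (g y) = y"
    show ?thesis by (rule left_isoI[OF g left_homD(1)[OF f] fg gf])
  qed auto
qed

lemma left_ideal_simps [simp]:
  "carrier (left_ideal u) = {x * u | x. True}" "add (left_ideal u) = (+)"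
  "zero (left_ideal u) = 0" "module.smult (left_ideal u) = (*)"
  by (simp_all add: left_ideal_def)

lemma left_ideal_mem:
  assumes "u * u = u" shows "x \<in> carrier (left_ideal u) \<longleftrightarrow> x * u = x"
  using assms by (auto simp: mult.assoc) metis

lemma lmod_left_ideal:
  assumes "\<And>x. e * (x * u) = x * u" shows "lmod e (left_ideal u)"
proof (rule lmod_intro)
  show "\<And>x y. x \<in> carrier (left_ideal u) \<Longrightarrow> y \<in> carrier (left_ideal u) \<Longrightarrow> x \<oplus>\<^bsub>left_ideal u\<^esub> y \<in> carrier (left_ideal u)"
    by (auto simp flip: distrib_right)
  show "\<zero>\<^bsub>left_ideal u\<^esub> \<in> carrier (left_ideal u)" by (auto intro: exI[of _ 0])
  show "\<And>a x. x \<in> carrier (left_ideal u) \<Longrightarrow> a \<odot>\<^bsub>left_ideal u\<^esub> x \<in> carrier (left_ideal u)"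
    by (auto simp flip: mult.assoc)
qed (use assms in \<open>auto simp: algebra_simps\<close>)

lemma lmod_left_ideal_1: "lmod 1 (left_ideal u)" by (rule lmod_left_ideal) simp

section \<open>Coordinates in direct sums\<close>

lemma direct_sum_simps:
  "carrier (direct_sum n M) = (\<Pi>\<^sub>E i\<in>{..<n}. carrier (M i))"
  "zero (direct_sum n M) = (\<lambda>i\<in>{..<n}. \<zero>\<^bsub>M i\<^esub>)"
  "add (direct_sum n M) = (\<lambda>v w. \<lambda>i\<in>{..<n}. v i \<oplus>\<^bsub>M i\<^esub> w i)"
  "module.smult (direct_sum n M) = (\<lambda>a v. \<lambda>i\<in>{..<n}. a \<odot>\<^bsub>M i\<^esub> v i)"
  by (simp_all add: direct_sum_def)

lemma lmod_direct_sum: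
  assumes "\<And>i. i < n \<Longrightarrow> lmod e (M i)" shows "lmod e (direct_sum n M)"
proof -
  have ab: "abelian_group (M i)" if "i < n" for i using assms[OF that] unfolding lmod_def by blast
  note a = abelian_group.axioms(1)[OF ab]
  note simps = direct_sum_simps PiE_iff extensional_def restrict_def fun_eq_iff
  show ?thesis
  proof (rule lmod_intro)
    show "\<And>x y. x \<in> carrier (direct_sum n M) \<Longrightarrow> y \<in> carrier (direct_sum n M) \<Longrightarrow> x \<oplus>\<^bsub>direct_sum n M\<^esub> y \<in> carrier (direct_sum n M)"
      by (simp add: simps abelian_monoid.a_closed[OF a])
    show "\<And>x y. x \<in> carrier (direct_sum n M) \<Longrightarrow> y \<in> carrier (direct_sum n M) \<Longrightarrow> x \<oplus>\<^bsub>direct_sum n M\<^esub> y = y \<oplus>\<^bsub>direct_sum n M\<^esub> x"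
      using abelian_monoid.a_comm[OF a] by (simp add: simps)
  qed (simp_all add: simps abelian_monoid.zero_closed[OF a] abelian_monoid.a_assoc[OF a]
      abelian_monoid.l_zero[OF a] lmod.smult_closed[OF assms]
        lmod.smult_l[OF assms] lmod.smult_r[OF assms] lmod.smult_assoc[OF assms] lmod.smult_e[OF assms]
        lmod.smult_0[OF assms])
qed

definition inj_sum :: "nat \<Rightarrow> (nat \<Rightarrow> ('r, 'm) module) \<Rightarrow> nat \<Rightarrow> 'm \<Rightarrow> nat \<Rightarrow> 'm" where
  "inj_sum n M j z = (\<lambda>i\<in>{..<n}. if i = j then z else \<zero>\<^bsub>M i\<^esub>)"

text \<open>The partial sums of the coordinates of \<open>v\<close>: a substitute for finite sums in
  a module, built up by one \<open>inj_sum\<close> at a time.\<close>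

definition trunc_sum :: "nat \<Rightarrow> (nat \<Rightarrow> ('r, 'm) module) \<Rightarrow> nat \<Rightarrow> (nat \<Rightarrow> 'm) \<Rightarrow> nat \<Rightarrow> 'm" where
  "trunc_sum n M j v = (\<lambda>i\<in>{..<n}. if i < j then v i else \<zero>\<^bsub>M i\<^esub>)"

lemma left_hom_inj_sum:
  assumes "\<And>i. i < n \<Longrightarrow> lmod e (M i)" "j < n"
  shows "left_hom (M j) (direct_sum n M) (inj_sum n M j)"
proof -
  have ab: "abelian_group (M i)" if "i < n" for i using assms(1)[OF that] unfolding lmod_def by blast
  note a = abelian_group.axioms(1)[OF ab]
  show ?thesis
    by (rule left_homI) (auto simp: inj_sum_def direct_sum_simps fun_eq_iff assms(2)
        abelian_monoid.zero_closed[OF a] abelian_monoid.l_zero[OF a] lmod.smult_zero[OF assms(1)])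
qed

lemma trunc_sum_simps:
  assumes "\<And>i. i < n \<Longrightarrow> lmod e (M i)" "v \<in> carrier (direct_sum n M)"
  shows "trunc_sum n M 0 v = zero (direct_sum n M)"
    and "j < n \<Longrightarrow> trunc_sum n M (Suc j) v = trunc_sum n M j v \<oplus>\<^bsub>direct_sum n M\<^esub> inj_sum n M j (v j)"
    and "trunc_sum n M n v = v"
    and "trunc_sum n M j v \<in> carrier (direct_sum n M)"
proof -
  have ab: "abelian_group (M i)" if "i < n" for i using assms(1)[OF that] unfolding lmod_def by blast
  note a = abelian_group.axioms(1)[OF ab]
  have v: "v i \<in> carrier (M i)" if "i < n" for i using assms(2) that by (auto simp: direct_sum_simps)
  show "trunc_sum n M 0 v = zero (direct_sum n M)" by (simp add: trunc_sum_def direct_sum_simps)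
  show "trunc_sum n M (Suc j) v = trunc_sum n M j v \<oplus>\<^bsub>direct_sum n M\<^esub> inj_sum n M j (v j)" if "j < n"
    using that by (auto simp: trunc_sum_def inj_sum_def direct_sum_simps fun_eq_iff v less_Suc_eq
        abelian_monoid.zero_closed[OF a] abelian_monoid.l_zero[OF a] abelian_monoid.r_zero[OF a])
  show "trunc_sum n M n v = v" using assms(2)
    by (auto simp: trunc_sum_def direct_sum_simps fun_eq_iff PiE_iff extensional_def)
  show "trunc_sum n M j v \<in> carrier (direct_sum n M)"
    by (auto simp: trunc_sum_def direct_sum_simps v abelian_monoid.zero_closed[OF a])
qed

lemma hom_to_ring_expand:
  assumes M: "\<And>i. i < n \<Longrightarrow> lmod e (M i)" and v: "v \<in> carrier (direct_sum n M)"
    and h: "left_hom (direct_sum n M) (left_ideal u) h"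
  shows "h v = (\<Sum>j<n. h (inj_sum n M j (v j)))"
proof -
  note L = lmod_direct_sum[of n e M, OF M] 
  have "h (trunc_sum n M k v) = (\<Sum>j<k. h (inj_sum n M j (v j)))" if "k \<le> n" for k
    using that
  proof (induction k)
    case 0 show ?case
      using left_hom_zero[OF L lmod_left_ideal_1 h] trunc_sum_simps(1)[of n e M, OF M v] by simp
  next
    case (Suc k)
    have kn: "k < n" using Suc.prems by simp
    have vk: "v k \<in> carrier (M k)"
      by (rule PiE_mem[OF v[unfolded direct_sum_simps]]) (simp add: kn)
    have inj: "inj_sum n M k (v k) \<in> carrier (direct_sum n M)"
      by (rule left_homD(1)[OF left_hom_inj_sum[of n e M k, OF M kn] vk])
    have "h (trunc_sum n M (Suc k) v) = h (trunc_sum n M k v) + h (inj_sum n M k (v k))"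
      by (simp only: trunc_sum_simps(2)[of n e M v k, OF M v kn]
          left_homD(2)[OF h trunc_sum_simps(4)[of n e M v k, OF M v] inj] left_ideal_simps)
    thus ?case using Suc by simp
  qed
  from this[of n] show ?thesis using trunc_sum_simps(3)[of n e M v, OF M v] by (simp only: le_refl)
qed

text \<open>\<open>M\<close> is the direct sum of the image of \<open>\<beta>\<close> and the kernel
  of \<open>\<gamma>\<close>. The image is not zero as \<open>u\<close> is not, so the kernel
  is.\<close>

lemma summand_iso:
  assumes M: "lmod e M" "indecomposable M" and u: "u * u = u" "u \<noteq> 0"
    and b: "left_hom (left_ideal u) M \<beta>" and g: "left_hom M (left_ideal u) \<gamma>"
    and gb: "\<And>z. z \<in> carrier (left_ideal u) \<Longrightarrow> \<gamma> (\<beta> z) = z"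
  shows "left_iso M (left_ideal u)"
proof -
  interpret M: lmod e M by fact
  note bD = left_homD[OF b] and gD = left_homD[OF g]
  let ?U = "left_ideal u"
  have b0: "\<beta> 0 = \<zero>\<^bsub>M\<^esub>" and g0: "\<gamma> \<zero>\<^bsub>M\<^esub> = 0"
    using left_hom_zero[OF lmod_left_ideal_1 M(1) b] left_hom_zero[OF M(1) lmod_left_ideal_1 g] by simp_all
  define X where "X = \<beta> ` carrier ?U"
  define Y where "Y = {x \<in> carrier M. \<gamma> x = 0}"
  interpret U: lmod 1 ?U by (rule lmod_left_ideal_1)
  have sX: "left_submodule M X" unfolding left_submodule_def X_def
  proof (intro conjI ballI allI)
    show "\<beta> ` carrier ?U \<subseteq> carrier M" using bD(1) by blast
    show "\<zero>\<^bsub>M\<^esub> \<in> \<beta> ` carrier ?U" using b0 U.zero_closed by (metis image_eqI left_ideal_simps(3))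
    fix x assume "x \<in> \<beta> ` carrier ?U"
    then obtain z where z: "z \<in> carrier ?U" "x = \<beta> z" by blast
    show "a \<odot>\<^bsub>M\<^esub> x \<in> \<beta> ` carrier ?U" for a using bD(3)[OF z(1), of a] z U.smult_closed[OF z(1), of a] by (metis image_eqI)
    fix y assume "y \<in> \<beta> ` carrier ?U"
    then obtain w where w: "w \<in> carrier ?U" "y = \<beta> w" by blast
    show "x \<oplus>\<^bsub>M\<^esub> y \<in> \<beta> ` carrier ?U" using bD(2)[OF z(1) w(1)] z w U.a_closed[OF z(1) w(1)] by (metis image_eqI)
  qed
  have sY: "left_submodule M Y" unfolding left_submodule_def Y_def using gD g0 by auto
  have XY: "X \<inter> Y = {\<zero>\<^bsub>M\<^esub>}"
  proof
    show "X \<inter> Y \<subseteq> {\<zero>\<^bsub>M\<^esub>}"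
    proof
      fix x assume "x \<in> X \<inter> Y"
      then obtain z where "z \<in> carrier ?U" "x = \<beta> z" "\<gamma> x = 0" unfolding X_def Y_def by blast
      thus "x \<in> {\<zero>\<^bsub>M\<^esub>}" using gb b0 by force
    qed
    show "{\<zero>\<^bsub>M\<^esub>} \<subseteq> X \<inter> Y" using sX sY unfolding left_submodule_def by blast
  qed
  have "carrier M = {x \<oplus>\<^bsub>M\<^esub> y | x y. x \<in> X \<and> y \<in> Y}"
  proof
    show "carrier M \<subseteq> {x \<oplus>\<^bsub>M\<^esub> y | x y. x \<in> X \<and> y \<in> Y}"
    proof
      fix x assume x: "x \<in> carrier M"
      let ?x = "\<beta> (\<gamma> x)"
      have xM: "?x \<in> carrier M" using x bD gD by blast
      have "x = ?x \<oplus>\<^bsub>M\<^esub> (x \<ominus>\<^bsub>M\<^esub> ?x)" using x xM by (simp add: a_minus_def M.a_lcomm M.r_neg)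
      moreover have "\<gamma> (x \<ominus>\<^bsub>M\<^esub> ?x) = 0"
        using left_hom_diff[OF M(1) lmod_left_ideal_1 g x xM] gb[OF gD(1)[OF x]] gD(1)[OF x] U.r_neg by (simp add: a_minus_def)
      moreover have "?x \<in> X" unfolding X_def using gD(1)[OF x] by blast
      moreover have "x \<ominus>\<^bsub>M\<^esub> ?x \<in> carrier M" using x xM by simp
      ultimately show "x \<in> {x \<oplus>\<^bsub>M\<^esub> y | x y. x \<in> X \<and> y \<in> Y}" unfolding Y_def by blast
    qed
    show "{x \<oplus>\<^bsub>M\<^esub> y | x y. x \<in> X \<and> y \<in> Y} \<subseteq> carrier M"
      using sX sY unfolding left_submodule_def by blast
  qed
  hence "X = {\<zero>\<^bsub>M\<^esub>} \<or> Y = {\<zero>\<^bsub>M\<^esub>}" using M(2) sX sY XY unfolding indecomposable_def by blast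
  moreover have "X \<noteq> {\<zero>\<^bsub>M\<^esub>}"
  proof
    assume "X = {\<zero>\<^bsub>M\<^esub>}"
    have "u \<in> carrier ?U" using u by (simp add: left_ideal_mem[OF u(1)] del: left_ideal_simps)
    hence "\<beta> u = \<zero>\<^bsub>M\<^esub>" "\<gamma> (\<beta> u) = u" using \<open>X = {\<zero>\<^bsub>M\<^esub>}\<close> gb unfolding X_def by blast+
    thus False using g0 u by simp
  qed
  ultimately have Y: "Y = {\<zero>\<^bsub>M\<^esub>}" by blast
  have bg: "\<beta> (\<gamma> x) = x" if x: "x \<in> carrier M" for x
  proof -
    have xM: "\<beta> (\<gamma> x) \<in> carrier M" using x bD gD by blast
    have "\<gamma> (x \<ominus>\<^bsub>M\<^esub> \<beta> (\<gamma> x)) = 0"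
      using left_hom_diff[OF M(1) lmod_left_ideal_1 g x xM] gb[OF gD(1)[OF x]] gD(1)[OF x] U.r_neg by (simp add: a_minus_def)
    hence "x \<ominus>\<^bsub>M\<^esub> \<beta> (\<gamma> x) \<in> Y" unfolding Y_def using x xM by simp
    hence "x \<ominus>\<^bsub>M\<^esub> \<beta> (\<gamma> x) = \<zero>\<^bsub>M\<^esub>" using Y by blast
    moreover have "x = (x \<ominus>\<^bsub>M\<^esub> \<beta> (\<gamma> x)) \<oplus>\<^bsub>M\<^esub> \<beta> (\<gamma> x)"
      using x xM by (simp add: a_minus_def M.a_assoc M.l_neg)
    ultimately show ?thesis using xM by simp
  qed
  show ?thesis by (rule left_isoI[OF g bD(1) bg gb])
qed

text \<open>An element fixed by \<open>u\<close> is a homomorphism from \<open>left_ideal u\<close>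
  to \<open>M\<close>; composed with \<open>\<alpha>\<close> it becomes an endomorphism of
  \<open>left_ideal u\<close>, that is, an element of the corner.\<close>

lemma hom_from_ideal_corner:
  assumes u: "u * u = u" and a: "left_hom M (left_ideal u) \<alpha>" and m: "m \<in> carrier M" "u \<odot>\<^bsub>M\<^esub> m = m"
  shows "\<alpha> m \<in> corner u"
proof -
  have "\<alpha> m * u = \<alpha> m" using left_homD(1)[OF a m(1)] left_ideal_mem[OF u] by blast
  moreover have "u * \<alpha> m = \<alpha> m" using left_homD(3)[OF a m(1), of u] m(2) by simp
  ultimately show ?thesis unfolding corner_def by simp
qed

lemma split_local_nonzero: "split_local l u \<Longrightarrow> u * u = u \<and> u \<noteq> 0 \<and> l 0 = 0 \<and> l u = 1"
proof -
  assume s: "split_local l u"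
  have "0 \<in> corner u" by (simp add: corner_def)
  hence "l (0 + 0) = l 0 + l 0" using s unfolding split_local_def by blast
  hence "l 0 + l 0 = l 0 + 0" by simp
  hence "l 0 = 0" by (simp only: add_left_cancel)
  thus ?thesis using s unfolding split_local_def by auto
qed

text \<open>The composite of \<open>\<beta>\<close> and \<open>\<alpha>\<close> is right
  multiplication by \<open>\<alpha> (\<beta> u)\<close>. A non-zero residue makes this a unit of the
  corner, and correcting \<open>\<alpha>\<close> by its inverse splits
  \<open>\<beta>\<close>.\<close>

lemma local_summand:
  assumes M: "lmod e M" "indecomposable M" and l: "split_local l u"
    and a: "left_hom M (left_ideal u) \<alpha>" and b: "left_hom (left_ideal u) M \<beta>"
    and nz: "l (\<alpha> (\<beta> u)) \<noteq> 0"
  shows "left_iso M (left_ideal u)"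
proof -
  have u: "u * u = u" "u \<noteq> 0" using split_local_nonzero[OF l] by auto
  have uU: "u \<in> carrier (left_ideal u)" using u left_ideal_mem by blast
  have bu: "u \<odot>\<^bsub>M\<^esub> \<beta> u = \<beta> u" using left_homD(3)[OF b uU, of u] u by simp
  have y: "\<alpha> (\<beta> u) \<in> corner u"
    by (rule hom_from_ideal_corner[OF u(1) a left_homD(1)[OF b uU] bu])
  obtain v where v: "v \<in> corner u" "\<alpha> (\<beta> u) * v = u" using l y nz unfolding split_local_def by blast
  have vu: "v * u = v" using v by (simp add: corner_def)
  have g: "left_hom M (left_ideal u) (\<lambda>x. \<alpha> x * v)"
  proof (rule left_homI)
    show "\<alpha> x * v \<in> carrier (left_ideal u)" for x
      using vu by (simp only: left_ideal_mem[OF u(1)] mult.assoc)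
  qed (use left_homD[OF a] in \<open>simp_all add: distrib_right mult.assoc del: left_ideal_simps(1)\<close>)
  show ?thesis
  proof (rule summand_iso[OF M u b g])
    fix z assume z: "z \<in> carrier (left_ideal u)"
    hence zu: "z * u = z" using left_ideal_mem[OF u(1)] by blast
    have "\<beta> (z * u) = z \<odot>\<^bsub>M\<^esub> \<beta> u" using left_homD(3)[OF b uU, of z] by simp
    hence "\<alpha> (\<beta> z) = z * \<alpha> (\<beta> u)" using left_homD(3)[OF a left_homD(1)[OF b uU], of z] zu by simp
    thus "\<alpha> (\<beta> z) * v = z" using v zu by (simp add: mult.assoc)
  qed
qed

text \<open>Padded with zeros, \<open>Z\<close> and \<open>Y\<close> become square matrices with
  product 1. The product in the other order is then 1 as well, although the padding puts a zero on
  its diagonal if \<open>B\<close> is smaller than \<open>A\<close>.\<close>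

lemma orthogonal_systems_card:
  fixes Z :: "'a \<Rightarrow> 'b \<Rightarrow> 'f::field" and Y :: "'b \<Rightarrow> 'a \<Rightarrow> 'f"
  assumes fin: "finite A" "finite B"
    and ZY: "\<And>a b. a \<in> A \<Longrightarrow> b \<in> A \<Longrightarrow> (\<Sum>j\<in>B. Z a j * Y j b) = (if a = b then 1 else 0)"
  shows "card A \<le> card B"
proof (rule ccontr)
  assume "\<not> ?thesis"
  hence lt: "card B < card A" by simp
  define n where "n = card A"
  obtain f where f: "bij_betw f {..<n} A" using ex_bij_betw_nat_finite[OF fin(1)] by (auto simp: n_def lessThan_atLeast0)
  obtain g where g: "bij_betw g {..<card B} B" using ex_bij_betw_nat_finite[OF fin(2)] by (auto simp: lessThan_atLeast0)
  define P where "P = mat n n (\<lambda>(i, j). if j < card B then Z (f i) (g j) else 0)"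
  define Q where "Q = mat n n (\<lambda>(j, i). if j < card B then Y (g j) (f i) else 0)"
  have "P * Q = 1\<^sub>m n"
  proof (rule eq_matI)
    fix i k assume ik: "i < dim_row (1\<^sub>m n :: 'f mat)" "k < dim_col (1\<^sub>m n :: 'f mat)"
    hence A: "f i \<in> A" "f k \<in> A" using f by (auto simp: bij_betw_def)
    have "(P * Q) $$ (i, k) = (\<Sum>j<n. if j < card B then Z (f i) (g j) * Y (g j) (f k) else 0)"
      using ik unfolding P_def Q_def by (auto simp: scalar_prod_def lessThan_atLeast0 intro!: sum.cong)
    also have "\<dots> = (\<Sum>j<card B. Z (f i) (g j) * Y (g j) (f k))"
    proof -
      have "{..<n} \<inter> {j. j < card B} = {..<card B}" using lt by (auto simp: n_def)
      thus ?thesis by (simp add: sum.If_cases)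
    qed
    also have "\<dots> = (\<Sum>j\<in>B. Z (f i) j * Y j (f k))" by (rule sum.reindex_bij_betw[OF g])
    also have "\<dots> = (if f i = f k then 1 else 0)" using ZY A by simp
    also have "f i = f k \<longleftrightarrow> i = k" using f ik by (auto simp: bij_betw_def inj_on_def)
    finally show "(P * Q) $$ (i, k) = 1\<^sub>m n $$ (i, k)" using ik by simp
  qed (simp_all add: P_def Q_def)
  hence "Q * P = 1\<^sub>m n" by (rule mat_mult_left_right_inverse[rotated 2]) (simp_all add: P_def Q_def)
  moreover have "(Q * P) $$ (card B, card B) = 0"
    using lt unfolding P_def Q_def n_def by (auto simp: scalar_prod_def intro!: sum.neutral)
  ultimately show False using lt by (simp add: n_def)
qed

lemma split_local_sum:
  assumes l: "split_local l u" and f: "\<And>i. i \<in> A \<Longrightarrow> f i \<in> corner u"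
  shows "l (sum f A) = (\<Sum>i\<in>A. l (f i))"
proof -
  have "sum f A \<in> corner u \<and> l (sum f A) = (\<Sum>i\<in>A. l (f i))"
    using f
  proof (induction A rule: infinite_finite_induct)
    case (insert i A)
    hence "f i \<in> corner u" "sum f A \<in> corner u" "l (sum f A) = (\<Sum>i\<in>A. l (f i))" by blast+
    thus ?case using insert(1,2) l corner_add unfolding split_local_def by auto
  qed (use split_local_nonzero[OF l] in \<open>auto simp: corner_def\<close>)
  thus ?thesis by blast
qed

text \<open>Composing the isomorphism with the projections to the summands isomorphic to \<open>left_ideal u\<close> and
  applying \<open>l\<close> gives two matrices over \<open>F\<close> whose product is an identity matrix.\<close>

theorem krull_schmidt_count:
  assumes N: "\<And>i. i < s \<Longrightarrow> lmod e (N i)" and N': "\<And>i. i < s' \<Longrightarrow> lmod e (N' i) \<and> indecomposable (N' i)"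
    and iso: "left_iso (direct_sum s N) (direct_sum s' N')" and l: "split_local l u"
  shows "card {i. i < s \<and> left_iso (N i) (left_ideal u)} \<le> card {i. i < s' \<and> left_iso (N' i) (left_ideal u)}"
proof -
  let ?D = "direct_sum s N" and ?D' = "direct_sum s' N'"
  let ?U = "left_ideal u"
  note N'1 = N'[THEN conjunct1]
  interpret D: lmod e ?D by (rule lmod_direct_sum[OF N])
  obtain \<Phi> \<Psi> where P: "left_hom ?D ?D' \<Phi>" "left_hom ?D' ?D \<Psi>" "\<And>x. x \<in> carrier ?D \<Longrightarrow> \<Psi> (\<Phi> x) = x"
    using left_iso_obtain[OF iso] D.a_closed D.smult_closed by metis
  have u: "u * u = u" "u \<noteq> 0" "l 0 = 0" "l u = 1" using split_local_nonzero[OF l] by auto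
  have uU: "u \<in> carrier ?U" using left_ideal_mem[OF u(1)] u(1) by blast
  define I where "I = {i. i < s \<and> left_iso (N i) ?U}"
  define I' where "I' = {i. i < s' \<and> left_iso (N' i) ?U}"
  have "\<forall>i\<in>I. \<exists>\<theta> \<kappa>. left_hom ?U (N i) \<theta> \<and> left_hom (N i) ?U \<kappa> \<and> (\<forall>z\<in>carrier ?U. \<kappa> (\<theta> z) = z)"
  proof
    fix i assume "i \<in> I"
    hence i: "lmod e (N i)" "left_iso (N i) ?U" using N unfolding I_def by auto
    interpret M: lmod e "N i" by (rule i)
    show "\<exists>\<theta> \<kappa>. left_hom ?U (N i) \<theta> \<and> left_hom (N i) ?U \<kappa> \<and> (\<forall>z\<in>carrier ?U. \<kappa> (\<theta> z) = z)"
      by (rule left_iso_obtain[OF i(2)]) (auto simp del: left_ideal_simps)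
  qed
  then obtain \<theta> \<kappa> where tk: "\<And>i. i \<in> I \<Longrightarrow> left_hom ?U (N i) (\<theta> i)" "\<And>i. i \<in> I \<Longrightarrow> left_hom (N i) ?U (\<kappa> i)"
    "\<And>i z. i \<in> I \<Longrightarrow> z \<in> carrier ?U \<Longrightarrow> \<kappa> i (\<theta> i z) = z"
    by (metis (no_types, lifting))
  have "\<forall>i\<in>I'. \<exists>\<theta> \<kappa>. left_hom ?U (N' i) \<theta> \<and> left_hom (N' i) ?U \<kappa> \<and> (\<forall>x\<in>carrier (N' i). \<theta> (\<kappa> x) = x)"
  proof
    fix i assume "i \<in> I'"
    hence i: "lmod e (N' i)" "left_iso (N' i) ?U" using N' unfolding I'_def by auto
    interpret M: lmod e "N' i" by (rule i)
    show "\<exists>\<theta> \<kappa>. left_hom ?U (N' i) \<theta> \<and> left_hom (N' i) ?U \<kappa> \<and> (\<forall>x\<in>carrier (N' i). \<theta> (\<kappa> x) = x)"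
      by (rule left_iso_obtain[OF i(2)]) (auto simp del: left_ideal_simps)
  qed
  then obtain \<theta>' \<kappa>' where tk': "\<And>i. i \<in> I' \<Longrightarrow> left_hom ?U (N' i) (\<theta>' i)" "\<And>i. i \<in> I' \<Longrightarrow> left_hom (N' i) ?U (\<kappa>' i)"
    "\<And>i z. i \<in> I' \<Longrightarrow> z \<in> carrier (N' i) \<Longrightarrow> \<theta>' i (\<kappa>' i z) = z"
    by (metis (no_types, lifting))
  have IN: "i < s" if "i \<in> I" for i using that by (simp add: I_def)
  \<comment> \<open>\<open>w a\<close> is the generator of the \<open>a\<close>-th summand moved to
    the other decomposition, and \<open>\<phi> b\<close> leads back to the \<open>b\<close>-th
    summand. Inserting the coordinates of the second decomposition between them gives the matrix
    product.\<close>
  define w where "w a = \<Phi> (inj_sum s N a (\<theta> a u))" for a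
  define \<phi> where "\<phi> b v = \<kappa> b (\<Psi> v b)" for b v
  have tu: "\<theta> a u \<in> carrier (N a)" "u \<odot>\<^bsub>N a\<^esub> \<theta> a u = \<theta> a u" if "a \<in> I" for a
    using left_homD(1)[OF tk(1)[OF that] uU] left_homD(3)[OF tk(1)[OF that] uU, of u] u by simp_all
  have inj: "left_hom (N a) ?D (inj_sum s N a)" if "a < s" for a by (rule left_hom_inj_sum[OF N that])
  have inj': "left_hom (N' a) ?D' (inj_sum s' N' a)" if "a < s'" for a by (rule left_hom_inj_sum[OF N'1 that])
  have wD: "w a \<in> carrier ?D'" "u \<odot>\<^bsub>?D'\<^esub> w a = w a" if a: "a \<in> I" for a
  proof -
    have 1: "inj_sum s N a (\<theta> a u) \<in> carrier ?D" by (rule left_homD(1)[OF inj[OF IN[OF a]] tu(1)[OF a]])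
    show "w a \<in> carrier ?D'" unfolding w_def by (rule left_homD(1)[OF P(1) 1])
    have "u \<odot>\<^bsub>?D\<^esub> inj_sum s N a (\<theta> a u) = inj_sum s N a (\<theta> a u)"
      using left_homD(3)[OF inj[OF IN[OF a]] tu(1)[OF a], of u] tu(2)[OF a] by simp
    thus "u \<odot>\<^bsub>?D'\<^esub> w a = w a" unfolding w_def using left_homD(3)[OF P(1) 1, of u] by simp
  qed
  have waj: "w a j \<in> carrier (N' j)" "u \<odot>\<^bsub>N' j\<^esub> w a j = w a j" if "a \<in> I" "j < s'" for a j
  proof -
    show "w a j \<in> carrier (N' j)"
      by (rule PiE_mem[OF wD(1)[OF that(1), unfolded direct_sum_simps]]) (use that in simp)
    show "u \<odot>\<^bsub>N' j\<^esub> w a j = w a j"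
      using fun_cong[OF wD(2)[OF that(1)], of j] that(2) by (simp add: direct_sum_simps)
  qed
  have phi: "left_hom ?D' ?U (\<phi> b)" if b: "b \<in> I" for b
  proof -
    have proj: "left_hom ?D (N b) (\<lambda>v. v b)"
      by (rule left_homI) (use IN[OF b] in \<open>auto simp: direct_sum_simps\<close>)
    show ?thesis unfolding \<phi>_def by (rule left_hom_comp[OF left_hom_comp[OF P(2) proj] tk(2)[OF b]])
  qed
  have phiw: "\<phi> b (w a) = (if a = b then u else 0)" if ab: "a \<in> I" "b \<in> I" for a b
  proof -
    have 1: "inj_sum s N a (\<theta> a u) \<in> carrier ?D" by (rule left_homD(1)[OF inj[OF IN[OF ab(1)]] tu(1)[OF ab(1)]])
    have "\<phi> b (w a) = \<kappa> b (inj_sum s N a (\<theta> a u) b)" unfolding \<phi>_def w_def P(3)[OF 1] ..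
    also have "\<dots> = (if a = b then u else 0)"
      using IN[OF ab(2)] tk(3)[OF ab(1) uU] left_hom_zero[OF N[OF IN[OF ab(2)]] lmod_left_ideal_1 tk(2)[OF ab(2)]]
      by (auto simp: inj_sum_def)
    finally show ?thesis .
  qed
  define Z where "Z a j = l (\<kappa>' j (w a j))" for a j
  define Y where "Y j b = l (\<phi> b (inj_sum s' N' j (\<theta>' j u)))" for j b
  have phij: "left_hom (N' j) ?U (\<lambda>x. \<phi> b (inj_sum s' N' j x))" if "b \<in> I" "j < s'" for b j
    by (rule left_hom_comp[OF inj'[OF that(2)] phi[OF that(1)]])
  have cor: "\<phi> b (inj_sum s' N' j (w a j)) \<in> corner u" if "a \<in> I" "b \<in> I" "j < s'" for a b j
    by (rule hom_from_ideal_corner[OF u(1) phij[OF that(2,3)] waj[OF that(1,3)]])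
  have term_in: "l (\<phi> b (inj_sum s' N' j (w a j))) = Z a j * Y j b" if ab: "a \<in> I" "b \<in> I" and j: "j \<in> I'" for a b j
  proof -
    have js: "j < s'" using j by (simp add: I'_def)
    have t: "\<theta>' j u \<in> carrier (N' j)" "u \<odot>\<^bsub>N' j\<^esub> \<theta>' j u = \<theta>' j u"
      using left_homD(1)[OF tk'(1)[OF j] uU] left_homD(3)[OF tk'(1)[OF j] uU, of u] u by simp_all
    have z: "\<kappa>' j (w a j) \<in> corner u"
      by (rule hom_from_ideal_corner[OF u(1) tk'(2)[OF j] waj[OF ab(1) js]])
    have y: "\<phi> b (inj_sum s' N' j (\<theta>' j u)) \<in> corner u"
      by (rule hom_from_ideal_corner[OF u(1) phij[OF ab(2) js] t])
    have "w a j = \<theta>' j (\<kappa>' j (w a j) * u)" using tk'(3)[OF j waj(1)[OF ab(1) js]] z by (simp add: corner_def)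
    also have "\<dots> = \<kappa>' j (w a j) \<odot>\<^bsub>N' j\<^esub> \<theta>' j u" using left_homD(3)[OF tk'(1)[OF j] uU, of "\<kappa>' j (w a j)"] by simp
    finally have "\<phi> b (inj_sum s' N' j (w a j)) = \<kappa>' j (w a j) * \<phi> b (inj_sum s' N' j (\<theta>' j u))"
      using left_homD(3)[OF phij[OF ab(2) js] t(1), of "\<kappa>' j (w a j)"] by simp
    thus ?thesis using l y z unfolding Z_def Y_def split_local_def by simp
  qed
  \<comment> \<open>A non-zero residue would make \<open>N' j\<close> isomorphic to
    \<open>left_ideal u\<close> by \<open>local_summand\<close>, so only the indices in
    \<open>I'\<close> contribute.\<close>
  have term_out: "l (\<phi> b (inj_sum s' N' j (w a j))) = 0" if ab: "a \<in> I" "b \<in> I" and j: "j < s'" "j \<notin> I'" for a b j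
  proof (rule ccontr)
    assume nz: "l (\<phi> b (inj_sum s' N' j (w a j))) \<noteq> 0"
    interpret M: lmod e "N' j" by (rule N'1[OF j(1)])
    have b: "left_hom ?U (N' j) (\<lambda>z. z \<odot>\<^bsub>N' j\<^esub> w a j)"
      by (rule left_homI) (use waj[OF ab(1) j(1)] in \<open>auto simp: M.smult_l M.smult_assoc\<close>)
    have "left_iso (N' j) ?U"
      using local_summand[OF N'1[OF j(1)] N'[THEN conjunct2, OF j(1)] l phij[OF ab(2) j(1)] b] nz waj(2)[OF ab(1) j(1)] by simp
    thus False using j by (simp add: I'_def)
  qed
  have "card I \<le> card I'"
  proof (rule orthogonal_systems_card)
    show "finite I" "finite I'" by (simp_all add: I_def I'_def)
    fix a b assume ab: "a \<in> I" "b \<in> I"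
    have "\<phi> b (w a) = (\<Sum>j<s'. \<phi> b (inj_sum s' N' j (w a j)))"
      by (rule hom_to_ring_expand[OF N'1 wD(1)[OF ab(1)] phi[OF ab(2)]])
    hence "l (\<phi> b (w a)) = (\<Sum>j<s'. l (\<phi> b (inj_sum s' N' j (w a j))))"
      using split_local_sum[OF l, of "{..<s'}" "\<lambda>j. \<phi> b (inj_sum s' N' j (w a j))"] cor[OF ab] by simp
    also have "\<dots> = (\<Sum>j\<in>I'. l (\<phi> b (inj_sum s' N' j (w a j))))"
      using term_out[OF ab] by (intro sum.mono_neutral_right) (auto simp: I'_def)
    also have "\<dots> = (\<Sum>j\<in>I'. Z a j * Y j b)" using term_in[OF ab] by simp
    finally show "(\<Sum>j\<in>I'. Z a j * Y j b) = (if a = b then 1 else 0)"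
      using phiw[OF ab] u by (simp split: if_splits)
  qed
  thus ?thesis unfolding I_def I'_def .
qed

section \<open>Indecomposable projective modules\<close>

text \<open>The Jacobson radical of the endomorphism ring.\<close>

definition radical_endo :: "('r, 'm) module \<Rightarrow> ('m \<Rightarrow> 'm) \<Rightarrow> bool" where
  "radical_endo M f \<longleftrightarrow> left_hom M M f \<and>
     (\<forall>g. left_hom M M g \<longrightarrow> (\<exists>h. left_hom M M h \<and> (\<forall>x\<in>carrier M. h (x \<ominus>\<^bsub>M\<^esub> g (f x)) = x)))"

lemma radical_endo_cong:
  assumes M: "lmod e M" and f: "radical_endo M f" "\<And>x. x \<in> carrier M \<Longrightarrow> f' x = f x"
  shows "radical_endo M f'"
proof -
  interpret M: lmod e M by fact
  have "left_hom M M f'" using f left_homD[of M M f] unfolding radical_endo_def by (intro left_homI) auto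
  thus ?thesis using f unfolding radical_endo_def by auto
qed

lemma radical_endo_zero:
  assumes M: "lmod e M" shows "radical_endo M (\<lambda>_. \<zero>\<^bsub>M\<^esub>)"
proof -
  interpret M: lmod e M by fact
  have "x \<ominus>\<^bsub>M\<^esub> g \<zero>\<^bsub>M\<^esub> = x" if "left_hom M M g" "x \<in> carrier M" for g x
    using left_hom_zero[OF M M that(1)] that(2) by (simp add: a_minus_def)
  moreover have "left_hom M M (\<lambda>x. x)" by (simp add: left_hom_def)
  ultimately show ?thesis unfolding radical_endo_def
    by (auto simp: left_hom_def M.smult_zero intro!: exI[of _ "\<lambda>x. x"])
qed

text \<open>If \<open>h1\<close> is a left inverse of \<open>1 - g f1\<close> and \<open>h2\<close>
  one of \<open>1 - h1 g f2\<close>, then \<open>h2 h1\<close> is one of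
  \<open>1 - g (f1 + f2)\<close>.\<close>

lemma radical_endo_add:
  assumes M: "lmod e M" and f: "radical_endo M f1" "radical_endo M f2"
  shows "radical_endo M (\<lambda>x. f1 x \<oplus>\<^bsub>M\<^esub> f2 x)"
  unfolding radical_endo_def
proof (intro conjI allI impI)
  interpret M: lmod e M by fact
  have h: "left_hom M M f1" "left_hom M M f2" using f unfolding radical_endo_def by auto
  note D1 = left_homD[OF h(1)] and D2 = left_homD[OF h(2)]
  show "left_hom M M (\<lambda>x. f1 x \<oplus>\<^bsub>M\<^esub> f2 x)"
    by (rule left_homI) (simp_all add: D1 D2 M.smult_r M.a_ac)
  fix g assume g: "left_hom M M g"
  obtain h1 where h1: "left_hom M M h1" "\<And>x. x \<in> carrier M \<Longrightarrow> h1 (x \<ominus>\<^bsub>M\<^esub> g (f1 x)) = x"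
    using f(1) g unfolding radical_endo_def by blast
  obtain h2 where h2: "left_hom M M h2" "\<And>x. x \<in> carrier M \<Longrightarrow> h2 (x \<ominus>\<^bsub>M\<^esub> h1 (g (f2 x))) = x"
    using f(2) left_hom_comp[OF g h1(1)] unfolding radical_endo_def by blast
  have "h2 (h1 (x \<ominus>\<^bsub>M\<^esub> g (f1 x \<oplus>\<^bsub>M\<^esub> f2 x))) = x" if x: "x \<in> carrier M" for x
  proof -
    have c: "f1 x \<in> carrier M" "f2 x \<in> carrier M" "g (f1 x) \<in> carrier M" "g (f2 x) \<in> carrier M"
      using D1 D2 left_homD(1)[OF g] x by auto
    have "x \<ominus>\<^bsub>M\<^esub> g (f1 x \<oplus>\<^bsub>M\<^esub> f2 x) = (x \<ominus>\<^bsub>M\<^esub> g (f1 x)) \<ominus>\<^bsub>M\<^esub> g (f2 x)"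
      using x c left_homD(2)[OF g c(1,2)] by (simp add: a_minus_def M.minus_add M.a_assoc)
    moreover have "x \<ominus>\<^bsub>M\<^esub> g (f1 x) \<in> carrier M" using x c by simp
    ultimately have "h1 (x \<ominus>\<^bsub>M\<^esub> g (f1 x \<oplus>\<^bsub>M\<^esub> f2 x)) = x \<ominus>\<^bsub>M\<^esub> h1 (g (f2 x))"
      using left_hom_diff[OF M M h1(1) _ c(4)] h1(2)[OF x] by simp
    thus ?thesis using h2(2)[OF x] by simp
  qed
  thus "\<exists>h. left_hom M M h \<and> (\<forall>x\<in>carrier M. h (x \<ominus>\<^bsub>M\<^esub> g (f1 x \<oplus>\<^bsub>M\<^esub> f2 x)) = x)"
    using left_hom_comp[OF h1(1) h2(1)] by (intro exI[of _ "\<lambda>x. h2 (h1 x)"]) simp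
qed

text \<open>The composite of \<open>\<beta>\<close>, \<open>g\<close> and \<open>\<alpha>\<close> is
  right multiplication on \<open>left_ideal u\<close> by an element \<open>y\<close> of the corner.
  Its residue is 0, since otherwise \<open>local_summand\<close> would make \<open>M\<close>
  isomorphic to \<open>left_ideal u\<close>; hence \<open>u - y\<close> is a unit.\<close>

lemma radical_endo_factor:
  assumes M: "lmod e M" "indecomposable M" and l: "split_local l u" and ni: "\<not> left_iso M (left_ideal u)"
    and a: "left_hom M (left_ideal u) \<alpha>" and b: "left_hom (left_ideal u) M \<beta>"
  shows "radical_endo M (\<lambda>x. \<beta> (\<alpha> x))"
  unfolding radical_endo_def
proof (intro conjI allI impI)
  interpret M: lmod e M by fact
  let ?U = "left_ideal u"
  show "left_hom M M (\<lambda>x. \<beta> (\<alpha> x))" by (rule left_hom_comp[OF a b])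
  fix g assume g: "left_hom M M g"
  have u: "u * u = u" "l u = 1" using split_local_nonzero[OF l] by auto
  have uU: "u \<in> carrier ?U" using left_ideal_mem[OF u(1)] u(1) by blast
  have gb: "left_hom ?U M (\<lambda>z. g (\<beta> z))" by (rule left_hom_comp[OF b g])
  note gbD = left_homD[OF gb] and aD = left_homD[OF a]
  define m where "m = g (\<beta> u)"
  have m: "m \<in> carrier M" "u \<odot>\<^bsub>M\<^esub> m = m" using gbD(1)[OF uU] gbD(3)[OF uU, of u] u by (simp_all add: m_def)
  have gz: "g (\<beta> z) = z \<odot>\<^bsub>M\<^esub> m" if "z \<in> carrier ?U" for z
  proof -
    have "z * u = z" using that left_ideal_mem[OF u(1)] by blast
    thus ?thesis using gbD(3)[OF uU, of z] by (simp add: m_def)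
  qed
  define y where "y = \<alpha> m"
  have y: "y \<in> corner u" unfolding y_def by (rule hom_from_ideal_corner[OF u(1) a m])
  have "l y = 0"
    using local_summand[OF M l a gb] ni unfolding y_def m_def by blast
  moreover have uy: "u - y \<in> corner u" "u \<in> corner u" using y u(1) corner_diff by (auto simp: corner_def algebra_simps)
  moreover have "l ((u - y) + y) = l (u - y) + l y" using l uy y unfolding split_local_def by blast
  ultimately have "l (u - y) = 1" using u(2) by simp
  then obtain v where v: "v \<in> corner u" "(u - y) * v = u" using l uy unfolding split_local_def by force
  have vu: "v * u = v" "u * v = v" using v by (auto simp: corner_def)
  have yv: "y * v = v - u" using v(2) vu by (simp add: algebra_simps)
  \<comment> \<open>An instance of \<open>(1 - s t)^(-1) = 1 + s (1 - t s)^(-1) t\<close> with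
    \<open>s = g \<beta>\<close> and \<open>t = \<alpha>\<close>; \<open>v\<close> inverts
    \<open>u - y\<close>.\<close>
  define h where "h x = x \<oplus>\<^bsub>M\<^esub> (\<alpha> x * v) \<odot>\<^bsub>M\<^esub> m" for x
  have "left_hom M M h" unfolding h_def
    by (rule left_homI)
      (use aD m in \<open>simp_all add: M.smult_r distrib_right M.smult_l M.smult_assoc M.a_ac del: left_ideal_simps(1)\<close>)
  moreover have "h (x \<ominus>\<^bsub>M\<^esub> g (\<beta> (\<alpha> x))) = x" if x: "x \<in> carrier M" for x
  proof -
    have ax: "\<alpha> x \<in> carrier ?U" "\<alpha> x * u = \<alpha> x" using aD(1)[OF x] left_ideal_mem[OF u(1)] by blast+
    let ?t = "\<alpha> x \<odot>\<^bsub>M\<^esub> m"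
    have t: "?t \<in> carrier M" using m by blast
    have "\<alpha> (x \<ominus>\<^bsub>M\<^esub> ?t) = \<alpha> x - \<alpha> x * y"
      using aD(2)[OF x M.smult_closed[OF t, of "- 1"]] aD(3)[OF t, of "- 1"] aD(3)[OF m(1), of "\<alpha> x"]
      by (simp add: M.diff_smult x t y_def)
    hence "\<alpha> (x \<ominus>\<^bsub>M\<^esub> ?t) * v = \<alpha> x"
      using ax(2) by (simp add: left_diff_distrib mult.assoc yv right_diff_distrib)
    hence "h (x \<ominus>\<^bsub>M\<^esub> ?t) = (x \<ominus>\<^bsub>M\<^esub> ?t) \<oplus>\<^bsub>M\<^esub> ?t" unfolding h_def by simp
    also have "\<dots> = x" using x t by (simp add: a_minus_def M.a_assoc M.l_neg)
    finally show ?thesis using gz[OF ax(1)] by simp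
  qed
  ultimately show "\<exists>h. left_hom M M h \<and> (\<forall>x\<in>carrier M. h (x \<ominus>\<^bsub>M\<^esub> g (\<beta> (\<alpha> x))) = x)" by blast
qed

text \<open>If \<open>M\<close> were isomorphic to no \<open>left_ideal (u k)\<close>, then the identity of \<open>M\<close>, which factors through
  a free module, would be a sum of radical endomorphisms.\<close>

theorem indec_projective_classify:
  assumes P: "indec_projective e M" and e: "e * e = e" "\<And>x. e * x = x * e"
    and u: "(\<Sum>k<N. u k) = (1 :: 'r::ring_1)" "\<And>k. k < N \<Longrightarrow> split_local (l k) (u k)"
  shows "\<exists>k<(N::nat). left_iso M (left_ideal (u k))"
proof (rule ccontr)
  assume ni: "\<not> ?thesis"
  have M: "lmod e M" "indecomposable M" using P lmodI unfolding indec_projective_def projective_def by auto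
  interpret M: lmod e M by (rule M)
  let ?E = "\<lambda>_ :: nat. left_ideal e"
  obtain n i q where iq: "left_hom M (direct_sum n ?E) i" "left_hom (direct_sum n ?E) M q"
    "\<And>x. x \<in> carrier M \<Longrightarrow> q (i x) = x"
    using P unfolding indec_projective_def projective_def by blast
  have E: "lmod e (left_ideal e)" by (rule lmod_left_ideal) (metis e mult.assoc)
  let ?D = "direct_sum n ?E"
  have D: "lmod e ?D" by (rule lmod_direct_sum) (rule E)
  note iD = left_homD[OF iq(1)] and qD = left_homD[OF iq(2)]
  have proj: "left_hom M (left_ideal e) (\<lambda>x. i x j)" if "j < n" for j
  proof -
    have "left_hom ?D (left_ideal e) (\<lambda>v. v j)"
      by (rule left_homI) (use that in \<open>auto simp: direct_sum_simps simp del: left_ideal_simps(1)\<close>)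
    thus ?thesis by (rule left_hom_comp[OF iq(1)])
  qed
  have inj: "left_hom (left_ideal e) ?D (inj_sum n ?E j)" if "j < n" for j by (rule left_hom_inj_sum[OF E that])
  \<comment> \<open>The identity of \<open>M\<close> is cut into one piece for each coordinate
    \<open>j\<close> of the free module and each \<open>u k\<close>; such a piece factors through
    \<open>left_ideal (u k)\<close>. The pieces are added up in \<open>partial\<close> over
    \<open>k\<close> and in \<open>trunc\<close> over \<open>j\<close>.\<close>
  have piece: "radical_endo M (\<lambda>x. q (inj_sum n ?E j (i x j * u k * e)))" if j: "j < n" and k: "k < N" for j k
  proof -
    have a: "left_hom M (left_ideal (u k)) (\<lambda>x. i x j * u k)"
      by (rule left_homI) (use left_homD[OF proj[OF j]] in \<open>auto simp: distrib_right mult.assoc\<close>)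
    have "left_hom (left_ideal (u k)) (left_ideal e) (\<lambda>z. z * e)"
      by (rule left_homI) (auto simp: distrib_right mult.assoc)
    hence b: "left_hom (left_ideal (u k)) M (\<lambda>z. q (inj_sum n ?E j (z * e)))"
      by (rule left_hom_comp[OF left_hom_comp[OF _ inj[OF j]] iq(2)])
    show ?thesis using radical_endo_factor[OF M u(2)[OF k] _ a b] ni k by blast
  qed
  have partial: "radical_endo M (\<lambda>x. q (inj_sum n ?E j (i x j * (\<Sum>k<K. u k) * e)))" if j: "j < n" and "K \<le> N" for j K
    using that(2)
  proof (induction K)
    case 0
    have "inj_sum n ?E j 0 = zero ?D" using left_hom_zero[OF E D inj[OF j]] by simp
    hence "q (inj_sum n ?E j 0) = \<zero>\<^bsub>M\<^esub>" using left_hom_zero[OF D M(1) iq(2)] by simp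
    thus ?case using radical_endo_zero[OF M(1)] by simp
  next
    case (Suc K)
    show ?case
    proof (rule radical_endo_cong[OF M(1) radical_endo_add[OF M(1) Suc.IH piece[OF j, of K]]])
      fix x assume x: "x \<in> carrier M"
      let ?a = "i x j * (\<Sum>k<K. u k) * e" and ?b = "i x j * u K * e"
      have ab: "?a \<in> carrier (left_ideal e)" "?b \<in> carrier (left_ideal e)" by auto
      have "inj_sum n ?E j (?a + ?b) = inj_sum n ?E j ?a \<oplus>\<^bsub>?D\<^esub> inj_sum n ?E j ?b"
        using left_homD(2)[OF inj[OF j] ab] by simp
      moreover have "i x j * (\<Sum>k<Suc K. u k) * e = ?a + ?b" by (simp add: algebra_simps)
      ultimately show "q (inj_sum n ?E j (i x j * (\<Sum>k<Suc K. u k) * e)) = q (inj_sum n ?E j ?a) \<oplus>\<^bsub>M\<^esub> q (inj_sum n ?E j ?b)"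
        using qD(2) left_homD(1)[OF inj[OF j]] ab by simp
    qed (use Suc in auto)
  qed
  have comp: "radical_endo M (\<lambda>x. q (inj_sum n ?E j (i x j)))" if j: "j < n" for j
  proof (rule radical_endo_cong[OF M(1) partial[OF j le_refl]])
    fix x assume "x \<in> carrier M"
    hence "i x j * e = i x j" using left_homD(1)[OF proj[OF j]] left_ideal_mem[OF e(1)] by blast
    thus "q (inj_sum n ?E j (i x j)) = q (inj_sum n ?E j (i x j * (\<Sum>k<N. u k) * e))" by (simp add: u)
  qed
  have trunc: "radical_endo M (\<lambda>x. q (trunc_sum n ?E j (i x)))" if "j \<le> n" for j
    using that
  proof (induction j)
    case 0
    show ?case
    proof (rule radical_endo_cong[OF M(1) radical_endo_zero[OF M(1)]])
      fix x assume "x \<in> carrier M"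
      thus "q (trunc_sum n ?E 0 (i x)) = \<zero>\<^bsub>M\<^esub>"
        using trunc_sum_simps(1)[of n e ?E "i x", OF E] iD(1) left_hom_zero[OF D M(1) iq(2)] by simp
    qed
  next
    case (Suc j)
    hence j: "j < n" by simp
    show ?case
    proof (rule radical_endo_cong[OF M(1) radical_endo_add[OF M(1) Suc.IH comp[OF j]]])
      fix x assume x: "x \<in> carrier M"
      have inj': "inj_sum n ?E j (i x j) \<in> carrier ?D"
        by (rule left_homD(1)[OF inj[OF j] left_homD(1)[OF proj[OF j] x]])
      show "q (trunc_sum n ?E (Suc j) (i x)) = q (trunc_sum n ?E j (i x)) \<oplus>\<^bsub>M\<^esub> q (inj_sum n ?E j (i x j))"
        unfolding trunc_sum_simps(2)[of n e ?E "i x" j, OF E iD(1)[OF x] j]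
        by (rule qD(2)[OF trunc_sum_simps(4)[of n e ?E "i x" j, OF E iD(1)[OF x]] inj'])
    qed (use j in simp)
  qed
  have "radical_endo M (\<lambda>x. x)"
  proof (rule radical_endo_cong[OF M(1) trunc[OF le_refl]])
    fix x assume x: "x \<in> carrier M"
    show "x = q (trunc_sum n ?E n (i x))"
      using trunc_sum_simps(3)[of n e ?E "i x", OF E iD(1)[OF x]] iq(3)[OF x] by simp
  qed
  moreover have "left_hom M M (\<lambda>x. x)" by (simp add: left_hom_def)
  \<comment> \<open>With \<open>g\<close> the identity as well, \<open>1 - 1 = 0\<close> would have
    a left inverse, which forces \<open>M\<close> to be zero.\<close>
  ultimately obtain h where h: "left_hom M M h" "\<And>x. x \<in> carrier M \<Longrightarrow> h (x \<ominus>\<^bsub>M\<^esub> x) = x"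
    unfolding radical_endo_def by blast
  have "x = \<zero>\<^bsub>M\<^esub>" if "x \<in> carrier M" for x
    using h(2)[OF that] left_hom_zero[OF M(1) M(1) h(1)] that by (simp add: a_minus_def M.r_neg)
  hence "carrier M = {\<zero>\<^bsub>M\<^esub>}" using M.zero_closed by blast
  thus False using M(2) unfolding indecomposable_def by blast
qed

section \<open>Transport along isomorphisms and isomorphism classes\<close>

lemma lmod_copy:
  fixes M :: "('r::ring_1, 'm) module" and h :: "'m \<Rightarrow> 'n"
  assumes M: "lmod e M" and h: "inj_on h (carrier M)"
  shows "\<exists>N :: ('r, 'n) module. lmod e N \<and> left_iso N M"
proof -
  interpret M: lmod e M by fact
  define g where "g = inv_into (carrier M) h"
  have gh: "g (h x) = x" if "x \<in> carrier M" for x using h that by (simp add: g_def)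
  define N :: "('r, 'n) module" where "N = \<lparr>carrier = h ` carrier M, monoid.mult = undefined, one = undefined,
      zero = h \<zero>\<^bsub>M\<^esub>, add = (\<lambda>x y. h (g x \<oplus>\<^bsub>M\<^esub> g y)), smult = (\<lambda>a x. h (a \<odot>\<^bsub>M\<^esub> g x))\<rparr>"
  have N: "carrier N = h ` carrier M" "\<zero>\<^bsub>N\<^esub> = h \<zero>\<^bsub>M\<^esub>" "x \<oplus>\<^bsub>N\<^esub> y = h (g x \<oplus>\<^bsub>M\<^esub> g y)"
    "a \<odot>\<^bsub>N\<^esub> x = h (a \<odot>\<^bsub>M\<^esub> g x)" for a x y by (simp_all add: N_def)
  have "lmod e N"
    by (rule lmod_intro)
      (auto simp: N gh M.a_ac M.smult_0 M.smult_l M.smult_r M.smult_assoc M.smult_e)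
  moreover have "left_iso N M"
    by (rule left_isoI[of _ _ g h]) (auto simp: N gh left_hom_def)
  ultimately show ?thesis by blast
qed

lemma indec_projective_iso:
  assumes N: "lmod e N" and iso: "left_iso N M" and P: "indec_projective e M"
  shows "indec_projective e N"
proof -
  interpret N: lmod e N by fact
  have M: "lmod e M" "indecomposable M" using P lmodI unfolding indec_projective_def projective_def by auto
  interpret M: lmod e M by (rule M)
  show ?thesis
  proof (rule left_iso_obtain[OF iso])
    fix f g assume f: "left_hom N M f" and g: "left_hom M N g"
      and gf: "\<And>x. x \<in> carrier N \<Longrightarrow> g (f x) = x" and fg: "\<And>y. y \<in> carrier M \<Longrightarrow> f (g y) = y"
    note fD = left_homD[OF f] and gD = left_homD[OF g]
    have f0: "f \<zero>\<^bsub>N\<^esub> = \<zero>\<^bsub>M\<^esub>" by (rule left_hom_zero[OF N M(1) f])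
    have g0: "g \<zero>\<^bsub>M\<^esub> = \<zero>\<^bsub>N\<^esub>" by (rule left_hom_zero[OF M(1) N g])
    obtain n i q where iq: "left_hom M (direct_sum n (\<lambda>_. left_ideal e)) i"
      "left_hom (direct_sum n (\<lambda>_. left_ideal e)) M q" "\<forall>x\<in>carrier M. q (i x) = x"
      using P unfolding indec_projective_def projective_def by blast
    have "projective e N"
      unfolding projective_def
    proof (intro conjI exI ballI)
      show "left_module e N" by (rule lmod_left_module[OF N])
      show "left_hom N (direct_sum n (\<lambda>_. left_ideal e)) (\<lambda>x. i (f x))" by (rule left_hom_comp[OF f iq(1)])
      show "left_hom (direct_sum n (\<lambda>_. left_ideal e)) N (\<lambda>v. g (q v))" by (rule left_hom_comp[OF iq(2) g])
      show "g (q (i (f x))) = x" if "x \<in> carrier N" for x using iq(3) fD(1) gf that by simp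
    qed
    moreover have "indecomposable N"
      unfolding indecomposable_def
    proof (intro conjI allI impI)
      show "carrier N \<noteq> {\<zero>\<^bsub>N\<^esub>}"
      proof
        assume c: "carrier N = {\<zero>\<^bsub>N\<^esub>}"
        have "y = \<zero>\<^bsub>M\<^esub>" if "y \<in> carrier M" for y using fg[OF that] gD(1)[OF that] c f0 by simp
        hence "carrier M = {\<zero>\<^bsub>M\<^esub>}" using M.zero_closed by blast
        thus False using M(2) unfolding indecomposable_def by blast
      qed
      fix X Y assume XY: "left_submodule N X \<and> left_submodule N Y \<and> X \<inter> Y = {\<zero>\<^bsub>N\<^esub>} \<and>
        carrier N = {x \<oplus>\<^bsub>N\<^esub> y | x y. x \<in> X \<and> y \<in> Y}"
      have sub: "left_submodule M (f ` X)" if "left_submodule N X" for X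
        unfolding left_submodule_def
      proof (intro conjI ballI allI)
        have X: "X \<subseteq> carrier N" "\<zero>\<^bsub>N\<^esub> \<in> X" "\<And>x y. x \<in> X \<Longrightarrow> y \<in> X \<Longrightarrow> x \<oplus>\<^bsub>N\<^esub> y \<in> X" "\<And>a x. x \<in> X \<Longrightarrow> a \<odot>\<^bsub>N\<^esub> x \<in> X"
          using that unfolding left_submodule_def by blast+
        show "f ` X \<subseteq> carrier M" using X(1) fD(1) by blast
        show "\<zero>\<^bsub>M\<^esub> \<in> f ` X" using X(2) f0 by (metis image_eqI)
        fix x assume "x \<in> f ` X"
        then obtain x' where x': "x' \<in> X" "x = f x'" by blast
        show "a \<odot>\<^bsub>M\<^esub> x \<in> f ` X" for a using X(1) X(4)[OF x'(1), of a] fD(3)[of x' a] x' by (metis image_eqI subsetD)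
        fix y assume "y \<in> f ` X"
        then obtain y' where y': "y' \<in> X" "y = f y'" by blast
        show "x \<oplus>\<^bsub>M\<^esub> y \<in> f ` X" using X(1) X(3)[OF x'(1) y'(1)] fD(2)[of x' y'] x' y' by (metis image_eqI subsetD)
      qed
      have XN: "X \<subseteq> carrier N" "Y \<subseteq> carrier N" and zXY: "\<zero>\<^bsub>N\<^esub> \<in> X" "\<zero>\<^bsub>N\<^esub> \<in> Y" using XY unfolding left_submodule_def by blast+
      have "f ` X \<inter> f ` Y = {\<zero>\<^bsub>M\<^esub>}"
      proof
        show "f ` X \<inter> f ` Y \<subseteq> {\<zero>\<^bsub>M\<^esub>}"
        proof
          fix z assume "z \<in> f ` X \<inter> f ` Y"
          then obtain x y where xy: "x \<in> X" "y \<in> Y" "z = f x" "z = f y" by blast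
          hence "g (f x) = g (f y)" by simp
          hence "x = y" using gf[of x] gf[of y] XN xy(1,2) by (metis subsetD)
          hence "x \<in> X \<inter> Y" using xy by blast
          hence "x = \<zero>\<^bsub>N\<^esub>" using XY by blast
          thus "z \<in> {\<zero>\<^bsub>M\<^esub>}" using f0 xy by simp
        qed
        show "{\<zero>\<^bsub>M\<^esub>} \<subseteq> f ` X \<inter> f ` Y" using zXY f0 by (metis Int_iff empty_subsetI image_eqI insert_subset)
      qed
      moreover have "carrier M = {x \<oplus>\<^bsub>M\<^esub> y | x y. x \<in> f ` X \<and> y \<in> f ` Y}"
      proof
        show "carrier M \<subseteq> {x \<oplus>\<^bsub>M\<^esub> y | x y. x \<in> f ` X \<and> y \<in> f ` Y}"
        proof
          fix z assume z: "z \<in> carrier M"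
          have "g z \<in> {x \<oplus>\<^bsub>N\<^esub> y | x y. x \<in> X \<and> y \<in> Y}" using gD(1)[OF z] XY by blast
          then obtain x y where xy: "x \<in> X" "y \<in> Y" "g z = x \<oplus>\<^bsub>N\<^esub> y" by blast
          have "x \<in> carrier N" "y \<in> carrier N" using xy XN by blast+
          hence "z = f x \<oplus>\<^bsub>M\<^esub> f y" using fg[OF z] xy(3) fD(2) by simp
          thus "z \<in> {x \<oplus>\<^bsub>M\<^esub> y | x y. x \<in> f ` X \<and> y \<in> f ` Y}" using xy by blast
        qed
        show "{x \<oplus>\<^bsub>M\<^esub> y | x y. x \<in> f ` X \<and> y \<in> f ` Y} \<subseteq> carrier M" using XN fD(1) by blast
      qed
      ultimately have "f ` X = {\<zero>\<^bsub>M\<^esub>} \<or> f ` Y = {\<zero>\<^bsub>M\<^esub>}"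
        using M(2) sub XY unfolding indecomposable_def by blast
      moreover have "X' = {\<zero>\<^bsub>N\<^esub>}" if "f ` X' = {\<zero>\<^bsub>M\<^esub>}" "X' \<subseteq> carrier N" for X'
      proof -
        have "x = \<zero>\<^bsub>N\<^esub>" if x: "x \<in> X'" for x
        proof -
          have "f x = \<zero>\<^bsub>M\<^esub>" using x \<open>f ` X' = {\<zero>\<^bsub>M\<^esub>}\<close> by blast
          thus ?thesis using gf[of x] g0 x \<open>X' \<subseteq> carrier N\<close> by auto
        qed
        moreover have "X' \<noteq> {}" using that by auto
        ultimately show ?thesis by blast
      qed
      ultimately show "X = {\<zero>\<^bsub>N\<^esub>} \<or> Y = {\<zero>\<^bsub>N\<^esub>}" using XN by blast
    qed
    ultimately show ?thesis unfolding indec_projective_def by blast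
  qed auto
qed

text \<open>\<open>e u = u\<close> makes \<open>left_ideal u\<close> a summand of
  \<open>left_ideal e\<close>. A decomposition into submodules would write \<open>u\<close> as a sum
  of two orthogonal idempotents of the corner, and a local ring has no non-trivial ones.\<close>

lemma indec_projective_left_ideal:
  assumes e: "e * e = e" "\<And>x. e * x = x * e" and u: "e * u = u" and l: "split_local l u"
  shows "indec_projective e (left_ideal u)"
proof -
  have uu: "u * u = u" "u \<noteq> 0" using split_local_nonzero[OF l] by auto
  have mem: "x \<in> carrier (left_ideal u) \<longleftrightarrow> x * u = x" for x by (rule left_ideal_mem[OF uu(1)])
  have ue: "u * e = u" using e(2)[of u] u by simp
  have U: "lmod e (left_ideal u)" by (rule lmod_left_ideal) (metis e(2) mult.assoc ue)
  have E: "lmod e (left_ideal e)" by (rule lmod_left_ideal) (metis e mult.assoc)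
  let ?E = "\<lambda>_ :: nat. left_ideal e"
  let ?D = "direct_sum 1 ?E"
  have inc: "left_hom (left_ideal u) (left_ideal e) (\<lambda>x. x)"
  proof (rule left_homI)
    fix x assume "x \<in> carrier (left_ideal u)"
    hence "x * u = x" using mem by blast
    hence "x * e = x" using ue by (metis mult.assoc)
    thus "x \<in> carrier (left_ideal e)" using left_ideal_mem[OF e(1)] by blast
  qed simp_all
  have "projective e (left_ideal u)"
    unfolding projective_def
  proof (intro conjI exI ballI)
    show "left_module e (left_ideal u)" by (rule lmod_left_module[OF U])
    show "left_hom (left_ideal u) ?D (\<lambda>x. inj_sum 1 ?E 0 x)"
      by (rule left_hom_comp[OF inc left_hom_inj_sum[OF E]]) simp
    show "left_hom ?D (left_ideal u) (\<lambda>v. v 0 * u)"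
      by (rule left_homI) (auto simp: direct_sum_simps distrib_right mult.assoc)
    show "inj_sum 1 ?E 0 x 0 * u = x" if "x \<in> carrier (left_ideal u)" for x
      using that mem by (simp add: inj_sum_def del: left_ideal_simps(1))
  qed
  moreover have "indecomposable (left_ideal u)"
    unfolding indecomposable_def
  proof (intro conjI allI impI)
    show "carrier (left_ideal u) \<noteq> {\<zero>\<^bsub>left_ideal u\<^esub>}"
      using mem[of u] uu by (auto simp del: left_ideal_simps(1))
    fix X Y assume "left_submodule (left_ideal u) X \<and> left_submodule (left_ideal u) Y \<and>
        X \<inter> Y = {\<zero>\<^bsub>left_ideal u\<^esub>} \<and> carrier (left_ideal u) = {x \<oplus>\<^bsub>left_ideal u\<^esub> y | x y. x \<in> X \<and> y \<in> Y}"
    hence X: "X \<subseteq> carrier (left_ideal u)" "\<And>x y. x \<in> X \<Longrightarrow> y \<in> X \<Longrightarrow> x + y \<in> X" "\<And>a x. x \<in> X \<Longrightarrow> a * x \<in> X"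
      and Y: "Y \<subseteq> carrier (left_ideal u)" "\<And>x y. x \<in> Y \<Longrightarrow> y \<in> Y \<Longrightarrow> x + y \<in> Y" "\<And>a x. x \<in> Y \<Longrightarrow> a * x \<in> Y"
      and XY: "X \<inter> Y = {0}" and sum: "carrier (left_ideal u) = {x + y | x y. x \<in> X \<and> y \<in> Y}"
      unfolding left_submodule_def by (auto simp del: left_ideal_simps(1))
    have "u \<in> {x + y | x y. x \<in> X \<and> y \<in> Y}" using mem[of u] uu sum by blast
    then obtain x y where xy: "x \<in> X" "y \<in> Y" "u = x + y" by blast
    have xu: "x * u = x" using X(1) xy(1) mem by blast
    have neg: "w \<in> X \<Longrightarrow> - w \<in> X" "w \<in> Y \<Longrightarrow> - w \<in> Y" for w using X(3)[of w "- 1"] Y(3)[of w "- 1"] by simp_all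
    have "x = x * x + x * y" using xu xy(3) by (simp only: distrib_left[symmetric])
    hence "x - x * x = x * y" by (metis add_diff_cancel_left')
    moreover have "x - x * x \<in> X" using X(2)[OF xy(1) neg(1)[OF X(3)[OF xy(1), of x]]] by simp
    moreover have "x * y \<in> Y" by (rule Y(3)[OF xy(2)])
    ultimately have "x - x * x \<in> X \<inter> Y" by simp
    hence xx: "x * x = x" using XY by simp
    have "u * x + u * y = u * (x + y)" by (rule distrib_left[symmetric])
    also have "\<dots> = x + y" by (simp only: xy(3)[symmetric] uu(1))
    finally have "u * x - x = y - u * y" by (simp add: algebra_simps)
    moreover have "u * x - x \<in> X" using X(2)[OF X(3)[OF xy(1), of u] neg(1)[OF xy(1)]] by simp
    moreover have "y - u * y \<in> Y" using Y(2)[OF xy(2) neg(2)[OF Y(3)[OF xy(2), of u]]] by simp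
    ultimately have "u * x - x \<in> X \<inter> Y" by simp
    hence ux: "u * x = x" using XY by simp
    have xc: "x \<in> corner u" "u - x \<in> corner u" "u \<in> corner u" using xu ux uu by (auto simp: corner_def algebra_simps)
    have "l ((u - x) + x) = l (u - x) + l x" using l xc unfolding split_local_def by blast
    hence lux: "l (u - x) = 1 - l x" using split_local_nonzero[OF l] by (simp add: eq_diff_eq)
    \<comment> \<open>The residues of \<open>x\<close> and \<open>u - x\<close> add up to 1, so one
      of the two is a unit of the corner; their product being 0, the other one vanishes.\<close>
    have zero: "z = 0" if z: "z \<in> corner u" "z * (u - z) = 0" "l (u - z) \<noteq> 0" "u - z \<in> corner u" for z
    proof -
      obtain v where "v \<in> corner u" "(u - z) * v = u" using l z unfolding split_local_def by blast
      hence "z = z * ((u - z) * v)" using z(1) by (simp add: corner_def)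
      also have "\<dots> = 0" using z(2) by (simp flip: mult.assoc)
      finally show ?thesis .
    qed
    have "x = 0 \<or> y = 0"
    proof (cases "l x = 0")
      case True
      moreover have "x * (u - x) = 0" by (simp only: right_diff_distrib xu xx) simp
      ultimately have "x = 0" using zero[of x] lux xc by simp
      thus ?thesis ..
    next
      case False
      have "u - (u - x) = x" by simp
      moreover have "(u - x) * x = 0" by (simp only: left_diff_distrib ux xx) simp
      ultimately have "u - x = 0" using zero[of "u - x"] xc False by simp
      thus ?thesis using xy(3) by simp
    qed
    thus "X = {\<zero>\<^bsub>left_ideal u\<^esub>} \<or> Y = {\<zero>\<^bsub>left_ideal u\<^esub>}"
    proof
      assume "x = 0"
      hence "w \<in> Y" if "w \<in> X" for w
        using that X(1) mem[of w] xy Y(3)[OF xy(2), of w] by auto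
      hence "X = {0}" using XY by blast
      thus ?thesis by simp
    next
      assume "y = 0"
      hence "w \<in> X" if "w \<in> Y" for w
        using that Y(1) mem[of w] xy X(3)[OF xy(1), of w] by auto
      hence "Y = {0}" using XY by blast
      thus ?thesis by simp
    qed
  qed
  ultimately show ?thesis unfolding indec_projective_def by blast
qed

text \<open>Isomorphism classes contain only modules on \<open>nat \<Rightarrow> 'f\<close>. An
  enumeration of the finite index set turns an element of the algebra into its sequence of
  coefficients.\<close>

lemma left_ideal_copy:
  fixes u :: "'x::{finite,monoid_add} \<Rightarrow>\<^sub>0 'f::field"
  assumes "lmod e (left_ideal u)"
  shows "\<exists>N :: ('x \<Rightarrow>\<^sub>0 'f, nat \<Rightarrow> 'f) module. lmod e N \<and> left_iso N (left_ideal u)"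
proof -
  obtain g :: "nat \<Rightarrow> 'x" where g: "bij_betw g {0..<card (UNIV :: 'x set)} UNIV"
    using ex_bij_betw_nat_finite[of "UNIV :: 'x set"] by auto
  have "inj_on (\<lambda>x n. Poly_Mapping.lookup x (g n)) (carrier (left_ideal u))"
  proof (rule inj_onI, rule poly_mapping_eqI)
    fix x y :: "'x \<Rightarrow>\<^sub>0 'f" and k
    assume eq: "(\<lambda>n. Poly_Mapping.lookup x (g n)) = (\<lambda>n. Poly_Mapping.lookup y (g n))"
    obtain n where "k = g n" using g by (auto simp: bij_betw_def)
    thus "Poly_Mapping.lookup x k = Poly_Mapping.lookup y k" using fun_cong[OF eq, of n] by simp
  qed
  thus ?thesis by (rule lmod_copy[OF assms])
qed

lemma iso_class_eq_iff:
  fixes M N :: "('x::monoid_add \<Rightarrow>\<^sub>0 'f::field, nat \<Rightarrow> 'f) module"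
  assumes "lmod e M" "lmod e N"
  shows "iso_class e M = iso_class e N \<longleftrightarrow> left_iso M N"
proof
  assume "iso_class e M = iso_class e N"
  moreover have "M \<in> iso_class e M" using assms lmod_left_module left_iso_refl unfolding iso_class_def by blast
  ultimately show "left_iso M N" unfolding iso_class_def by blast
next
  assume i: "left_iso M N"
  show "iso_class e M = iso_class e N"
    unfolding iso_class_def using left_iso_trans i left_iso_sym[OF assms(1) i] by blast
qed

text \<open>Used twice: for \<open>FG\<close> with the block idempotent, and for
  \<open>F[G \<times> G]\<close> with \<open>bi_idem b\<close>.\<close>

locale split_algebra =
  fixes e :: "'x::{finite,monoid_add} \<Rightarrow>\<^sub>0 'f::field" and K :: nat and u and l :: "nat \<Rightarrow> ('x \<Rightarrow>\<^sub>0 'f) \<Rightarrow> 'f"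
  assumes e: "e * e = e" "\<And>x. e * x = x * e"
    and u: "(\<Sum>k<K. u k) = 1" "\<And>k. k < K \<Longrightarrow> split_local (l k) (u k)"
begin

lemma classify: "indec_projective e M \<Longrightarrow> \<exists>k<K. left_iso M (left_ideal (u k))"
  by (rule indec_projective_classify[OF _ e u])

lemma indec_lmod: "indec_projective e M \<Longrightarrow> lmod e M \<and> indecomposable M"
  using lmodI unfolding indec_projective_def projective_def by blast

lemma class_count_le:
  fixes N N' :: "nat \<Rightarrow> ('x \<Rightarrow>\<^sub>0 'f, nat \<Rightarrow> 'f) module"
  assumes N: "\<And>i. i < s \<Longrightarrow> indec_projective e (N i)" and N': "\<And>i. i < s' \<Longrightarrow> indec_projective e (N' i)"
    and iso: "left_iso (direct_sum s N) (direct_sum s' N')"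
  shows "card {i. i < s \<and> iso_class e (N i) = P} \<le> card {i. i < s' \<and> iso_class e (N' i) = P}"
proof (cases "\<exists>i<s. iso_class e (N i) = P")
  case False
  hence "{i. i < s \<and> iso_class e (N i) = P} = {}" by blast
  thus ?thesis by (metis card.empty le0)
next
  case True
  then obtain i0 where i0: "i0 < s" "iso_class e (N i0) = P" by blast
  obtain k where k: "k < K" "left_iso (N i0) (left_ideal (u k))" using classify N i0 by blast
  have L0: "lmod e (N i0)" using indec_lmod N i0 by blast
  have *: "iso_class e Q = P \<longleftrightarrow> left_iso Q (left_ideal (u k))" if Q: "lmod e Q"
    for Q :: "('x \<Rightarrow>\<^sub>0 'f, nat \<Rightarrow> 'f) module"
    unfolding i0(2)[symmetric] iso_class_eq_iff[OF Q L0]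
    using left_iso_trans k(2) left_iso_trans[OF _ left_iso_sym[OF L0 k(2)]] by blast
  have "{i. i < s \<and> iso_class e (N i) = P} = {i. i < s \<and> left_iso (N i) (left_ideal (u k))}"
    using * indec_lmod N by blast
  moreover have "{i. i < s' \<and> iso_class e (N' i) = P} = {i. i < s' \<and> left_iso (N' i) (left_ideal (u k))}"
    using * indec_lmod N' by blast
  moreover have "card {i. i < s \<and> left_iso (N i) (left_ideal (u k))} \<le> card {i. i < s' \<and> left_iso (N' i) (left_ideal (u k))}"
    by (rule krull_schmidt_count[OF _ _ iso u(2)[OF k(1)]]) (use indec_lmod N N' in blast)+
  ultimately show ?thesis by simp
qed

text \<open>The definite description is unambiguous by Krull-Schmidt: two decompositions contain
  every class equally often, by \<open>class_count_le\<close> in both directions.\<close>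

theorem module_class_eqI:
  fixes N :: "nat \<Rightarrow> ('x \<Rightarrow>\<^sub>0 'f, nat \<Rightarrow> 'f) module"
  assumes N: "\<And>i. i < s \<Longrightarrow> indec_projective e (N i)" and iso: "left_iso M (direct_sum s N)"
    and closed: "\<And>x y. x \<in> carrier M \<Longrightarrow> y \<in> carrier M \<Longrightarrow> x \<oplus>\<^bsub>M\<^esub> y \<in> carrier M"
      "\<And>a x. x \<in> carrier M \<Longrightarrow> a \<odot>\<^bsub>M\<^esub> x \<in> carrier M"
  shows "module_class e M = (\<Sum>i<s. frag_of (iso_class e (N i)))"
  unfolding module_class_def
proof (rule the_equality)
  show "\<exists>t (N' :: nat \<Rightarrow> ('x \<Rightarrow>\<^sub>0 'f, nat \<Rightarrow> 'f) module).
        (\<forall>i<t. indec_projective e (N' i)) \<and> left_iso M (direct_sum t N') \<and>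
        (\<Sum>i<s. frag_of (iso_class e (N i))) = (\<Sum>i<t. frag_of (iso_class e (N' i)))"
    using N iso by blast
next
  have sym: "left_iso (direct_sum t N') M" if "left_iso M (direct_sum t N')" for t and N' :: "nat \<Rightarrow> ('x \<Rightarrow>\<^sub>0 'f, nat \<Rightarrow> 'f) module"
  proof (rule left_iso_obtain[OF that])
    fix f g assume f: "left_hom M (direct_sum t N') f" and g: "left_hom (direct_sum t N') M g"
      and gf: "\<And>x. x \<in> carrier M \<Longrightarrow> g (f x) = x" and fg: "\<And>y. y \<in> carrier (direct_sum t N') \<Longrightarrow> f (g y) = y"
    show "left_iso (direct_sum t N') M"
      by (rule left_isoI[where f = g and g = f]) (fact g left_homD(1)[OF f] fg gf)+
  qed (use closed in auto)
  fix c assume "\<exists>t (N' :: nat \<Rightarrow> ('x \<Rightarrow>\<^sub>0 'f, nat \<Rightarrow> 'f) module).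
        (\<forall>i<t. indec_projective e (N' i)) \<and> left_iso M (direct_sum t N') \<and>
        c = (\<Sum>i<t. frag_of (iso_class e (N' i)))"
  then obtain t and N' :: "nat \<Rightarrow> ('x \<Rightarrow>\<^sub>0 'f, nat \<Rightarrow> 'f) module" where
    N': "\<And>i. i < t \<Longrightarrow> indec_projective e (N' i)" "left_iso M (direct_sum t N')"
    "c = (\<Sum>i<t. frag_of (iso_class e (N' i)))" by blast
  have i1: "left_iso (direct_sum s N) (direct_sum t N')" by (rule left_iso_trans[OF sym[OF iso] N'(2)])
  have i2: "left_iso (direct_sum t N') (direct_sum s N)" by (rule left_iso_trans[OF sym[OF N'(2)] iso])
  have cnt: "Poly_Mapping.lookup (\<Sum>i<m. frag_of (iso_class e (Q i))) P = int (card {i. i < m \<and> iso_class e (Q i) = P})"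
    for m P and Q :: "nat \<Rightarrow> ('x \<Rightarrow>\<^sub>0 'f, nat \<Rightarrow> 'f) module"
  proof -
    have "Poly_Mapping.lookup (\<Sum>i<m. frag_of (iso_class e (Q i))) P = (\<Sum>i<m. if P = iso_class e (Q i) then 1 else 0)"
      by (simp add: lookup_sum)
    also have "\<dots> = int (card ({..<m} \<inter> {i. P = iso_class e (Q i)}))" by (simp add: sum.If_cases)
    also have "{..<m} \<inter> {i. P = iso_class e (Q i)} = {i. i < m \<and> iso_class e (Q i) = P}" by auto
    finally show ?thesis .
  qed
  show "c = (\<Sum>i<s. frag_of (iso_class e (N i)))"
  proof (rule poly_mapping_eqI)
    fix P
    have "card {i. i < s \<and> iso_class e (N i) = P} = card {i. i < t \<and> iso_class e (N' i) = P}"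
      using class_count_le[of s N t N' P, OF N N'(1) i1] class_count_le[of t N' s N P, OF N'(1) N i2] by linarith
    thus "Poly_Mapping.lookup c P = Poly_Mapping.lookup (\<Sum>i<s. frag_of (iso_class e (N i))) P"
      unfolding N'(3) cnt by simp
  qed
qed

end

section \<open>Tensor products over the group algebra\<close>

lemma additive_sum:
  assumes "\<And>x y. f (x + y) = f x + (f y :: 'b::ab_group_add)" shows "f (sum h A) = (\<Sum>i\<in>A. f (h i))"
proof -
  have "f (0 + 0) = f 0 + f 0" by (rule assms)
  hence "f 0 = 0" by simp
  thus ?thesis by (induction A rule: infinite_finite_induct) (simp_all add: assms)
qed

lemma additive_eqI:
  fixes f f' :: "('x::finite \<Rightarrow>\<^sub>0 'f::comm_monoid_add) \<Rightarrow> 'b::ab_group_add"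
  assumes "\<And>x y. f (x + y) = f x + f y" "\<And>x y. f' (x + y) = f' x + f' y"
    and "\<And>g c. f (Poly_Mapping.single g c) = f' (Poly_Mapping.single g c)"
  shows "f x = f' x"
  using additive_sum[of f, OF assms(1), of "\<lambda>g. Poly_Mapping.single g (Poly_Mapping.lookup x g)" UNIV]
    additive_sum[of f', OF assms(2), of "\<lambda>g. Poly_Mapping.single g (Poly_Mapping.lookup x g)" UNIV] assms(3)
  by (simp flip: poly_mapping_expand)

locale linear_functional =
  fixes \<psi> :: "('g::{finite,group_add} \<Rightarrow>\<^sub>0 'f::field) \<Rightarrow> 'f"
  assumes add: "\<psi> (v + w) = \<psi> v + \<psi> w" and scal: "\<psi> (scal c * v) = c * \<psi> v"
begin

lemma psi_single: "\<psi> (Poly_Mapping.single g c) = c * \<psi> (Poly_Mapping.single g 1)"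
  using scal[of c "Poly_Mapping.single g 1"] by (simp add: mult_single)

text \<open>The map of \<open>F[G \<times> G] \<otimes>\<^sub>F\<^sub>G F[G \<times> G]\<close> to \<open>F[G \<times> G]\<close> that
  applies \<open>\<psi>\<close> to the inner factors: if \<open>F[G \<times> G]\<close> is \<open>FG \<otimes> FG\<close>, then
  \<open>(a \<otimes> b) \<otimes> (c \<otimes> d) \<mapsto> \<psi>(b c) a \<otimes> d\<close>, see \<open>theta_pure\<close>.\<close>

definition theta :: "('g \<times> 'g \<Rightarrow>\<^sub>0 'f) \<Rightarrow> ('g \<times> 'g \<Rightarrow>\<^sub>0 'f) \<Rightarrow> ('g \<times> 'g \<Rightarrow>\<^sub>0 'f)" where
  "theta x y = (\<Sum>p\<in>UNIV. \<Sum>p'\<in>UNIV. Poly_Mapping.single (fst p, snd p')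
     (Poly_Mapping.lookup x p * Poly_Mapping.lookup y p' * \<psi> (Poly_Mapping.single (- snd p + fst p') 1)))"

lemma theta_add: "theta (x + x') y = theta x y + theta x' y" "theta x (y + y') = theta x y + theta x y'"
  by (simp_all add: theta_def lookup_add distrib_left distrib_right single_add sum.distrib)

lemma theta_single: "theta (Poly_Mapping.single (g, h) c) (Poly_Mapping.single (g', h') d) =
    Poly_Mapping.single (g, h') (c * d * \<psi> (Poly_Mapping.single (- h + g') 1))"
proof -
  let ?X = "Poly_Mapping.single (g, h) c" and ?Y = "Poly_Mapping.single (g', h') d"
  define V where "V p = Poly_Mapping.single (fst p, h') (Poly_Mapping.lookup ?X p * d *
    \<psi> (Poly_Mapping.single (- snd p + g') 1))" for p
  have "theta ?X ?Y = (\<Sum>p\<in>UNIV. \<Sum>p'\<in>UNIV. if p' = (g', h') then V p else 0)"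
    unfolding theta_def by (intro sum.cong refl) (auto simp: lookup_single V_def)
  also have "\<dots> = (\<Sum>p\<in>UNIV. V p)" by simp
  also have "\<dots> = (\<Sum>p\<in>UNIV. if p = (g, h) then Poly_Mapping.single (g, h')
    (c * d * \<psi> (Poly_Mapping.single (- h + g') 1)) else 0)"
    by (intro sum.cong refl) (auto simp: V_def lookup_single)
  finally show ?thesis by simp
qed

text \<open>\<open>tensor_act\<close> concerns the outer factors of a tensor, and these are left in
  place by \<open>theta\<close>.\<close>

lemma theta_act:
  "theta (Poly_Mapping.single (g, 0) c * x) (Poly_Mapping.single (0, h) 1 * y) = Poly_Mapping.single (g, h) c * theta x y"
proof -
  have "theta (Poly_Mapping.single (g, 0) c * Poly_Mapping.single p d) (Poly_Mapping.single (0, h) 1 * y) =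
        Poly_Mapping.single (g, h) c * theta (Poly_Mapping.single p d) y" for p d
  proof (rule additive_eqI[of _ _ y])
    fix p' d'
    show "theta (Poly_Mapping.single (g, 0) c * Poly_Mapping.single p d) (Poly_Mapping.single (0, h) 1 * Poly_Mapping.single p' d') =
          Poly_Mapping.single (g, h) c * theta (Poly_Mapping.single p d) (Poly_Mapping.single p' d')"
      by (cases p; cases p') (simp add: mult_single theta_single mult.assoc)
  qed (simp_all add: distrib_left theta_add)
  thus ?thesis by (intro additive_eqI[of "\<lambda>x. theta (Poly_Mapping.single (g, 0) c * x) (Poly_Mapping.single (0, h) 1 * y)" _ x])
    (simp_all add: distrib_left theta_add)
qed

text \<open>Moving \<open>a\<close> across the tensor sign does not change the product of the inner
  factors to which \<open>\<psi>\<close> is applied. This lets \<open>theta\<close> descend to the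
  tensor product over \<open>FG\<close>.\<close>

lemma theta_balanced: "theta (right_emb a * x) y = theta x (left_emb a * y)"
proof -
  have 1: "theta (right_emb (Poly_Mapping.single k s) * Poly_Mapping.single p d) (Poly_Mapping.single p' d') =
        theta (Poly_Mapping.single p d) (left_emb (Poly_Mapping.single k s) * Poly_Mapping.single p' d')" for k s p d p' d'
    by (cases p; cases p')
      (simp add: right_emb_single left_emb_single mult_single theta_single minus_add add.assoc mult_ac)
  have 2: "theta (right_emb (Poly_Mapping.single k s) * Poly_Mapping.single p d) y =
        theta (Poly_Mapping.single p d) (left_emb (Poly_Mapping.single k s) * y)" for k s p d
    by (rule additive_eqI[of _ _ y]) (simp_all add: distrib_left theta_add 1)
  have 3: "theta (right_emb (Poly_Mapping.single k s) * x) y = theta x (left_emb (Poly_Mapping.single k s) * y)" for k s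
    by (rule additive_eqI[of "\<lambda>x. theta (right_emb (Poly_Mapping.single k s) * x) y" _ x]) (simp_all add: distrib_left theta_add 2)
  show ?thesis
    by (rule additive_eqI[of "\<lambda>a. theta (right_emb a * x) y" _ a])
      (simp_all add: right_emb_add left_emb_add distrib_right theta_add 3)
qed

lemma theta_left: "theta (x * left_emb a) y = theta x y * left_emb a"
proof -
  have 1: "theta (Poly_Mapping.single p d * left_emb (Poly_Mapping.single k s)) (Poly_Mapping.single p' d') =
        theta (Poly_Mapping.single p d) (Poly_Mapping.single p' d') * left_emb (Poly_Mapping.single k s)" for k s p d p' d'
    by (cases p; cases p') (simp add: left_emb_single mult_single theta_single mult_ac)
  have 2: "theta (Poly_Mapping.single p d * left_emb (Poly_Mapping.single k s)) y =
        theta (Poly_Mapping.single p d) y * left_emb (Poly_Mapping.single k s)" for k s p d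
    by (rule additive_eqI[of _ _ y]) (simp_all add: distrib_right theta_add 1)
  have 3: "theta (x * left_emb (Poly_Mapping.single k s)) y = theta x y * left_emb (Poly_Mapping.single k s)" for k s
    by (rule additive_eqI[of "\<lambda>x. theta (x * left_emb (Poly_Mapping.single k s)) y" _ x]) (simp_all add: distrib_right theta_add 2)
  show ?thesis
    by (rule additive_eqI[of "\<lambda>a. theta (x * left_emb a) y" _ a])
      (simp_all add: left_emb_add distrib_left theta_add 3)
qed

lemma theta_right: "theta x (y * right_emb a) = theta x y * right_emb a"
proof -
  have 1: "theta (Poly_Mapping.single p d) (Poly_Mapping.single p' d' * right_emb (Poly_Mapping.single k s)) =
        theta (Poly_Mapping.single p d) (Poly_Mapping.single p' d') * right_emb (Poly_Mapping.single k s)" for k s p d p' d'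
    by (cases p; cases p') (simp add: right_emb_single mult_single theta_single mult_ac)
  have 2: "theta (Poly_Mapping.single p d) (y * right_emb (Poly_Mapping.single k s)) =
        theta (Poly_Mapping.single p d) y * right_emb (Poly_Mapping.single k s)" for k s p d
    by (rule additive_eqI[of _ _ y]) (simp_all add: distrib_right theta_add 1)
  have 3: "theta x (y * right_emb (Poly_Mapping.single k s)) = theta x y * right_emb (Poly_Mapping.single k s)" for k s
    by (rule additive_eqI[of "\<lambda>x. theta x (y * right_emb (Poly_Mapping.single k s))" _ x]) (simp_all add: distrib_right theta_add 2)
  show ?thesis
    by (rule additive_eqI[of "\<lambda>a. theta x (y * right_emb a)" _ a])
      (simp_all add: right_emb_add distrib_left theta_add 3)
qed

lemma theta_1: "theta (right_emb b) (left_emb c) = Poly_Mapping.single (0, 0) (\<psi> (b * c))"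
proof -
  have 0: "theta (right_emb (Poly_Mapping.single k s)) (left_emb (Poly_Mapping.single k' s')) =
     Poly_Mapping.single (0, 0) (\<psi> (Poly_Mapping.single k s * Poly_Mapping.single k' s'))" for k s k' s'
    using psi_single[of "k + k'" "s * s'"]
    by (simp add: right_emb_single left_emb_single theta_single mult_single mult_ac)
  have 1: "theta (right_emb (Poly_Mapping.single k s)) (left_emb c) = Poly_Mapping.single (0, 0) (\<psi> (Poly_Mapping.single k s * c))" for k s
    by (rule additive_eqI[of _ _ c]) (simp_all add: left_emb_add distrib_left theta_add add single_add 0)
  show ?thesis
    by (rule additive_eqI[of _ _ b]) (simp_all add: right_emb_add distrib_right theta_add add single_add 1)
qed

lemma theta_pure: "theta (left_emb a * right_emb b) (left_emb c * right_emb d) = scal (\<psi> (b * c)) * (left_emb a * right_emb d)"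
proof -
  have "theta (left_emb a * right_emb b) (left_emb c * right_emb d) = theta (right_emb b * left_emb a) (left_emb c) * right_emb d"
    by (simp only: theta_right left_right_commute[of a b])
  also have "\<dots> = theta (right_emb b) (left_emb c) * left_emb a * right_emb d" by (simp only: theta_left)
  finally show ?thesis unfolding theta_1 by (simp add: mult.assoc zero_prod_def)
qed

end

definition frag_lin :: "('a \<Rightarrow> 'r::ring_1) \<Rightarrow> ('a \<Rightarrow>\<^sub>0 int) \<Rightarrow> 'r" where
  "frag_lin f z = (\<Sum>p\<in>Poly_Mapping.keys z. of_int (Poly_Mapping.lookup z p) * f p)"

lemma frag_lin_superset:
  "finite A \<Longrightarrow> Poly_Mapping.keys z \<subseteq> A \<Longrightarrow> frag_lin f z = (\<Sum>p\<in>A. of_int (Poly_Mapping.lookup z p) * f p)"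
  unfolding frag_lin_def by (rule sum.mono_neutral_left) (auto simp: in_keys_iff)

lemma frag_lin_add: "frag_lin f (z + w) = frag_lin f z + frag_lin f w"
proof -
  let ?A = "Poly_Mapping.keys z \<union> Poly_Mapping.keys w"
  have "Poly_Mapping.keys (z + w) \<subseteq> ?A" by (rule keys_add)
  thus ?thesis by (simp add: frag_lin_superset[of ?A] lookup_add distrib_right sum.distrib)
qed

lemma frag_lin_0: "frag_lin f 0 = 0" by (simp add: frag_lin_def)

lemma frag_lin_minus: "frag_lin f (- z) = - frag_lin f z"
  using frag_lin_add[of f z "- z"] by (simp add: frag_lin_0 eq_neg_iff_add_eq_0 add.commute)

lemma frag_lin_diff: "frag_lin f (z - w) = frag_lin f z - frag_lin f w"
  using frag_lin_add[of f z "- w"] by (simp add: frag_lin_minus)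

lemma frag_lin_of: "frag_lin f (frag_of p) = f p"
  by (simp add: frag_lin_def keys_frag_of)

lemma frag_lin_sum: "frag_lin f (sum h A) = (\<Sum>i\<in>A. frag_lin f (h i))"
  by (induction A rule: infinite_finite_induct) (simp_all add: frag_lin_add frag_lin_0)

text \<open>A basis of \<open>j FG k\<close> with its coordinate functionals, extended to
  \<open>FG\<close> through the projection \<open>v \<mapsto> j v k\<close>. For idempotents
  \<open>\<epsilon>\<close> its length \<open>s\<close> is a Cartan number.\<close>

lemma corner_coordinates:
  fixes j k :: "'g::{finite,group_add} \<Rightarrow>\<^sub>0 'f::field"
  assumes j: "j * j = j" and k: "k * k = k" and s: "s = group_algebra_dim {j * x * k | x. True}"
  obtains \<beta> \<psi> where "\<And>t. t < s \<Longrightarrow> j * \<beta> t * k = \<beta> t" "\<And>t. t < s \<Longrightarrow> linear_functional (\<psi> t)"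
    "\<And>v. j * v * k = (\<Sum>t<s. scal (\<psi> t v) * \<beta> t)"
    "\<And>t u. t < s \<Longrightarrow> u < s \<Longrightarrow> \<psi> t (\<beta> u) = (if t = u then 1 else 0)"
proof -
  interpret V: vector_space "\<lambda>(c::'f) (x::'g \<Rightarrow>\<^sub>0 'f). scal c * x"
    by unfold_locales (simp_all add: distrib_left distrib_right scal_add scal_mult mult.assoc)
  define W where "W = {j * x * k | x. True}"
  obtain B where B: "B \<subseteq> W" "V.independent B" "W \<subseteq> V.span B" "card B = V.dim W"
    using V.basis_exists by blast
  have "x \<in> V.span (range (\<lambda>g. Poly_Mapping.single g 1))" for x :: "'g \<Rightarrow>\<^sub>0 'f"
  proof -
    have "(\<Sum>g\<in>UNIV. scal (Poly_Mapping.lookup x g) * Poly_Mapping.single g 1) \<in> V.span (range (\<lambda>g. Poly_Mapping.single g 1))"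
      by (intro V.span_sum V.span_scale V.span_base) auto
    thus ?thesis by (simp add: mult_single flip: poly_mapping_expand)
  qed
  hence finB: "finite B" using V.independent_span_bound[of "range (\<lambda>g. Poly_Mapping.single g 1)" B] B(2) by auto
  have cB: "card B = s" using B(4) s by (simp add: W_def group_algebra_dim_def)
  obtain b where b: "bij_betw b {..<s} B"
    using ex_bij_betw_nat_finite[OF finB] cB by (auto simp: lessThan_atLeast0)
  have bB: "b t \<in> B" if "t < s" for t using b that by (auto simp: bij_betw_def)
  have fix_W: "j * w * k = w" if w: "w \<in> W" for w
  proof -
    obtain x where "w = j * x * k" using w unfolding W_def by blast
    hence "j * w * k = (j * j) * x * (k * k)" by (simp only: mult.assoc)
    thus ?thesis using j k \<open>w = j * x * k\<close> by simp
  qed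
  have sp: "j * v * k \<in> V.span B" for v using B(3) unfolding W_def by blast
  define \<psi> where "\<psi> t v = V.representation B (j * v * k) (b t)" for t v
  show ?thesis
  proof (rule that[of b \<psi>])
    show "j * b t * k = b t" if "t < s" for t using fix_W bB[OF that] B(1) by blast
    show "linear_functional (\<psi> t)" for t
    proof
      show "\<psi> t (v + w) = \<psi> t v + \<psi> t w" for v w
        using V.representation_add[OF B(2) sp sp, of v w] by (simp add: \<psi>_def distrib_left distrib_right)
      show "\<psi> t (scal c * v) = c * \<psi> t v" for c v
      proof -
        have "j * (scal c * v) * k = scal c * (j * v * k)" by (simp only: scal_left_commute mult.assoc)
        thus ?thesis using V.representation_scale[OF B(2) sp, of c v] by (simp add: \<psi>_def)
      qed
    qed
    show "j * v * k = (\<Sum>t<s. scal (\<psi> t v) * b t)" for v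
    proof -
      have "(\<Sum>t<s. scal (\<psi> t v) * b t) = (\<Sum>w\<in>B. scal (V.representation B (j * v * k) w) * w)"
        unfolding \<psi>_def by (rule sum.reindex_bij_betw[OF b])
      also have "\<dots> = j * v * k" by (rule V.sum_representation_eq[OF B(2) sp finB]) simp
      finally show ?thesis ..
    qed
    show "\<psi> t (b u) = (if t = u then 1 else 0)" if "t < s" "u < s" for t u
    proof -
      have "j * b u * k = b u" using fix_W bB[OF that(2)] B(1) by blast
      moreover have "b t = b u \<longleftrightarrow> t = u" using b that by (auto simp: bij_betw_def inj_on_def)
      ultimately show ?thesis using V.representation_basis[OF B(2) bB[OF that(2)]] by (simp add: \<psi>_def)
    qed
  qed
qed

lemma poly_mapping_additive_induct:
  fixes x :: "'x::finite \<Rightarrow>\<^sub>0 'f::comm_monoid_add"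
  assumes "\<And>g c. P (Poly_Mapping.single g c)" "\<And>x y. P x \<Longrightarrow> P y \<Longrightarrow> P (x + y)"
  shows "P x"
proof -
  have 0: "P 0" using assms(1)[of undefined 0] by simp
  have "P (\<Sum>g\<in>A. Poly_Mapping.single g (Poly_Mapping.lookup x g))" if "finite A" for A
    using that by (induction A rule: finite_induct) (auto intro: assms 0)
  from this[of UNIV] show ?thesis by (simp flip: poly_mapping_expand)
qed

section \<open>Calculus with representatives of tensors\<close>

locale tensor_product = M: lmod e M + N: lmod e' N
  for e e' :: "'g::{finite,group_add} \<times> 'g \<Rightarrow>\<^sub>0 'f::field"
    and M :: "('g \<times> 'g \<Rightarrow>\<^sub>0 'f, 'm) module" and N :: "('g \<times> 'g \<Rightarrow>\<^sub>0 'f, 'n) module"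
begin

abbreviation A where "A \<equiv> free_Abelian_group (carrier M \<times> carrier N)"
definition K where "K = generate A (tensor_rels M N)"
abbreviation br :: "'m \<Rightarrow> 'n \<Rightarrow> ('m \<times> 'n \<Rightarrow>\<^sub>0 int)" where "br m n \<equiv> frag_of (m, n)"
abbreviation act where "act \<equiv> tensor_act M N"

text \<open>Equality in the tensor product, stated for representatives in the free abelian group so
  that computations avoid cosets until \<open>tensor_simps\<close>.\<close>

definition cg :: "('m \<times> 'n \<Rightarrow>\<^sub>0 int) \<Rightarrow> ('m \<times> 'n \<Rightarrow>\<^sub>0 int) \<Rightarrow> bool" where
  "cg z w \<longleftrightarrow> z - w \<in> K"

lemma A_diff: "z \<in> carrier A \<Longrightarrow> w \<in> carrier A \<Longrightarrow> z - w \<in> carrier A"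
  unfolding free_Abelian_group_def using keys_diff by fastforce
lemma A_add: "z \<in> carrier A \<Longrightarrow> w \<in> carrier A \<Longrightarrow> z + w \<in> carrier A"
  unfolding free_Abelian_group_def using keys_add by fastforce
lemma A_sum: "(\<And>i. i \<in> I \<Longrightarrow> z i \<in> carrier A) \<Longrightarrow> sum z I \<in> carrier A"
  by (rule sum_closed_free_Abelian_group)

lemma rels_A: "tensor_rels M N \<subseteq> carrier A"
proof
  fix z assume "z \<in> tensor_rels M N"
  thus "z \<in> carrier A" unfolding tensor_rels_def
    by (auto intro!: A_diff simp del: carrier_free_Abelian_group_iff keys_frag_of)
qed

lemma rels_keys: "r \<in> tensor_rels M N \<Longrightarrow> Poly_Mapping.keys r \<subseteq> carrier M \<times> carrier N"
  using subsetD[OF rels_A, of r] by simp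
lemma A_0: "0 \<in> carrier A" by simp

lemma A_induct [consumes 1, case_names zero diff of]:
  assumes "z \<in> carrier A" "P 0" "\<And>x y. x \<in> carrier A \<Longrightarrow> y \<in> carrier A \<Longrightarrow> P x \<Longrightarrow> P y \<Longrightarrow> P (x - y)"
    "\<And>m n. m \<in> carrier M \<Longrightarrow> n \<in> carrier N \<Longrightarrow> P (br m n)"
  shows "P z"
proof -
  have "Poly_Mapping.keys z \<subseteq> carrier M \<times> carrier N" using assms(1) by simp
  thus ?thesis by (rule free_Abelian_group_induct) (use assms in auto)
qed

lemma K_induct [consumes 1, case_names zero rel minus add]:
  assumes "z \<in> K" "P 0" "\<And>r. r \<in> tensor_rels M N \<Longrightarrow> P r" "\<And>x. P x \<Longrightarrow> P (- x)"
    "\<And>x y. P x \<Longrightarrow> P y \<Longrightarrow> P (x + y)"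
  shows "P z"
  using assms(1) unfolding K_def
proof (induction rule: generate.induct)
  case (inv h)
  thus ?case using assms(3,4) rels_keys by simp
qed (use assms in auto)

lemma K_0: "0 \<in> K" using generate.one[of A "tensor_rels M N"] unfolding K_def by simp
lemma K_rel: "r \<in> tensor_rels M N \<Longrightarrow> r \<in> K" unfolding K_def by (rule generate.incl)
lemma K_add: "x \<in> K \<Longrightarrow> y \<in> K \<Longrightarrow> x + y \<in> K" 
  using generate.eng[of x A "tensor_rels M N" y] unfolding K_def by simp
lemma K_minus: "x \<in> K \<Longrightarrow> - x \<in> K"
proof -
  assume "x \<in> K"
  hence "x \<in> K \<and> - x \<in> K"
  proof (induction x rule: K_induct)
    case (rel r)
    thus ?case using K_rel generate.inv[OF rel, of A] rels_keys[OF rel] unfolding K_def by simp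
  next
    case (add x y)
    have "- (x + y) = - x + - y" by simp
    thus ?case using K_add add by metis
  qed (simp_all add: K_0)
  thus ?thesis by blast
qed
lemma K_diff: "x \<in> K \<Longrightarrow> y \<in> K \<Longrightarrow> x - y \<in> K" using K_add[of x "- y"] K_minus by simp
lemma K_sum: "(\<And>i. i \<in> I \<Longrightarrow> z i \<in> K) \<Longrightarrow> sum z I \<in> K"
  by (induction I rule: infinite_finite_induct) (auto simp: K_0 K_add)
lemma cg_refl: "cg z z" by (simp add: cg_def K_0)
lemma cg_sym: "cg z w \<Longrightarrow> cg w z" unfolding cg_def using K_minus[of "z - w"] by simp
lemma cg_trans [trans]: "cg z w \<Longrightarrow> cg w v \<Longrightarrow> cg z v" unfolding cg_def using K_add[of "z - w" "w - v"] by simp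
lemma cg_add: "cg z w \<Longrightarrow> cg z' w' \<Longrightarrow> cg (z + z') (w + w')"
  unfolding cg_def using K_add[of "z - w" "z' - w'"] by (simp add: algebra_simps)
lemma cg_diff: "cg z w \<Longrightarrow> cg z' w' \<Longrightarrow> cg (z - z') (w - w')"
  unfolding cg_def using K_diff[of "z - w" "z' - w'"] by (simp add: algebra_simps)
lemma cg_sum: "(\<And>i. i \<in> I \<Longrightarrow> cg (z i) (w i)) \<Longrightarrow> cg (sum z I) (sum w I)"
  unfolding cg_def by (simp add: K_sum flip: sum_subtractf)

lemma cg_add_l: "m \<in> carrier M \<Longrightarrow> m' \<in> carrier M \<Longrightarrow> n \<in> carrier N \<Longrightarrow> cg (br (m \<oplus>\<^bsub>M\<^esub> m') n) (br m n + br m' n)"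
proof -
  assume "m \<in> carrier M" "m' \<in> carrier M" "n \<in> carrier N"
  hence "br (m \<oplus>\<^bsub>M\<^esub> m') n - br m n - br m' n \<in> K" by (intro K_rel) (auto simp: tensor_rels_def)
  thus ?thesis by (simp add: cg_def diff_diff_eq)
qed

lemma cg_add_r: "m \<in> carrier M \<Longrightarrow> n \<in> carrier N \<Longrightarrow> n' \<in> carrier N \<Longrightarrow> cg (br m (n \<oplus>\<^bsub>N\<^esub> n')) (br m n + br m n')"
proof -
  assume "m \<in> carrier M" "n \<in> carrier N" "n' \<in> carrier N"
  hence "br m (n \<oplus>\<^bsub>N\<^esub> n') - br m n - br m n' \<in> K" by (intro K_rel) (auto simp: tensor_rels_def)
  thus ?thesis by (simp add: cg_def diff_diff_eq)
qed

lemma cg_balanced: "m \<in> carrier M \<Longrightarrow> n \<in> carrier N \<Longrightarrow> cg (br (right_emb a \<odot>\<^bsub>M\<^esub> m) n) (br m (left_emb a \<odot>\<^bsub>N\<^esub> n))"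
  unfolding cg_def by (rule K_rel) (auto simp: tensor_rels_def)

lemma br_zero_l: "n \<in> carrier N \<Longrightarrow> br \<zero>\<^bsub>M\<^esub> n \<in> K"
  using cg_add_l[of "\<zero>\<^bsub>M\<^esub>" "\<zero>\<^bsub>M\<^esub>" n] K_minus unfolding cg_def by fastforce
lemma br_zero_r: "m \<in> carrier M \<Longrightarrow> br m \<zero>\<^bsub>N\<^esub> \<in> K"
  using cg_add_r[of m "\<zero>\<^bsub>N\<^esub>" "\<zero>\<^bsub>N\<^esub>"] K_minus unfolding cg_def by fastforce

lemma act_of: "act x (br m n) = (\<Sum>p\<in>UNIV. br (Poly_Mapping.single (fst p, 0) (Poly_Mapping.lookup x p) \<odot>\<^bsub>M\<^esub> m)
    (Poly_Mapping.single (0, snd p) 1 \<odot>\<^bsub>N\<^esub> n))"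
  unfolding tensor_act_def by (simp add: case_prod_unfold)
lemma act_diff: "act x (z - w) = act x z - act x w" unfolding tensor_act_def by (rule frag_extend_diff)
lemma act_add: "act x (z + w) = act x z + act x w" unfolding tensor_act_def by (rule frag_extend_add)
lemma act_0: "act x 0 = 0" unfolding tensor_act_def by simp
lemma act_minus: "act x (- z) = - act x z" using act_diff[of x 0 z] by (simp add: act_0)

lemma act_A: "z \<in> carrier A \<Longrightarrow> act x z \<in> carrier A"
proof (induction z rule: A_induct)
  case (of m n)
  thus ?case unfolding act_of by (intro A_sum) (simp del: carrier_free_Abelian_group_iff)
qed (auto simp: act_0 act_diff A_0 intro: A_diff simp del: carrier_free_Abelian_group_iff)

text \<open>Each kind of relation is mapped to a sum of relations of the same kind. For the
  balancing relation this rests on the fact that left and right multiplications commute.\<close>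

lemma act_K: "z \<in> K \<Longrightarrow> act x z \<in> K"
proof (induction z rule: K_induct)
  case (rel r)
  let ?a = "\<lambda>p. Poly_Mapping.single (fst p, 0) (Poly_Mapping.lookup x p)" and ?b = "\<lambda>p. Poly_Mapping.single (0, snd p) 1"
  consider m m' n where "r = br (m \<oplus>\<^bsub>M\<^esub> m') n - br m n - br m' n" "m \<in> carrier M" "m' \<in> carrier M" "n \<in> carrier N"
    | m n n' where "r = br m (n \<oplus>\<^bsub>N\<^esub> n') - br m n - br m n'" "m \<in> carrier M" "n \<in> carrier N" "n' \<in> carrier N"
    | a m n where "r = br (right_emb a \<odot>\<^bsub>M\<^esub> m) n - br m (left_emb a \<odot>\<^bsub>N\<^esub> n)" "m \<in> carrier M" "n \<in> carrier N"
    using rel unfolding tensor_rels_def by blast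
  thus ?case
  proof cases
    case 1
    have "act x r = (\<Sum>p\<in>UNIV. br (?a p \<odot>\<^bsub>M\<^esub> m \<oplus>\<^bsub>M\<^esub> ?a p \<odot>\<^bsub>M\<^esub> m') (?b p \<odot>\<^bsub>N\<^esub> n) -
        (br (?a p \<odot>\<^bsub>M\<^esub> m) (?b p \<odot>\<^bsub>N\<^esub> n) + br (?a p \<odot>\<^bsub>M\<^esub> m') (?b p \<odot>\<^bsub>N\<^esub> n)))"
      unfolding 1(1) act_diff act_of using 1 by (simp add: M.smult_r sum_subtractf sum.distrib diff_diff_eq)
    also have "\<dots> \<in> K" using cg_add_l 1 unfolding cg_def by (intro K_sum) auto
    finally show ?thesis .
  next
    case 2
    have "act x r = (\<Sum>p\<in>UNIV. br (?a p \<odot>\<^bsub>M\<^esub> m) (?b p \<odot>\<^bsub>N\<^esub> n \<oplus>\<^bsub>N\<^esub> ?b p \<odot>\<^bsub>N\<^esub> n') -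
        (br (?a p \<odot>\<^bsub>M\<^esub> m) (?b p \<odot>\<^bsub>N\<^esub> n) + br (?a p \<odot>\<^bsub>M\<^esub> m) (?b p \<odot>\<^bsub>N\<^esub> n')))"
      unfolding 2(1) act_diff act_of using 2 by (simp add: N.smult_r sum_subtractf sum.distrib diff_diff_eq)
    also have "\<dots> \<in> K" using cg_add_r 2 unfolding cg_def by (intro K_sum) auto
    finally show ?thesis .
  next
    case 3
    have a: "?a p \<odot>\<^bsub>M\<^esub> (right_emb a \<odot>\<^bsub>M\<^esub> m) = right_emb a \<odot>\<^bsub>M\<^esub> (?a p \<odot>\<^bsub>M\<^esub> m)" for p
    proof -
      have "?a p * right_emb a = right_emb a * ?a p"
        using left_right_commute[of "Poly_Mapping.single (fst p) (Poly_Mapping.lookup x p)" a] by (simp add: left_emb_single)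
      thus ?thesis using 3(2) by (simp flip: M.smult_assoc)
    qed
    have b: "?b p \<odot>\<^bsub>N\<^esub> (left_emb a \<odot>\<^bsub>N\<^esub> n) = left_emb a \<odot>\<^bsub>N\<^esub> (?b p \<odot>\<^bsub>N\<^esub> n)" for p :: "'g \<times> 'g"
    proof -
      have "?b p * left_emb a = left_emb a * ?b p"
        using left_right_commute[of a "Poly_Mapping.single (- snd p) 1"] by (simp add: right_emb_single)
      thus ?thesis using 3(3) by (simp flip: N.smult_assoc)
    qed
    have "act x r = (\<Sum>p\<in>UNIV. br (right_emb a \<odot>\<^bsub>M\<^esub> (?a p \<odot>\<^bsub>M\<^esub> m)) (?b p \<odot>\<^bsub>N\<^esub> n) -
        br (?a p \<odot>\<^bsub>M\<^esub> m) (left_emb a \<odot>\<^bsub>N\<^esub> (?b p \<odot>\<^bsub>N\<^esub> n)))"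
      unfolding 3(1) act_diff act_of a b by (simp add: sum_subtractf)
    also have "\<dots> \<in> K" using cg_balanced 3 unfolding cg_def by (intro K_sum) auto
    finally show ?thesis .
  qed
qed (auto simp: act_0 act_add act_minus intro: K_0 K_add K_minus)

lemma act_cg: "cg z w \<Longrightarrow> cg (act x z) (act x w)"
  unfolding cg_def using act_K[of "z - w" x] by (simp add: act_diff)

text \<open>The other terms of the defining sum have zero as left entry. In the free abelian group
  they are non-zero generators, but they lie in \<open>K\<close>.\<close>

lemma act_single:
  assumes "m \<in> carrier M" "n \<in> carrier N"
  shows "cg (act (Poly_Mapping.single (g, h) c) (br m n)) (br (Poly_Mapping.single (g, 0) c \<odot>\<^bsub>M\<^esub> m) (Poly_Mapping.single (0, h) 1 \<odot>\<^bsub>N\<^esub> n))"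
proof -
  let ?f = "\<lambda>p. br (Poly_Mapping.single (fst p, 0) (Poly_Mapping.lookup (Poly_Mapping.single (g, h) c) p) \<odot>\<^bsub>M\<^esub> m) (Poly_Mapping.single (0, snd p) 1 \<odot>\<^bsub>N\<^esub> n)"
  have "sum ?f UNIV = ?f (g, h) + sum ?f (UNIV - {(g, h)})" by (rule sum.remove) auto
  moreover have "sum ?f (UNIV - {(g, h)}) \<in> K"
  proof (rule K_sum)
    fix p assume "p \<in> UNIV - {(g, h)}"
    hence "Poly_Mapping.lookup (Poly_Mapping.single (g, h) c) p = 0" by (simp add: lookup_single)
    thus "?f p \<in> K" using br_zero_l assms by (simp add: M.smult_0)
  qed
  ultimately show ?thesis unfolding cg_def act_of by simp
qed

lemma act_add_left: "z \<in> carrier A \<Longrightarrow> cg (act (x + y) z) (act x z + act y z)"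
proof (induction z rule: A_induct)
  case zero show ?case by (simp add: act_0 cg_refl)
next
  case (diff z w)
  have "act x (z - w) + act y (z - w) = (act x z + act y z) - (act x w + act y w)" by (simp add: act_diff)
  thus ?case using cg_diff[OF diff(3,4)] by (simp only: act_diff[of "x + y"])
next
  case (of m n)
  have "cg (act (x + y) (br m n)) (\<Sum>p\<in>UNIV.
      br (Poly_Mapping.single (fst p, 0) (Poly_Mapping.lookup x p) \<odot>\<^bsub>M\<^esub> m) (Poly_Mapping.single (0, snd p) 1 \<odot>\<^bsub>N\<^esub> n) +
      br (Poly_Mapping.single (fst p, 0) (Poly_Mapping.lookup y p) \<odot>\<^bsub>M\<^esub> m) (Poly_Mapping.single (0, snd p) 1 \<odot>\<^bsub>N\<^esub> n))"
    unfolding act_of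
  proof (rule cg_sum)
    fix p :: "'g \<times> 'g"
    show "cg (br (Poly_Mapping.single (fst p, 0) (Poly_Mapping.lookup (x + y) p) \<odot>\<^bsub>M\<^esub> m) (Poly_Mapping.single (0, snd p) 1 \<odot>\<^bsub>N\<^esub> n))
      (br (Poly_Mapping.single (fst p, 0) (Poly_Mapping.lookup x p) \<odot>\<^bsub>M\<^esub> m) (Poly_Mapping.single (0, snd p) 1 \<odot>\<^bsub>N\<^esub> n) +
      br (Poly_Mapping.single (fst p, 0) (Poly_Mapping.lookup y p) \<odot>\<^bsub>M\<^esub> m) (Poly_Mapping.single (0, snd p) 1 \<odot>\<^bsub>N\<^esub> n))"
      unfolding lookup_add single_add M.smult_l[OF of(1)]
      by (rule cg_add_l) (use of in auto)
  qed
  thus ?case unfolding act_of by (simp add: sum.distrib)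
qed

lemma act_zero_left: "z \<in> carrier A \<Longrightarrow> act 0 z \<in> K"
  using act_add_left[of z 0 0] K_minus unfolding cg_def by fastforce

lemma act_diff_left: "z \<in> carrier A \<Longrightarrow> cg (act (x - y) z) (act x z - act y z)"
  using act_add_left[of z "x - y" y] K_minus unfolding cg_def by (fastforce simp: algebra_simps)

text \<open>For pure tensors \<open>x\<close> and \<open>y\<close> the inner factors can be
  collected into one element \<open>v\<close> of \<open>FG\<close> between \<open>m0\<close> and
  \<open>n0\<close>. As \<open>m0 j = m0\<close> and \<open>k n0 = n0\<close>, it may be replaced by
  \<open>j v k\<close>, which is expanded in the \<open>\<beta> t\<close>; pulling the coefficients
  out gives the values of \<open>theta\<close>.\<close>

lemma normal_form_generator:
  fixes \<beta> :: "nat \<Rightarrow> 'g \<Rightarrow>\<^sub>0 'f"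
  assumes m0: "m0 \<in> carrier M" "right_emb j \<odot>\<^bsub>M\<^esub> m0 = m0" and n0: "n0 \<in> carrier N" "left_emb k \<odot>\<^bsub>N\<^esub> n0 = n0"
    and \<psi>: "\<And>t. t < s \<Longrightarrow> linear_functional (\<psi> t)" "\<And>v. j * v * k = (\<Sum>t<s. scal (\<psi> t v) * \<beta> t)"
  shows "cg (br (x \<odot>\<^bsub>M\<^esub> m0) (y \<odot>\<^bsub>N\<^esub> n0))
    (\<Sum>t<s. act (linear_functional.theta (\<psi> t) x y) (br m0 (left_emb (\<beta> t) \<odot>\<^bsub>N\<^esub> n0)))"
proof -
  let ?z = "\<lambda>t. br m0 (left_emb (\<beta> t) \<odot>\<^bsub>N\<^esub> n0)" and ?th = "\<lambda>t. linear_functional.theta (\<psi> t)"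
  have zA: "?z t \<in> carrier A" for t using m0 n0 by (simp del: carrier_free_Abelian_group_iff)
  have single: "cg (br (Poly_Mapping.single (g, h) c \<odot>\<^bsub>M\<^esub> m0) (Poly_Mapping.single (g', h') d \<odot>\<^bsub>N\<^esub> n0))
    (\<Sum>t<s. act (?th t (Poly_Mapping.single (g, h) c) (Poly_Mapping.single (g', h') d)) (?z t))" for g h c g' h' d
  proof -
    define m1 where "m1 = Poly_Mapping.single (g, 0) c \<odot>\<^bsub>M\<^esub> m0"
    have m1: "m1 \<in> carrier M" using m0 by (simp add: m1_def)
    define n1 where "n1 w = Poly_Mapping.single (0, h') 1 \<odot>\<^bsub>N\<^esub> (left_emb w \<odot>\<^bsub>N\<^esub> n0)" for w
    have n1: "n1 w \<in> carrier N" for w using n0 by (simp add: n1_def)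
    define v :: "'g \<Rightarrow>\<^sub>0 'f" where "v = Poly_Mapping.single (- h + g') d"
    \<comment> \<open>The right-hand part \<open>h\<close> of the first factor is moved across the
      tensor sign, where it joins the left-hand part \<open>g'\<close> of the second to form
      \<open>v\<close>.\<close>
    have "Poly_Mapping.single (g, h) c \<odot>\<^bsub>M\<^esub> m0 = right_emb (Poly_Mapping.single (- h) 1) \<odot>\<^bsub>M\<^esub> m1"
      unfolding m1_def M.smult_assoc[OF m0(1), symmetric] by (simp add: right_emb_single mult_single)
    hence "cg (br (Poly_Mapping.single (g, h) c \<odot>\<^bsub>M\<^esub> m0) (Poly_Mapping.single (g', h') d \<odot>\<^bsub>N\<^esub> n0))
      (br m1 (left_emb (Poly_Mapping.single (- h) 1) \<odot>\<^bsub>N\<^esub> (Poly_Mapping.single (g', h') d \<odot>\<^bsub>N\<^esub> n0)))"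
      using cg_balanced[OF m1] n0 by simp
    also have "left_emb (Poly_Mapping.single (- h) 1) \<odot>\<^bsub>N\<^esub> (Poly_Mapping.single (g', h') d \<odot>\<^bsub>N\<^esub> n0) = n1 v"
      unfolding n1_def v_def N.smult_assoc[OF n0(1), symmetric] by (simp add: left_emb_single mult_single)
    also have "cg (br m1 (n1 v)) (br m1 (n1 (j * v * k)))"
    proof -
      have "right_emb j * Poly_Mapping.single (g, 0) c = Poly_Mapping.single (g, 0) c * right_emb j"
        using left_right_commute[of "Poly_Mapping.single g c" j] by (simp add: left_emb_single)
      hence "right_emb j \<odot>\<^bsub>M\<^esub> m1 = m1"
        unfolding m1_def M.smult_assoc[OF m0(1), symmetric] by (simp add: M.smult_assoc m0)
      hence "cg (br m1 (n1 v)) (br m1 (left_emb j \<odot>\<^bsub>N\<^esub> n1 v))" using cg_balanced[OF m1 n1, of j v] by simp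
      moreover have "left_emb j \<odot>\<^bsub>N\<^esub> n1 v = n1 (j * v * k)"
      proof -
        have "left_emb j * Poly_Mapping.single (0, h') 1 = Poly_Mapping.single (0, h') 1 * left_emb j"
          using left_right_commute[of j "Poly_Mapping.single (- h') 1"] by (simp add: right_emb_single)
        hence "left_emb j * (Poly_Mapping.single (0, h') 1 * left_emb v) = Poly_Mapping.single (0, h') 1 * left_emb (j * v)"
          by (simp only: left_emb_mult mult.assoc[symmetric])
        hence "left_emb j \<odot>\<^bsub>N\<^esub> n1 v = Poly_Mapping.single (0, h') 1 \<odot>\<^bsub>N\<^esub> (left_emb (j * v) \<odot>\<^bsub>N\<^esub> n0)"
          unfolding n1_def N.smult_assoc[OF n0(1), symmetric] N.smult_assoc[OF N.smult_closed[OF n0(1)], symmetric] by (simp add: N.smult_assoc n0)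
        also have "left_emb (j * v) \<odot>\<^bsub>N\<^esub> n0 = left_emb (j * v * k) \<odot>\<^bsub>N\<^esub> n0"
          unfolding left_emb_mult[of "j * v" k] N.smult_assoc[OF n0(1)] n0(2) ..
        finally show ?thesis unfolding n1_def .
      qed
      ultimately show ?thesis by simp
    qed
    also have "j * v * k = (\<Sum>t<s. scal (\<psi> t v) * \<beta> t)" by (rule \<psi>(2))
    also have "cg (br m1 (n1 (\<Sum>t<s. scal (\<psi> t v) * \<beta> t))) (\<Sum>t<s. br m1 (n1 (scal (\<psi> t v) * \<beta> t)))"
    proof (induction s)
      case 0
      have "n1 0 = \<zero>\<^bsub>N\<^esub>" using n0 by (simp add: n1_def left_emb_0 N.smult_0 N.smult_zero)
      thus ?case using br_zero_r[OF m1] by (simp add: cg_def)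
    next
      case (Suc s)
      have "n1 (a + b) = n1 a \<oplus>\<^bsub>N\<^esub> n1 b" for a b
        unfolding n1_def left_emb_add using n0 by (simp add: N.smult_l N.smult_r)
      thus ?case using cg_trans[OF cg_add_r[OF m1 n1 n1] cg_add[OF Suc cg_refl]] by simp
    qed
    also have "cg (\<Sum>t<s. br m1 (n1 (scal (\<psi> t v) * \<beta> t)))
      (\<Sum>t<s. act (?th t (Poly_Mapping.single (g, h) c) (Poly_Mapping.single (g', h') d)) (?z t))"
    proof (rule cg_sum)
      fix t assume "t \<in> {..<s}"
      then interpret linear_functional "\<psi> t" using \<psi>(1) by simp
      let ?c = "\<psi> t v"
      have "n1 (scal ?c * \<beta> t) = left_emb (scal ?c) \<odot>\<^bsub>N\<^esub> n1 (\<beta> t)"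
        unfolding n1_def N.smult_assoc[OF n0(1), symmetric] N.smult_assoc[OF N.smult_closed[OF n0(1)], symmetric] left_emb_mult left_emb_scal
        by (simp only: scal_left_commute)
      hence "cg (br m1 (n1 (scal ?c * \<beta> t))) (br (right_emb (scal ?c) \<odot>\<^bsub>M\<^esub> m1) (n1 (\<beta> t)))"
        using cg_sym[OF cg_balanced[OF m1 n1]] by simp
      also have "right_emb (scal ?c) \<odot>\<^bsub>M\<^esub> m1 = Poly_Mapping.single (g, 0) (?c * c) \<odot>\<^bsub>M\<^esub> m0"
        unfolding m1_def M.smult_assoc[OF m0(1), symmetric] right_emb_scal by (simp add: mult_single)
      also have "cg (br (Poly_Mapping.single (g, 0) (?c * c) \<odot>\<^bsub>M\<^esub> m0) (n1 (\<beta> t))) (act (Poly_Mapping.single (g, h') (?c * c)) (?z t))"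
        unfolding n1_def using m0 n0 by (intro cg_sym[OF act_single]) auto
      also have "Poly_Mapping.single (g, h') (?c * c) = theta (Poly_Mapping.single (g, h) c) (Poly_Mapping.single (g', h') d)"
        unfolding theta_single v_def psi_single[of "- h + g'" d] by (simp add: mult_ac)
      finally show "cg (br m1 (n1 (scal ?c * \<beta> t))) (act (theta (Poly_Mapping.single (g, h) c) (Poly_Mapping.single (g', h') d)) (?z t))" .
    qed
    finally show ?thesis .
  qed
  have add1: "cg (\<Sum>t<s. act (?th t (x + x') y) (?z t)) ((\<Sum>t<s. act (?th t x y) (?z t)) + (\<Sum>t<s. act (?th t x' y) (?z t)))" for x x' y
    unfolding sum.distrib[symmetric]
  proof (rule cg_sum)
    fix t assume "t \<in> {..<s}"
    then interpret linear_functional "\<psi> t" using \<psi>(1) by simp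
    show "cg (act (theta (x + x') y) (?z t)) (act (theta x y) (?z t) + act (theta x' y) (?z t))"
      unfolding theta_add by (rule act_add_left[OF zA])
  qed
  have add2: "cg (\<Sum>t<s. act (?th t x (y + y')) (?z t)) ((\<Sum>t<s. act (?th t x y) (?z t)) + (\<Sum>t<s. act (?th t x y') (?z t)))" for x y y'
    unfolding sum.distrib[symmetric]
  proof (rule cg_sum)
    fix t assume "t \<in> {..<s}"
    then interpret linear_functional "\<psi> t" using \<psi>(1) by simp
    show "cg (act (theta x (y + y')) (?z t)) (act (theta x y) (?z t) + act (theta x y') (?z t))"
      unfolding theta_add by (rule act_add_left[OF zA])
  qed
  let ?P = "\<lambda>x y. cg (br (x \<odot>\<^bsub>M\<^esub> m0) (y \<odot>\<^bsub>N\<^esub> n0)) (\<Sum>t<s. act (?th t x y) (?z t))"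
  have P2: "?P (Poly_Mapping.single p c) y" for p c y
  proof (induction y rule: poly_mapping_additive_induct)
    case (1 p' d) show ?case using single by (cases p; cases p') simp
  next
    case (2 y y')
    have "cg (br (Poly_Mapping.single p c \<odot>\<^bsub>M\<^esub> m0) ((y + y') \<odot>\<^bsub>N\<^esub> n0))
      (br (Poly_Mapping.single p c \<odot>\<^bsub>M\<^esub> m0) (y \<odot>\<^bsub>N\<^esub> n0) + br (Poly_Mapping.single p c \<odot>\<^bsub>M\<^esub> m0) (y' \<odot>\<^bsub>N\<^esub> n0))"
      unfolding N.smult_l[OF n0(1)] by (rule cg_add_r) (use m0 n0 in auto)
    thus ?case using cg_trans[OF _ cg_trans[OF cg_add[OF 2] cg_sym[OF add2]]] by blast
  qed
  show ?thesis
  proof (induction x rule: poly_mapping_additive_induct)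
    case (1 p c) show ?case by (rule P2)
  next
    case (2 x x')
    have "cg (br ((x + x') \<odot>\<^bsub>M\<^esub> m0) (y \<odot>\<^bsub>N\<^esub> n0)) (br (x \<odot>\<^bsub>M\<^esub> m0) (y \<odot>\<^bsub>N\<^esub> n0) + br (x' \<odot>\<^bsub>M\<^esub> m0) (y \<odot>\<^bsub>N\<^esub> n0))"
      unfolding M.smult_l[OF m0(1)] by (rule cg_add_l) (use m0 n0 in auto)
    thus ?case using cg_trans[OF _ cg_trans[OF cg_add[OF 2] cg_sym[OF add1]]] by blast
  qed
qed

definition coset :: "('m \<times> 'n \<Rightarrow>\<^sub>0 int) \<Rightarrow> ('m \<times> 'n \<Rightarrow>\<^sub>0 int) set" where
  "coset z = (\<lambda>k. k + z) ` K"

lemma coset_eq: "coset z = coset w \<longleftrightarrow> cg z w"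
proof
  assume "coset z = coset w"
  moreover have "z \<in> coset z" unfolding coset_def using K_0 by (auto intro!: image_eqI[of _ _ 0])
  ultimately obtain k where "k \<in> K" "z = k + w" unfolding coset_def by blast
  thus "cg z w" by (simp add: cg_def)
next
  have "coset z \<subseteq> coset w" if "cg z w" for z w
  proof
    fix v assume "v \<in> coset z"
    then obtain k where "k \<in> K" "v = k + z" unfolding coset_def by blast
    thus "v \<in> coset w" using that K_add[of k "z - w"] unfolding coset_def cg_def
      by (intro image_eqI[of _ _ "k + (z - w)"]) auto
  qed
  thus "cg z w \<Longrightarrow> coset z = coset w" using cg_sym by blast
qed

lemma tensor_simps:
  shows "carrier (tensor M N) = coset ` carrier A"
    and "coset z \<oplus>\<^bsub>tensor M N\<^esub> coset w = coset (z + w)"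
    and "coset z \<in> coset ` carrier A \<Longrightarrow> z \<in> carrier A \<Longrightarrow> x \<odot>\<^bsub>tensor M N\<^esub> coset z = coset (act x z)"
proof -
  have rc: "K #>\<^bsub>A\<^esub> z = coset z" for z by (auto simp: r_coset_def coset_def)
  show "carrier (tensor M N) = coset ` carrier A"
    unfolding tensor_def Let_def K_def[symmetric] by (auto simp: FactGroup_def RCOSETS_def rc)
  have "coset z \<oplus>\<^bsub>tensor M N\<^esub> coset w = coset z <#>\<^bsub>A\<^esub> coset w"
    unfolding tensor_def Let_def by (simp add: FactGroup_def)
  also have "\<dots> = coset (z + w)"
  proof (intro Set.set_eqI iffI)
    fix v assume "v \<in> coset z <#>\<^bsub>A\<^esub> coset w"
    then obtain k l where "k \<in> K" "l \<in> K" "v = (k + z) + (l + w)" by (auto simp: set_mult_def coset_def)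
    thus "v \<in> coset (z + w)" using K_add[of k l] unfolding coset_def
      by (intro image_eqI[of _ _ "k + l"]) (auto simp: algebra_simps)
  next
    fix v assume "v \<in> coset (z + w)"
    then obtain k where "k \<in> K" "v = (k + z) + (0 + w)" by (auto simp: coset_def algebra_simps)
    thus "v \<in> coset z <#>\<^bsub>A\<^esub> coset w" using K_0 unfolding set_mult_def coset_def by force
  qed
  finally show "coset z \<oplus>\<^bsub>tensor M N\<^esub> coset w = coset (z + w)" .
  have "x \<odot>\<^bsub>tensor M N\<^esub> coset z = (\<Union>w\<in>coset z. coset (act x w))"
    unfolding tensor_def Let_def K_def[symmetric] by (simp add: rc)
  also have "\<dots> = coset (act x z)"
  proof -
    have "coset (act x w) = coset (act x z)" if "w \<in> coset z" for w
      using that unfolding coset_eq by (intro act_cg) (auto simp: coset_def cg_def)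
    moreover have "z \<in> coset z" unfolding coset_def using K_0 by (auto intro!: image_eqI[of _ _ 0])
    ultimately show ?thesis by blast
  qed
  finally show "x \<odot>\<^bsub>tensor M N\<^esub> coset z = coset (act x z)" .
qed

lemma tensor_closed:
  "X \<in> carrier (tensor M N) \<Longrightarrow> Y \<in> carrier (tensor M N) \<Longrightarrow> X \<oplus>\<^bsub>tensor M N\<^esub> Y \<in> carrier (tensor M N)"
  "X \<in> carrier (tensor M N) \<Longrightarrow> x \<odot>\<^bsub>tensor M N\<^esub> X \<in> carrier (tensor M N)"
  unfolding tensor_simps(1) using tensor_simps(2,3) A_add act_A by (auto simp del: carrier_free_Abelian_group_iff)

text \<open>With \<open>M = FG i \<otimes> j FG\<close> and \<open>N = FG k \<otimes> l FG\<close>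
  the product over \<open>FG\<close> is \<open>FG i \<otimes> (j FG k) \<otimes> l FG\<close>; a
  basis of the middle space, of dimension \<open>s\<close>, gives \<open>s\<close> copies of
  \<open>FG i \<otimes> l FG\<close>.\<close>

theorem tensor_iso:
  assumes isoM: "left_iso M (left_ideal (left_emb i * right_emb j))"
    and isoN: "left_iso N (left_ideal (left_emb k * right_emb l))"
    and idem: "i * i = i" "j * j = j" "k * k = k" "l * l = l"
    and s: "s = group_algebra_dim {j * x * k | x. True}"
  shows "left_iso (tensor M N) (direct_sum s (\<lambda>_. left_ideal (left_emb i * right_emb l)))"
proof -
  obtain \<beta> \<psi> where \<beta>: "\<And>t. t < s \<Longrightarrow> j * \<beta> t * k = \<beta> t" and lin: "\<And>t. t < s \<Longrightarrow> linear_functional (\<psi> t)"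
    and expand: "\<And>v. j * v * k = (\<Sum>t<s. scal (\<psi> t v) * \<beta> t)"
    and dual: "\<And>t u. t < s \<Longrightarrow> u < s \<Longrightarrow> \<psi> t (\<beta> u) = (if t = u then 1 else 0)"
    using corner_coordinates[OF idem(2,3) s] by blast
  let ?u = "left_emb i * right_emb j" and ?v = "left_emb k * right_emb l" and ?w = "left_emb i * right_emb l"
  have uu: "?u * ?u = ?u" and vv: "?v * ?v = ?v" and ww: "?w * ?w = ?w" using idem by (simp_all add: left_right_mult)
  obtain \<phi> \<phi>i where \<phi>: "left_hom M (left_ideal ?u) \<phi>" "left_hom (left_ideal ?u) M \<phi>i"
    "\<And>x. x \<in> carrier M \<Longrightarrow> \<phi>i (\<phi> x) = x" "\<And>y. y \<in> carrier (left_ideal ?u) \<Longrightarrow> \<phi> (\<phi>i y) = y"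
    using left_iso_obtain[OF isoM M.a_closed M.smult_closed] by blast
  obtain \<chi> \<chi>i where \<chi>: "left_hom N (left_ideal ?v) \<chi>" "left_hom (left_ideal ?v) N \<chi>i"
    "\<And>x. x \<in> carrier N \<Longrightarrow> \<chi>i (\<chi> x) = x" "\<And>y. y \<in> carrier (left_ideal ?v) \<Longrightarrow> \<chi> (\<chi>i y) = y"
    using left_iso_obtain[OF isoN N.a_closed N.smult_closed] by blast
  have uU: "?u \<in> carrier (left_ideal ?u)" and vV: "?v \<in> carrier (left_ideal ?v)"
    using left_ideal_mem[OF uu] left_ideal_mem[OF vv] uu vv by blast+
  define m0 where "m0 = \<phi>i ?u"
  define n0 where "n0 = \<chi>i ?v"
  have m0: "m0 \<in> carrier M" and n0: "n0 \<in> carrier N"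
    using left_homD(1)[OF \<phi>(2) uU] left_homD(1)[OF \<chi>(2) vV] by (simp_all add: m0_def n0_def)
  have xm0: "x \<odot>\<^bsub>M\<^esub> m0 = \<phi>i (x * ?u)" and xn0: "x \<odot>\<^bsub>N\<^esub> n0 = \<chi>i (x * ?v)" for x
    using left_homD(3)[OF \<phi>(2) uU, of x] left_homD(3)[OF \<chi>(2) vV, of x] by (simp_all add: m0_def n0_def)
  have jm0: "right_emb j \<odot>\<^bsub>M\<^esub> m0 = m0"
  proof -
    have "right_emb j * ?u = (right_emb j * left_emb i) * right_emb j" by (simp only: mult.assoc)
    also have "\<dots> = left_emb i * (right_emb j * right_emb j)" by (simp only: left_right_commute[symmetric] mult.assoc)
    finally have "right_emb j * ?u = ?u" by (simp only: right_emb_mult[symmetric] idem)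
    thus ?thesis unfolding xm0 by (simp add: m0_def)
  qed
  have kn0: "left_emb k \<odot>\<^bsub>N\<^esub> n0 = n0"
  proof -
    have "left_emb k * ?v = ?v" by (simp only: mult.assoc[symmetric] left_emb_mult[symmetric] idem)
    thus ?thesis unfolding xn0 by (simp add: n0_def)
  qed
  have mu: "\<phi> m * ?u = \<phi> m" "m = \<phi> m \<odot>\<^bsub>M\<^esub> m0" if "m \<in> carrier M" for m
  proof -
    show 1: "\<phi> m * ?u = \<phi> m" using left_homD(1)[OF \<phi>(1) that] left_ideal_mem[OF uu] by blast
    show "m = \<phi> m \<odot>\<^bsub>M\<^esub> m0" unfolding xm0 1 using \<phi>(3)[OF that] by simp
  qed
  have nv: "\<chi> n * ?v = \<chi> n" "n = \<chi> n \<odot>\<^bsub>N\<^esub> n0" if "n \<in> carrier N" for n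
  proof -
    show 1: "\<chi> n * ?v = \<chi> n" using left_homD(1)[OF \<chi>(1) that] left_ideal_mem[OF vv] by blast
    show "n = \<chi> n \<odot>\<^bsub>N\<^esub> n0" unfolding xn0 1 using \<chi>(3)[OF that] by simp
  qed
  define th where "th t = linear_functional.theta (\<psi> t)" for t
  \<comment> \<open>The \<open>t\<close>-th coordinate, computed on representatives after
    \<open>M\<close> and \<open>N\<close> are identified with left ideals; \<open>T_K\<close> shows
    that it is well defined.\<close>
  define T where "T t = frag_lin (\<lambda>(m, n). th t (\<phi> m) (\<chi> n))" for t
  \<comment> \<open>The tensors \<open>m0 \<otimes> \<beta>_t n0\<close> generate the product, by
    \<open>nf\<close>, and are dual to the coordinates, by \<open>T_z0\<close>. These two facts make
    the two maps at the end mutually inverse.\<close>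
  define z0 where "z0 t = br m0 (left_emb (\<beta> t) \<odot>\<^bsub>N\<^esub> n0)" for t
  have z0A: "z0 t \<in> carrier A" for t using m0 n0 by (simp add: z0_def del: carrier_free_Abelian_group_iff)
  have T_of: "T t (br m n) = th t (\<phi> m) (\<chi> n)" for t m n by (simp add: T_def frag_lin_of)
  have T_diff: "T t (z - w) = T t z - T t w" and T_add: "T t (z + w) = T t z + T t w" and T_0: "T t 0 = 0" and T_minus: "T t (- z) = - T t z" for t z w
    by (simp_all add: T_def frag_lin_diff frag_lin_add frag_lin_0 frag_lin_minus)
  have T_K: "T t z = 0" if "z \<in> K" and t: "t < s" for t z
    using that(1)
  proof (induction z rule: K_induct)
    case (rel r)
    interpret linear_functional "\<psi> t" by (rule lin[OF t])
    show ?case using rel unfolding tensor_rels_def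
      by (auto simp: T_diff T_of left_homD[OF \<phi>(1)] left_homD[OF \<chi>(1)] th_def theta_add theta_balanced)
  qed (simp_all add: T_0 T_add T_minus)
  have T_cg: "T t z = T t w" if "cg z w" "t < s" for t z w
    using T_K[of "z - w" t] that by (simp add: cg_def T_diff)
  have T_act: "T t (act x z) = x * T t z" if z: "z \<in> carrier A" and t: "t < s" for t x z
    using z
  proof (induction z rule: A_induct)
    case (of m n)
    interpret linear_functional "\<psi> t" by (rule lin[OF t])
    have "T t (act x (br m n)) = (\<Sum>p\<in>UNIV. theta (Poly_Mapping.single (fst p, 0) (Poly_Mapping.lookup x p) * \<phi> m)
        (Poly_Mapping.single (0, snd p) 1 * \<chi> n))"
      unfolding act_of T_def frag_lin_sum frag_lin_of
      using of by (simp add: left_homD(3)[OF \<phi>(1)] left_homD(3)[OF \<chi>(1)] th_def)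
    also have "\<dots> = (\<Sum>p\<in>UNIV. Poly_Mapping.single p (Poly_Mapping.lookup x p) * theta (\<phi> m) (\<chi> n))"
      unfolding theta_act by simp
    also have "\<dots> = x * theta (\<phi> m) (\<chi> n)" by (simp flip: sum_distrib_right poly_mapping_expand)
    finally show ?case unfolding T_of th_def .
  qed (simp_all add: act_0 T_0 act_diff T_diff right_diff_distrib)
  have T_w: "T t z * ?w = T t z" if z: "z \<in> carrier A" and t: "t < s" for t z
    using z
  proof (induction z rule: A_induct)
    case (of m n)
    interpret linear_functional "\<psi> t" by (rule lin[OF t])
    have 1: "\<phi> m * left_emb i = \<phi> m"
    proof -
      have "?u * left_emb i = left_emb i * (right_emb j * left_emb i)" by (simp only: mult.assoc)
      also have "\<dots> = (left_emb i * left_emb i) * right_emb j" by (simp only: left_right_commute[symmetric] mult.assoc)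
      finally have "?u * left_emb i = ?u" by (simp only: left_emb_mult[symmetric] idem)
      thus ?thesis using mu(1)[OF of(1)] by (metis mult.assoc)
    qed
    have 2: "\<chi> n * right_emb l = \<chi> n"
    proof -
      have "?v * right_emb l = ?v" by (simp only: mult.assoc right_emb_mult[symmetric] idem)
      thus ?thesis using nv(1)[OF of(2)] by (metis mult.assoc)
    qed
    have "theta (\<phi> m) (\<chi> n) * ?w = theta (\<phi> m * left_emb i) (\<chi> n * right_emb l)"
      by (simp only: theta_left theta_right mult.assoc)
    thus ?case unfolding T_of th_def 1 2 .
  qed (simp_all add: T_0 T_diff left_diff_distrib)
  have nf: "cg z (\<Sum>t<s. act (T t z) (z0 t))" if "z \<in> carrier A" for z
    using that
  proof (induction z rule: A_induct)
    case zero
    show ?case unfolding cg_def T_0 using K_diff[OF K_0 K_sum[of "{..<s}"]] act_zero_left[OF z0A] by simp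
  next
    case (diff x y)
    have "cg (\<Sum>t<s. act (T t (x - y)) (z0 t)) (\<Sum>t<s. act (T t x) (z0 t) - act (T t y) (z0 t))"
      unfolding T_diff by (rule cg_sum) (rule act_diff_left[OF z0A])
    thus ?case using cg_trans[OF cg_diff[OF diff(3,4)]] cg_sym by (simp add: sum_subtractf)
  next
    case (of m n)
    have "cg (br (\<phi> m \<odot>\<^bsub>M\<^esub> m0) (\<chi> n \<odot>\<^bsub>N\<^esub> n0)) (\<Sum>t<s. act (th t (\<phi> m) (\<chi> n)) (z0 t))"
      unfolding th_def z0_def by (rule normal_form_generator[OF m0 jm0 n0 kn0 lin expand])
    thus ?case unfolding T_of by (simp flip: mu(2)[OF of(1)] nv(2)[OF of(2)])
  qed
  have T_z0: "T t (z0 r) = (if t = r then ?w else 0)" if t: "t < s" and r: "r < s" for t r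
  proof -
    interpret linear_functional "\<psi> t" by (rule lin[OF t])
    have "\<chi> (left_emb (\<beta> r) \<odot>\<^bsub>N\<^esub> n0) = left_emb (\<beta> r) * ?v"
      unfolding xn0 by (rule \<chi>(4)) auto
    moreover have "\<phi> m0 = ?u" unfolding m0_def by (rule \<phi>(4)[OF uU])
    ultimately have "T t (z0 r) = theta ?u (left_emb (\<beta> r * k) * right_emb l)"
      unfolding z0_def T_of th_def by (simp add: left_emb_mult mult.assoc)
    also have "\<dots> = scal (\<psi> t (j * (\<beta> r * k))) * ?w" by (rule theta_pure)
    also have "j * (\<beta> r * k) = \<beta> r" using \<beta>[OF r] by (simp add: mult.assoc)
    finally show ?thesis using dual[OF t r] by simp
  qed
  define F where "F X = (\<lambda>t\<in>{..<s}. T t (SOME z. z \<in> carrier A \<and> X = coset z))" for X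
  have F: "F (coset z) = (\<lambda>t\<in>{..<s}. T t z)" if "z \<in> carrier A" for z
  proof -
    have "(SOME z'. z' \<in> carrier A \<and> coset z = coset z') \<in> carrier A \<and> coset z = coset (SOME z'. z' \<in> carrier A \<and> coset z = coset z')"
      by (rule someI[of _ z]) (use that in blast)
    hence "cg (SOME z'. z' \<in> carrier A \<and> coset z = coset z') z" using coset_eq cg_sym by blast
    thus ?thesis unfolding F_def using T_cg by auto
  qed
  let ?D = "direct_sum s (\<lambda>_ :: nat. left_ideal ?w)"
  show ?thesis
  proof (rule left_isoI[where f = F and g = "\<lambda>v. coset (\<Sum>t<s. act (v t) (z0 t))"])
    show "left_hom (tensor M N) ?D F"
    proof (rule left_homI)
      fix X assume "X \<in> carrier (tensor M N)"
      then obtain z where z: "X = coset z" "z \<in> carrier A" unfolding tensor_simps by blast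
      show "F X \<in> carrier ?D"
        unfolding z(1) F[OF z(2)] direct_sum_simps using T_w[OF z(2)] left_ideal_mem[OF ww] by (simp del: left_ideal_simps)
      show "F (a \<odot>\<^bsub>tensor M N\<^esub> X) = a \<odot>\<^bsub>?D\<^esub> F X" for a
        unfolding z(1) using tensor_simps(3)[of z a] z F[OF z(2)] F[OF act_A[OF z(2)]] T_act[OF z(2)]
        by (auto simp: direct_sum_simps)
      fix Y assume "Y \<in> carrier (tensor M N)"
      then obtain w where w: "Y = coset w" "w \<in> carrier A" unfolding tensor_simps by blast
      show "F (X \<oplus>\<^bsub>tensor M N\<^esub> Y) = F X \<oplus>\<^bsub>?D\<^esub> F Y"
        unfolding z(1) w(1) tensor_simps(2) F[OF z(2)] F[OF w(2)] F[OF A_add[OF z(2) w(2)]] T_add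
        by (auto simp: direct_sum_simps)
    qed
    fix v assume v: "v \<in> carrier ?D"
    have zA: "(\<Sum>t<s. act (v t) (z0 t)) \<in> carrier A" by (intro A_sum act_A z0A)
    thus "coset (\<Sum>t<s. act (v t) (z0 t)) \<in> carrier (tensor M N)" unfolding tensor_simps by blast
    have vt: "v t * ?w = v t" if "t < s" for t
      using PiE_mem[OF v[unfolded direct_sum_simps], of t] that left_ideal_mem[OF ww] by blast
    have "T t (\<Sum>r<s. act (v r) (z0 r)) = v t" if t: "t < s" for t
    proof -
      have "T t (\<Sum>r<s. act (v r) (z0 r)) = (\<Sum>r<s. v r * T t (z0 r))"
        unfolding T_def frag_lin_sum using T_act[OF z0A t] unfolding T_def by simp
      also have "\<dots> = (\<Sum>r<s. if r = t then v t else 0)"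
        using T_z0[OF t] vt[OF t] by (intro sum.cong) auto
      finally show ?thesis using t by simp
    qed
    thus "F (coset (\<Sum>t<s. act (v t) (z0 t))) = v"
      unfolding F[OF zA] using v by (auto simp: direct_sum_simps fun_eq_iff PiE_iff extensional_def)
  next
    fix X assume "X \<in> carrier (tensor M N)"
    then obtain z where z: "X = coset z" "z \<in> carrier A" unfolding tensor_simps by blast
    have "(\<Sum>t<s. act (F X t) (z0 t)) = (\<Sum>t<s. act (T t z) (z0 t))" unfolding z(1) F[OF z(2)] by simp
    thus "coset (\<Sum>t<s. act (F X t) (z0 t)) = X"
      unfolding z(1) coset_eq using nf[OF z(2)] cg_sym z(1) by simp
  qed
qed

end

section \<open>Orthogonal systems of integral matrices\<close>

text \<open>More vectors than coordinates: arranged as columns and padded with zero rows they form a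
  singular square matrix over the integers.\<close>

lemma integer_relation:
  fixes y :: "'a \<Rightarrow> 'b \<Rightarrow> int"
  assumes fin: "finite T" "finite I" and less: "card I < card T"
  shows "\<exists>c. (\<exists>a\<in>T. c a \<noteq> 0) \<and> (\<forall>i\<in>I. (\<Sum>a\<in>T. c a * y a i) = 0)"
proof -
  define t where "t = card T"
  obtain f where f: "bij_betw f {..<t} T" using ex_bij_betw_nat_finite[OF fin(1)] by (auto simp: t_def lessThan_atLeast0)
  obtain g where g: "bij_betw g {..<card I} I" using ex_bij_betw_nat_finite[OF fin(2)] by (auto simp: lessThan_atLeast0)
  define A where "A = mat t t (\<lambda>(i, a). if i < card I then y (f a) (g i) else 0)"
  have A: "A \<in> carrier_mat t t" by (simp add: A_def)
  \<comment> \<open>Row \<open>card I\<close> is the first padding row, so the expansion along it is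
    zero.\<close>
  have "det A = (\<Sum>j<t. A $$ (card I, j) * cofactor A (card I) j)"
    using less by (intro laplace_expansion_row[OF A]) (simp add: t_def)
  also have "\<dots> = 0" using less by (intro sum.neutral) (simp add: A_def t_def)
  finally obtain v where v: "v \<in> carrier_vec t" "v \<noteq> 0\<^sub>v t" "A *\<^sub>v v = 0\<^sub>v t"
    using det_0_iff_vec_prod_zero[OF A] by blast
  define h where "h = inv_into {..<t} f"
  have hf: "h (f a) = a" if "a < t" for a using f that by (simp add: h_def bij_betw_inv_into_left)
  obtain a where a: "a < t" "v $ a \<noteq> 0" using v(1,2) by (metis carrier_vecD eq_vecI index_zero_vec)
  have "(\<Sum>a\<in>T. v $ h a * y a i) = 0" if i: "i \<in> I" for i
  proof -
    obtain i' where i': "i' < card I" "i = g i'" using g i by (auto simp: bij_betw_def)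
    have it: "i' < t" using i' less by (simp add: t_def)
    have "(\<Sum>a\<in>T. v $ h a * y a i) = (\<Sum>a<t. v $ h (f a) * y (f a) i)" by (rule sum.reindex_bij_betw[OF f, symmetric])
    also have "\<dots> = (\<Sum>a<t. A $$ (i', a) * v $ a)"
      using i' it by (intro sum.cong) (auto simp: hf A_def mult.commute)
    also have "\<dots> = (A *\<^sub>v v) $ i'" using it A v(1) by (simp add: scalar_prod_def lessThan_atLeast0)
    finally show ?thesis using v(3) it by simp
  qed
  moreover have "f a \<in> T" "v $ h (f a) \<noteq> 0" using a hf f by (auto simp: bij_betw_def)
  ultimately show ?thesis by (intro exI[of _ "\<lambda>a. v $ h a"]) blast
qed

text \<open>A relation with the least sum of absolute values cannot have all its coefficients
  divisible by \<open>q\<close>, since division by \<open>q\<close> would give a smaller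
  one.\<close>

lemma relation_not_divisible:
  fixes y :: "'a \<Rightarrow> 'b \<Rightarrow> int"
  assumes T: "finite T" and R: "\<exists>c. (\<exists>a\<in>T. c a \<noteq> 0) \<and> (\<forall>i\<in>I. (\<Sum>a\<in>T. c a * y a i) = 0)" and q: "q > 1"
  shows "\<exists>c. (\<exists>a\<in>T. \<not> q dvd c a) \<and> (\<forall>i\<in>I. (\<Sum>a\<in>T. c a * y a i) = 0)"
proof -
  let ?P = "\<lambda>c. (\<exists>a\<in>T. c a \<noteq> 0) \<and> (\<forall>i\<in>I. (\<Sum>a\<in>T. c a * y a i) = 0)"
  define m where "m c = nat (\<Sum>a\<in>T. \<bar>c a\<bar>)" for c :: "'a \<Rightarrow> int"
  obtain c where c: "?P c" and min: "\<And>d. ?P d \<Longrightarrow> m c \<le> m d"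
    using ex_has_least_nat[of ?P _ m] R by blast
  have "\<exists>a\<in>T. \<not> q dvd c a"
  proof (rule ccontr)
    assume "\<not> ?thesis"
    hence dv: "c a = q * (c a div q)" if "a \<in> T" for a using that by simp
    let ?d = "\<lambda>a. c a div q"
    have "(\<Sum>a\<in>T. ?d a * y a i) = 0" if "i \<in> I" for i
    proof -
      have "(\<Sum>a\<in>T. c a * y a i) = (\<Sum>a\<in>T. q * (?d a * y a i))"
        using dv by (intro sum.cong refl) (metis mult.assoc)
      hence "q * (\<Sum>a\<in>T. ?d a * y a i) = 0" using c that by (simp add: sum_distrib_left)
      thus ?thesis using q by simp
    qed
    moreover obtain a0 where a0: "a0 \<in> T" "c a0 \<noteq> 0" using c by blast
    moreover from a0 have d0: "?d a0 \<noteq> 0" using dv by fastforce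
    ultimately have "m c \<le> m ?d" by (intro min) blast
    have pos: "0 < (\<Sum>a\<in>T. \<bar>?d a\<bar>)" using T a0 d0 by (intro sum_pos2[of _ a0]) auto
    have "(\<Sum>a\<in>T. \<bar>c a\<bar>) = (\<Sum>a\<in>T. q * \<bar>?d a\<bar>)"
    proof (rule sum.cong[OF refl])
      fix a assume "a \<in> T"
      from arg_cong[OF dv[OF this], of abs] have "\<bar>c a\<bar> = \<bar>q\<bar> * \<bar>?d a\<bar>" by (simp only: abs_mult)
      thus "\<bar>c a\<bar> = q * \<bar>?d a\<bar>" using q by simp
    qed
    also have "\<dots> = q * (\<Sum>a\<in>T. \<bar>?d a\<bar>)" by (simp add: sum_distrib_left)
    also have "\<dots> > (\<Sum>a\<in>T. \<bar>?d a\<bar>)" using q pos by simp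
    finally show False using \<open>m c \<le> m ?d\<close> pos by (simp add: m_def)
  qed
  thus ?thesis using c by blast
qed

lemma mat_mult_entry:
  fixes A B :: "int mat"
  assumes "A \<in> carrier_mat l l" "B \<in> carrier_mat l l" "r < l" "s < l"
  shows "(A * B) $$ (r, s) = (\<Sum>k<l. A $$ (r, k) * B $$ (k, s))"
  using assms by (simp add: scalar_prod_def lessThan_atLeast0)

text \<open>Modulo \<open>q\<close> the product sees only the coordinates where \<open>D\<close> has
  entry 1. More orthogonal idempotents than such coordinates would yield a linear relation between
  columns that contradicts orthogonality. An integral relation with a coefficient prime to
  \<open>q\<close> takes the place of linear algebra over the field with \<open>q\<close>
  elements.\<close>

lemma diagonal_orthogonal_bound:
  fixes D :: "int mat" and Y :: "'a \<Rightarrow> int mat"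
  assumes D: "D \<in> carrier_mat l l" "diagonal_mat D" and q: "prime q" "\<And>i. i < l \<Longrightarrow> D $$ (i, i) \<noteq> 1 \<Longrightarrow> q dvd D $$ (i, i)"
    and T: "finite T" and Y: "\<And>a. a \<in> T \<Longrightarrow> Y a \<in> carrier_mat l l" "\<And>a. a \<in> T \<Longrightarrow> Y a \<noteq> 0\<^sub>m l l"
    and orth: "\<And>a b. a \<in> T \<Longrightarrow> b \<in> T \<Longrightarrow> Y a * D * Y b = (if a = b then Y a else 0\<^sub>m l l)"
  shows "card T \<le> card {i. i < l \<and> D $$ (i, i) = 1}"
proof (rule ccontr)
  define I where "I = {i. i < l \<and> D $$ (i, i) = 1}"
  assume "\<not> ?thesis"
  hence less: "card I < card T" by (simp add: I_def)
  have entry: "(Y a * D * Y b) $$ (r, j) = (\<Sum>i<l. Y a $$ (r, i) * D $$ (i, i) * Y b $$ (i, j))"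
    if "a \<in> T" "b \<in> T" "r < l" "j < l" for a b r j
  proof -
    have "(Y a * D) $$ (r, i) = Y a $$ (r, i) * D $$ (i, i)" if i: "i < l" for i
    proof -
      have "(Y a * D) $$ (r, i) = (\<Sum>k<l. Y a $$ (r, k) * D $$ (k, i))"
        by (rule mat_mult_entry[OF Y(1)[OF \<open>a \<in> T\<close>] D(1) \<open>r < l\<close> i])
      also have "\<dots> = (\<Sum>k<l. if k = i then Y a $$ (r, i) * D $$ (i, i) else 0)"
        using D i by (intro sum.cong) (auto simp: diagonal_mat_def)
      finally show ?thesis using i by simp
    qed
    thus ?thesis using mat_mult_entry[OF mult_carrier_mat[OF Y(1)[OF that(1)] D(1)] Y(1)[OF that(2)] that(3,4)] by simp
  qed
  \<comment> \<open>If \<open>q\<close> divided all entries of \<open>Y a\<close>, the equation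
    \<open>Y a = Y a * D * Y a\<close> would raise the divisibility to every power of
    \<open>q\<close>.\<close>
  have nz: "\<exists>r<l. \<exists>j<l. \<not> q dvd Y a $$ (r, j)" if a: "a \<in> T" for a
  proof (rule ccontr)
    assume nd: "\<not> ?thesis"
    have "q ^ Suc k dvd Y a $$ (r, j)" if "r < l" "j < l" for k r j
      using that
    proof (induction k arbitrary: r j)
      case 0 thus ?case using nd by simp
    next
      case (Suc k)
      have "Y a $$ (r, j) = (\<Sum>i<l. Y a $$ (r, i) * D $$ (i, i) * Y a $$ (i, j))"
        using entry[OF a a Suc.prems] orth[OF a a] by simp
      also have "q ^ Suc (Suc k) dvd \<dots>"
      proof (rule dvd_sum)
        fix i assume "i \<in> {..<l}"
        hence "q ^ Suc k dvd Y a $$ (r, i)" "q dvd Y a $$ (i, j)" using Suc nd by auto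
        hence "q ^ Suc k * q dvd Y a $$ (r, i) * Y a $$ (i, j)" by (rule mult_dvd_mono)
        hence "q ^ Suc k * q dvd Y a $$ (r, i) * Y a $$ (i, j) * D $$ (i, i)" by (rule dvd_mult2)
        thus "q ^ Suc (Suc k) dvd Y a $$ (r, i) * D $$ (i, i) * Y a $$ (i, j)" by (simp add: ac_simps)
      qed
      finally show ?case .
    qed
    hence dv: "q ^ k dvd Y a $$ (r, j)" if "r < l" "j < l" for k r j
      using that dvd_trans[OF le_imp_power_dvd[of k "Suc k" q]] by simp
    have "Y a $$ (r, j) = 0" if rj: "r < l" "j < l" for r j
    proof (rule ccontr)
      assume n0: "Y a $$ (r, j) \<noteq> 0"
      have "\<not> is_unit q" using q(1) not_prime_unit by blast
      hence "finite {k. q ^ k dvd Y a $$ (r, j)}" using n0 by (intro finite_divisor_powers)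
      moreover have "{k. q ^ k dvd Y a $$ (r, j)} = UNIV" using dv[OF rj] by simp
      ultimately show False by simp
    qed
    hence "Y a = 0\<^sub>m l l" using Y(1)[OF a] by (intro eq_matI) auto
    thus False using Y(2)[OF a] by blast
  qed
  \<comment> \<open>One column of each \<open>Y a\<close> is kept that is non-zero modulo
    \<open>q\<close>; restricted to \<open>I\<close>, these columns are more vectors than
    coordinates.\<close>
  define j where "j a = (SOME j. j < l \<and> (\<exists>r<l. \<not> q dvd Y a $$ (r, j)))" for a
  have j: "j a < l \<and> (\<exists>r<l. \<not> q dvd Y a $$ (r, j a))" if "a \<in> T" for a
    unfolding j_def by (rule someI_ex) (use nz[OF that] in blast)
  have q1: "q > 1" using q(1) prime_gt_1_int by blast
  have "finite I" by (simp add: I_def)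
  then obtain c where c: "\<exists>a\<in>T. \<not> q dvd c a" "\<And>i. i \<in> I \<Longrightarrow> (\<Sum>a\<in>T. c a * Y a $$ (i, j a)) = 0"
    using relation_not_divisible[OF T integer_relation[OF T _ less, of "\<lambda>a i. Y a $$ (i, j a)"] q1] by blast
  then obtain b where b: "b \<in> T" "\<not> q dvd c b" by blast
  obtain r where r: "r < l" "\<not> q dvd Y b $$ (r, j b)" using j[OF b(1)] by blast
  \<comment> \<open>Orthogonality leaves only the term of \<open>b\<close>. Expanded along the
    diagonal of \<open>D\<close>, the same sum is divisible by \<open>q\<close>: the coordinates in
    \<open>I\<close> vanish by the relation, and the others contain an entry of \<open>D\<close>
    divisible by \<open>q\<close>.\<close>
  have "c b * Y b $$ (r, j b) = (\<Sum>a\<in>T. c a * (Y b * D * Y a) $$ (r, j a))"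
  proof -
    have "(\<Sum>a\<in>T. c a * (Y b * D * Y a) $$ (r, j a)) = (\<Sum>a\<in>T. if a = b then c b * Y b $$ (r, j b) else 0)"
      using orth[OF b(1)] j r by (intro sum.cong) auto
    thus ?thesis using T b by simp
  qed
  also have "\<dots> = (\<Sum>a\<in>T. \<Sum>i<l. c a * (Y b $$ (r, i) * D $$ (i, i) * Y a $$ (i, j a)))"
    using entry[OF b(1) _ r(1)] j by (intro sum.cong refl) (simp add: sum_distrib_left)
  also have "\<dots> = (\<Sum>i<l. \<Sum>a\<in>T. c a * (Y b $$ (r, i) * D $$ (i, i) * Y a $$ (i, j a)))" by (rule sum.swap)
  also have "\<dots> = (\<Sum>i<l. Y b $$ (r, i) * D $$ (i, i) * (\<Sum>a\<in>T. c a * Y a $$ (i, j a)))"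
    by (intro sum.cong refl) (simp add: sum_distrib_left ac_simps)
  also have "q dvd \<dots>"
  proof (rule dvd_sum)
    fix i assume i: "i \<in> {..<l}"
    show "q dvd Y b $$ (r, i) * D $$ (i, i) * (\<Sum>a\<in>T. c a * Y a $$ (i, j a))"
    proof (cases "i \<in> I")
      case True thus ?thesis using c(2) by simp
    next
      case False
      hence "q dvd D $$ (i, i)" using q(2) i by (simp add: I_def)
      thus ?thesis by simp
    qed
  qed
  finally show False using prime_dvd_multD[OF q(1)] b r by blast
qed

lemma diagonal_common_prime:
  fixes D :: "int mat"
  assumes D: "D \<in> carrier_mat l l" "\<And>i. i < l \<Longrightarrow> D $$ (i, i) \<ge> 0" "\<And>i. Suc i < l \<Longrightarrow> D $$ (i, i) dvd D $$ (Suc i, Suc i)"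
  shows "\<exists>q::int. prime q \<and> (\<forall>i<l. D $$ (i, i) \<noteq> 1 \<longrightarrow> q dvd D $$ (i, i))"
proof (cases "\<exists>i<l. D $$ (i, i) \<noteq> 1")
  case False thus ?thesis by (intro exI[of _ 2]) simp
next
  case True
  define i0 where "i0 = (LEAST i. i < l \<and> D $$ (i, i) \<noteq> 1)"
  have i0: "i0 < l \<and> D $$ (i0, i0) \<noteq> 1" unfolding i0_def by (rule LeastI_ex) (use True in blast)
  have le: "i0 \<le> i" if "i < l" "D $$ (i, i) \<noteq> 1" for i unfolding i0_def by (rule Least_le) (use that in blast)
  have dv: "D $$ (i0, i0) dvd D $$ (i0 + k, i0 + k)" if "i0 + k < l" for k
    using that
  proof (induction k)
    case (Suc k) thus ?case using D(3)[of "i0 + k"] dvd_trans by fastforce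
  qed simp
  have "\<exists>q::int. prime q \<and> q dvd D $$ (i0, i0)"
  \<comment> \<open>A zero entry is divisible by every prime, and so are all entries after it, which
    are zero too; the choice of 2 is arbitrary.\<close>
  proof (cases "D $$ (i0, i0) = 0")
    case True thus ?thesis by (intro exI[of _ 2]) simp
  next
    case False
    moreover have "\<not> is_unit (D $$ (i0, i0))" using i0 D(2)[of i0] by auto
    ultimately show ?thesis using prime_divisor_exists by blast
  qed
  then obtain q :: int where q: "prime q" "q dvd D $$ (i0, i0)" by blast
  have "q dvd D $$ (i, i)" if "i < l" "D $$ (i, i) \<noteq> 1" for i
  proof -
    have "i0 + (i - i0) = i" using le[OF that] by simp
    thus ?thesis using dvd_trans[OF q(2) dv[of "i - i0"]] that(1) by simp
  qed
  thus ?thesis using q by blast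
qed

section \<open>Base change to the Smith normal form\<close>

lemma invertible_mat_obtain:
  assumes "P \<in> carrier_mat n n" "invertible_mat (P :: int mat)"
  obtains P' where "P' \<in> carrier_mat n n" "P * P' = 1\<^sub>m n" "P' * P = 1\<^sub>m n"
proof -
  obtain B where B: "P * B = 1\<^sub>m n" "B * P = 1\<^sub>m (dim_row B)"
    using assms unfolding invertible_mat_def inverts_mat_def by auto
  have "dim_col B = n" using arg_cong[OF B(1), of dim_col] by simp
  moreover have "dim_row B = n" using arg_cong[OF B(2), of dim_col] assms(1) by simp
  ultimately show ?thesis using that[of B] B by auto
qed

lemma smith_normal_form_ofD:
  assumes C: "C \<in> carrier_mat l l" and "smith_normal_form_of C D"
  obtains P P' Q Q' where "P \<in> carrier_mat l l" "P' \<in> carrier_mat l l" "Q \<in> carrier_mat l l" "Q' \<in> carrier_mat l l"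
    "P * P' = 1\<^sub>m l" "P' * P = 1\<^sub>m l" "Q * Q' = 1\<^sub>m l" "Q' * Q = 1\<^sub>m l" "D = P * C * Q" "D \<in> carrier_mat l l"
    "diagonal_mat D" "\<And>i. i < l \<Longrightarrow> D $$ (i, i) \<ge> 0" "\<And>i. Suc i < l \<Longrightarrow> D $$ (i, i) dvd D $$ (Suc i, Suc i)"
proof -
  obtain P Q where P: "P \<in> carrier_mat l l" "invertible_mat P" and Q: "Q \<in> carrier_mat l l" "invertible_mat Q"
    and D: "D = P * C * Q" "diagonal_mat D" "\<And>i. i < min (dim_row D) (dim_col D) \<Longrightarrow> D $$ (i, i) \<ge> 0"
      "\<And>i. Suc i < min (dim_row D) (dim_col D) \<Longrightarrow> D $$ (i, i) dvd D $$ (Suc i, Suc i)"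
    using assms unfolding smith_normal_form_of_def by auto
  obtain P' where P': "P' \<in> carrier_mat l l" "P * P' = 1\<^sub>m l" "P' * P = 1\<^sub>m l" by (rule invertible_mat_obtain[OF P])
  obtain Q' where Q': "Q' \<in> carrier_mat l l" "Q * Q' = 1\<^sub>m l" "Q' * Q = 1\<^sub>m l" by (rule invertible_mat_obtain[OF Q])
  have DC: "D \<in> carrier_mat l l" using D(1) P(1) Q(1) C by simp
  show ?thesis
    by (rule that[OF P(1) P'(1) Q(1) Q'(1) P'(2,3) Q'(2,3) D(1) DC D(2)]) (use D(3,4) DC in auto)
qed

text \<open>Since \<open>D = P C Q\<close>, the substitution \<open>Y = Q' X P'\<close> with the
  inverses of \<open>Q\<close> and \<open>P\<close> turns the product formed with \<open>C\<close>
  into the one formed with \<open>D\<close>.\<close>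

theorem orthogonal_matrices_bound:
  assumes C: "C \<in> carrier_mat l l" and smith: "smith_normal_form_of C D"
    and T: "finite T" and X: "\<And>a. a \<in> T \<Longrightarrow> X a \<in> carrier_mat l l" "\<And>a. a \<in> T \<Longrightarrow> X a \<noteq> 0\<^sub>m l l"
    and orth: "\<And>a b. a \<in> T \<Longrightarrow> b \<in> T \<Longrightarrow> X a * C * X b = (if a = b then X a else 0\<^sub>m l l)"
  shows "card T \<le> card {i. i < l \<and> D $$ (i, i) = 1}"
proof (rule smith_normal_form_ofD[OF C smith])
  fix P P' Q Q'
  assume c: "P \<in> carrier_mat l l" "P' \<in> carrier_mat l l" "Q \<in> carrier_mat l l" "Q' \<in> carrier_mat l l"
    and inv: "P * P' = 1\<^sub>m l" "P' * P = 1\<^sub>m l" "Q * Q' = 1\<^sub>m l" "Q' * Q = 1\<^sub>m l"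
    and D: "D = P * C * Q" "D \<in> carrier_mat l l" "diagonal_mat D" "\<And>i. i < l \<Longrightarrow> D $$ (i, i) \<ge> 0"
      "\<And>i. Suc i < l \<Longrightarrow> D $$ (i, i) dvd D $$ (Suc i, Suc i)"
  obtain q :: int where q: "prime q" "\<And>i. i < l \<Longrightarrow> D $$ (i, i) \<noteq> 1 \<Longrightarrow> q dvd D $$ (i, i)"
    using diagonal_common_prime[OF D(2,4,5)] by blast
  have as: "A * B * E = A * (B * E)" if "A \<in> carrier_mat l l" "B \<in> carrier_mat l l" "E \<in> carrier_mat l l" for A B E :: "int mat"
    using assoc_mult_mat[OF that] .
  have cl: "A * B \<in> carrier_mat l l" if "A \<in> carrier_mat l l" "B \<in> carrier_mat l l" for A B :: "int mat" using that by simp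
  have left: "A * (B * E) = E" if "A * B = 1\<^sub>m l" "A \<in> carrier_mat l l" "B \<in> carrier_mat l l" "E \<in> carrier_mat l l" for A B E :: "int mat"
    using as[OF that(2-4)] that by simp
  define Y where "Y a = Q' * X a * P'" for a
  show ?thesis
  proof (rule diagonal_orthogonal_bound[OF D(2,3) q T])
    fix a assume a: "a \<in> T"
    show "Y a \<in> carrier_mat l l" unfolding Y_def using c X(1)[OF a] by simp
    show "Y a \<noteq> 0\<^sub>m l l"
    proof
      assume "Y a = 0\<^sub>m l l"
      hence "Q * (Y a * P) = 0\<^sub>m l l" using c by simp
      moreover have "Q * (Y a * P) = X a"
        unfolding Y_def using c X(1)[OF a] inv by (simp add: as cl left)
      ultimately show False using X(2)[OF a] by simp
    qed
    fix b assume b: "b \<in> T"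
    have "Y a * D * Y b = Q' * (X a * C * X b) * P'"
      unfolding Y_def D(1) using c X(1)[OF a] X(1)[OF b] C inv by (simp add: as cl left)
    thus "Y a * D * Y b = (if a = b then Y a else 0\<^sub>m l l)"
      unfolding orth[OF a b] Y_def using c by simp
  qed
qed

text \<open>The inverse substitution \<open>X = Q E P\<close>, applied to the diagonal matrix units
  at the entries 1 of \<open>D\<close>.\<close>

theorem orthogonal_matrices_exist:
  assumes C: "C \<in> carrier_mat l l" and smith: "smith_normal_form_of C D"
  shows "\<exists>X. \<forall>a\<in>{i. i < l \<and> D $$ (i, i) = 1}. X a \<in> carrier_mat l l \<and> X a \<noteq> 0\<^sub>m l l \<and>
    (\<forall>b\<in>{i. i < l \<and> D $$ (i, i) = 1}. X a * C * X b = (if a = b then X a else 0\<^sub>m l l))"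
proof (rule smith_normal_form_ofD[OF C smith])
  fix P P' Q Q'
  assume c: "P \<in> carrier_mat l l" "P' \<in> carrier_mat l l" "Q \<in> carrier_mat l l" "Q' \<in> carrier_mat l l"
    and inv: "P * P' = 1\<^sub>m l" "P' * P = 1\<^sub>m l" "Q * Q' = 1\<^sub>m l" "Q' * Q = 1\<^sub>m l"
    and D: "D = P * C * Q" "D \<in> carrier_mat l l" "diagonal_mat D"
  have as: "A * B * E = A * (B * E)" if "A \<in> carrier_mat l l" "B \<in> carrier_mat l l" "E \<in> carrier_mat l l" for A B E :: "int mat"
    using assoc_mult_mat[OF that] .
  have cl: "A * B \<in> carrier_mat l l" if "A \<in> carrier_mat l l" "B \<in> carrier_mat l l" for A B :: "int mat" using that by simp
  have left: "A * (B * E) = E" if "A * B = 1\<^sub>m l" "A \<in> carrier_mat l l" "B \<in> carrier_mat l l" "E \<in> carrier_mat l l" for A B E :: "int mat"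
    using as[OF that(2-4)] that by simp
  define E where "E a = mat l l (\<lambda>(r, s). if r = a \<and> s = a then 1 else 0 :: int)" for a
  have E: "E a \<in> carrier_mat l l" for a by (simp add: E_def)
  have EDE: "E a * D * E b = (if a = b then E a else 0\<^sub>m l l)" if ab: "a < l" "b < l" "D $$ (a, a) = 1" for a b
  proof (rule eq_matI)
    fix r s assume rs: "r < dim_row (if a = b then E a else 0\<^sub>m l l)" "s < dim_col (if a = b then E a else 0\<^sub>m l l)"
    hence rs: "r < l" "s < l" by (auto simp: E_def split: if_splits)
    have ED: "(E a * D) $$ (r, k) = (if r = a then D $$ (a, k) else 0)" if k: "k < l" for k
    proof -
      have "(E a * D) $$ (r, k) = (\<Sum>i<l. if i = a then (if r = a then D $$ (a, k) else 0) else 0)"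
        unfolding mat_mult_entry[OF E D(2) rs(1) k] using rs k ab by (intro sum.cong) (auto simp: E_def)
      thus ?thesis using ab by simp
    qed
    have "(E a * D * E b) $$ (r, s) = (\<Sum>k<l. (E a * D) $$ (r, k) * E b $$ (k, s))"
      by (rule mat_mult_entry[OF mult_carrier_mat[OF E D(2)] E rs])
    also have "\<dots> = (\<Sum>k<l. if k = b then (if r = a \<and> s = b then D $$ (a, b) else 0) else 0)"
    proof (rule sum.cong[OF refl])
      fix k assume "k \<in> {..<l}"
      hence k: "k < l" by simp
      have "E b $$ (k, s) = (if k = b \<and> s = b then 1 else 0)" using k rs by (simp add: E_def)
      thus "(E a * D) $$ (r, k) * E b $$ (k, s) = (if k = b then (if r = a \<and> s = b then D $$ (a, b) else 0) else 0)"
        unfolding ED[OF k] by auto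
    qed
    also have "\<dots> = (if r = a \<and> s = b then D $$ (a, b) else 0)" using ab by simp
    finally have val: "(E a * D * E b) $$ (r, s) = (if r = a \<and> s = b then D $$ (a, b) else 0)" .
    have "D $$ (a, b) = 0" if "a \<noteq> b" using D(2,3) ab(1,2) that by (simp add: diagonal_mat_def)
    thus "(E a * D * E b) $$ (r, s) = (if a = b then E a else 0\<^sub>m l l) $$ (r, s)"
      unfolding val using rs ab by (auto simp: E_def)
  qed (use D E[of a] E[of b] in \<open>auto simp: E_def\<close>)
  define X where "X a = Q * E a * P" for a
  have X: "X a \<in> carrier_mat l l" for a unfolding X_def using c E[of a] by simp
  have "X a \<noteq> 0\<^sub>m l l" if "a < l" for a
  proof
    assume "X a = 0\<^sub>m l l"
    hence "Q' * (X a * P') = 0\<^sub>m l l" using c by simp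
    moreover have "Q' * (X a * P') = E a" unfolding X_def using c E[of a] inv by (simp add: as cl left)
    ultimately have "E a $$ (a, a) = 0" using that by simp
    thus False using that by (simp add: E_def)
  qed
  moreover have "X a * C * X b = (if a = b then X a else 0\<^sub>m l l)" if "a < l" "b < l" "D $$ (a, a) = 1" for a b
  proof -
    have "X a * C * X b = Q * (E a * D * E b) * P"
      unfolding X_def D(1) using c E C by (simp add: as cl)
    thus ?thesis unfolding EDE[OF that] X_def using c by simp
  qed
  ultimately show ?thesis using X by (intro exI[of _ X]) blast
qed

section \<open>Projective bimodules of a block\<close>

text \<open>For idempotents this is isomorphism of the left ideals, see
  \<open>idem_equiv_iff_iso\<close>, in an equational form that passes to tensor products.\<close>

definition idem_equiv :: "'r::ring_1 \<Rightarrow> 'r \<Rightarrow> bool" where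
  "idem_equiv u v \<longleftrightarrow> (\<exists>a b. a * b = u \<and> b * a = v \<and> u * a = a \<and> a * v = a \<and> v * b = b \<and> b * u = b)"

lemma idem_equiv_sym: "idem_equiv u v \<Longrightarrow> idem_equiv v u"
  unfolding idem_equiv_def by blast

lemma idem_equiv_iff_iso:
  assumes u: "u * u = u" and v: "v * v = v"
  shows "idem_equiv u v \<longleftrightarrow> left_iso (left_ideal u) (left_ideal v)"
proof
  have mu: "x \<in> carrier (left_ideal u) \<longleftrightarrow> x * u = x" and mv: "x \<in> carrier (left_ideal v) \<longleftrightarrow> x * v = x" for x
    using left_ideal_mem u v by blast+
  {
    assume "idem_equiv u v"
    then obtain a b where ab: "a * b = u" "b * a = v" "u * a = a" "a * v = a" "v * b = b" "b * u = b"
      unfolding idem_equiv_def by blast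
    show "left_iso (left_ideal u) (left_ideal v)"
    proof (rule left_isoI[where f = "\<lambda>x. x * a" and g = "\<lambda>y. y * b"])
      show "left_hom (left_ideal u) (left_ideal v) (\<lambda>x. x * a)"
        using ab by (intro left_homI) (simp_all only: mv mult.assoc distrib_right left_ideal_simps(2-))
    next
      fix y assume "y \<in> carrier (left_ideal v)"
      hence "y * v = y" by (simp only: mv)
      thus "y * b * a = y" "y * b \<in> carrier (left_ideal u)" using ab by (simp_all only: mu mult.assoc)
    next
      fix x assume "x \<in> carrier (left_ideal u)"
      thus "x * a * b = x" using ab by (simp only: mu mult.assoc)
    qed
  }
  interpret U: lmod 1 "left_ideal u" by (rule lmod_left_ideal_1)
  assume iso: "left_iso (left_ideal u) (left_ideal v)"
  obtain f g where f: "left_hom (left_ideal u) (left_ideal v) f" and g: "left_hom (left_ideal v) (left_ideal u) g"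
    and gf: "\<And>x. x \<in> carrier (left_ideal u) \<Longrightarrow> g (f x) = x" and fg: "\<And>y. y \<in> carrier (left_ideal v) \<Longrightarrow> f (g y) = y"
    using left_iso_obtain[OF iso U.a_closed U.smult_closed] by blast
  have uU: "u \<in> carrier (left_ideal u)" and vV: "v \<in> carrier (left_ideal v)" using mu mv u v by blast+
  have fx: "f (x * y) = x * f y" if "y \<in> carrier (left_ideal u)" for x y using left_homD(3)[OF f that, of x] by simp
  have gx: "g (x * y) = x * g y" if "y \<in> carrier (left_ideal v)" for x y using left_homD(3)[OF g that, of x] by simp
  have a: "u * f u = f u" "f u * v = f u" using fx[OF uU, of u] u left_homD(1)[OF f uU] mv by auto
  have b: "v * g v = g v" "g v * u = g v" using gx[OF vV, of v] v left_homD(1)[OF g vV] mu by auto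
  have "f u * g v = u" using gx[OF vV, of "f u"] a gf[OF uU] by simp
  moreover have "g v * f u = v" using fx[OF uU, of "g v"] b fg[OF vV] by simp
  ultimately show "idem_equiv u v" unfolding idem_equiv_def using a b by blast
qed

lemma split_local_equiv:
  fixes l :: "'r::ring_1 \<Rightarrow> 'f::field"
  assumes "idem_equiv u v" "split_local l u" shows "\<exists>l' :: 'r \<Rightarrow> 'f. split_local l' v"
proof -
  obtain a b where "a * b = u" "b * a = v" "u * a = a" "a * v = a" "v * b = b" "b * u = b"
    using assms(1) unfolding idem_equiv_def by blast
  from split_local_transport[OF assms(2) this] show ?thesis by blast
qed

lemma idem_equiv_tensor:
  assumes "idem_equiv u v" "idem_equiv u' v'"
  shows "idem_equiv (left_emb u * right_emb u') (left_emb v * right_emb v')"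
proof -
  obtain a b where ab: "a * b = u" "b * a = v" "u * a = a" "a * v = a" "v * b = b" "b * u = b"
    using assms(1) unfolding idem_equiv_def by blast
  obtain c d where cd: "c * d = u'" "d * c = v'" "u' * c = c" "c * v' = c" "v' * d = d" "d * u' = d"
    using assms(2) unfolding idem_equiv_def by blast
  let ?a = "left_emb a * right_emb d" and ?b = "left_emb b * right_emb c"
  let ?u = "left_emb u * right_emb u'" and ?v = "left_emb v * right_emb v'"
  have "?a * ?b = ?u" "?b * ?a = ?v" "?u * ?a = ?a" "?a * ?v = ?a" "?v * ?b = ?b" "?b * ?u = ?b"
    by (simp_all only: left_right_mult ab cd)
  thus ?thesis unfolding idem_equiv_def by blast
qed

lemma split_local_idempotent:
  assumes l: "split_local l u" and f: "f \<in> corner u" "f * f = f"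
  shows "f = 0 \<or> f = u"
proof (cases "l f = 0")
  case True
  hence "nilpotent f" using l f unfolding split_local_def by blast
  thus ?thesis using nilpotent_fix_right[of f f] f by simp
next
  case False
  then obtain y where y: "y \<in> corner u" "f * y = u" using l f unfolding split_local_def by blast
  have "f = f * (f * y)" using y f by (simp add: corner_def)
  also have "\<dots> = f * y" using f by (simp flip: mult.assoc)
  finally show ?thesis using y by simp
qed

lemma split_local_nilpotent:
  assumes l: "split_local l u" and x: "x \<in> corner u" "nilpotent x"
  shows "l x = 0"
proof -
  have pw: "x ^ Suc m \<in> corner u \<and> l (x ^ Suc m) = l x ^ Suc m" for m
  proof (induction m)
    case (Suc m)
    have "l (x * x ^ Suc m) = l x * l (x ^ Suc m)" using l x Suc unfolding split_local_def by blast
    moreover have "x * x ^ Suc m \<in> corner u" using corner_mult x Suc by blast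
    ultimately show ?case using Suc by (simp only: power_Suc)
  qed (use x in simp)
  obtain m where "x ^ m = 0" using x unfolding nilpotent_def by blast
  hence "x ^ Suc m = 0" by simp
  hence "l x ^ Suc m = 0" using pw[of m] split_local_nonzero[OF l] by simp
  thus ?thesis by (rule power_eq_0_iff[THEN iffD1, THEN conjunct1])
qed

text \<open>With a non-zero residue the product would be a unit of the corner of \<open>u\<close>,
  giving \<open>a c = u\<close> with \<open>a\<close> in \<open>u R v\<close> and \<open>c\<close>
  in \<open>v R u\<close>. Then \<open>c a\<close> is a non-zero idempotent of the local corner of
  \<open>v\<close>, hence \<open>v\<close> itself, and \<open>u\<close>, \<open>v\<close> are
  equivalent.\<close>

lemma not_equiv_product:
  assumes u: "split_local l u" and v: "split_local l' v" and ne: "\<not> idem_equiv u v"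
  shows "nilpotent (u * x * v * y * u)"
proof -
  have uu: "u * u = u" "u \<noteq> 0" and vv: "v * v = v" using split_local_nonzero[OF u] split_local_nonzero[OF v] by auto
  define s where "s = u * x * v * y * u"
  have s: "s \<in> corner u" using cornerI[OF uu(1), of "x * v * y"] by (simp add: s_def mult.assoc)
  have "l s = 0"
  proof (rule ccontr)
    assume "l s \<noteq> 0"
    then obtain z where z: "z \<in> corner u" "s * z = u" using u s unfolding split_local_def by blast
    define a c where "a = u * x * v" and "c = v * y * u * z"
    have "a * c = u * x * (v * v) * y * u * z" unfolding a_def c_def by (simp only: mult.assoc)
    hence ac: "a * c = u" using z(2) by (simp add: vv s_def)
    have ua: "u * a = a" "a * v = a" unfolding a_def by (simp_all add: mult.assoc[symmetric] uu) (simp add: mult.assoc vv)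
    have vc: "v * c = c" unfolding c_def by (simp add: mult.assoc[symmetric] vv)
    have cu: "c * u = c" using z(1) unfolding c_def by (simp add: corner_def mult.assoc)
    define f where "f = c * a"
    have "f * f = c * (a * c) * a" unfolding f_def by (simp only: mult.assoc)
    hence ff: "f * f = f" by (simp add: ac mult.assoc ua f_def)
    have fc: "f \<in> corner v" unfolding corner_def f_def using vc ua by (simp add: mult.assoc) (simp flip: mult.assoc)
    have "f \<noteq> 0"
    proof
      assume "f = 0"
      have "u = (a * c) * (a * c)" using ac uu by simp
      also have "\<dots> = a * f * c" by (simp only: f_def mult.assoc)
      finally show False using \<open>f = 0\<close> uu by simp
    qed
    hence "c * a = v" using split_local_idempotent[OF v fc ff] by (simp add: f_def)
    thus False using ne ac ua vc cu unfolding idem_equiv_def by blast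
  qed
  thus ?thesis using u s unfolding split_local_def s_def by blast
qed

text \<open>Let \<open>U\<close> and \<open>V\<close> be the two products of idempotents.
  Equivalence writes \<open>U\<close> as \<open>a V b\<close>. If one pair of factors is
  inequivalent, \<open>not_equiv_product\<close> makes \<open>U x V y U\<close> nilpotent for pure
  tensors \<open>x\<close>, \<open>y\<close>; by additivity its residue is then 0 for all
  \<open>x\<close>, \<open>y\<close>, while the residue of \<open>U\<close> is 1.\<close>

lemma idem_equiv_tensorD:
  fixes u u' v v' :: "'g::{finite,group_add} \<Rightarrow>\<^sub>0 'f::field" and L :: "('g \<times> 'g \<Rightarrow>\<^sub>0 'f) \<Rightarrow> 'f"
  assumes u: "split_local l1 u" and u': "split_local l2 u'" and v: "split_local l3 v" and v': "split_local l4 v'"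
    and L: "split_local L (left_emb u * right_emb u')"
    and eq: "idem_equiv (left_emb u * right_emb u') (left_emb v * right_emb v')"
  shows "idem_equiv u v \<and> idem_equiv u' v'"
proof (rule ccontr)
  assume ne: "\<not> ?thesis"
  let ?U = "left_emb u * right_emb u'" and ?V = "left_emb v * right_emb v'"
  have UU: "?U * ?U = ?U" "L ?U = 1" "L 0 = 0" using split_local_nonzero[OF L] by auto
  have c: "?U * x * ?U \<in> corner ?U" for x by (rule cornerI[OF UU(1)])
  have L_add: "L (?U * (x + y) * ?U) = L (?U * x * ?U) + L (?U * y * ?U)" for x y
    using L c[of x] c[of y] unfolding split_local_def by (simp add: distrib_left distrib_right)
  have pure: "L (?U * ((left_emb x1 * right_emb x2) * ?V * (left_emb y1 * right_emb y2)) * ?U) = 0" for x1 x2 y1 y2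
  proof -
    have "?U * ((left_emb x1 * right_emb x2) * ?V * (left_emb y1 * right_emb y2)) * ?U =
      left_emb (u * x1 * v * y1 * u) * right_emb (u' * y2 * v' * x2 * u')"
      by (simp only: left_right_mult) (simp only: mult.assoc)
    moreover have "nilpotent (u * x1 * v * y1 * u) \<or> nilpotent (u' * y2 * v' * x2 * u')"
      using ne not_equiv_product[OF u v] not_equiv_product[OF u' v'] by blast
    ultimately have "nilpotent (?U * ((left_emb x1 * right_emb x2) * ?V * (left_emb y1 * right_emb y2)) * ?U)"
      using nilpotent_left_right by metis
    thus ?thesis by (rule split_local_nilpotent[OF L c])
  qed
  have single: "\<exists>x1 x2. Poly_Mapping.single p c = left_emb x1 * right_emb x2" for p and c :: 'f
    using single_left_right[of "fst p" "snd p" c] by auto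
  have 1: "L (?U * (Poly_Mapping.single p c * ?V * y) * ?U) = 0" for p c y
  proof (induction y rule: poly_mapping_additive_induct)
    case (1 p' c')
    obtain x1 x2 where "Poly_Mapping.single p c = left_emb x1 * right_emb x2" using single by blast
    moreover obtain y1 y2 where "Poly_Mapping.single p' c' = left_emb y1 * right_emb y2" using single by blast
    ultimately show ?case using pure by simp
  next
    case (2 y y') thus ?case using L_add by (simp add: distrib_left)
  qed
  have 2: "L (?U * (x * ?V * y) * ?U) = 0" for x y
  proof (induction x rule: poly_mapping_additive_induct)
    case (2 x x')
    have "(x + x') * ?V * y = x * ?V * y + x' * ?V * y" by (simp only: distrib_right)
    thus ?case using 2 L_add by simp
  qed (rule 1)
  obtain a b where ab: "a * b = ?U" "a * ?V = a" using eq unfolding idem_equiv_def by blast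
  have "?U * (a * ?V * b) * ?U = ?U" by (simp only: ab UU)
  thus False using 2[of a b] UU by simp
qed

lemma left_iso_direct_sum:
  assumes M: "lmod e M" and iso: "left_iso M N"
  shows "left_iso (direct_sum n (\<lambda>_. M)) (direct_sum n (\<lambda>_. N))"
proof -
  interpret M: lmod e M by fact
  obtain f g where f: "left_hom M N f" and g: "left_hom N M g"
    and gf: "\<And>x. x \<in> carrier M \<Longrightarrow> g (f x) = x" and fg: "\<And>y. y \<in> carrier N \<Longrightarrow> f (g y) = y"
    using left_iso_obtain[OF iso M.a_closed M.smult_closed] by blast
  show ?thesis
  proof (rule left_isoI[where f = "\<lambda>v. \<lambda>i\<in>{..<n}. f (v i)" and g = "\<lambda>v. \<lambda>i\<in>{..<n}. g (v i)"])
    show "left_hom (direct_sum n (\<lambda>_. M)) (direct_sum n (\<lambda>_. N)) (\<lambda>v. \<lambda>i\<in>{..<n}. f (v i))"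
      by (rule left_homI) (auto simp: direct_sum_simps PiE_iff extensional_def restrict_def fun_eq_iff left_homD[OF f])
  next
    fix y assume "y \<in> carrier (direct_sum n (\<lambda>_. N))"
    thus "(\<lambda>i\<in>{..<n}. f ((\<lambda>i\<in>{..<n}. g (y i)) i)) = y" "(\<lambda>i\<in>{..<n}. g (y i)) \<in> carrier (direct_sum n (\<lambda>_. M))"
      using fg left_homD(1)[OF g] by (auto simp: direct_sum_simps PiE_iff extensional_def restrict_def fun_eq_iff)
  next
    fix x assume "x \<in> carrier (direct_sum n (\<lambda>_. M))"
    thus "(\<lambda>i\<in>{..<n}. g ((\<lambda>i\<in>{..<n}. f (x i)) i)) = x"
      using gf by (auto simp: direct_sum_simps PiE_iff extensional_def restrict_def fun_eq_iff)
  qed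
qed

text \<open>The \<open>u k\<close> decompose the unit of the whole group algebra, with repetitions up to isomorphism; the
  \<open>\<epsilon> i\<close> represent those isomorphism classes that belong to the block.\<close>

locale block_pims =
  fixes b :: "'g::{finite,group_add} \<Rightarrow>\<^sub>0 'f::field" and l :: nat and \<epsilon> :: "nat \<Rightarrow> 'g \<Rightarrow>\<^sub>0 'f"
    and N :: nat and u T
  assumes b: "b * b = b" "\<And>x. b * x = x * b"
    and pims: "pim_idempotents b l \<epsilon>"
    and u: "(\<Sum>k<N. u k) = (1 :: 'g \<Rightarrow>\<^sub>0 'f)" "\<And>k. k < N \<Longrightarrow> split_data (u k) (T k)"
begin

definition lam :: "nat \<Rightarrow> ('g \<Rightarrow>\<^sub>0 'f) \<Rightarrow> 'f" where "lam k = (SOME l. split_local l (u k))"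

lemma lam: "k < N \<Longrightarrow> split_local (lam k) (u k)"
  unfolding lam_def using split_data_imp_split_local[OF u(2)] by (rule someI_ex)

sublocale FG: split_algebra b N u lam
proof
  show "b * b = b" "b * x = x * b" for x by (rule b)+
qed (rule u(1), rule lam)

abbreviation e2 where "e2 \<equiv> bi_idem b"

lemma e2: "e2 * e2 = e2" "e2 * x = x * e2"
proof -
  show "e2 * e2 = e2" unfolding bi_idem_def by (simp add: left_right_mult b(1))
  show "e2 * x = x * e2"
  proof (induction x rule: poly_mapping_additive_induct)
    case (1 p c)
    have "Poly_Mapping.single p c = left_emb (Poly_Mapping.single (fst p) c) * right_emb (Poly_Mapping.single (- snd p) 1)"
      using single_left_right[of "fst p" "snd p" c] by simp
    thus ?case unfolding bi_idem_def by (simp only: left_right_mult b(2))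
  qed (simp add: distrib_left distrib_right)
qed

text \<open>\<open>split_algebra\<close> numbers its idempotents by an initial segment of the
  naturals, so the pairs of indices have to be enumerated.\<close>

definition pairing :: "nat \<Rightarrow> nat \<times> nat" where
  "pairing = (SOME h. bij_betw h {..<N * N} ({..<N} \<times> {..<N}))"

lemma pairing: "bij_betw pairing {..<N * N} ({..<N} \<times> {..<N})"
proof -
  have "\<exists>h. bij_betw h {..<N * N} ({..<N} \<times> {..<N})"
    using ex_bij_betw_nat_finite[of "{..<N} \<times> {..<N}"] by (simp add: lessThan_atLeast0)
  thus ?thesis unfolding pairing_def by (rule someI_ex)
qed

definition u2 :: "nat \<Rightarrow> ('g \<times> 'g \<Rightarrow>\<^sub>0 'f)" where
  "u2 k = left_emb (u (fst (pairing k))) * right_emb (u (snd (pairing k)))"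

lemma u2_tensor: "i < N \<Longrightarrow> j < N \<Longrightarrow> \<exists>L :: ('g \<times> 'g \<Rightarrow>\<^sub>0 'f) \<Rightarrow> 'f. split_local L (left_emb (u i) * right_emb (u j))"
  using split_data_imp_split_local[OF split_data_tensor[OF u(2) u(2)]] by blast

definition lam2 :: "nat \<Rightarrow> ('g \<times> 'g \<Rightarrow>\<^sub>0 'f) \<Rightarrow> 'f" where "lam2 k = (SOME l. split_local l (u2 k))"

sublocale FGG: split_algebra e2 "N * N" u2 lam2
proof
  have "(\<Sum>k<N * N. u2 k) = (\<Sum>p\<in>{..<N} \<times> {..<N}. left_emb (u (fst p)) * right_emb (u (snd p)))"
    unfolding u2_def by (rule sum.reindex_bij_betw[OF pairing])
  also have "\<dots> = (\<Sum>i<N. left_emb (u i)) * (\<Sum>j<N. right_emb (u j))"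
    by (simp add: sum.cartesian_product sum_product case_prod_unfold)
  finally show "(\<Sum>k<N * N. u2 k) = 1"
    by (simp add: u(1) left_emb_1 right_emb_1 flip: left_emb_sum right_emb_sum)
  show "split_local (lam2 k) (u2 k)" if "k < N * N" for k
  proof -
    have "pairing k \<in> {..<N} \<times> {..<N}" using pairing that by (auto simp: bij_betw_def)
    hence "\<exists>L :: ('g \<times> 'g \<Rightarrow>\<^sub>0 'f) \<Rightarrow> 'f. split_local L (u2 k)" unfolding u2_def by (intro u2_tensor) auto
    thus ?thesis unfolding lam2_def by (rule someI_ex)
  qed
  show "e2 * e2 = e2" "e2 * x = x * e2" for x by (rule e2)+
qed

lemma eps: "i < l \<Longrightarrow> \<epsilon> i * \<epsilon> i = \<epsilon> i" "i < l \<Longrightarrow> \<epsilon> i * b = \<epsilon> i" "i < l \<Longrightarrow> indec_projective b (left_ideal (\<epsilon> i))"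
  "i < l \<Longrightarrow> j < l \<Longrightarrow> left_iso (left_ideal (\<epsilon> i)) (left_ideal (\<epsilon> j)) \<Longrightarrow> i = j"
proof -
  show "\<epsilon> i * \<epsilon> i = \<epsilon> i" "indec_projective b (left_ideal (\<epsilon> i))" if "i < l" for i
    using pims that unfolding pim_idempotents_def primitive_idempotent_def by auto
  show "\<epsilon> i * b = \<epsilon> i" if "i < l"
  proof -
    have "\<epsilon> i \<in> block b" using pims that unfolding pim_idempotents_def primitive_idempotent_def by blast
    then obtain x where "\<epsilon> i = x * b" unfolding block_def by blast
    thus ?thesis using b(1) by (simp add: mult.assoc)
  qed
  show "i < l \<Longrightarrow> j < l \<Longrightarrow> left_iso (left_ideal (\<epsilon> i)) (left_ideal (\<epsilon> j)) \<Longrightarrow> i = j"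
    using pims unfolding pim_idempotents_def by blast
qed

lemma u_idem: "k < N \<Longrightarrow> u k * u k = u k" using u(2) unfolding split_data_def by blast

lemma eps_equiv: "i < l \<Longrightarrow> \<exists>k<N. idem_equiv (u k) (\<epsilon> i)"
  using FG.classify[OF eps(3)] idem_equiv_iff_iso[OF eps(1) u_idem] idem_equiv_sym by blast

text \<open>\<open>b u k\<close> is an idempotent of a local corner, so it equals \<open>u k\<close>
  if it is not 0, and \<open>u k\<close> generates an indecomposable projective module of the block.
  Completeness of the list speaks of modules on \<open>nat \<Rightarrow> 'f\<close> and is applied
  to a copy.\<close>

lemma u_equiv_eps:
  assumes k: "k < N" and bu: "b * u k \<noteq> 0"
  shows "\<exists>i<l. idem_equiv (u k) (\<epsilon> i)"
proof -
  have uu: "u k * u k = u k" by (rule u_idem[OF k])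
  have "u k * (b * u k) = (b * u k) * u k" by (simp only: b(2) mult.assoc)
  hence c: "(b * u k) * u k = b * u k" "u k * (b * u k) = b * u k" using uu by (simp_all only: mult.assoc)
  hence "b * u k \<in> corner (u k)" unfolding corner_def by simp
  moreover have "(b * u k) * (b * u k) = b * (u k * (b * u k))" by (simp only: mult.assoc)
  hence "(b * u k) * (b * u k) = b * u k" unfolding c(2) by (simp add: b(1) flip: mult.assoc)
  ultimately have "b * u k = u k" using split_local_idempotent[OF lam[OF k]] bu by blast
  hence P: "indec_projective b (left_ideal (u k))" by (rule indec_projective_left_ideal[OF b _ lam[OF k]])
  have L: "lmod b (left_ideal (u k))" using FG.indec_lmod P by blast
  obtain M :: "('g \<Rightarrow>\<^sub>0 'f, nat \<Rightarrow> 'f) module" where M: "lmod b M" "left_iso M (left_ideal (u k))"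
    using left_ideal_copy[OF L] by blast
  have "indec_projective b M" by (rule indec_projective_iso[OF M P])
  then obtain i where i: "i < l" "left_iso M (left_ideal (\<epsilon> i))" using pims unfolding pim_idempotents_def by blast
  have "left_iso (left_ideal (u k)) (left_ideal (\<epsilon> i))" by (rule left_iso_trans[OF left_iso_sym[OF M] i(2)])
  thus ?thesis using idem_equiv_iff_iso[OF uu eps(1)[OF i(1)]] i(1) by blast
qed

text \<open>The idempotent whose left ideal is the bimodule
  \<open>B \<epsilon>_i \<otimes> \<epsilon>_j B\<close>.\<close>

definition E :: "nat \<Rightarrow> nat \<Rightarrow> ('g \<times> 'g \<Rightarrow>\<^sub>0 'f)" where "E i j = left_emb (\<epsilon> i) * right_emb (\<epsilon> j)"

lemma E_idem: "i < l \<Longrightarrow> j < l \<Longrightarrow> E i j * E i j = E i j"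
  unfolding E_def by (simp add: left_right_mult eps)

text \<open>The certificates belong to the \<open>u k\<close>; locality reaches the
  \<open>\<epsilon> i\<close> and their products along equivalence of idempotents.\<close>

lemma E_local: "i < l \<Longrightarrow> j < l \<Longrightarrow> \<exists>L :: ('g \<times> 'g \<Rightarrow>\<^sub>0 'f) \<Rightarrow> 'f. split_local L (E i j)"
  unfolding E_def using eps_equiv[of i] eps_equiv[of j] idem_equiv_tensor u2_tensor split_local_equiv by metis

lemma eps_local: "i < l \<Longrightarrow> \<exists>L :: ('g \<Rightarrow>\<^sub>0 'f) \<Rightarrow> 'f. split_local L (\<epsilon> i)"
  using eps_equiv[of i] lam split_local_equiv by metis

lemma E_indec: "i < l \<Longrightarrow> j < l \<Longrightarrow> indec_projective e2 (left_ideal (E i j))"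
proof -
  assume ij: "i < l" "j < l"
  obtain L :: "('g \<times> 'g \<Rightarrow>\<^sub>0 'f) \<Rightarrow> 'f" where L: "split_local L (E i j)" using E_local ij by blast
  have "e2 * E i j = E i j" unfolding bi_idem_def E_def left_right_mult using eps(2) ij b(2)[of "\<epsilon> i"] by simp
  thus ?thesis by (rule indec_projective_left_ideal[OF e2 _ L])
qed

definition P :: "nat \<Rightarrow> nat \<Rightarrow> ('g \<times> 'g \<Rightarrow>\<^sub>0 'f, nat \<Rightarrow> 'f) module set" where
  "P i j = iso_class e2 (left_ideal (E i j))"

lemma P_rep:
  assumes "i < l" "j < l"
  shows "\<exists>M :: ('g \<times> 'g \<Rightarrow>\<^sub>0 'f, nat \<Rightarrow> 'f) module. lmod e2 M \<and> left_iso M (left_ideal (E i j)) \<and> indec_projective e2 M \<and> iso_class e2 M = P i j"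
proof -
  have L: "lmod e2 (left_ideal (E i j))" using FGG.indec_lmod E_indec assms by blast
  obtain M :: "('g \<times> 'g \<Rightarrow>\<^sub>0 'f, nat \<Rightarrow> 'f) module" where M: "lmod e2 M" "left_iso M (left_ideal (E i j))"
    using left_ideal_copy[OF L] by blast
  have "iso_class e2 M = P i j"
    unfolding P_def iso_class_def using left_iso_trans[OF _ M(2)] left_iso_trans[OF _ left_iso_sym[OF M]] by blast
  thus ?thesis using M indec_projective_iso[OF M E_indec[OF assms]] by blast
qed

text \<open>An isomorphism makes the two products of idempotents equivalent, hence also their
  factors by \<open>idem_equiv_tensorD\<close>; but the \<open>\<epsilon> i\<close> are pairwise
  inequivalent.\<close>

lemma P_inj:
  assumes ij: "i < l" "j < l" "i' < l" "j' < l" and eq: "P i j = P i' j'"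
  shows "i = i' \<and> j = j'"
proof -
  obtain M :: "('g \<times> 'g \<Rightarrow>\<^sub>0 'f, nat \<Rightarrow> 'f) module" where M: "lmod e2 M" "left_iso M (left_ideal (E i j))" "iso_class e2 M = P i j" using P_rep ij by blast
  have "M \<in> P i' j'" using M eq lmod_left_module[OF M(1)] left_iso_refl unfolding iso_class_def by blast
  hence "left_iso M (left_ideal (E i' j'))" unfolding P_def iso_class_def by blast
  hence "left_iso (left_ideal (E i j)) (left_ideal (E i' j'))" using left_iso_trans[OF left_iso_sym[OF M(1,2)]] by blast
  hence *: "idem_equiv (E i j) (E i' j')" using idem_equiv_iff_iso E_idem ij by blast
  obtain L :: "('g \<times> 'g \<Rightarrow>\<^sub>0 'f) \<Rightarrow> 'f" where L: "split_local L (E i j)" using E_local ij by blast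
  obtain l1 l2 l3 l4 :: "('g \<Rightarrow>\<^sub>0 'f) \<Rightarrow> 'f" where
    "split_local l1 (\<epsilon> i)" "split_local l2 (\<epsilon> j)" "split_local l3 (\<epsilon> i')" "split_local l4 (\<epsilon> j')"
    using eps_local ij by metis
  hence "idem_equiv (\<epsilon> i) (\<epsilon> i') \<and> idem_equiv (\<epsilon> j) (\<epsilon> j')"
    using idem_equiv_tensorD L * unfolding E_def by blast
  thus ?thesis using idem_equiv_iff_iso eps(1,4) ij by blast
qed

lemma classes: "indec_projective_classes e2 = {P i j | i j. i < l \<and> j < l}"
proof
  show "{P i j | i j. i < l \<and> j < l} \<subseteq> indec_projective_classes e2"
  proof
    fix X assume "X \<in> {P i j | i j. i < l \<and> j < l}"
    then obtain i j where ij: "i < l" "j < l" "X = P i j" by blast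
    obtain M :: "('g \<times> 'g \<Rightarrow>\<^sub>0 'f, nat \<Rightarrow> 'f) module" where "indec_projective e2 M" "iso_class e2 M = P i j" using P_rep[OF ij(1,2)] by blast
    thus "X \<in> indec_projective_classes e2" unfolding indec_projective_classes_def using ij(3) by blast
  qed
  show "indec_projective_classes e2 \<subseteq> {P i j | i j. i < l \<and> j < l}"
  proof
    fix X assume "X \<in> indec_projective_classes e2"
    then obtain M :: "('g \<times> 'g \<Rightarrow>\<^sub>0 'f, nat \<Rightarrow> 'f) module" where M: "indec_projective e2 M" "X = iso_class e2 M" unfolding indec_projective_classes_def by blast
    have L: "lmod e2 M" using FGG.indec_lmod M by blast
    interpret M: lmod e2 M by (rule L)
    obtain k where k: "k < N * N" "left_iso M (left_ideal (u2 k))" using FGG.classify[OF M(1)] by blast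
    define i j where "i = fst (pairing k)" and "j = snd (pairing k)"
    have "pairing k \<in> {..<N} \<times> {..<N}" using pairing k by (auto simp: bij_betw_def)
    hence ij: "i < N" "j < N" by (auto simp: i_def j_def)
    have uk: "u2 k = left_emb (u i) * right_emb (u j)" by (simp add: u2_def i_def j_def)
    have kk: "u2 k * u2 k = u2 k" "u2 k \<noteq> 0" using split_local_nonzero[OF FGG.u(2)[OF k(1)]] by auto
    obtain f g where f: "left_hom M (left_ideal (u2 k)) f" and g: "left_hom (left_ideal (u2 k)) M g"
      and gf: "\<And>x. x \<in> carrier M \<Longrightarrow> g (f x) = x" and fg: "\<And>y. y \<in> carrier (left_ideal (u2 k)) \<Longrightarrow> f (g y) = y"
      using left_iso_obtain[OF k(2) M.a_closed M.smult_closed] by blast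
    have uU: "u2 k \<in> carrier (left_ideal (u2 k))" using left_ideal_mem[OF kk(1)] kk by blast
    have gu: "g (u2 k) \<in> carrier M" by (rule left_homD(1)[OF g uU])
    \<comment> \<open>\<open>e2\<close> acts as the identity on \<open>M\<close>, hence on the
      generator of the isomorphic left ideal. So neither \<open>b u i\<close> nor
      \<open>b u j\<close> is 0, and both idempotents belong to the block.\<close>
    have "e2 * u2 k = u2 k"
      using left_homD(3)[OF f gu, of e2] M.smult_e[OF gu] fg[OF uU] by simp
    hence nz: "left_emb (b * u i) * right_emb (u j * b) \<noteq> 0" using kk unfolding bi_idem_def uk left_right_mult by simp
    have "b * u i \<noteq> 0" using nz by (auto simp: left_emb_0)
    moreover have "b * u j \<noteq> 0" using nz b(2)[of "u j"] by (auto simp: right_emb_0)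
    ultimately obtain i' j' where i': "i' < l" "idem_equiv (u i) (\<epsilon> i')" "j' < l" "idem_equiv (u j) (\<epsilon> j')"
      using u_equiv_eps ij by metis
    have "idem_equiv (u2 k) (E i' j')" unfolding uk E_def by (rule idem_equiv_tensor[OF i'(2,4)])
    hence iso: "left_iso M (left_ideal (E i' j'))"
      using left_iso_trans[OF k(2)] idem_equiv_iff_iso[OF kk(1) E_idem[OF i'(1,3)]] by blast
    have "X = P i' j'"
      unfolding M(2) P_def iso_class_def using left_iso_trans[OF _ iso] left_iso_trans[OF _ left_iso_sym[OF L iso]] by blast
    thus "X \<in> {P i j | i j. i < l \<and> j < l}" using i' by blast
  qed
qed

definition cartan :: "nat \<Rightarrow> nat \<Rightarrow> int" where
  "cartan i j = int (group_algebra_dim {\<epsilon> i * x * \<epsilon> j | x. True})"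

lemma cartan_matrix_entry: "i < l \<Longrightarrow> j < l \<Longrightarrow> cartan_matrix b l \<epsilon> $$ (i, j) = cartan i j"
proof -
  assume ij: "i < l" "j < l"
  have "{\<epsilon> i * x * \<epsilon> j | x. x \<in> block b} = {\<epsilon> i * x * \<epsilon> j | x. True}"
  proof (intro Set.set_eqI iffI)
    fix y assume "y \<in> {\<epsilon> i * x * \<epsilon> j | x. True}"
    then obtain x where "y = \<epsilon> i * x * \<epsilon> j" by blast
    also have "\<dots> = \<epsilon> i * (x * b) * \<epsilon> j" using eps(2)[OF ij(2)] b(2)[of "\<epsilon> j"] by (simp add: mult.assoc)
    finally show "y \<in> {\<epsilon> i * x * \<epsilon> j | x. x \<in> block b}" unfolding block_def by blast
  qed blast
  thus ?thesis using ij by (simp add: cartan_matrix_def cartan_def)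
qed

text \<open>The inner pair \<open>\<epsilon>_j\<close>, \<open>\<epsilon>_k\<close> contributes its
  Cartan number. As \<open>tensor_iso\<close> accepts arbitrary isomorphic copies, any
  representatives chosen by \<open>SOME\<close> will do.\<close>

lemma Pr_mult_basis:
  assumes ij: "i < l" "j < l" "k < l" "m < l"
  shows "Pr_mult b (frag_of (P i j)) (frag_of (P k m)) = frag_cmul (cartan j k) (frag_of (P i m))"
proof -
  define s where "s = group_algebra_dim {\<epsilon> j * x * \<epsilon> k | x. True}"
  define M where "M = (SOME M. M \<in> P i j)"
  define Q where "Q = (SOME M. M \<in> P k m)"
  have some: "(SOME M. M \<in> P i j) \<in> P i j" if "i < l" "j < l" for i j
  proof -
    obtain M :: "('g \<times> 'g \<Rightarrow>\<^sub>0 'f, nat \<Rightarrow> 'f) module" where "lmod e2 M" "iso_class e2 M = P i j" using P_rep \<open>i < l\<close> \<open>j < l\<close> by blast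
    hence "M \<in> P i j" using lmod_left_module left_iso_refl unfolding iso_class_def by blast
    thus ?thesis by (rule someI)
  qed
  have M: "lmod e2 M" "left_iso M (left_ideal (E i j))"
    using some[of i j] ij lmodI unfolding P_def iso_class_def M_def by blast+
  have Q: "lmod e2 Q" "left_iso Q (left_ideal (E k m))"
    using some[of k m] ij lmodI unfolding P_def iso_class_def Q_def by blast+
  interpret TP: tensor_product e2 e2 M Q unfolding tensor_product_def using M Q by blast
  obtain R :: "('g \<times> 'g \<Rightarrow>\<^sub>0 'f, nat \<Rightarrow> 'f) module" where R: "lmod e2 R" "left_iso R (left_ideal (E i m))" "indec_projective e2 R" "iso_class e2 R = P i m"
    using P_rep ij by blast
  have L: "lmod e2 (left_ideal (E i m))" using FGG.indec_lmod E_indec ij by blast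
  have "left_iso (tensor M Q) (direct_sum s (\<lambda>_. left_ideal (E i m)))"
    unfolding E_def by (rule TP.tensor_iso[OF M(2)[unfolded E_def] Q(2)[unfolded E_def]]) (use eps ij s_def in auto)
  hence iso: "left_iso (tensor M Q) (direct_sum s (\<lambda>_. R))"
    by (rule left_iso_trans[OF _ left_iso_direct_sum[OF L left_iso_sym[OF R(1,2)]]])
  have "module_class e2 (tensor M Q) = (\<Sum>t<s. frag_of (iso_class e2 R))"
    by (rule FGG.module_class_eqI[OF R(3) iso TP.tensor_closed])
  also have "\<dots> = frag_cmul (cartan j k) (frag_of (P i m))"
    unfolding R(4) cartan_def s_def[symmetric] by (rule poly_mapping_eqI) (simp add: lookup_sum)
  finally show ?thesis unfolding Pr_mult_def M_def Q_def by simp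
qed

section \<open>The matrix model of \<open>Pr b\<close>\<close>

definition of_matrix :: "int mat \<Rightarrow> (('g \<times> 'g \<Rightarrow>\<^sub>0 'f, nat \<Rightarrow> 'f) module set \<Rightarrow>\<^sub>0 int)" where
  "of_matrix X = (\<Sum>i<l. \<Sum>j<l. frag_cmul (X $$ (i, j)) (frag_of (P i j)))"

definition to_matrix :: "(('g \<times> 'g \<Rightarrow>\<^sub>0 'f, nat \<Rightarrow> 'f) module set \<Rightarrow>\<^sub>0 int) \<Rightarrow> int mat" where
  "to_matrix x = mat l l (\<lambda>(i, j). Poly_Mapping.lookup x (P i j))"

lemma lookup_of_matrix: "i < l \<Longrightarrow> j < l \<Longrightarrow> Poly_Mapping.lookup (of_matrix X) (P i j) = X $$ (i, j)"
proof -
  assume ij: "i < l" "j < l"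
  have "Poly_Mapping.lookup (of_matrix X) (P i j) = (\<Sum>i'<l. \<Sum>j'<l. if i' = i \<and> j' = j then X $$ (i, j) else 0)"
    unfolding of_matrix_def lookup_sum lookup_frag_cmul lookup_frag_of
    using P_inj[OF ij] by (intro sum.cong refl) auto
  also have "\<dots> = (\<Sum>i'<l. if i' = i then X $$ (i, j) else 0)"
    using ij by (intro sum.cong refl) auto
  finally show ?thesis using ij by simp
qed

lemma of_matrix_Pr: "of_matrix X \<in> Pr b"
  unfolding Pr_def of_matrix_def
proof (intro sum_closed_free_Abelian_group)
  fix i j assume "i \<in> {..<l}" "j \<in> {..<l}"
  hence "P i j \<in> indec_projective_classes e2" unfolding classes by blast
  thus "frag_cmul (X $$ (i, j)) (frag_of (P i j)) \<in> carrier (free_Abelian_group (indec_projective_classes e2))"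
    using keys_cmul[of "X $$ (i, j)" "frag_of (P i j)"] by (auto simp: keys_frag_of)
qed

lemma Pr_eqI:
  assumes "x \<in> Pr b" "y \<in> Pr b" "\<And>i j. i < l \<Longrightarrow> j < l \<Longrightarrow> Poly_Mapping.lookup x (P i j) = Poly_Mapping.lookup y (P i j)"
  shows "x = y"
proof (rule poly_mapping_eqI)
  fix X show "Poly_Mapping.lookup x X = Poly_Mapping.lookup y X"
  proof (cases "X \<in> indec_projective_classes e2")
    case True thus ?thesis using assms(3) unfolding classes by blast
  next
    case False
    hence "X \<notin> Poly_Mapping.keys x" "X \<notin> Poly_Mapping.keys y" using assms(1,2) unfolding Pr_def by auto
    thus ?thesis by (simp add: in_keys_iff)
  qed
qed

lemma of_to_matrix: "x \<in> Pr b \<Longrightarrow> of_matrix (to_matrix x) = x"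
  by (rule Pr_eqI[OF of_matrix_Pr]) (simp_all add: lookup_of_matrix to_matrix_def)

lemma to_matrix_carrier: "to_matrix x \<in> carrier_mat l l" by (simp add: to_matrix_def)

lemma Pr_mult_of_matrix:
  assumes X: "X \<in> carrier_mat l l" and Y: "Y \<in> carrier_mat l l"
  shows "Pr_mult b (of_matrix X) (of_matrix Y) = of_matrix (X * cartan_matrix b l \<epsilon> * Y)"
proof -
  let ?C = "cartan_matrix b l \<epsilon>"
  have C: "?C \<in> carrier_mat l l" by (simp add: cartan_matrix_def)
  have basis: "module_class e2 (tensor (SOME M. M \<in> P i j) (SOME M. M \<in> P k m)) = frag_cmul (cartan j k) (frag_of (P i m))"
    if "i < l" "j < l" "k < l" "m < l" for i j k m
    using Pr_mult_basis[OF that] unfolding Pr_mult_def by simp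
  have "Pr_mult b (of_matrix X) (of_matrix Y) =
    (\<Sum>i<l. \<Sum>j<l. frag_cmul (X $$ (i, j)) (\<Sum>k<l. \<Sum>m<l. frag_cmul (Y $$ (k, m))
      (module_class e2 (tensor (SOME M. M \<in> P i j) (SOME M. M \<in> P k m)))))"
    unfolding Pr_mult_def of_matrix_def by (simp add: frag_extend_sum frag_extend_cmul)
  also have "\<dots> = (\<Sum>i<l. \<Sum>j<l. \<Sum>k<l. \<Sum>m<l. frag_cmul (X $$ (i, j) * Y $$ (k, m) * cartan j k) (frag_of (P i m)))"
    by (intro sum.cong refl) (simp add: frag_cmul_sum basis mult.assoc)
  finally have "Pr_mult b (of_matrix X) (of_matrix Y) =
    (\<Sum>i<l. \<Sum>j<l. \<Sum>k<l. \<Sum>m<l. frag_cmul (X $$ (i, j) * Y $$ (k, m) * cartan j k) (frag_of (P i m)))" .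
  moreover have "Poly_Mapping.lookup (\<Sum>i<l. \<Sum>j<l. \<Sum>k<l. \<Sum>m<l. frag_cmul (X $$ (i, j) * Y $$ (k, m) * cartan j k) (frag_of (P i m))) (P i0 m0)
    = (X * ?C * Y) $$ (i0, m0)" if im: "i0 < l" "m0 < l" for i0 m0
  proof -
    have "Poly_Mapping.lookup (\<Sum>i<l. \<Sum>j<l. \<Sum>k<l. \<Sum>m<l. frag_cmul (X $$ (i, j) * Y $$ (k, m) * cartan j k) (frag_of (P i m))) (P i0 m0)
      = (\<Sum>i<l. \<Sum>j<l. \<Sum>k<l. \<Sum>m<l. if m = m0 then (if i = i0 then X $$ (i0, j) * Y $$ (k, m0) * cartan j k else 0) else 0)"
      unfolding lookup_sum lookup_frag_cmul lookup_frag_of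
    proof (intro sum.cong refl)
      fix i j k m assume "i \<in> {..<l}" "m \<in> {..<l}"
      hence "P i m = P i0 m0 \<longleftrightarrow> i = i0 \<and> m = m0" using P_inj[OF im, of i m] by fastforce
      thus "X $$ (i, j) * Y $$ (k, m) * cartan j k * (if P i0 m0 = P i m then 1 else 0) =
        (if m = m0 then (if i = i0 then X $$ (i0, j) * Y $$ (k, m0) * cartan j k else 0) else 0)"
        by (cases "i = i0"; cases "m = m0") (simp_all add: eq_commute[of "P i0 m0"])
    qed
    also have "\<dots> = (\<Sum>i<l. if i = i0 then (\<Sum>j<l. \<Sum>k<l. X $$ (i0, j) * Y $$ (k, m0) * cartan j k) else 0)"
      using im by (intro sum.cong refl) auto
    also have "\<dots> = (\<Sum>j<l. \<Sum>k<l. X $$ (i0, j) * Y $$ (k, m0) * cartan j k)" using im by simp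
    also have "\<dots> = (\<Sum>k<l. \<Sum>j<l. X $$ (i0, j) * Y $$ (k, m0) * cartan j k)" by (rule sum.swap)
    also have "\<dots> = (\<Sum>k<l. (X * ?C) $$ (i0, k) * Y $$ (k, m0))"
      using mat_mult_entry[OF X C im(1)] cartan_matrix_entry
      by (intro sum.cong refl) (simp add: sum_distrib_left sum_distrib_right mult_ac)
    also have "\<dots> = (X * ?C * Y) $$ (i0, m0)"
      by (rule mat_mult_entry[OF mult_carrier_mat[OF X C] Y im, symmetric])
    finally show ?thesis .
  qed
  moreover have "(\<Sum>i<l. \<Sum>j<l. \<Sum>k<l. \<Sum>m<l. frag_cmul (X $$ (i, j) * Y $$ (k, m) * cartan j k) (frag_of (P i m))) \<in> Pr b"
    unfolding Pr_def
  proof (intro sum_closed_free_Abelian_group)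
    fix i j k m assume "i \<in> {..<l}" "m \<in> {..<l}"
    hence "P i m \<in> indec_projective_classes e2" unfolding classes by blast
    thus "frag_cmul (X $$ (i, j) * Y $$ (k, m) * cartan j k) (frag_of (P i m)) \<in> carrier (free_Abelian_group (indec_projective_classes e2))"
      using keys_cmul[of "X $$ (i, j) * Y $$ (k, m) * cartan j k" "frag_of (P i m)"] by (auto simp: keys_frag_of)
  qed
  ultimately show ?thesis using lookup_of_matrix by (intro Pr_eqI[OF _ of_matrix_Pr]) auto
qed

lemma of_matrix_inj: "X \<in> carrier_mat l l \<Longrightarrow> Y \<in> carrier_mat l l \<Longrightarrow> of_matrix X = of_matrix Y \<Longrightarrow> X = Y"
proof (rule eq_matI)
  fix i j assume "X \<in> carrier_mat l l" "Y \<in> carrier_mat l l" "of_matrix X = of_matrix Y" "i < dim_row Y" "j < dim_col Y"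
  thus "X $$ (i, j) = Y $$ (i, j)" using lookup_of_matrix[of i j X] lookup_of_matrix[of i j Y] by simp
qed auto

lemma of_matrix_0: "of_matrix (0\<^sub>m l l) = 0"
  unfolding of_matrix_def by simp

lemma orthogonal_idempotents_exist:
  assumes smith: "smith_normal_form_of (cartan_matrix b l \<epsilon>) D"
  shows "\<exists>F. Pr_orthogonal_idempotents b F \<and> finite F \<and> card F = card {i. i < l \<and> D $$ (i, i) = 1}"
proof -
  let ?C = "cartan_matrix b l \<epsilon>" and ?I = "{i. i < l \<and> D $$ (i, i) = 1}"
  have C: "?C \<in> carrier_mat l l" by (simp add: cartan_matrix_def)
  obtain X where X: "\<And>a. a \<in> ?I \<Longrightarrow> X a \<in> carrier_mat l l" "\<And>a. a \<in> ?I \<Longrightarrow> X a \<noteq> 0\<^sub>m l l"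
    "\<And>a b. a \<in> ?I \<Longrightarrow> b \<in> ?I \<Longrightarrow> X a * ?C * X b = (if a = b then X a else 0\<^sub>m l l)"
    using orthogonal_matrices_exist[OF C smith] by blast
  have nz: "of_matrix (X a) \<noteq> 0" if "a \<in> ?I" for a
    using of_matrix_inj[OF X(1)[OF that], of "0\<^sub>m l l"] X(2)[OF that] of_matrix_0 by auto
  have prod: "Pr_mult b (of_matrix (X a)) (of_matrix (X c)) = (if a = c then of_matrix (X a) else 0)"
    if "a \<in> ?I" "c \<in> ?I" for a c
    unfolding Pr_mult_of_matrix[OF X(1)[OF that(1)] X(1)[OF that(2)]] X(3)[OF that] by (simp add: of_matrix_0)
  have "inj_on (\<lambda>a. of_matrix (X a)) ?I"
  proof (rule inj_onI, rule ccontr)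
    fix a c assume ac: "a \<in> ?I" "c \<in> ?I" "of_matrix (X a) = of_matrix (X c)" "a \<noteq> c"
    have "of_matrix (X a) = 0" using prod[OF ac(1,1)] prod[OF ac(1,2)] ac(3,4) by simp
    thus False using nz[OF ac(1)] by simp
  qed
  hence "card ((\<lambda>a. of_matrix (X a)) ` ?I) = card ?I" by (rule card_image)
  moreover have "Pr_orthogonal_idempotents b ((\<lambda>a. of_matrix (X a)) ` ?I)"
    unfolding Pr_orthogonal_idempotents_def
  proof (intro conjI ballI impI)
    show "(\<lambda>a. of_matrix (X a)) ` ?I \<subseteq> Pr b" using of_matrix_Pr by blast
    fix x assume "x \<in> (\<lambda>a. of_matrix (X a)) ` ?I"
    then obtain a where a: "a \<in> ?I" "x = of_matrix (X a)" by blast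
    show "x \<noteq> 0" "Pr_mult b x x = x" using nz[OF a(1)] prod[OF a(1) a(1)] a(2) by auto
    fix y assume "y \<in> (\<lambda>a. of_matrix (X a)) ` ?I" "x \<noteq> y"
    then obtain c where c: "c \<in> ?I" "y = of_matrix (X c)" "a \<noteq> c" using a by blast
    show "Pr_mult b x y = 0" using prod[OF a(1) c(1)] a(2) c(2,3) by simp
  qed
  ultimately show ?thesis by (intro exI[of _ "(\<lambda>a. of_matrix (X a)) ` ?I"]) auto
qed

lemma orthogonal_idempotents_bound:
  assumes smith: "smith_normal_form_of (cartan_matrix b l \<epsilon>) D" and F: "Pr_orthogonal_idempotents b F"
  shows "finite F \<and> card F \<le> card {i. i < l \<and> D $$ (i, i) = 1}"
proof -
  let ?C = "cartan_matrix b l \<epsilon>" and ?I = "{i. i < l \<and> D $$ (i, i) = 1}"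
  have C: "?C \<in> carrier_mat l l" by (simp add: cartan_matrix_def)
  have EP: "\<And>x. x \<in> F \<Longrightarrow> x \<in> Pr b" and Enz: "\<And>x. x \<in> F \<Longrightarrow> x \<noteq> 0" and Ei: "\<And>x. x \<in> F \<Longrightarrow> Pr_mult b x x = x"
    and Eo: "\<And>x y. x \<in> F \<Longrightarrow> y \<in> F \<Longrightarrow> x \<noteq> y \<Longrightarrow> Pr_mult b x y = 0"
    using F unfolding Pr_orthogonal_idempotents_def by blast+
  \<comment> \<open>The bound is proved for finite subsets first; finiteness of \<open>F\<close> is
    a consequence of it.\<close>
  have le: "card S \<le> card ?I" if S: "finite S" "S \<subseteq> F" for S
  proof (rule orthogonal_matrices_bound[OF C smith S(1), of to_matrix])
    fix x assume x: "x \<in> S"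
    show "to_matrix x \<in> carrier_mat l l" by (rule to_matrix_carrier)
    show "to_matrix x \<noteq> 0\<^sub>m l l" using of_to_matrix[of x] of_matrix_0 EP Enz x S(2) by force
    fix y assume y: "y \<in> S"
    have xy: "of_matrix (to_matrix x) = x" "of_matrix (to_matrix y) = y" using of_to_matrix EP x y S(2) by blast+
    have "of_matrix (to_matrix x * ?C * to_matrix y) = Pr_mult b x y"
      using Pr_mult_of_matrix[OF to_matrix_carrier to_matrix_carrier, of x y] xy by simp
    also have "\<dots> = of_matrix (if x = y then to_matrix x else 0\<^sub>m l l)"
      using Ei[of x] Eo[of x y] x y S(2) xy by (auto simp: of_matrix_0)
    finally show "to_matrix x * ?C * to_matrix y = (if x = y then to_matrix x else 0\<^sub>m l l)"
      by (rule of_matrix_inj[rotated 2]) (use C to_matrix_carrier[of x] to_matrix_carrier[of y] in auto)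
  qed
  have "finite F"
  proof (rule ccontr)
    assume "infinite F"
    then obtain S where "S \<subseteq> F" "finite S" "card S = Suc (card ?I)" using infinite_arbitrarily_large by blast
    thus False using le[of S] by simp
  qed
  thus ?thesis using le by blast
qed

end

theorem theoremA:
  fixes b :: "'g::{finite,group_add} \<Rightarrow>\<^sub>0 'f::field"
    and \<epsilon> :: "nat \<Rightarrow> 'g \<Rightarrow>\<^sub>0 'f"
    and \<zeta> :: 'f
    and p l r :: nat
    and D :: "int mat"
  assumes char: "CHAR('f) = p" "p > 0"
    and root: "root_of_unity_of_order \<zeta> (p_prime_part p CARD('g))"
    and block: "block_idempotent b"
    and pims: "pim_idempotents b l \<epsilon>"
    and smith: "smith_normal_form_of (cartan_matrix b l \<epsilon>) D"
    and r: "r = card {i. i < l \<and> D $$ (i, i) = 1}"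
  shows "(\<exists>E. Pr_orthogonal_idempotents b E \<and> finite E \<and> card E = r) \<and>
         (\<forall>E. Pr_orthogonal_idempotents b E \<longrightarrow> finite E \<and> card E \<le> r)"
proof -
  have prime: "prime p" using char prime_CHAR_semidom[where 'a = 'f] by simp
  define n where "n = p_prime_part p CARD('g)"
  define a where "a = multiplicity p CARD('g)"
  have card: "CARD('g) = n * p ^ a"
    unfolding n_def a_def p_prime_part_def by (simp add: multiplicity_dvd)
  have n0: "n > 0" using card by (metis finite_UNIV_card_ge_0 finite mult_0 not_gr0)
  have "\<not> p dvd n"
    unfolding n_def p_prime_part_def using prime not_prime_unit by (intro multiplicity_decompose) auto
  hence "coprime p n" using prime prime_imp_coprime by blast
  hence "[p ^ totient n = 1] (mod n)" by (rule euler_theorem)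
  hence dvd: "n dvd p ^ totient n - 1" using prime prime_gt_0_nat by (simp add: cong_altdef_nat Suc_leI)
  interpret char_p_splitting p "totient n" n a \<zeta> "TYPE('g)"
  proof
    show "0 < totient n" using n0 by simp
    show "CHAR('f) = p" "prime p" "n dvd p ^ totient n - 1" "0 < n" "CARD('g) = n * p ^ a"
      "root_of_unity_of_order \<zeta> n"
      by (fact char prime dvd n0 card root[folded n_def])+
  qed
  obtain N :: nat and u T where uT: "(\<Sum>k<N. u k) = (1 :: 'g \<Rightarrow>\<^sub>0 'f)" "\<And>k. k < N \<Longrightarrow> split_data (u k) (T k)"
    by (rule split_decomposition) (rule that)
  have b: "b * b = b" "\<And>x. b * x = x * b"
    using block unfolding block_idempotent_def primitive_idempotent_def ring_center_def by blast+
  interpret block_pims b l \<epsilon> N u T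
    by (rule block_pims.intro) (fact b pims uT)+
  show ?thesis
    using orthogonal_idempotents_exist[OF smith] orthogonal_idempotents_bound[OF smith] r by blast
qed

end
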